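(* Let $(\mathcal E,\mathcal C)$ be an admissible form on $X$ of martingale dimension one, let $B\subset X$ be finite, let $(\mathcal E,\mathcal C)$ be complete (with respect to a fixed point $p\in X\setminus B$), and let $b\in\ker\partial_B^\ast$ be minimal energy-dominant, with orthogonal decomposition $b=\partial h+v$, $h\in\mathcal C$, $v\in\ker\partial^\ast$. Let $$\mathring B=\{q\in B:n_Bb(q)=0\},\quad\check B=\{q\in B:n_Bb(q)<0\},\quad\hat B=\{q\in B:n_Bb(q)>0\}.$$ Let $\widetilde H_\pm:=\ell(\mathring B)\oplus\ell(\check B,|n_Bb|)\oplus\ell(\hat B,|n_Bb|)\oplus\ker\partial^\bot$ be endowed with the scalar product $$\big\langle(\mathring F_1,\check F_1,\hat F_1,F_1^\bot),(\mathring F_2,\check F_2,\hat F_2,F_2^\bot)\big\rangle=\sum_{\mathring B}\mathring F_1\mathring F_2+\sum_{\check B}\check F_1\check F_2|n_Bb|+\sum_{\hat B}\hat F_1\hat F_2|n_Bb|+\langle F_1^\bot,F_2^\bot\rangle_{L^2(X,\nu_b)},$$ and let $$H_-:=\widetilde H_\pm\ominus\operatorname{span}\Big\{\Big(\tfrac{\mathbf 1}{\sqrt2},\mathbf 1,0,-\tfrac1{\sqrt2}\star_b^{-1}v\Big)\Big\},\qquad H_+:=\widetilde H_\pm\ominus\operatorname{span}\Big\{\Big(\tfrac{\mathbf 1}{\sqrt2},0,-\mathbf 1,-\tfrac1{\sqrt2}\star_b^{-1}v\Big)\Big\}$$ (orthogonal complements), with orthogonal projections $P_-,P_+$ onto $H_-,H_+$.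 For $f\in\mathcal D(\partial_B^\bot)$ with canonical representation $f=g+\star_b^{-1}\partial u+w$ and $z=\partial_B^\bot f-\star_b^{-1}\partial g$ set $$G_-f:=P_-\Big(\tfrac1{\sqrt2}(g+n_B(fb)),\tfrac{(du)_B}{|n_Bb|},\tfrac{n_B(fb)}{|n_Bb|},\tfrac1{\sqrt2}(w+z)\Big),$$ $$G_+f:=P_+\Big(\tfrac1{\sqrt2}(g-n_B(fb)),\tfrac{n_B(fb)}{|n_Bb|},\tfrac{(du)_B}{|n_Bb|},\tfrac1{\sqrt2}(w-z)\Big),$$ where the first three components are restricted to $\mathring B,\check B,\hat B$, respectively. Then $(H_-,H_+,G_-,G_+)$ is a boundary quadruple for the operator $(-\star_b^{-1}\partial_B,\mathcal C_B)$ on $L^2(X,\nu_b)$.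
   Context: **Admissible forms.** $(X,\varrho)$ is a locally compact separable metric space, $C_c(X)$ the space of continuous compactly supported real functions with norm $\|\cdot\|_{\sup}$. An admissible form is a pair $(\mathcal E,\mathcal C)$, $\mathcal C\subset C_c(X)$ a subalgebra, $\mathcal E:\mathcal C\times\mathcal C\to\mathbb R$ nonnegative definite symmetric bilinear, $\mathcal E(f):=\mathcal E(f,f)$, such that: (1) $\mathcal C$ is dense in $C_c(X)$; (2) $\mathcal C$ is separable for the seminorm $\mathcal E^{1/2}$; (3) $u\in\mathcal C$ implies $(u\wedge1)\vee0\in\mathcal C$ and $\mathcal E((u\wedge1)\vee0)\le\mathcal E(u)$; (4) for $f\in\mathcal C$ the functional $g\mapsto\mathcal E(fg,f)-\frac12\mathcal E(f^2,g)$ is positive on $\mathcal C$ and bounded w.r.t. $\|\cdot\|_{\sup}$; (5) $\mathcal E(f,g)=0$ whenever $g$ is constant on a neighborhood of $\operatorname{supp}f$. **First order structure.** For $f_1,f_2\in\mathcal C$, $\nu_{f_1,f_2}$ is the unique finite signed Radon measure with $\int g\,d\nu_{f_1,f_2}=\frac12\{\mathcal E(f_1g,f_2)+\mathcal E(f_1,f_2g)-\mathcal E(f_1f_2,g)\}$, $g\in\mathcal C$; $\nu_f:=\nu_{f,f}$. Put $d_uf(x,y)=f(x)-f(y)$, $\overline g(x,y)=\frac12(g(x)+g(y))$. $\mathcal H$ is the Hilbert space obtained from the span of all $\overline g\,d_uf$ ($g\in C_c(X)$, $f\in\mathcal C$) with the nonnegative definite form $\langle\overline g_1d_uf_1,\overline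 g_2d_uf_2\rangle_{\mathcal H}=\int g_1g_2\,d\nu_{f_1,f_2}$ by factoring out null elements and completing. $\partial f$ is the class of $d_uf$, $g\,\partial f$ the class of $\overline g\,d_uf$; this extends to a bounded action of $C_c(X)$ on $\mathcal H$. One has $\|\partial f\|_{\mathcal H}^2=\mathcal E(f)$ and $\partial(fg)=f\partial g+g\partial f$. For $v,w\in\mathcal H$, $\nu_{v,w}$ is the finite signed measure determined by bilinear continuous extension of $\nu_{g_1\partial f_1,g_2\partial f_2}=g_1g_2\nu_{f_1,f_2}$; $\nu_v:=\nu_{v,v}\ge0$, $\nu_{v,w}(X)=\langle v,w\rangle_{\mathcal H}$. The map $g\mapsto gv$ extends to an isometry $L^2(X,\nu_v)\to\mathcal H$. $\mathcal C$ is normed by $\|f\|_{\mathcal C}=\mathcal E(f)^{1/2}+\|f\|_{\sup}$, with dual $\mathcal C^\ast$. **Energy dominance, martingale dimension.** A $\sigma$-finite Borel measure $\nu$ is energy-dominant if $\nu_f\ll\nu$ for all $f\in\mathcal C$; minimal if moreover $\nu\ll\nu'$ for every energy-dominant $\nu'$. $v\in\mathcal H$ is minimal energy-dominant if $\nu_v$ is. For a minimal energy-dominant $\nu$, the pointwise index is the ($\nu$-a.e. unique) minimal Borel function $p(\cdot):X\to\mathbb N\cup\{\infty\}$ with $\operatorname{rank}\big(\frac{d\nu_{f_i,f_j}}{d\nu}(x)\big)_{i,j=1}^N\le p(x)$ for $\nu$-a.e. $x$, for all $N$ and $f_1,\dots,f_N\in\mathcal C$. The martingale dimension is $\nu\text{-}\operatorname{ess\,sup}p(\cdot)$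 (independent of $\nu$). **Duality and operators.** If the martingale dimension is one and $b$ is minimal energy-dominant, $\star_b:L^2(X,\nu_b)\to\mathcal H$, $\star_bg:=gb$, is an isometric isomorphism. $\mathcal C_B:=\{f\in\mathcal C:f|_B\equiv0\}$, $\partial_B:=\partial|_{\mathcal C_B}$. For $v\in\mathcal H$, $v\in\ker\partial_B^\ast$ (resp. $v\in\ker\partial^\ast$) means $\langle v,\partial\varphi\rangle_{\mathcal H}=0$ for all $\varphi\in\mathcal C_B$ (resp. $\varphi\in\mathcal C$). $(\partial^\ast,\mathcal D(\partial^\ast))$ and $(\partial_B^\ast,\mathcal D(\partial_B^\ast))$ are the adjoints (from $\mathcal H$ to $L^2(X,\nu_b)$) of the densely defined operators $(\partial,\mathcal C)$, $(\partial_B,\mathcal C_B)$ from $L^2(X,\nu_b)$ to $\mathcal H$. $\mathcal D(\partial^\bot):=\star_b^{-1}\mathcal D(\partial^\ast)$, $\partial^\bot f:=-\partial^\ast\star_bf$; $\mathcal D(\partial_B^\bot):=\star_b^{-1}\mathcal D(\partial_B^\ast)$, $\partial_B^\bot f:=-\partial_B^\ast\star_bf$. For $b\in\ker\partial_B^\ast$ the operator $(-\star_b^{-1}\partial_B,\mathcal C_B)$ is skew-symmetric on $L^2(X,\nu_b)$ and $(\star_b^{-1}\partial_B)^\ast=-\partial_B^\bot$. **Completeness.** The form is complete with respect to $p\in X\setminus B$ if $\mathbf 1\in\mathcal C$, $\ker\partial=\mathbb R$ (constants), $\mathcal C_p:=\{f\in\mathcal C:f(p)=0\}$ is a Hilbert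 space with scalar product $\mathcal E$, and $\|f\|_{\sup}\le c_p\mathcal E(f)^{1/2}$ for $f\in\mathcal C_p$ with some $c_p>0$. Then $X$ is compact, energy measures have no atoms (so finite $B$ are null sets for minimal energy-dominant measures), and $\mathcal H=\partial(\mathcal C)\oplus\ker\partial^\ast$ orthogonally. **Laplacian, normal parts, Neumann problem** (with $\nu=\nu_b$). $u\in\mathcal C$ is in $\mathcal D(\Delta_B)$ with $\Delta_Bu=f\in L^2(X,\nu)$ if $\mathcal E(u,\varphi)=-\int_Xf\varphi\,d\nu$ for all $\varphi\in\mathcal C_B$. For $B\ne\emptyset$ and $v\in\mathcal D(\partial_B^\ast)$ the normal part $n_Bv\in\mathcal C^\ast$ is $n_Bv(\varphi):=\langle v,\partial\varphi\rangle_{\mathcal H}-\int_X(\partial_B^\ast v)\varphi\,d\nu$, $\varphi\in\mathcal C$; for $B=\emptyset$, $n_Bv:=0$. For finite $B$, $n_Bv$ is identified with the function $n_Bv(q):=n_Bv(\psi_q)$ in the space $\ell(B)$ of real functions on $B$, where $\psi_q\in\mathcal C$ is the function with $\psi_q(q)=1$, $\psi_q=0$ on $B\setminus\{q\}$ and $\mathcal E(\psi_q,\varphi)=0$ for all $\varphi\in\mathcal C_B$; then $n_Bv(\varphi)=\sum_{q\in B}\varphi(q)n_Bv(q)$. $(du)_B:=n_B\partial u$ for $u\in\mathcal D(\Delta_B)$. For $f\in L^2(X,\nu)$ and $G\in\mathcal C^\ast$ vanishing on $\mathcal C_B$, $u\in\mathcal C$ is a weak solution of $\Delta_Bu=f$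 on $X\setminus B$, $(du)_B=G$ on $B$, if $\mathcal E(u,\varphi)=G(\varphi)-\int_Xf\varphi\,d\nu$ for all $\varphi\in\mathcal C$ (for $B=\emptyset$: the Poisson equation $\Delta u=f$, $G=0$). **Canonical representation** of $f\in\mathcal D(\partial_B^\bot)$: $f=g+\star_b^{-1}\partial u+w$ with $g\in\mathcal C$ such that $z:=\partial_B^\bot f-\star_b^{-1}\partial g\in\ker\partial^\bot$, $w\in\ker\partial^\bot$, and $u$ a weak solution of $\Delta_Bu=z$ on $X\setminus B$, $(du)_B=n_B(fb)-n_Bb(g\,\cdot)$ on $B$. Every $f\in\mathcal D(\partial_B^\bot)$ has one; any two are related by $\widetilde g=g+c$, $\partial\widetilde u=\partial u-c\,\partial h$, $\widetilde w=w-c\star_b^{-1}v$ with $c\in\mathbb R$. Consequently $G_\pm$ are well defined. **Boundary quadruple.** For a densely defined skew-symmetric operator $A_0$ on a real Hilbert space $H$ put $\hat A:=(-A_0)^\ast$. A boundary quadruple $(H_-,H_+,G_-,G_+)$ for $A_0$ consists of pre-Hilbert spaces $H_-,H_+$ and linear maps $G_\mp:\mathcal D(\hat A)\to H_\mp$ with: $\langle\hat Af_1,f_2\rangle_H+\langle f_1,\hat Af_2\rangle_H=\langle G_+f_1,G_+f_2\rangle_{H_+}-\langle G_-f_1,G_-f_2\rangle_{H_-}$ for all $f_1,f_2\in\mathcal D(\hat A)$; $\ker G_++\ker G_-=\mathcal D(\hat A)$; and $G_-(\mathcal D(\hat A))=H_-$, $G_+(\mathcal D(\hat A))=H_+$.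 **Convention.** If one of the summands of $\widetilde H_\pm$ is trivial, it and the corresponding components are omitted. *)

theory Defs
  imports "HOL-Probability.Probability" "HOL-Library.Function_Algebras"
begin

unbundle inner_syntax

text \<open>
  Functions carry pointwise \<open>+\<close>, \<open>*\<close>, \<open>0\<close>, \<open>1\<close> (from \<open>Function_Algebras\<close>) and the pointwise
  scalar multiplication added here, so that \<open>subspace\<close>, \<open>span\<close>, \<open>dim\<close> and \<open>linear\<close> apply to
  spaces of functions.
\<close>

instantiation "fun" :: (type, scaleR) scaleR
begin
definition "scaleR c f = (\<lambda>x. scaleR c (f x))"
instance ..
end

lemma scaleR_fun_apply [simp]: "(scaleR c f) x = scaleR c (f x)"
  by (simp add: scaleR_fun_def)

instance "fun" :: (type, real_vector) real_vector
  by standard (auto simp: fun_eq_iff scaleR_right_distrib scaleR_left_distrib)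

section \<open>Finite signed Borel measures\<close>

text \<open>
  Set functions vanishing off the Borel sets, so that two of them are equal iff they agree on
  Borel sets. On a locally compact separable metric space every finite signed Borel measure is
  Radon.
\<close>

definition finite_signed_measure :: "('a::topological_space set \<Rightarrow> real) \<Rightarrow> bool" where
  "finite_signed_measure \<sigma> \<longleftrightarrow>
     \<sigma> {} = 0 \<and>
     (\<forall>A :: nat \<Rightarrow> 'a set. range A \<subseteq> sets borel \<longrightarrow> disjoint_family A \<longrightarrow>
        (\<lambda>n. \<sigma> (A n)) sums \<sigma> (\<Union>n. A n)) \<and>
     (\<forall>A. A \<notin> sets borel \<longrightarrow> \<sigma> A = 0)"

definition to_measure :: "('a::topological_space set \<Rightarrow> real) \<Rightarrow> 'a measure" where
  "to_measure \<sigma> = measure_of UNIV (sets borel) (\<lambda>A. ennreal (\<sigma> A))"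

text \<open>The Jordan decomposition is \<open>\<sigma> = jordan_pos \<sigma> - jordan_neg \<sigma>\<close>.\<close>

definition jordan_pos :: "('a::topological_space set \<Rightarrow> real) \<Rightarrow> 'a measure" where
  "jordan_pos \<sigma> = to_measure (\<lambda>A. SUP D \<in> {D \<in> sets borel. D \<subseteq> A}. \<sigma> D)"

definition jordan_neg :: "('a::topological_space set \<Rightarrow> real) \<Rightarrow> 'a measure" where
  "jordan_neg \<sigma> = jordan_pos (\<lambda>A. - \<sigma> A)"

definition signed_integral :: "('a::topological_space set \<Rightarrow> real) \<Rightarrow> ('a \<Rightarrow> real) \<Rightarrow> real" where
  "signed_integral \<sigma> g = (\<integral>x. g x \<partial>jordan_pos \<sigma>) - (\<integral>x. g x \<partial>jordan_neg \<sigma>)"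

definition signed_density :: "('a::topological_space set \<Rightarrow> real) \<Rightarrow> 'a measure \<Rightarrow> 'a \<Rightarrow> real" where
  "signed_density \<sigma> \<nu> x =
     enn2real (RN_deriv \<nu> (jordan_pos \<sigma>) x) - enn2real (RN_deriv \<nu> (jordan_neg \<sigma>) x)"

section \<open>Admissible forms\<close>

definition supp :: "('a::topological_space \<Rightarrow> real) \<Rightarrow> 'a set" where
  "supp f = closure {x. f x \<noteq> 0}"

definition Cc :: "('a::topological_space \<Rightarrow> real) set" where
  "Cc = {f. continuous_on UNIV f \<and> compact (supp f)}"

definition sup_norm :: "('a \<Rightarrow> real) \<Rightarrow> real" where
  "sup_norm f = (SUP x. \<bar>f x\<bar>)"

definition admissible_form ::
  "(('a::metric_space \<Rightarrow> real) \<Rightarrow> ('a \<Rightarrow> real) \<Rightarrow> real) \<Rightarrow> ('a \<Rightarrow> real) set \<Rightarrow> bool" where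
  "admissible_form E C \<longleftrightarrow>
     C \<subseteq> Cc \<and> subspace C \<and> (\<forall>f\<in>C. \<forall>g\<in>C. f * g \<in> C) \<and>
     (\<forall>f\<in>C. \<forall>g\<in>C. E f g = E g f) \<and>
     (\<forall>f\<in>C. \<forall>g\<in>C. \<forall>k\<in>C. E (f + g) k = E f k + E g k) \<and>
     (\<forall>f\<in>C. \<forall>g\<in>C. \<forall>c. E (c *\<^sub>R f) g = c * E f g) \<and>
     (\<forall>f\<in>C. 0 \<le> E f f) \<and>
     (\<forall>f\<in>Cc. \<forall>\<epsilon>>0. \<exists>g\<in>C. sup_norm (f - g) < \<epsilon>) \<and>
     (\<exists>S\<subseteq>C. countable S \<and> (\<forall>f\<in>C. \<forall>\<epsilon>>0. \<exists>g\<in>S. sqrt (E (f - g) (f - g)) < \<epsilon>)) \<and>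
     (\<forall>u\<in>C. let u' = (\<lambda>x. max (min (u x) 1) 0) in u' \<in> C \<and> E u' u' \<le> E u u) \<and>
     (\<forall>f\<in>C. (\<forall>g\<in>C. (\<forall>x. 0 \<le> g x) \<longrightarrow> 0 \<le> E (f * g) f - E (f * f) g / 2) \<and>
            (\<exists>K. \<forall>g\<in>C. \<bar>E (f * g) f - E (f * f) g / 2\<bar> \<le> K * sup_norm g)) \<and>
     (\<forall>f\<in>C. \<forall>g\<in>C. (\<exists>U c. open U \<and> supp f \<subseteq> U \<and> (\<forall>x\<in>U. g x = c)) \<longrightarrow> E f g = 0)"

text \<open>\<open>\<nu>\<^bsub>f1,f2\<^esub>\<close>; it exists by Riesz representation and is unique since \<open>C\<close> is dense in \<open>C\<^sub>c(X)\<close>.\<close>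

definition energy_measure ::
  "(('a::metric_space \<Rightarrow> real) \<Rightarrow> ('a \<Rightarrow> real) \<Rightarrow> real) \<Rightarrow> ('a \<Rightarrow> real) set \<Rightarrow>
   ('a \<Rightarrow> real) \<Rightarrow> ('a \<Rightarrow> real) \<Rightarrow> 'a set \<Rightarrow> real" where
  "energy_measure E C f1 f2 =
     (THE \<sigma>. finite_signed_measure \<sigma> \<and>
        (\<forall>g\<in>C. signed_integral \<sigma> g = (E (f1 * g) f2 + E f1 (f2 * g) - E (f1 * f2) g) / 2))"

section \<open>Energy dominance and martingale dimension\<close>

text \<open>The library's \<open>absolutely_continuous M N\<close> means \<open>N \<lless> M\<close>.\<close>

definition energy_dominant ::
  "(('a::metric_space \<Rightarrow> real) \<Rightarrow> ('a \<Rightarrow> real) \<Rightarrow> real) \<Rightarrow> ('a \<Rightarrow> real) set \<Rightarrow> 'a measure \<Rightarrow> bool" where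
  "energy_dominant E C \<nu> \<longleftrightarrow>
     sets \<nu> = sets borel \<and> sigma_finite_measure \<nu> \<and>
     (\<forall>f\<in>C. absolutely_continuous \<nu> (to_measure (energy_measure E C f f)))"

definition minimal_energy_dominant ::
  "(('a::metric_space \<Rightarrow> real) \<Rightarrow> ('a \<Rightarrow> real) \<Rightarrow> real) \<Rightarrow> ('a \<Rightarrow> real) set \<Rightarrow> 'a measure \<Rightarrow> bool" where
  "minimal_energy_dominant E C \<nu> \<longleftrightarrow>
     energy_dominant E C \<nu> \<and> (\<forall>\<nu>'. energy_dominant E C \<nu>' \<longrightarrow> absolutely_continuous \<nu>' \<nu>)"

text \<open>The dimension of the column space of an \<open>N \<times> N\<close> matrix.\<close>

definition matrix_rank :: "nat \<Rightarrow> (nat \<Rightarrow> nat \<Rightarrow> real) \<Rightarrow> nat" where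
  "matrix_rank N A = dim ((\<lambda>j i. if i < N then A i j else 0) ` {..<N})"

definition index_bound ::
  "(('a::metric_space \<Rightarrow> real) \<Rightarrow> ('a \<Rightarrow> real) \<Rightarrow> real) \<Rightarrow> ('a \<Rightarrow> real) set \<Rightarrow> 'a measure \<Rightarrow>
   ('a \<Rightarrow> enat) \<Rightarrow> bool" where
  "index_bound E C \<nu> p \<longleftrightarrow>
     p \<in> borel \<rightarrow>\<^sub>M count_space UNIV \<and>
     (\<forall>N (f :: nat \<Rightarrow> 'a \<Rightarrow> real). (\<forall>i<N. f i \<in> C) \<longrightarrow>
        (AE x in \<nu>. enat (matrix_rank N
           (\<lambda>i j. signed_density (energy_measure E C (f i) (f j)) \<nu> x)) \<le> p x))"

definition pointwise_index ::
  "(('a::metric_space \<Rightarrow> real) \<Rightarrow> ('a \<Rightarrow> real) \<Rightarrow> real) \<Rightarrow> ('a \<Rightarrow> real) set \<Rightarrow> 'a measure \<Rightarrow>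
   ('a \<Rightarrow> enat) \<Rightarrow> bool" where
  "pointwise_index E C \<nu> p \<longleftrightarrow>
     index_bound E C \<nu> p \<and> (\<forall>q. index_bound E C \<nu> q \<longrightarrow> (AE x in \<nu>. p x \<le> q x))"

text \<open>
  The essential supremum does not depend on the minimal energy-dominant measure nor on the
  version of the pointwise index, so \<open>\<exists>\<close> could be replaced by \<open>\<forall>\<close> here. The library's
  \<open>esssup\<close> is not available for \<open>enat\<close>, which is not densely ordered.
\<close>

definition has_martingale_dimension ::
  "(('a::metric_space \<Rightarrow> real) \<Rightarrow> ('a \<Rightarrow> real) \<Rightarrow> real) \<Rightarrow> ('a \<Rightarrow> real) set \<Rightarrow> enat \<Rightarrow> bool" where
  "has_martingale_dimension E C d \<longleftrightarrow>
     (\<exists>\<nu> p. minimal_energy_dominant E C \<nu> \<and> pointwise_index E C \<nu> p \<and>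
            d = Inf {c. AE x in \<nu>. p x \<le> c})"

section \<open>First order structure\<close>

definition d_u :: "('a \<Rightarrow> real) \<Rightarrow> 'a \<times> 'a \<Rightarrow> real" where
  "d_u f = (\<lambda>(x, y). f x - f y)"

definition tens :: "('a \<Rightarrow> real) \<Rightarrow> ('a \<Rightarrow> real) \<Rightarrow> 'a \<times> 'a \<Rightarrow> real" where
  "tens g f = (\<lambda>(x, y). (g x + g y) / 2) * d_u f"

text \<open>
  The Hilbert space \<open>\<H>\<close> is the type \<open>'h\<close>, presented by the map \<open>\<iota>\<close> taking an element of the span of the
  \<open>tens g f\<close> to its class in the completion: \<open>\<iota>\<close> is linear, carries the form on the span to the
  scalar product of \<open>'h\<close>, and has dense image. This determines \<open>'h\<close> up to a unique isometric
  isomorphism. The values of \<open>\<iota>\<close> outside the span are irrelevant (a linear map on the span always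
  has a linear extension to all functions).
\<close>

definition first_order_structure ::
  "(('a::metric_space \<Rightarrow> real) \<Rightarrow> ('a \<Rightarrow> real) \<Rightarrow> real) \<Rightarrow> ('a \<Rightarrow> real) set \<Rightarrow>
   (('a \<times> 'a \<Rightarrow> real) \<Rightarrow> 'h::{real_inner, complete_space}) \<Rightarrow> bool" where
  "first_order_structure E C \<iota> \<longleftrightarrow>
     linear \<iota> \<and>
     (\<forall>g1\<in>Cc. \<forall>f1\<in>C. \<forall>g2\<in>Cc. \<forall>f2\<in>C.
        \<iota> (tens g1 f1) \<bullet> \<iota> (tens g2 f2) = signed_integral (energy_measure E C f1 f2) (g1 * g2)) \<and>
     closure (\<iota> ` span {tens g f | g f. g \<in> Cc \<and> f \<in> C}) = UNIV"

text \<open>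
  In the same way, the Hilbert space \<open>L\<^sup>2(M)\<close> is the type \<open>'l\<close>, presented by the
  map \<open>cls\<close> taking a square integrable function to its class.
\<close>

definition L2_functions :: "'a measure \<Rightarrow> ('a \<Rightarrow> real) set" where
  "L2_functions M = {f \<in> borel_measurable M. integrable M (\<lambda>x. (f x)\<^sup>2)}"

definition L2_space ::
  "'a measure \<Rightarrow> (('a \<Rightarrow> real) \<Rightarrow> 'l::{real_inner, complete_space}) \<Rightarrow> bool" where
  "L2_space M cls \<longleftrightarrow>
     cls ` L2_functions M = UNIV \<and>
     (\<forall>f\<in>L2_functions M. \<forall>g\<in>L2_functions M. cls (f + g) = cls f + cls g) \<and>
     (\<forall>f\<in>L2_functions M. \<forall>c. cls (c *\<^sub>R f) = c *\<^sub>R cls f) \<and>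
     (\<forall>f\<in>L2_functions M. \<forall>g\<in>L2_functions M. cls f \<bullet> cls g = (\<integral>x. f x * g x \<partial>M))"

locale form_data =
  fixes E :: "('a::metric_space \<Rightarrow> real) \<Rightarrow> ('a \<Rightarrow> real) \<Rightarrow> real"
    and C :: "('a \<Rightarrow> real) set"
    and \<iota> :: "('a \<times> 'a \<Rightarrow> real) \<Rightarrow> 'h::{real_inner, complete_space}"
begin

text \<open>
  For compact \<open>X\<close> (which holds for complete forms) \<open>d_u f = tens 1 f\<close> lies in the span on which
  \<open>\<iota>\<close> is specified.
\<close>

definition grad :: "('a \<Rightarrow> real) \<Rightarrow> 'h" where
  "grad f = \<iota> (d_u f)"

definition act :: "('a \<Rightarrow> real) \<Rightarrow> 'h \<Rightarrow> 'h" where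
  "act g = (THE T. bounded_linear T \<and> (\<forall>k\<in>Cc. \<forall>f\<in>C. T (\<iota> (tens k f)) = \<iota> (tens (g * k) f)))"

text \<open>
  \<open>\<nu>\<^bsub>v,w\<^esub>\<close>: the bilinear continuous extension of \<open>\<nu>\<close> from the elements \<open>g \<partial>f = \<iota> (tens g f)\<close>,
  where it is \<open>g1 g2 \<nu>\<^bsub>f1,f2\<^esub>\<close>.
\<close>

definition field_energy_measure :: "'h \<Rightarrow> 'h \<Rightarrow> 'a set \<Rightarrow> real" where
  "field_energy_measure =
     (THE N. (\<forall>v w. finite_signed_measure (N v w)) \<and>
             (\<forall>A\<in>sets borel. bounded_bilinear (\<lambda>v w. N v w A)) \<and>
             (\<forall>g1\<in>Cc. \<forall>f1\<in>C. \<forall>g2\<in>Cc. \<forall>f2\<in>C. \<forall>A\<in>sets borel.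
                N (\<iota> (tens g1 f1)) (\<iota> (tens g2 f2)) A =
                signed_integral (energy_measure E C f1 f2) (indicator A * g1 * g2)))"

definition field_measure :: "'h \<Rightarrow> 'a measure" where
  "field_measure v = to_measure (field_energy_measure v v)"

definition vanishing :: "'a set \<Rightarrow> ('a \<Rightarrow> real) set" where
  "vanishing B = {f \<in> C. \<forall>x\<in>B. f x = 0}"

text \<open>\<open>ker \<partial>\<^sub>B\<^sup>*\<close>; the case \<open>B = {}\<close> is \<open>ker \<partial>\<^sup>*\<close>.\<close>

definition ker_coderiv :: "'a set \<Rightarrow> 'h set" where
  "ker_coderiv B = {v. \<forall>\<phi>\<in>vanishing B. v \<bullet> grad \<phi> = 0}"

definition complete_form :: "'a \<Rightarrow> bool" where
  "complete_form p \<longleftrightarrow>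
     1 \<in> C \<and>
     {f \<in> C. grad f = 0} = range (\<lambda>c x. c) \<and>
     (\<forall>f\<in>vanishing {p}. E f f = 0 \<longrightarrow> f = 0) \<and>
     (\<forall>F. (\<forall>n. F n \<in> vanishing {p}) \<longrightarrow>
        (\<forall>\<epsilon>>0. \<exists>M. \<forall>m\<ge>M. \<forall>n\<ge>M. sqrt (E (F m - F n) (F m - F n)) < \<epsilon>) \<longrightarrow>
        (\<exists>f\<in>vanishing {p}. (\<lambda>n. sqrt (E (F n - f) (F n - f))) \<longlonglongrightarrow> 0)) \<and>
     (\<exists>c>0. \<forall>f\<in>vanishing {p}. sup_norm f \<le> c * sqrt (E f f))"

end

section \<open>Operators and boundary quadruples\<close>

text \<open>Unbounded operators are given by their graphs.\<close>

definition adjoint_graph ::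
  "('u::real_inner \<times> 'w::real_inner) set \<Rightarrow> ('w \<times> 'u) set" where
  "adjoint_graph T = {(w, u). \<forall>(x, y)\<in>T. y \<bullet> w = x \<bullet> u}"

definition op_value :: "('u \<times> 'w) set \<Rightarrow> 'u \<Rightarrow> 'w" where
  "op_value T u = (THE w. (u, w) \<in> T)"

definition densely_defined_skew :: "('u::real_inner \<times> 'u) set \<Rightarrow> bool" where
  "densely_defined_skew A \<longleftrightarrow>
     subspace A \<and> single_valued A \<and> closure (Domain A) = UNIV \<and>
     (\<forall>(x, y)\<in>A. \<forall>(x', y')\<in>A. y \<bullet> x' = - (x \<bullet> y'))"

text \<open>\<open>max_extension A\<close> is the operator \<open>(-A)\<^sup>*\<close>.\<close>

definition max_extension :: "('u::real_inner \<times> 'u) set \<Rightarrow> ('u \<times> 'u) set" where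
  "max_extension A = adjoint_graph ((\<lambda>(x, y). (x, - y)) ` A)"

definition pre_hilbert :: "'m::real_vector set \<Rightarrow> ('m \<Rightarrow> 'm \<Rightarrow> real) \<Rightarrow> bool" where
  "pre_hilbert H ip \<longleftrightarrow>
     subspace H \<and>
     (\<forall>F\<in>H. \<forall>G\<in>H. ip F G = ip G F) \<and>
     (\<forall>F\<in>H. \<forall>G\<in>H. \<forall>K\<in>H. ip (F + G) K = ip F K + ip G K) \<and>
     (\<forall>F\<in>H. \<forall>G\<in>H. \<forall>c. ip (c *\<^sub>R F) G = c * ip F G) \<and>
     (\<forall>F\<in>H. F \<noteq> 0 \<longrightarrow> 0 < ip F F)"

definition linear_map_on :: "'u::real_vector set \<Rightarrow> ('u \<Rightarrow> 'm::real_vector) \<Rightarrow> bool" where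
  "linear_map_on D G \<longleftrightarrow>
     (\<forall>f\<in>D. \<forall>g\<in>D. G (f + g) = G f + G g) \<and> (\<forall>f\<in>D. \<forall>c. G (c *\<^sub>R f) = c *\<^sub>R G f)"

text \<open>
  The pre-Hilbert spaces \<open>H\<^sub>-\<close>, \<open>H\<^sub>+\<close> are linear subspaces \<open>Hm\<close>, \<open>Hp\<close> of a vector space with their
  own scalar products \<open>ipm\<close>, \<open>ipp\<close>.
\<close>

definition boundary_quadruple ::
  "('u::{real_inner, complete_space} \<times> 'u) set \<Rightarrow>
   'm::real_vector set \<Rightarrow> ('m \<Rightarrow> 'm \<Rightarrow> real) \<Rightarrow> 'n::real_vector set \<Rightarrow> ('n \<Rightarrow> 'n \<Rightarrow> real) \<Rightarrow>
   ('u \<Rightarrow> 'm) \<Rightarrow> ('u \<Rightarrow> 'n) \<Rightarrow> bool" where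
  "boundary_quadruple A Hm ipm Hp ipp Gm Gp \<longleftrightarrow>
     (let Ah = max_extension A; D = Domain Ah in
        densely_defined_skew A \<and>
        pre_hilbert Hm ipm \<and> pre_hilbert Hp ipp \<and>
        linear_map_on D Gm \<and> linear_map_on D Gp \<and>
        (\<forall>f1\<in>D. \<forall>f2\<in>D.
           op_value Ah f1 \<bullet> f2 + f1 \<bullet> op_value Ah f2 =
           ipp (Gp f1) (Gp f2) - ipm (Gm f1) (Gm f2)) \<and>
        {x + y | x y. x \<in> D \<and> Gp x = 0 \<and> y \<in> D \<and> Gm y = 0} = D \<and>
        Gm ` D = Hm \<and> Gp ` D = Hp)"

definition orth_complement :: "('m::real_vector \<Rightarrow> 'm \<Rightarrow> real) \<Rightarrow> 'm set \<Rightarrow> 'm set \<Rightarrow> 'm set" where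
  "orth_complement ip H S = {F \<in> H. \<forall>K\<in>S. ip F K = 0}"

definition orth_proj :: "('m::real_vector \<Rightarrow> 'm \<Rightarrow> real) \<Rightarrow> 'm set \<Rightarrow> 'm \<Rightarrow> 'm" where
  "orth_proj ip V F = (THE G. G \<in> V \<and> (\<forall>K\<in>V. ip (F - G) K = 0))"

section \<open>Boundary data\<close>

text \<open>\<open>\<ell>(S)\<close> as the functions vanishing off \<open>S\<close>; for \<open>S = {}\<close> it is trivial.\<close>

definition ell :: "'a set \<Rightarrow> ('a \<Rightarrow> real) set" where
  "ell S = {F. \<forall>x. x \<notin> S \<longrightarrow> F x = 0}"

definition restr :: "'a set \<Rightarrow> ('a \<Rightarrow> real) \<Rightarrow> 'a \<Rightarrow> real" where
  "restr S F = (\<lambda>x. if x \<in> S then F x else 0)"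

type_synonym ('a, 'l) boundary_tuple = "('a \<Rightarrow> real) \<times> ('a \<Rightarrow> real) \<times> ('a \<Rightarrow> real) \<times> 'l"

locale boundary_data = form_data E C \<iota>
  for E :: "('a::metric_space \<Rightarrow> real) \<Rightarrow> ('a \<Rightarrow> real) \<Rightarrow> real"
    and C :: "('a \<Rightarrow> real) set"
    and \<iota> :: "('a \<times> 'a \<Rightarrow> real) \<Rightarrow> 'h::{real_inner, complete_space}" +
  fixes cls :: "('a \<Rightarrow> real) \<Rightarrow> 'l::{real_inner, complete_space}"
    and b :: 'h
begin

text \<open>
  \<open>star k\<close> is \<open>\<star>\<^sub>b k = k b\<close>, the continuous extension of \<open>g \<mapsto> g b\<close> from \<open>C\<^sub>c(X)\<close> to
  \<open>L\<^sup>2(X, \<nu>\<^sub>b)\<close>.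
\<close>

definition star :: "'l \<Rightarrow> 'h" where
  "star = (THE T. bounded_linear T \<and> (\<forall>g\<in>Cc. T (cls g) = act g b))"

definition star_inv :: "'h \<Rightarrow> 'l" where
  "star_inv = inv star"

text \<open>Throughout, \<open>B = {}\<close> gives the operators without index: \<open>\<partial>\<close>, \<open>\<partial>\<^sup>*\<close>, \<open>\<partial>\<^sup>\<bottom>\<close>.\<close>

definition grad_graph :: "'a set \<Rightarrow> ('l \<times> 'h) set" where
  "grad_graph B = {(cls \<phi>, grad \<phi>) | \<phi>. \<phi> \<in> vanishing B}"

definition coderiv_dom :: "'a set \<Rightarrow> 'h set" where
  "coderiv_dom B = Domain (adjoint_graph (grad_graph B))"

definition coderiv :: "'a set \<Rightarrow> 'h \<Rightarrow> 'l" where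
  "coderiv B = op_value (adjoint_graph (grad_graph B))"

definition perp_dom :: "'a set \<Rightarrow> 'l set" where
  "perp_dom B = star -` coderiv_dom B"

definition perp :: "'a set \<Rightarrow> 'l \<Rightarrow> 'l" where
  "perp B f = - coderiv B (star f)"

definition ker_perp :: "'l set" where
  "ker_perp = {f \<in> perp_dom {}. perp {} f = 0}"

definition skew_graph :: "'a set \<Rightarrow> ('l \<times> 'l) set" where
  "skew_graph B = {(cls \<phi>, - star_inv (grad \<phi>)) | \<phi>. \<phi> \<in> vanishing B}"

text \<open>
  \<open>n\<^sub>B v\<close> is \<open>normal B v\<close> as a functional on \<open>C\<close>, and \<open>normal_at B v\<close> as a function on a finite \<open>B\<close>.
  The integral of \<open>(\<partial>\<^sub>B\<^sup>* v) \<phi>\<close> is written as a scalar product in \<open>L\<^sup>2(X, \<nu>\<^sub>b)\<close>.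
\<close>

definition normal :: "'a set \<Rightarrow> 'h \<Rightarrow> ('a \<Rightarrow> real) \<Rightarrow> real" where
  "normal B v \<phi> = (if B = {} then 0 else v \<bullet> grad \<phi> - coderiv B v \<bullet> cls \<phi>)"

definition harmonic_hat :: "'a set \<Rightarrow> 'a \<Rightarrow> 'a \<Rightarrow> real" where
  "harmonic_hat B q = (THE \<psi>. \<psi> \<in> C \<and> \<psi> q = 1 \<and> (\<forall>x\<in>B - {q}. \<psi> x = 0) \<and>
                              (\<forall>\<phi>\<in>vanishing B. E \<psi> \<phi> = 0))"

definition normal_at :: "'a set \<Rightarrow> 'h \<Rightarrow> 'a \<Rightarrow> real" where
  "normal_at B v q = normal B v (harmonic_hat B q)"

definition weak_solution :: "('a \<Rightarrow> real) \<Rightarrow> 'l \<Rightarrow> (('a \<Rightarrow> real) \<Rightarrow> real) \<Rightarrow> bool" where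
  "weak_solution u f G \<longleftrightarrow> u \<in> C \<and> (\<forall>\<phi>\<in>C. E u \<phi> = G \<phi> - f \<bullet> cls \<phi>)"

definition z_part :: "'a set \<Rightarrow> 'l \<Rightarrow> ('a \<Rightarrow> real) \<Rightarrow> 'l" where
  "z_part B f g = perp B f - star_inv (grad g)"

definition canonical_representation ::
  "'a set \<Rightarrow> 'l \<Rightarrow> ('a \<Rightarrow> real) \<Rightarrow> ('a \<Rightarrow> real) \<Rightarrow> 'l \<Rightarrow> bool" where
  "canonical_representation B f g u w \<longleftrightarrow>
     g \<in> C \<and> z_part B f g \<in> ker_perp \<and> w \<in> ker_perp \<and>
     weak_solution u (z_part B f g) (\<lambda>\<phi>. normal B (star f) \<phi> - normal B b (g * \<phi>)) \<and>
     f = cls g + star_inv (grad u) + w"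

definition B_null :: "'a set \<Rightarrow> 'a set" where
  "B_null B = {q \<in> B. normal_at B b q = 0}"

definition B_neg :: "'a set \<Rightarrow> 'a set" where
  "B_neg B = {q \<in> B. normal_at B b q < 0}"

definition B_pos :: "'a set \<Rightarrow> 'a set" where
  "B_pos B = {q \<in> B. normal_at B b q > 0}"

definition H_tilde :: "'a set \<Rightarrow> ('a, 'l) boundary_tuple set" where
  "H_tilde B = ell (B_null B) \<times> ell (B_neg B) \<times> ell (B_pos B) \<times> ker_perp"

fun ip_tilde :: "'a set \<Rightarrow> ('a, 'l) boundary_tuple \<Rightarrow> ('a, 'l) boundary_tuple \<Rightarrow> real" where
  "ip_tilde B (F1, G1, K1, k1) (F2, G2, K2, k2) =
     (\<Sum>q\<in>B_null B. F1 q * F2 q) +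
     (\<Sum>q\<in>B_neg B. G1 q * G2 q * \<bar>normal_at B b q\<bar>) +
     (\<Sum>q\<in>B_pos B. K1 q * K2 q * \<bar>normal_at B b q\<bar>) +
     k1 \<bullet> k2"

definition e_minus :: "'a set \<Rightarrow> 'h \<Rightarrow> ('a, 'l) boundary_tuple" where
  "e_minus B v = (restr (B_null B) (\<lambda>q. 1 / sqrt 2), restr (B_neg B) (\<lambda>q. 1), 0,
                  - (1 / sqrt 2) *\<^sub>R star_inv v)"

definition e_plus :: "'a set \<Rightarrow> 'h \<Rightarrow> ('a, 'l) boundary_tuple" where
  "e_plus B v = (restr (B_null B) (\<lambda>q. 1 / sqrt 2), 0, restr (B_pos B) (\<lambda>q. - 1),
                 - (1 / sqrt 2) *\<^sub>R star_inv v)"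

definition H_minus :: "'a set \<Rightarrow> 'h \<Rightarrow> ('a, 'l) boundary_tuple set" where
  "H_minus B v = orth_complement (ip_tilde B) (H_tilde B) (span {e_minus B v})"

definition H_plus :: "'a set \<Rightarrow> 'h \<Rightarrow> ('a, 'l) boundary_tuple set" where
  "H_plus B v = orth_complement (ip_tilde B) (H_tilde B) (span {e_plus B v})"

text \<open>
  \<open>G_minus\<close> and \<open>G_plus\<close> pick the value common to all canonical representations; \<open>(du)\<^sub>B\<close> is the
  normal part of \<open>grad u\<close>.
\<close>

definition G_minus :: "'a set \<Rightarrow> 'h \<Rightarrow> 'l \<Rightarrow> ('a, 'l) boundary_tuple" where
  "G_minus B v f = (THE F. \<exists>g u w. canonical_representation B f g u w \<and>
     F = orth_proj (ip_tilde B) (H_minus B v)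
       (restr (B_null B) (\<lambda>q. (1 / sqrt 2) * (g q + normal_at B (star f) q)),
        restr (B_neg B) (\<lambda>q. normal_at B (grad u) q / \<bar>normal_at B b q\<bar>),
        restr (B_pos B) (\<lambda>q. normal_at B (star f) q / \<bar>normal_at B b q\<bar>),
        (1 / sqrt 2) *\<^sub>R (w + z_part B f g)))"

definition G_plus :: "'a set \<Rightarrow> 'h \<Rightarrow> 'l \<Rightarrow> ('a, 'l) boundary_tuple" where
  "G_plus B v f = (THE F. \<exists>g u w. canonical_representation B f g u w \<and>
     F = orth_proj (ip_tilde B) (H_plus B v)
       (restr (B_null B) (\<lambda>q. (1 / sqrt 2) * (g q - normal_at B (star f) q)),
        restr (B_neg B) (\<lambda>q. normal_at B (star f) q / \<bar>normal_at B b q\<bar>),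
        restr (B_pos B) (\<lambda>q. normal_at B (grad u) q / \<bar>normal_at B b q\<bar>),
        (1 / sqrt 2) *\<^sub>R (w - z_part B f g)))"

end

end

theory Submission
  imports Defs
begin

text \<open>
  Write \<open>D = \<star>\<^sub>b\<^sup>-\<^sup>1 \<partial>\<close> and \<open>\<beta> = n\<^sub>B b\<close>, so that \<open>\<langle>g, D \<phi>\<rangle> + \<langle>\<phi>, D g\<rangle> = \<Sum>\<^sub>B g \<phi> \<beta>\<close> by the product rule. If
  \<open>f = g + D u + w\<close> and \<open>\<partial>\<^sub>B\<^sup>\<bottom> f = D g + z\<close> with \<open>w\<close>, \<open>z\<close> orthogonal to the range of \<open>D\<close>, then with
  \<open>n = n\<^sub>B(f b)\<close> the function \<open>u\<close> automatically solves the Neumann problem, \<open>(du)\<^sub>B = n - g \<beta>\<close>, and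
  \<open>\<langle>\<partial>\<^sub>B\<^sup>\<bottom> f, f'\<rangle> + \<langle>f, \<partial>\<^sub>B\<^sup>\<bottom> f'\<rangle> = \<Sum>\<^sub>B (g n' + g' n - g g' \<beta>) + \<langle>z, w'\<rangle> + \<langle>z', w\<rangle>\<close>. This is the difference of the
  scalar products of the unprojected boundary tuples, which depend linearly on \<open>(g, n, z, w)\<close>. The
  constant by which \<open>g\<close> is ambiguous moves them along the vectors spanning the complements of \<open>H\<^sub>-\<close> and
  \<open>H\<^sub>+\<close>; it can be chosen so that both tuples are orthogonal to these vectors at once, and then the
  projections do nothing. Conversely a pair of elements of \<open>H\<^sub>-\<close> and \<open>H\<^sub>+\<close> determines \<open>g\<close>, \<open>n\<close>, \<open>z\<close>, \<open>w\<close>,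
  and the two orthogonality conditions give the solvability condition of the Neumann problem for
  \<open>u\<close>. Hence \<open>f \<mapsto> (G\<^sub>- f, G\<^sub>+ f)\<close> is onto \<open>H\<^sub>- \<times> H\<^sub>+\<close>, which yields surjectivity and the kernel condition.
\<close>

section \<open>A Riesz representation theorem\<close>

text \<open>Most objects in the statement are definite descriptions or spaces presented by a map, so
  none of their properties is available before existence and uniqueness are proved. Energy measures
  come from a Riesz theorem for positive functionals known only on a dense subspace; the action on
  \<H>, \<open>star\<close> and the orthogonal splittings come from extension by density and
  projection in Hilbert space. Three facts then carry the analysis. Martingale dimension one gives
  surjectivity of \<open>star\<close>: if all 2 x 2 minors of the energy densities vanish, a field
  whose mutual measure with \<open>b\<close> is zero must itself be zero. Completeness makes the
  gradients of functions vanishing on \<open>B\<close> a closed subspace, which yields the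
  decomposition of \<H>, the harmonic functions on the boundary and the solutions of the Neumann
  problem. The same closedness excludes atoms: the zero set of a function carries none of its
  energy. Hence \<open>B\<close> is a null set, the functions vanishing on \<open>B\<close> stay
  dense in \<open>L\<^sup>2\<close>, and the adjoints are single-valued.\<close>

locale positive_functional =
  fixes I :: "('a::metric_space \<Rightarrow> real) \<Rightarrow> real"
  assumes compact_space: "compact (UNIV :: 'a set)"
    and I_add: "\<And>f g. continuous_on UNIV f \<Longrightarrow> continuous_on UNIV g \<Longrightarrow> I (\<lambda>x. f x + g x) = I f + I g"
    and I_scale: "\<And>c f. continuous_on UNIV f \<Longrightarrow> I (\<lambda>x. c * f x) = c * I f"
    and I_pos: "\<And>f. continuous_on UNIV f \<Longrightarrow> (\<And>x. 0 \<le> f x) \<Longrightarrow> 0 \<le> I f"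
begin

lemma I_diff:
  assumes "continuous_on UNIV f" "continuous_on UNIV g"
  shows "I (\<lambda>x. f x - g x) = I f - I g"
  using I_add[OF assms(1) continuous_on_mult_left[OF assms(2), of "-1"]] I_scale[OF assms(2), of "-1"]
  by simp

lemma I_mono:
  assumes "continuous_on UNIV f" "continuous_on UNIV g" "\<And>x. f x \<le> g x"
  shows "I f \<le> I g"
  using I_pos[of "\<lambda>x. g x - f x"] I_diff[OF assms(2,1)] assms
  by (auto intro!: continuous_on_diff)

lemma I_const: "I (\<lambda>x. c) = c * I (\<lambda>x. 1)"
  using I_scale[of "\<lambda>x. 1" c] by simp

lemma I_sum:
  assumes "\<And>k. k < n \<Longrightarrow> continuous_on UNIV (f k)"
  shows "I (\<lambda>x. \<Sum>k<n. f k x) = (\<Sum>k<(n::nat). I (f k))"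
  using assms
proof (induction n)
  case 0
  then show ?case using I_const[of 0] by simp
next
  case (Suc n)
  have "I (\<lambda>x. (\<Sum>k<n. f k x) + f n x) = I (\<lambda>x. \<Sum>k<n. f k x) + I (f n)"
    by (rule I_add) (auto intro!: continuous_on_sum Suc.prems)
  with Suc show ?case by simp
qed

text \<open>Subordination is pointwise domination by the indicator, without a condition on supports.
  Where a function living strictly inside \<open>U\<close> is needed, it is cut down to
  \<open>max (f x - e) 0\<close>, which vanishes off the closed set \<open>{x. e \<le> f x}\<close>
  contained in \<open>U\<close>.\<close>

definition below :: "'a set \<Rightarrow> ('a \<Rightarrow> real) set" where
  "below U = {f. continuous_on UNIV f \<and> (\<forall>x. 0 \<le> f x \<and> f x \<le> indicator U x)}"

definition inner_content :: "'a set \<Rightarrow> ennreal" where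
  "inner_content U = (SUP f \<in> below U. ennreal (I f))"

definition outer_content :: "'a set \<Rightarrow> ennreal" where
  "outer_content A = (INF U \<in> {U. open U \<and> A \<subseteq> U}. inner_content U)"

lemma zero_below: "(\<lambda>x. 0) \<in> below U"
  by (auto simp: below_def)

lemma inner_content_ge: "f \<in> below U \<Longrightarrow> ennreal (I f) \<le> inner_content U"
  unfolding inner_content_def by (rule SUP_upper)

lemma below_le_1: "f \<in> below U \<Longrightarrow> f x \<le> 1"
  unfolding below_def by (auto intro: order_trans[OF _ indicator_le_1[of U]])

lemma below_mono: "U \<subseteq> V \<Longrightarrow> below U \<subseteq> below V"
  unfolding below_def
  by (auto simp: indicator_def of_bool_def split: if_splits intro: order_trans[OF _ zero_le_one])

lemma inner_content_mono: "U \<subseteq> V \<Longrightarrow> inner_content U \<le> inner_content V"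
  unfolding inner_content_def by (intro SUP_subset_mono below_mono) auto

lemma outer_content_open: "open U \<Longrightarrow> outer_content U = inner_content U"
  unfolding outer_content_def
  by (intro antisym INF_lower2[of U] INF_greatest inner_content_mono) auto

lemma outer_content_mono: "A \<subseteq> B \<Longrightarrow> outer_content A \<le> outer_content B"
  unfolding outer_content_def by (intro INF_superset_mono) auto

lemma inner_content_empty: "inner_content {} = 0"
proof -
  have "below {} = {\<lambda>x. 0}" by (auto simp: below_def fun_eq_iff intro: antisym)
  then show ?thesis using I_const[of 0] by (simp add: inner_content_def)
qed

text \<open>The distance to the complement serves. The whole space is treated separately because
  \<open>infdist\<close> to the empty set is zero by convention.\<close>

lemma exists_positive_exactly_on_open:
  assumes "open (U :: 'a set)"
  obtains \<phi> :: "'a \<Rightarrow> real" where "continuous_on UNIV \<phi>" "\<And>x. 0 \<le> \<phi> x" "\<And>x. 0 < \<phi> x \<longleftrightarrow> x \<in> U"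
proof (cases "U = UNIV")
  case True
  then show ?thesis by (intro that[of "\<lambda>x. 1"]) auto
next
  case False
  have "0 < infdist x (- U) \<longleftrightarrow> x \<in> U" for x
  proof -
    have "closed (- U)" "- U \<noteq> {}" using assms False by auto
    then have "x \<in> - U \<longleftrightarrow> infdist x (- U) = 0" by (rule in_closed_iff_infdist_zero)
    moreover have "infdist x (- U) \<ge> 0" by (rule infdist_nonneg)
    ultimately show ?thesis by auto
  qed
  then show ?thesis
    by (intro that[of "\<lambda>x. infdist x (- U)"]) (auto intro!: continuous_intros infdist_nonneg)
qed

text \<open>The pointwise estimate is \<open>f x - e \<le> max (f x - e) 0\<close>. The loss
  \<open>e * I (\<lambda>x. 1)\<close> disappears with \<open>e\<close>, and
  \<open>ennreal_le_epsilon_I\<close> is the device for returning from truncations to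
  \<open>f\<close>.\<close>

lemma truncation_lower:
  assumes f: "continuous_on UNIV f"
  shows "I f - e * I (\<lambda>x. 1) \<le> I (\<lambda>x. max (f x - e) 0)"
proof -
  have "I f - I (\<lambda>x. e) = I (\<lambda>x. f x - e)" using f by (intro I_diff[symmetric]) auto
  also have "\<dots> \<le> I (\<lambda>x. max (f x - e) 0)"
    using f by (intro I_mono continuous_intros) auto
  finally show ?thesis using I_const[of e] by simp
qed

lemma ennreal_le_epsilon_I:
  assumes "\<And>e. 0 < e \<Longrightarrow> ennreal (I f - e * I (\<lambda>x. 1)) \<le> y"
  shows "ennreal (I f) \<le> y"
proof (rule tendsto_upperbound[where F = "at_right 0"])
  have "((\<lambda>e. I f - e * I (\<lambda>x. 1)) \<longlongrightarrow> I f - 0 * I (\<lambda>x. 1)) (at_right 0)"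
    by (intro tendsto_intros)
  then show "((\<lambda>e. ennreal (I f - e * I (\<lambda>x. 1))) \<longlongrightarrow> ennreal (I f)) (at_right 0)"
    by (intro tendsto_ennrealI) simp
  show "\<forall>\<^sub>F e in at_right 0. ennreal (I f - e * I (\<lambda>x. 1)) \<le> y"
    using assms by (auto intro: eventually_mono[OF eventually_at_right_less])
qed simp

text \<open>The functions \<open>g k\<close> telescope to \<open>min f (s N)\<close>, where \<open>N\<close> is so large that \<open>s N\<close> exceeds \<open>1\<close> on
  the compact set \<open>{x. e \<le> f x}\<close>.\<close>

lemma inner_content_countably_subadditive:
  assumes U: "\<And>n::nat. open (U n)"
  shows "inner_content (\<Union>n. U n) \<le> (\<Sum>n. inner_content (U n))"
  unfolding inner_content_def[of "\<Union>n. U n"]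
proof (rule SUP_least)
  fix f assume f: "f \<in> below (\<Union>n. U n)"
  then have fc: "continuous_on UNIV f" and f0: "\<And>x. 0 \<le> f x" and fU: "\<And>x. f x \<le> indicator (\<Union>n. U n) x"
    by (auto simp: below_def)
  have f1: "f x \<le> 1" for x by (rule below_le_1[OF f])
  have "\<forall>n. \<exists>\<phi>. continuous_on UNIV \<phi> \<and> (\<forall>x. 0 \<le> \<phi> x) \<and> (\<forall>x. 0 < (\<phi> x :: real) \<longleftrightarrow> x \<in> U n)"
    using exists_positive_exactly_on_open[OF U] by metis
  then obtain \<phi> where \<phi>: "\<And>n. continuous_on UNIV (\<phi> n)" "\<And>n x. 0 \<le> \<phi> n x"
      "\<And>n x. 0 < (\<phi> n x :: real) \<longleftrightarrow> x \<in> U n"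
    by metis
  show "ennreal (I f) \<le> (\<Sum>n. inner_content (U n))"
  proof (rule ennreal_le_epsilon_I)
    fix e :: real assume e: "0 < e"
    define K where "K = {x. e \<le> f x}"
    define W where "W N = {x. 1 < real N * (\<Sum>k<N. \<phi> k x)}" for N
    have "compact K"
      using closed_Collect_le[OF continuous_on_const fc] compact_space
      by (metis K_def compact_Int_closed inf_top_left)
    have W_open: "open (W N)" for N
      unfolding W_def by (intro open_Collect_less continuous_intros \<phi>)
    have W_mono: "W M \<subseteq> W N" if "M \<le> N" for M N
    proof
      fix x assume "x \<in> W M"
      then have "1 < real M * (\<Sum>k<M. \<phi> k x)" by (simp add: W_def)
      also have "\<dots> \<le> real N * (\<Sum>k<N. \<phi> k x)"
        using that \<phi>(2) by (intro mult_mono sum_mono2) (auto intro!: sum_nonneg)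
      finally show "x \<in> W N" by (simp add: W_def)
    qed
    have "K \<subseteq> (\<Union>N. W N)"
    proof
      fix x assume "x \<in> K"
      then have "indicator (\<Union>n. U n) x \<noteq> (0::real)" using e fU[of x] by (auto simp: K_def)
      then obtain n where n: "0 < \<phi> n x" using \<phi>(3) by (auto simp: indicator_eq_0_iff)
      obtain N where N: "1 / \<phi> n x < real N" using reals_Archimedean2 by blast
      have "1 < real N * \<phi> n x" using N n by (simp add: field_simps)
      also have "\<dots> \<le> real (max N (Suc n)) * (\<Sum>k<max N (Suc n). \<phi> k x)"
      proof (rule mult_mono)
        show "\<phi> n x \<le> (\<Sum>k<max N (Suc n). \<phi> k x)"
          using \<phi>(2) by (intro member_le_sum) auto
      qed (auto intro: \<phi>(2))
      finally show "x \<in> (\<Union>N. W N)" by (auto simp: W_def)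
    qed
    then obtain D where "finite D" "K \<subseteq> (\<Union>N\<in>D. W N)"
      using compactE_image[OF \<open>compact K\<close>, of UNIV W] W_open by auto
    then obtain N where N: "K \<subseteq> W N"
      using W_mono by (meson UN_least Max_ge order_trans)
    define s where "s n x = real N * (\<Sum>k<n. \<phi> k x)" for n x
    define g where "g k x = min (f x) (s (Suc k) x) - min (f x) (s k x)" for k x
    have sc: "continuous_on UNIV (s n)" for n
      unfolding s_def[abs_def] by (intro continuous_intros \<phi>)
    have gc: "continuous_on UNIV (g n)" for n
      unfolding g_def[abs_def] by (intro continuous_intros fc sc)
    have s_Suc: "s (Suc n) x = s n x + real N * \<phi> n x" for n x
      by (simp add: s_def algebra_simps)
    have s0: "0 \<le> s n x" for n x using \<phi>(2) by (simp add: s_def sum_nonneg)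
    have tele: "(\<Sum>k<n. g k x) = min (f x) (s n x)" for n x
      using f0 by (induction n) (auto simp: g_def s_def)
    have gb: "g k \<in> below (U k)" for k
    proof -
      have "0 \<le> g k x \<and> g k x \<le> indicator (U k) x" for x
      proof (cases "x \<in> U k")
        case True
        have "0 \<le> real N * \<phi> k x" using \<phi>(2) by simp
        then show ?thesis using True f1[of x] f0[of x] s0[of k x]
          by (auto simp: g_def s_Suc min_def)
      next
        case False
        then have "\<phi> k x = 0" using \<phi>(2)[of k x] \<phi>(3)[of k x] by linarith
        then show ?thesis using False by (simp add: g_def s_Suc)
      qed
      then show ?thesis using gc by (auto simp: below_def)
    qed
    have "I f - e * I (\<lambda>x. 1) \<le> I (\<lambda>x. max (f x - e) 0)"
      by (rule truncation_lower[OF fc])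
    also have "\<dots> \<le> I (\<lambda>x. min (f x) (s N x))"
    proof (intro I_mono continuous_intros fc sc)
      fix x
      show "max (f x - e) 0 \<le> min (f x) (s N x)"
      proof (cases "x \<in> K")
        case True
        then have "1 < s N x" using N by (auto simp: W_def s_def)
        then show ?thesis using f1[of x] f0[of x] e by auto
      next
        case False
        then show ?thesis using f0[of x] s0[of N x] by (auto simp: K_def)
      qed
    qed
    also have "\<dots> = (\<Sum>k<N. I (g k))"
      using I_sum[of N g] gc by (simp add: tele)
    finally have "ennreal (I f - e * I (\<lambda>x. 1)) \<le> ennreal (\<Sum>k<N. I (g k))"
      by (rule ennreal_leI)
    also have "\<dots> = (\<Sum>k<N. ennreal (I (g k)))"
      using gb by (intro sum_ennreal[symmetric] I_pos) (auto simp: below_def)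
    also have "\<dots> \<le> (\<Sum>k<N. inner_content (U k))"
      by (intro sum_mono inner_content_ge gb)
    also have "\<dots> \<le> (\<Sum>n. inner_content (U n))"
      by (intro sum_le_suminf) auto
    finally show "ennreal (I f - e * I (\<lambda>x. 1)) \<le> (\<Sum>n. inner_content (U n))" .
  qed
qed

lemma inner_content_finite: "inner_content U \<le> ennreal (I (\<lambda>x. 1))"
  unfolding inner_content_def
proof (rule SUP_least)
  fix f assume "f \<in> below U"
  then have "continuous_on UNIV f" "\<And>x. f x \<le> indicator U x" by (auto simp: below_def)
  then have "I f \<le> I (\<lambda>x. 1)"
    by (intro I_mono) (auto intro: order_trans[OF _ indicator_le_1])
  then show "ennreal (I f) \<le> ennreal (I (\<lambda>x. 1))" by (rule ennreal_leI)
qed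

lemma outer_measure_space_outer_content: "outer_measure_space (Pow UNIV) outer_content"
  unfolding outer_measure_space_def
proof (intro conjI)
  show "positive (Pow UNIV) outer_content"
    by (simp add: positive_def outer_content_open inner_content_empty)
  show "increasing (Pow UNIV) outer_content"
    by (auto simp: increasing_def intro: outer_content_mono)
  show "countably_subadditive (Pow UNIV) outer_content"
    unfolding countably_subadditive_def
  proof (intro allI impI)
    fix A :: "nat \<Rightarrow> 'a set"
    show "outer_content (\<Union>i. A i) \<le> (\<Sum>i. outer_content (A i))"
    proof (rule ennreal_le_epsilon)
      fix e :: real assume e: "0 < e"
      \<comment> \<open>The permitted excesses \<open>e * (1/2)^Suc n\<close> add up to
        \<open>e\<close>.\<close>
      have "\<exists>U. open U \<and> A n \<subseteq> U \<and> inner_content U \<le> outer_content (A n) + ennreal (e * (1/2)^Suc n)" for n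
      proof -
        have fin: "outer_content (A n) < \<top>"
          unfolding outer_content_def
          by (rule INF_lower2[of UNIV, THEN order.strict_trans1])
             (auto intro: order.strict_trans1[OF inner_content_finite])
        have "outer_content (A n) < outer_content (A n) + ennreal (e * (1/2)^Suc n)"
          using e fin by (simp add: ennreal_less_zero_iff less_top ennreal_add_left_cancel_less)
        then show ?thesis
          unfolding outer_content_def[of "A n"] INF_less_iff by (auto intro: less_imp_le)
      qed
      then obtain U where U: "\<And>n. open (U n)" "\<And>n. A n \<subseteq> U n"
          "\<And>n. inner_content (U n) \<le> outer_content (A n) + ennreal (e * (1/2)^Suc n)"
        by metis
      have "outer_content (\<Union>i. A i) \<le> outer_content (\<Union>i. U i)"
        using U by (intro outer_content_mono) auto
      also have "\<dots> \<le> (\<Sum>n. inner_content (U n))"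
        using U inner_content_countably_subadditive[of U] by (subst outer_content_open) auto
      also have "\<dots> \<le> (\<Sum>n. outer_content (A n) + ennreal (e * (1/2)^Suc n))"
        using U by (intro suminf_le) auto
      also have "\<dots> = (\<Sum>n. outer_content (A n)) + (\<Sum>n. ennreal (e * (1/2)^Suc n))"
        by (intro suminf_add[symmetric]) auto
      also have "(\<Sum>n. ennreal (e * (1/2)^Suc n)) = ennreal e"
        using e sums_mult[OF power_half_series, of e]
        by (intro suminf_ennreal_eq) auto
      finally show "outer_content (\<Union>i. A i) \<le> (\<Sum>i. outer_content (A i)) + ennreal e" .
    qed
  qed
qed

text \<open>Caratheodory's condition is checked on open \<open>V\<close> and passed to arbitrary
  sets by outer regularity. If \<open>f\<close> is below \<open>V \<inter> U\<close>, its truncation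
  lives on the closed set \<open>K = {x. e \<le> f x}\<close> inside \<open>V \<inter> U\<close>;
  adding any \<open>g\<close> below \<open>V - K\<close> stays below \<open>V\<close>, since the two
  functions are never nonzero at the same point. Taking suprema over \<open>g\<close> and then over
  \<open>f\<close> gives superadditivity.\<close>

lemma open_in_lambda_system:
  assumes "open U"
  shows "U \<in> lambda_system UNIV (Pow UNIV) outer_content"
proof -
  have key: "inner_content (V \<inter> U) + outer_content (V - U) \<le> inner_content V" if V: "open V" for V
    unfolding inner_content_def[of "V \<inter> U"]
  proof (subst ennreal_SUP_add_left[symmetric])
    show "below (V \<inter> U) \<noteq> {}" using zero_below by blast
    show "(SUP f\<in>below (V \<inter> U). ennreal (I f) + outer_content (V - U)) \<le> inner_content V"
    proof (rule SUP_least)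
      fix f assume f: "f \<in> below (V \<inter> U)"
      then have fc: "continuous_on UNIV f" and f0: "\<And>x. 0 \<le> f x" and fU: "\<And>x. f x \<le> indicator (V \<inter> U) x"
        by (auto simp: below_def)
      have f1: "f x \<le> 1" for x by (rule below_le_1[OF f])
      have A: "ennreal (I f - e * I (\<lambda>x. 1)) + outer_content (V - U) \<le> inner_content V" if e: "0 < e" for e
      proof -
        define K where "K = {x. e \<le> f x}"
        have "closed K" unfolding K_def by (intro closed_Collect_le continuous_intros fc)
        have "K \<subseteq> V \<inter> U"
        proof
          fix x assume "x \<in> K"
          then show "x \<in> V \<inter> U"
            using e fU[of x] by (auto simp: K_def indicator_def of_bool_def split: if_splits)
        qed
        have oVK: "open (V - K)" using V \<open>closed K\<close> by (rule open_Diff)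
        have "outer_content (V - U) \<le> outer_content (V - K)"
          using \<open>K \<subseteq> V \<inter> U\<close> by (intro outer_content_mono) auto
        then have "ennreal (I f - e * I (\<lambda>x. 1)) + outer_content (V - U) \<le>
            ennreal (I (\<lambda>x. max (f x - e) 0)) + inner_content (V - K)"
          using truncation_lower[OF fc, of e] outer_content_open[OF oVK]
          by (intro add_mono ennreal_leI) auto
        also have "\<dots> = (SUP g\<in>below (V - K). ennreal (I (\<lambda>x. max (f x - e) 0)) + ennreal (I g))"
          unfolding inner_content_def
          by (rule ennreal_SUP_add_right) (use zero_below in blast)
        also have "\<dots> \<le> inner_content V"
        proof (rule SUP_least)
          fix g assume g: "g \<in> below (V - K)"
          then have gc: "continuous_on UNIV g" and g0: "\<And>x. 0 \<le> g x" and gK: "\<And>x. g x \<le> indicator (V - K) x"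
            by (auto simp: below_def)
          have fec: "continuous_on UNIV (\<lambda>x. max (f x - e) 0)" by (intro continuous_intros fc)
          have "ennreal (I (\<lambda>x. max (f x - e) 0)) + ennreal (I g) = ennreal (I (\<lambda>x. max (f x - e) 0 + g x))"
            using gc g0 fec by (subst I_add) (auto intro!: ennreal_plus[symmetric] I_pos)
          also have "\<dots> \<le> inner_content V"
          proof (intro inner_content_ge)
            have "max (f x - e) 0 + g x \<le> indicator V x" for x
            proof (cases "x \<in> K")
              case True
              then have "g x = 0" "x \<in> V" using gK[of x] g0[of x] \<open>K \<subseteq> V \<inter> U\<close> by auto
              then show ?thesis using f1[of x] e by simp
            next
              case False
              then have "max (f x - e) 0 = 0" by (simp add: K_def)
              moreover have "indicator (V - K) x = (indicator V x :: real)"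
                using False by (simp add: indicator_def)
              ultimately show ?thesis using gK[of x] by simp
            qed
            then show "(\<lambda>x. max (f x - e) 0 + g x) \<in> below V"
              using g0 by (auto simp: below_def intro!: continuous_intros fc gc)
          qed
          finally show "ennreal (I (\<lambda>x. max (f x - e) 0)) + ennreal (I g) \<le> inner_content V" .
        qed
        finally show ?thesis .
      qed
      have "outer_content (V - U) \<le> inner_content V"
        using outer_content_mono[of "V - U" V] outer_content_open[OF V] by simp
      have fin: "inner_content V < \<top>" "outer_content (V - U) < \<top>"
        using inner_content_finite[of V] \<open>outer_content (V - U) \<le> inner_content V\<close>
        by (auto simp: less_top[symmetric] top_unique)
      have "ennreal (I f) \<le> inner_content V - outer_content (V - U)"
      proof (rule ennreal_le_epsilon_I)
        fix e :: real assume "0 < e"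
        from A[OF this] show "ennreal (I f - e * I (\<lambda>x. 1)) \<le> inner_content V - outer_content (V - U)"
          using fin by (simp add: ennreal_le_minus_iff add.commute)
      qed
      then show "ennreal (I f) + outer_content (V - U) \<le> inner_content V"
        using fin \<open>outer_content (V - U) \<le> inner_content V\<close>
        by (auto simp: ennreal_le_minus_iff add.commute)
    qed
  qed
  have "outer_content (A \<inter> U) + outer_content (A - U) \<le> outer_content A" for A
    unfolding outer_content_def[of A]
  proof (rule INF_greatest)
    fix V assume "V \<in> {V. open V \<and> A \<subseteq> V}"
    then have V: "open V" "A \<subseteq> V" by auto
    have "outer_content (A \<inter> U) + outer_content (A - U) \<le> outer_content (V \<inter> U) + outer_content (V - U)"
      using V by (intro add_mono outer_content_mono) auto
    also have "\<dots> \<le> inner_content V"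
      using key[OF V(1)] outer_content_open[OF open_Int[OF V(1) assms]] by simp
    finally show "outer_content (A \<inter> U) + outer_content (A - U) \<le> inner_content V" .
  qed
  moreover have "outer_content A \<le> outer_content (A \<inter> U) + outer_content (A - U)" for A
  proof -
    interpret P: sigma_algebra UNIV "Pow UNIV :: 'a set set" by (rule sigma_algebra_Pow)
    have "(A \<inter> U) \<inter> (A - U) = {}" by blast
    then have "outer_content ((A \<inter> U) \<union> (A - U)) \<le> outer_content (A \<inter> U) + outer_content (A - U)"
      using P.countably_subadditive_subadditive[of outer_content]
        outer_measure_space_outer_content
      by (auto simp: outer_measure_space_def subadditive_def)
    then show ?thesis by (simp add: Int_Diff_Un)
  qed
  ultimately show ?thesis
    by (auto simp: lambda_system_def Int_commute Diff_eq intro: antisym)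
qed

section \<open>The representing measure and the integral formula\<close>

definition rep_measure :: "'a measure" where
  "rep_measure = measure_of UNIV (sets borel) outer_content"

text \<open>Caratheodory's theorem makes \<open>outer_content\<close> a measure on its lambda
  system, which contains the open sets and therefore all Borel sets.\<close>

lemma emeasure_rep_measure: "A \<in> sets borel \<Longrightarrow> emeasure rep_measure A = outer_content A"
  and sets_rep_measure[simp, measurable_cong]: "sets rep_measure = sets borel"
  and space_rep_measure[simp]: "space rep_measure = UNIV"
proof -
  let ?L = "lambda_system UNIV (Pow UNIV) outer_content"
  interpret P: sigma_algebra UNIV "Pow UNIV :: 'a set set" by (rule sigma_algebra_Pow)
  have ms: "measure_space UNIV ?L outer_content"
    by (rule P.caratheodory_lemma[OF outer_measure_space_outer_content])
  then interpret L: sigma_algebra UNIV ?L by (simp add: measure_space_def)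
  have "sets (borel :: 'a measure) \<subseteq> ?L"
    unfolding borel_def using open_in_lambda_system L.sigma_sets_subset[of "Collect open"] by auto
  then have "measure_space UNIV (sets borel) outer_content"
    using measure_down[OF ms] sets.sigma_algebra_axioms[of "borel :: 'a measure"] by simp
  then show "A \<in> sets borel \<Longrightarrow> emeasure rep_measure A = outer_content A"
    unfolding rep_measure_def
    using emeasure_measure_of_sigma[of UNIV "sets (borel :: 'a measure)" outer_content A]
    by (simp add: measure_space_def)
  show "sets rep_measure = sets borel" "space rep_measure = UNIV"
    unfolding rep_measure_def
    using sigma_algebra.sets_measure_of_eq[OF sets.sigma_algebra_axioms[of "borel :: 'a measure"]]
    by (auto simp: space_measure_of_conv)
qed

lemma emeasure_rep_measure_open: "open U \<Longrightarrow> emeasure rep_measure U = inner_content U"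
  by (simp add: emeasure_rep_measure outer_content_open)

sublocale rep: finite_measure rep_measure
  by standard (use inner_content_finite[of UNIV] in
    \<open>auto simp: emeasure_rep_measure_open top_unique\<close>)

lemma measure_rep_measure_UNIV: "measure rep_measure UNIV = I (\<lambda>x. 1)"
proof -
  have "(\<lambda>x. 1) \<in> below UNIV" by (auto simp: below_def)
  then have "emeasure rep_measure UNIV = ennreal (I (\<lambda>x. 1))"
    using inner_content_ge[of "\<lambda>x. 1" UNIV] inner_content_finite[of UNIV]
    by (simp add: emeasure_rep_measure_open antisym)
  then show ?thesis using I_pos[of "\<lambda>x. 1"] by (simp add: measure_def)
qed

lemma le_measure_rep_measure:
  assumes "f \<in> below U" "open U"
  shows "I f \<le> measure rep_measure U"
proof -
  have "ennreal (I f) \<le> ennreal (measure rep_measure U)"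
    using inner_content_ge[OF assms(1)] emeasure_rep_measure_open[OF assms(2)]
    by (simp add: rep.emeasure_eq_measure)
  then show ?thesis by (simp add: ennreal_le_iff)
qed

lemma integrable_rep_measure:
  fixes f :: "'a \<Rightarrow> real"
  assumes "continuous_on UNIV f"
  shows "integrable rep_measure f"
proof -
  have "compact (f ` UNIV)" by (rule compact_continuous_image[OF assms compact_space])
  then obtain c where c: "\<And>x. norm (f x) \<le> c" using compact_imp_bounded by (force simp: bounded_iff)
  have "f \<in> borel_measurable rep_measure"
    using borel_measurable_continuous_onI[OF assms]
    by (simp add: measurable_cong_sets[OF sets_rep_measure refl])
  with c show ?thesis
    by (auto intro!: rep.integrable_const_bound[of f c])
qed

text \<open>Slice \<open>f\<close> into \<open>n\<close> layers of height \<open>1 / n\<close>, each lying between the indicators of two consecutive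
  superlevel sets.\<close>

lemma I_le_integral_unit:
  assumes fc: "continuous_on UNIV f" and f01: "\<And>x. 0 \<le> f x" "\<And>x. f x \<le> 1"
  shows "I f \<le> (\<integral>x. f x \<partial>rep_measure)"
proof -
  have *: "I f \<le> (\<integral>x. f x \<partial>rep_measure) + measure rep_measure UNIV / real n" if n: "0 < n" for n :: nat
  proof -
    define U where "U k = {x. real k / real n < f x}" for k
    define g where "g k x = min (max (real n * f x - real k) 0) 1" for k x
    have oU: "open (U k)" for k unfolding U_def by (intro open_Collect_less continuous_intros fc)
    have gc: "continuous_on UNIV (g k)" for k unfolding g_def[abs_def] by (intro continuous_intros fc)
    have tele: "(\<Sum>k<m. g k x) = min (real n * f x) (real m)" for m x
      using mult_nonneg_nonneg[OF of_nat_0_le_iff[of n] f01(1)[of x]]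
      by (induction m) (auto simp: g_def min_def max_def)
    have sumg: "(\<Sum>k<n. g k x) = real n * f x" for x
      using f01(2)[of x] mult_left_le[of "f x" "real n"] unfolding tele by simp
    have U_iff: "x \<in> U k \<longleftrightarrow> real k < real n * f x" for k x
      using n by (simp add: U_def field_simps)
    have gb: "g k \<in> below (U k)" for k
      using gc by (auto simp: below_def g_def U_iff indicator_def of_bool_def)
    have gl: "indicator (U (Suc k)) x \<le> g k x" for k x
      by (auto simp: g_def U_iff indicator_def of_bool_def)
    have "real n * I f = I (\<lambda>x. \<Sum>k<n. g k x)"
      unfolding sumg by (rule I_scale[OF fc, symmetric])
    also have "\<dots> = (\<Sum>k<n. I (g k))" by (rule I_sum[OF gc])
    also have "\<dots> \<le> (\<Sum>k<n. measure rep_measure (U k))"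
      by (intro sum_mono le_measure_rep_measure gb oU)
    \<comment> \<open>One further level set is added so that the index can be shifted:
      \<open>g k\<close> dominates the indicator of \<open>U (Suc k)\<close>, not of
      \<open>U k\<close>. The surplus term \<open>U 0\<close> has at most the total mass, which is
      divided by \<open>n\<close> at the end.\<close>
    also have "\<dots> \<le> (\<Sum>k<Suc n. measure rep_measure (U k))" by simp
    also have "\<dots> = measure rep_measure (U 0) + (\<Sum>k<n. measure rep_measure (U (Suc k)))"
      by (rule sum.lessThan_Suc_shift)
    also have "(\<Sum>k<n. measure rep_measure (U (Suc k))) \<le> (\<Sum>k<n. \<integral>x. g k x \<partial>rep_measure)"
    proof (rule sum_mono)
      fix k
      have "measure rep_measure (U (Suc k)) = (\<integral>x. indicator (U (Suc k)) x \<partial>rep_measure)"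
        using oU by simp
      also have "\<dots> \<le> (\<integral>x. g k x \<partial>rep_measure)"
        using gl oU by (intro integral_mono[OF _ integrable_rep_measure[OF gc]] integrable_real_indicator)
          (auto simp: rep.emeasure_eq_measure)
      finally show "measure rep_measure (U (Suc k)) \<le> (\<integral>x. g k x \<partial>rep_measure)" .
    qed
    also have "(\<Sum>k<n. \<integral>x. g k x \<partial>rep_measure) = (\<integral>x. (\<Sum>k<n. g k x) \<partial>rep_measure)"
      by (intro Bochner_Integration.integral_sum[symmetric] integrable_rep_measure gc)
    also have "\<dots> = real n * (\<integral>x. f x \<partial>rep_measure)" by (simp add: sumg)
    also have "measure rep_measure (U 0) \<le> measure rep_measure UNIV"
      by (intro rep.finite_measure_mono) auto
    finally show ?thesis using n by (simp add: field_simps)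
  qed
  have "(\<lambda>n. (\<integral>x. f x \<partial>rep_measure) + measure rep_measure UNIV / real n) \<longlonglongrightarrow>
      (\<integral>x. f x \<partial>rep_measure) + 0"
    by (intro tendsto_intros lim_const_over_n)
  then have "I f \<le> (\<integral>x. f x \<partial>rep_measure) + 0"
    by (rule LIMSEQ_le_const) (use * in \<open>auto intro: exI[of _ 1]\<close>)
  then show ?thesis by simp
qed

text \<open>An affine change of scale moves the values of \<open>f\<close> into the unit interval.
  There one inequality is known, and applying it to \<open>1 - g\<close> gives the reverse one,
  because \<open>I\<close> and the measure assign the same value to the constant 1.\<close>

theorem I_eq_integral:
  assumes fc: "continuous_on UNIV f"
  shows "I f = (\<integral>x. f x \<partial>rep_measure)"
proof -
  have "compact (f ` UNIV)" by (rule compact_continuous_image[OF fc compact_space])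
  then obtain c where c: "\<And>x. norm (f x) \<le> c" using compact_imp_bounded by (force simp: bounded_iff)
  define d where "d = c + 1"
  have d: "\<And>x. \<bar>f x\<bar> \<le> d" "0 < d"
    using c order_trans[OF norm_ge_zero c] unfolding d_def by (auto intro: order_trans add_increasing2)
  define g where "g x = (1 / (2 * d)) * f x + 1 / 2" for x
  have gc: "continuous_on UNIV g" unfolding g_def[abs_def] by (intro continuous_intros fc)
  have g01: "0 \<le> g x" "g x \<le> 1" for x
    using d(1)[of x] d(2) by (auto simp: g_def field_simps abs_le_iff)
  have one: "(\<integral>x. 1 \<partial>rep_measure) = I (\<lambda>x. 1)"
    by (simp add: measure_rep_measure_UNIV)
  have "I (\<lambda>x. 1 - g x) \<le> (\<integral>x. 1 - g x \<partial>rep_measure)"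
    using g01 by (intro I_le_integral_unit continuous_intros gc) auto
  moreover have "I (\<lambda>x. 1 - g x) = I (\<lambda>x. 1) - I g" by (intro I_diff gc) auto
  moreover have "(\<integral>x. 1 - g x \<partial>rep_measure) = I (\<lambda>x. 1) - (\<integral>x. g x \<partial>rep_measure)"
    by (subst Bochner_Integration.integral_diff) (auto simp: measure_rep_measure_UNIV integrable_rep_measure gc)
  ultimately have geq: "I g = (\<integral>x. g x \<partial>rep_measure)"
    using I_le_integral_unit[OF gc g01] by linarith
  have "f = (\<lambda>x. (2 * d) * g x + - d)" using d(2) by (auto simp: g_def fun_eq_iff field_simps)
  then have f_eq: "\<And>P. P f = P (\<lambda>x. (2 * d) * g x + - d)" by metis
  have "I f = I (\<lambda>x. (2 * d) * g x) + I (\<lambda>x. - d)"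
    by (subst f_eq) (intro I_add continuous_intros gc)
  also have "\<dots> = 2 * d * (\<integral>x. g x \<partial>rep_measure) + - d * (\<integral>x. 1 \<partial>rep_measure)"
    unfolding I_scale[OF gc] I_const[of "- d"] geq one ..
  also have "\<dots> = (\<integral>x. (2 * d) * g x + - d \<partial>rep_measure)"
    by (subst Bochner_Integration.integral_add) (auto simp: integrable_rep_measure gc)
  also have "\<dots> = (\<integral>x. f x \<partial>rep_measure)"
    by (rule f_eq[symmetric])
  finally show ?thesis .
qed

end

section \<open>Finite signed measures\<close>

lemma sum_fun_apply: "sum f S x = (\<Sum>i\<in>S. f i x)"
  by (induction S rule: infinite_finite_induct) auto

text \<open>A class of test functions that is closed under products, contains the indicators, and is
  integrable for every finite measure, so that signed integrals are linear on it without side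
  conditions.\<close>

definition bounded_borel :: "('a::topological_space \<Rightarrow> real) set" where
  "bounded_borel = {k \<in> borel_measurable borel. \<exists>c. \<forall>x. \<bar>k x\<bar> \<le> c}"

lemma bounded_borelI: "k \<in> borel_measurable borel \<Longrightarrow> (\<And>x. \<bar>k x\<bar> \<le> c) \<Longrightarrow> k \<in> bounded_borel"
  by (auto simp: bounded_borel_def)

lemma bounded_borel_measurable: "k \<in> bounded_borel \<Longrightarrow> k \<in> borel_measurable borel"
  by (simp add: bounded_borel_def)

lemma bounded_borel_bound:
  assumes "k \<in> bounded_borel"
  obtains c where "0 \<le> c" "\<And>x. \<bar>k x\<bar> \<le> c"
proof -
  obtain c where "\<And>x. \<bar>k x\<bar> \<le> c" using assms by (auto simp: bounded_borel_def)
  then show thesis using order_trans[OF abs_ge_zero] that by blast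
qed

lemma bounded_borel_indicator [simp, intro]: "A \<in> sets borel \<Longrightarrow> indicator A \<in> bounded_borel"
  by (rule bounded_borelI[of _ 1]) (auto simp: indicator_def)

lemma bounded_borel_const [simp, intro]: "(\<lambda>x. c) \<in> bounded_borel"
  by (rule bounded_borelI[of _ "\<bar>c\<bar>"]) auto

lemma bounded_borel_zero [simp, intro]: "0 \<in> bounded_borel"
  unfolding zero_fun_def by (rule bounded_borel_const)

lemma bounded_borel_add [intro]:
  assumes "f \<in> bounded_borel" "g \<in> bounded_borel" shows "f + g \<in> bounded_borel"
proof -
  obtain c d where "\<And>x. \<bar>f x\<bar> \<le> c" "\<And>x. \<bar>g x\<bar> \<le> d" using assms by (metis bounded_borel_bound)
  then show ?thesis
    using assms[THEN bounded_borel_measurable] unfolding plus_fun_def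
    by (intro bounded_borelI[of _ "c + d"]) (auto intro: order_trans[OF abs_triangle_ineq] add_mono)
qed

lemma bounded_borel_mult [intro]:
  assumes "f \<in> bounded_borel" "g \<in> bounded_borel" shows "f * g \<in> bounded_borel"
proof -
  obtain c d where "0 \<le> c" "\<And>x. \<bar>f x\<bar> \<le> c" "\<And>x. \<bar>g x\<bar> \<le> d" using assms by (metis bounded_borel_bound)
  then show ?thesis
    using assms[THEN bounded_borel_measurable] unfolding times_fun_def
    by (intro bounded_borelI[of _ "c * d"]) (auto simp: abs_mult intro: mult_mono)
qed

lemma bounded_borel_scaleR [intro]: "f \<in> bounded_borel \<Longrightarrow> c *\<^sub>R f \<in> bounded_borel"
  using bounded_borel_mult[of "\<lambda>x. c" f] by (simp add: times_fun_def scaleR_fun_def)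

lemma bounded_borel_sum [intro]: "(\<And>i. i \<in> S \<Longrightarrow> f i \<in> bounded_borel) \<Longrightarrow> sum f S \<in> bounded_borel"
  by (induction S rule: infinite_finite_induct) auto

lemma bounded_borel_continuous:
  assumes "compact (UNIV :: 'a::metric_space set)" "continuous_on UNIV (f :: 'a \<Rightarrow> real)"
  shows "f \<in> bounded_borel"
proof -
  have "compact (f ` UNIV)" by (rule compact_continuous_image[OF assms(2,1)])
  then obtain c where "\<And>x. \<bar>f x\<bar> \<le> c" using compact_imp_bounded by (force simp: bounded_iff)
  then show ?thesis using assms(2) by (intro bounded_borelI borel_measurable_continuous_onI)
qed

text \<open>An abstraction covering integrals against measures, signed measures and their densities.
  Such functionals are determined by their values on indicators, so an identity of integrals reduces
  to an identity of set functions.\<close>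

definition bounded_functional :: "(('a::topological_space \<Rightarrow> real) \<Rightarrow> real) \<Rightarrow> bool" where
  "bounded_functional I \<longleftrightarrow>
     (\<forall>f\<in>bounded_borel. \<forall>g\<in>bounded_borel. I (f + g) = I f + I g) \<and>
     (\<forall>f\<in>bounded_borel. \<forall>c. I (c *\<^sub>R f) = c * I f) \<and>
     (\<exists>K. \<forall>f\<in>bounded_borel. \<forall>c. (\<forall>x. \<bar>f x\<bar> \<le> c) \<longrightarrow> \<bar>I f\<bar> \<le> K * c)"

lemma bounded_functional_sum:
  assumes "bounded_functional I" "\<And>i. i \<in> S \<Longrightarrow> f i \<in> bounded_borel" "finite S"
  shows "I (sum f S) = (\<Sum>i\<in>S. I (f i))"
  using assms(3,2)
proof (induction S rule: finite_induct)
  case empty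
  have "I (0 *\<^sub>R 0) = 0 * I 0"
    using assms(1) bounded_borel_zero unfolding bounded_functional_def by blast
  then show ?case by (simp add: zero_fun_def)
next
  case (insert i S)
  have "I (f i + sum f S) = I (f i) + I (sum f S)"
    using assms(1) insert.prems unfolding bounded_functional_def by (meson bounded_borel_sum insertI1 insertI2)
  with insert show ?case by (simp add: plus_fun_def)
qed

lemma bounded_functional_diff:
  assumes "bounded_functional I" "f \<in> bounded_borel" "g \<in> bounded_borel"
  shows "I (f - g) = I f - I g"
proof -
  have "I (f + (-1) *\<^sub>R g) = I f + I ((-1) *\<^sub>R g)"
    using assms bounded_borel_scaleR[of g "-1"] unfolding bounded_functional_def by blast
  moreover have "I ((-1) *\<^sub>R g) = - 1 * I g"
    using assms unfolding bounded_functional_def by blast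
  ultimately show ?thesis by simp
qed

lemma bounded_functional_lincomb:
  assumes "bounded_functional I" "bounded_functional J"
  shows "bounded_functional (\<lambda>f. a * I f + b * J f)"
proof -
  from assms obtain K L where K: "\<And>f c. f \<in> bounded_borel \<Longrightarrow> (\<forall>x. \<bar>f x\<bar> \<le> c) \<Longrightarrow> \<bar>I f\<bar> \<le> K * c"
    and L: "\<And>f c. f \<in> bounded_borel \<Longrightarrow> (\<forall>x. \<bar>f x\<bar> \<le> c) \<Longrightarrow> \<bar>J f\<bar> \<le> L * c"
    unfolding bounded_functional_def by metis
  have "\<bar>a * I f + b * J f\<bar> \<le> (\<bar>a\<bar> * K + \<bar>b\<bar> * L) * c" if "f \<in> bounded_borel" "\<forall>x. \<bar>f x\<bar> \<le> c" for f c
  proof -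
    have "\<bar>a * I f + b * J f\<bar> \<le> \<bar>a\<bar> * \<bar>I f\<bar> + \<bar>b\<bar> * \<bar>J f\<bar>"
      using abs_triangle_ineq[of "a * I f" "b * J f"] by (simp add: abs_mult)
    also have "\<dots> \<le> \<bar>a\<bar> * (K * c) + \<bar>b\<bar> * (L * c)"
      using K[OF that] L[OF that] by (intro add_mono mult_left_mono) auto
    finally show ?thesis by (simp add: algebra_simps)
  qed
  then have "\<exists>K. \<forall>f\<in>bounded_borel. \<forall>c. (\<forall>x. \<bar>f x\<bar> \<le> c) \<longrightarrow> \<bar>a * I f + b * J f\<bar> \<le> K * c" by blast
  then show ?thesis
    using assms unfolding bounded_functional_def by (simp add: algebra_simps)
qed

text \<open>Rounding the values of \<open>f\<close> down to multiples of \<open>1 / n\<close> gives a simple function.\<close>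

lemma bounded_functional_eqI:
  assumes I: "bounded_functional I" and J: "bounded_functional J"
    and ind: "\<And>A. A \<in> sets borel \<Longrightarrow> I (indicator A) = J (indicator A)"
    and f: "f \<in> bounded_borel"
  shows "I f = J f"
proof -
  define D where "D g = 1 * I g + (-1) * J g" for g
  have D: "bounded_functional D"
    unfolding D_def[abs_def] by (rule bounded_functional_lincomb[OF I J])
  then obtain K where K: "\<And>f c. f \<in> bounded_borel \<Longrightarrow> (\<forall>x. \<bar>f x\<bar> \<le> c) \<Longrightarrow> \<bar>D f\<bar> \<le> K * c"
    unfolding bounded_functional_def by metis
  have fm: "f \<in> borel_measurable borel" using f by (rule bounded_borel_measurable)
  obtain c where c: "0 \<le> c" "\<And>x. \<bar>f x\<bar> \<le> c" using f by (metis bounded_borel_bound)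
  have *: "\<bar>D f\<bar> \<le> K * (1 / real n)" if n: "0 < n" for n :: nat
  proof -
    define N where "N = \<lceil>real n * c\<rceil> + 1"
    define A where "A j = {x. \<lfloor>real n * f x\<rfloor> = j}" for j
    define g where "g = (\<Sum>j\<in>{- N..N}. (real_of_int j / real n) *\<^sub>R (indicator (A j) :: _ \<Rightarrow> real))"
    have A: "A j \<in> sets borel" for j
      using measurable_sets[OF borel_measurable_times[OF borel_measurable_const fm, of "real n"], of "{j..<j+1}"]
      by (auto simp: A_def vimage_def floor_eq_iff)
    have gb: "g \<in> bounded_borel" unfolding g_def using A by auto
    have "D g = (\<Sum>j\<in>{- N..N}. D ((real_of_int j / real n) *\<^sub>R (indicator (A j) :: _ \<Rightarrow> real)))"
      unfolding g_def using A by (intro bounded_functional_sum[OF D]) auto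
    also have "\<dots> = (\<Sum>j\<in>{- N..N}. (real_of_int j / real n) * D (indicator (A j)))"
      using D A unfolding bounded_functional_def by (intro sum.cong refl) auto
    also have "\<dots> = 0" using ind[OF A] by (simp add: D_def)
    finally have Dg: "D g = 0" .
    have gval: "g x = real_of_int \<lfloor>real n * f x\<rfloor> / real n" for x
    proof -
      have "\<bar>real n * f x\<bar> \<le> real n * c" using c(2)[of x] n by (simp add: abs_mult)
      then have "\<lfloor>real n * f x\<rfloor> \<in> {- N..N}" unfolding N_def abs_le_iff by simp linarith
      then have "(\<Sum>j\<in>{- N..N}. (real_of_int j / real n) * (indicator (A j) x :: real)) =
          (\<Sum>j\<in>{- N..N}. if \<lfloor>real n * f x\<rfloor> = j then real_of_int j / real n else 0)"
        by (intro sum.cong) (auto simp: A_def)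
      also have "\<dots> = real_of_int \<lfloor>real n * f x\<rfloor> / real n"
        using \<open>\<lfloor>real n * f x\<rfloor> \<in> {- N..N}\<close> by (subst sum.delta') auto
      finally show ?thesis unfolding g_def by (simp add: sum_fun_apply)
    qed
    have "\<bar>(f - g) x\<bar> \<le> 1 / real n" for x
    proof -
      have "f x - g x = (real n * f x - real_of_int \<lfloor>real n * f x\<rfloor>) / real n"
        using n by (simp add: gval field_simps)
      moreover have "0 \<le> real n * f x - real_of_int \<lfloor>real n * f x\<rfloor>"
        "real n * f x - real_of_int \<lfloor>real n * f x\<rfloor> \<le> 1" by linarith+
      ultimately show ?thesis using n by (simp add: divide_right_mono)
    qed
    moreover have "f - g \<in> bounded_borel"
      using bounded_borel_add[OF f bounded_borel_scaleR[OF gb, of "-1"]] by simp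
    ultimately have "\<bar>D (f - g)\<bar> \<le> K * (1 / real n)" by (intro K) auto
    then show ?thesis using bounded_functional_diff[OF D f gb] Dg by simp
  qed
  have "(\<lambda>n. K * (1 / real n)) \<longlonglongrightarrow> K * 0" by (intro tendsto_intros lim_1_over_n)
  then have "\<bar>D f\<bar> \<le> K * 0"
    by (rule LIMSEQ_le_const) (use * in \<open>auto intro: exI[of _ 1]\<close>)
  then show ?thesis by (simp add: D_def)
qed

lemma integrable_bounded_borel:
  assumes "finite_measure M" "sets M = sets borel" "f \<in> bounded_borel"
  shows "integrable M f"
proof -
  interpret finite_measure M by fact
  obtain c where "\<And>x. \<bar>f x\<bar> \<le> c" using assms(3) by (metis bounded_borel_bound)
  moreover have "f \<in> borel_measurable M"
    using bounded_borel_measurable[OF assms(3)] by (simp add: measurable_cong_sets[OF assms(2) refl])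
  ultimately show ?thesis by (auto intro!: integrable_const_bound[of f c])
qed

lemma bounded_functional_integral:
  assumes "finite_measure M" "sets M = sets borel"
  shows "bounded_functional (\<lambda>f. \<integral>x. f x \<partial>M)"
proof -
  interpret finite_measure M by fact
  note int = integrable_bounded_borel[OF assms]
  have "\<bar>\<integral>x. f x \<partial>M\<bar> \<le> measure M (space M) * c" if "f \<in> bounded_borel" "\<forall>x. \<bar>f x\<bar> \<le> c" for f c
  proof -
    have "\<bar>\<integral>x. f x \<partial>M\<bar> \<le> (\<integral>x. \<bar>f x\<bar> \<partial>M)" by (rule integral_abs_bound)
    also have "\<dots> \<le> (\<integral>x. c \<partial>M)" using that int by (intro integral_mono) auto
    finally show ?thesis by simp
  qed
  then have "\<exists>K. \<forall>f\<in>bounded_borel. \<forall>c. (\<forall>x. \<bar>f x\<bar> \<le> c) \<longrightarrow> \<bar>\<integral>x. f x \<partial>M\<bar> \<le> K * c" by blast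
  then show ?thesis using int unfolding bounded_functional_def by (simp add: plus_fun_def scaleR_fun_def)
qed

text \<open>\<open>measure_of\<close> gives the zero measure unless its set function is a measure,
  so nonnegativity and countable additivity are exactly what makes \<open>to_measure\<close> carry
  the intended values.\<close>

lemma to_measure_nonneg:
  fixes \<sigma> :: "'a::topological_space set \<Rightarrow> real"
  assumes "\<sigma> {} = 0" "\<And>A. A \<in> sets borel \<Longrightarrow> 0 \<le> \<sigma> A"
    and "\<And>A :: nat \<Rightarrow> 'a set. range A \<subseteq> sets borel \<Longrightarrow> disjoint_family A \<Longrightarrow> (\<lambda>n. \<sigma> (A n)) sums \<sigma> (\<Union>n. A n)"
  shows "sets (to_measure \<sigma>) = sets borel"
    and "finite_measure (to_measure \<sigma>)"
    and "A \<in> sets borel \<Longrightarrow> measure (to_measure \<sigma>) A = \<sigma> A"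
proof -
  have sa: "sigma_algebra UNIV (sets (borel :: 'a measure))"
    using sets.sigma_algebra_axioms[of "borel :: 'a measure"] by simp
  show s: "sets (to_measure \<sigma>) = sets borel"
    unfolding to_measure_def by (rule sigma_algebra.sets_measure_of_eq[OF sa])
  have sp: "space (to_measure \<sigma>) = UNIV"
    unfolding to_measure_def by (simp add: space_measure_of_conv)
  have "countably_additive (sets (borel :: 'a measure)) (\<lambda>A. ennreal (\<sigma> A))"
    unfolding countably_additive_def
  proof (intro allI impI)
    fix A :: "nat \<Rightarrow> 'a set"
    assume A: "range A \<subseteq> sets borel" "disjoint_family A"
    then show "(\<Sum>i. ennreal (\<sigma> (A i))) = ennreal (\<sigma> (\<Union> (range A)))"
      using assms(2) assms(3)[OF A] by (intro suminf_ennreal_eq) auto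
  qed
  then have em: "emeasure (to_measure \<sigma>) A = ennreal (\<sigma> A)" if "A \<in> sets borel" for A
    unfolding to_measure_def using sa that
    by (intro emeasure_measure_of_sigma) (auto simp: positive_def assms)
  show "finite_measure (to_measure \<sigma>)"
    by standard (simp add: sp em)
  show "measure (to_measure \<sigma>) A = \<sigma> A" if "A \<in> sets borel"
    using em[OF that] assms(2)[OF that] by (simp add: measure_def)
qed

section \<open>Jordan decomposition and integration against a signed measure\<close>

locale signed =
  fixes \<sigma> :: "'a::topological_space set \<Rightarrow> real"
  assumes signed: "finite_signed_measure \<sigma>"
begin

lemma empty [simp]: "\<sigma> {} = 0"
  using signed by (simp add: finite_signed_measure_def)

lemma sums: "range A \<subseteq> sets borel \<Longrightarrow> disjoint_family A \<Longrightarrow> (\<lambda>n::nat. \<sigma> (A n)) sums \<sigma> (\<Union>n. A n)"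
  using signed by (simp add: finite_signed_measure_def)

lemma nonborel: "A \<notin> sets borel \<Longrightarrow> \<sigma> A = 0"
  using signed by (simp add: finite_signed_measure_def)

lemma union:
  assumes "A \<in> sets borel" "B \<in> sets borel" "A \<inter> B = {}"
  shows "\<sigma> (A \<union> B) = \<sigma> A + \<sigma> B"
proof -
  have "(\<lambda>n. \<sigma> (binaryset A B n)) sums \<sigma> (\<Union>n. binaryset A B n)"
    using assms by (intro sums) (auto simp: range_binaryset_eq disjoint_family_on_def binaryset_def)
  moreover have "(\<lambda>n. \<sigma> (binaryset A B n)) sums (\<sigma> A + \<sigma> B)"
    by (rule binaryset_sums) simp
  ultimately show ?thesis by (simp add: UN_binaryset_eq sums_unique2)
qed

lemma diff: "A \<in> sets borel \<Longrightarrow> D \<in> sets borel \<Longrightarrow> D \<subseteq> A \<Longrightarrow> \<sigma> (A - D) = \<sigma> A - \<sigma> D"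
  using union[of "A - D" D] by (simp add: Diff_disjoint Int_commute Un_absorb2)

text \<open>Call a Borel set bad if the values on its Borel subsets are unbounded. A bad set
  contains a bad subset whose removal takes away a piece of absolute value at least 1. Iterating
  yields disjoint pieces whose values form a convergent series without tending to zero.\<close>

lemma bounded: "\<exists>K. \<forall>D\<in>sets borel. \<bar>\<sigma> D\<bar> \<le> K"
proof (rule ccontr)
  assume unb: "\<not> ?thesis"
  define U where "U A \<longleftrightarrow> A \<in> sets borel \<and> (\<forall>K. \<exists>D\<in>sets borel. D \<subseteq> A \<and> \<bar>\<sigma> D\<bar> > K)" for A
  have step: "\<exists>A'. U A' \<and> (A' \<subseteq> A \<and> 1 \<le> \<bar>\<sigma> (A - A')\<bar>)" if A: "U A" for A
  proof -
    \<comment> \<open>The threshold \<open>\<bar>\<sigma> A\<bar> + 1\<close> makes both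
      \<open>D\<close> and \<open>A - D\<close> have absolute value at least 1, whichever of the two
      is kept.\<close>
    from A obtain D where D: "D \<in> sets borel" "D \<subseteq> A" "\<bar>\<sigma> D\<bar> > \<bar>\<sigma> A\<bar> + 1"
      unfolding U_def by blast
    have Ab: "A \<in> sets borel" using A by (simp add: U_def)
    have "U D \<or> U (A - D)"
    proof (rule ccontr)
      assume "\<not> ?thesis"
      then obtain K L where K: "\<And>E. E \<in> sets borel \<Longrightarrow> E \<subseteq> D \<Longrightarrow> \<bar>\<sigma> E\<bar> \<le> K"
        and L: "\<And>E. E \<in> sets borel \<Longrightarrow> E \<subseteq> A - D \<Longrightarrow> \<bar>\<sigma> E\<bar> \<le> L"
        using D Ab unfolding U_def by (meson not_less sets.Diff)
      have "\<bar>\<sigma> E\<bar> \<le> K + L" if E: "E \<in> sets borel" "E \<subseteq> A" for E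
      proof -
        have "\<sigma> E = \<sigma> (E \<inter> D) + \<sigma> (E - D)"
          using union[of "E \<inter> D" "E - D"] E D by (auto simp: Int_Diff_Un)
        moreover have "\<bar>\<sigma> (E \<inter> D)\<bar> \<le> K" "\<bar>\<sigma> (E - D)\<bar> \<le> L"
          using E D by (auto intro!: K L)
        ultimately show ?thesis by linarith
      qed
      then show False using A unfolding U_def by (meson not_less)
    qed
    then show ?thesis
    proof
      assume "U D"
      then show ?thesis using D diff[OF Ab D(1,2)] by (intro exI[of _ D]) auto
    next
      assume "U (A - D)"
      moreover have "A - (A - D) = D" using D by auto
      ultimately show ?thesis using D by (intro exI[of _ "A - D"]) auto
    qed
  qed
  have "U UNIV" unfolding U_def using unb by (auto simp: not_le)
  then obtain F where F: "\<And>n::nat. U (F n)" "\<And>n. F (Suc n) \<subseteq> F n" "\<And>n. 1 \<le> \<bar>\<sigma> (F n - F (Suc n))\<bar>"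
    using dependent_nat_choice[of "\<lambda>n. U" "\<lambda>n A A'. A' \<subseteq> A \<and> 1 \<le> \<bar>\<sigma> (A - A')\<bar>"] step by metis
  have dec: "F n \<subseteq> F m" if "m \<le> n" for m n
    using that by (induction rule: dec_induct) (use F(2) in auto)
  have "disjoint_family (\<lambda>n. F n - F (Suc n))"
    unfolding disjoint_family_on_def
  proof (intro ballI impI)
    fix m n :: nat assume "m \<noteq> n"
    then have "F n \<subseteq> F (Suc m) \<or> F m \<subseteq> F (Suc n)"
      using dec[of "Suc m" n] dec[of "Suc n" m] by linarith
    then show "(F m - F (Suc m)) \<inter> (F n - F (Suc n)) = {}" by blast
  qed
  then have "(\<lambda>n. \<sigma> (F n - F (Suc n))) sums \<sigma> (\<Union>n. F n - F (Suc n))"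
    using F(1) unfolding U_def by (intro sums) auto
  then have "(\<lambda>n. \<sigma> (F n - F (Suc n))) \<longlonglongrightarrow> 0"
    by (intro summable_LIMSEQ_zero sums_summable)
  then have "\<forall>\<^sub>F n in sequentially. \<bar>\<sigma> (F n - F (Suc n))\<bar> < 1"
    using tendstoD[of "\<lambda>n. \<sigma> (F n - F (Suc n))" 0 sequentially 1] by (simp only: dist_real_def zero_less_one diff_0_right)
  then show False using F(3) by (auto simp: eventually_sequentially not_less[symmetric])
qed

definition pos :: "'a set \<Rightarrow> real" where
  "pos A = (SUP D \<in> {D \<in> sets borel. D \<subseteq> A}. \<sigma> D)"

lemma bdd: "bdd_above (\<sigma> ` {D \<in> sets borel. D \<subseteq> A})"
  using bounded by (auto simp: bdd_above_def abs_le_iff)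

lemma pos_upper: "D \<in> sets borel \<Longrightarrow> D \<subseteq> A \<Longrightarrow> \<sigma> D \<le> pos A"
  unfolding pos_def by (rule cSUP_upper[OF _ bdd]) auto

lemma pos_least: "(\<And>D. D \<in> sets borel \<Longrightarrow> D \<subseteq> A \<Longrightarrow> \<sigma> D \<le> x) \<Longrightarrow> pos A \<le> x"
  unfolding pos_def by (rule cSUP_least) auto

lemma pos_nonneg: "0 \<le> pos A"
  using pos_upper[of "{}" A] by simp

lemma pos_union:
  assumes "A \<in> sets borel" "B \<in> sets borel" "A \<inter> B = {}"
  shows "pos A + pos B \<le> pos (A \<union> B)"
proof -
  have "pos A \<le> pos (A \<union> B) - pos B"
  proof (rule pos_least)
    fix D assume D: "D \<in> sets borel" "D \<subseteq> A"
    have "pos B \<le> pos (A \<union> B) - \<sigma> D"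
    proof (rule pos_least)
      fix D' assume D': "D' \<in> sets borel" "D' \<subseteq> B"
      have "\<sigma> D + \<sigma> D' = \<sigma> (D \<union> D')" using D D' assms by (intro union[symmetric]) auto
      also have "\<dots> \<le> pos (A \<union> B)" using D D' by (intro pos_upper) auto
      finally show "\<sigma> D' \<le> pos (A \<union> B) - \<sigma> D" by simp
    qed
    then show "\<sigma> D \<le> pos (A \<union> B) - pos B" by simp
  qed
  then show ?thesis by simp
qed

lemma pos_mono: "A \<subseteq> B \<Longrightarrow> pos A \<le> pos B"
  by (intro pos_least pos_upper) auto

text \<open>Superadditivity on finite unions bounds the partial sums by \<open>pos\<close> of the
  union; in the other direction a competitor \<open>D\<close> is split into the pieces
  \<open>D \<inter> A n\<close>.\<close>

lemma pos_sums:
  assumes A: "range A \<subseteq> sets borel" "disjoint_family A"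
  shows "(\<lambda>n::nat. pos (A n)) sums pos (\<Union>n. A n)"
proof -
  have Ab: "\<And>n. A n \<in> sets borel" using A by auto
  have part: "(\<Sum>k<n. pos (A k)) \<le> pos (\<Union>k<n. A k)" for n
  proof (induction n)
    case 0
    then show ?case by (simp add: pos_nonneg)
  next
    case (Suc n)
    have dj: "(\<Union>k<n. A k) \<inter> A n = {}"
      using A(2) by (auto simp: disjoint_family_on_def) (metis IntI empty_iff less_irrefl)
    have "(\<Sum>k<Suc n. pos (A k)) \<le> pos (\<Union>k<n. A k) + pos (A n)" using Suc by simp
    also have "\<dots> \<le> pos ((\<Union>k<n. A k) \<union> A n)" using Ab dj by (intro pos_union) auto
    also have "(\<Union>k<n. A k) \<union> A n = (\<Union>k<Suc n. A k)" by (auto simp: less_Suc_eq)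
    finally show ?case .
  qed
  have le: "(\<Sum>k<n. pos (A k)) \<le> pos (\<Union>n. A n)" for n
    using part[of n] by (rule order_trans) (auto intro!: pos_mono)
  have summ: "summable (\<lambda>n. pos (A n))"
    by (rule summableI_nonneg_bounded[OF pos_nonneg le])
  have "(\<Sum>n. pos (A n)) = pos (\<Union>n. A n)"
  proof (rule antisym)
    show "(\<Sum>n. pos (A n)) \<le> pos (\<Union>n. A n)"
      by (rule suminf_le_const[OF summ le])
    show "pos (\<Union>n. A n) \<le> (\<Sum>n. pos (A n))"
    proof (rule pos_least)
      fix D assume D: "D \<in> sets borel" "D \<subseteq> (\<Union>n. A n)"
      have "(\<lambda>n. \<sigma> (D \<inter> A n)) sums \<sigma> (\<Union>n. D \<inter> A n)"
        using A D by (intro sums) (auto simp: disjoint_family_on_def)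
      moreover have "(\<Union>n. D \<inter> A n) = D" using D by auto
      ultimately have "(\<lambda>n. \<sigma> (D \<inter> A n)) sums \<sigma> D" by simp
      then show "\<sigma> D \<le> (\<Sum>n. pos (A n))"
        using summ D Ab by (intro sums_le[OF _ _ summable_sums]) (auto intro!: pos_upper)
    qed
  qed
  with summ show ?thesis by (simp add: sums_iff)
qed

lemma pos_empty: "pos {} = 0"
  by (rule antisym[OF pos_least pos_nonneg]) auto

lemma jordan_pos_eq: "jordan_pos \<sigma> = to_measure pos"
  unfolding jordan_pos_def pos_def[abs_def] ..

lemma sets_jordan_pos [simp, measurable_cong]: "sets (jordan_pos \<sigma>) = sets borel"
  and finite_measure_jordan_pos: "finite_measure (jordan_pos \<sigma>)"
  and measure_jordan_pos: "A \<in> sets borel \<Longrightarrow> measure (jordan_pos \<sigma>) A = pos A"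
  unfolding jordan_pos_eq
  using to_measure_nonneg[of pos, OF pos_empty pos_nonneg pos_sums] by auto

end

lemma signed_uminus: "finite_signed_measure \<sigma> \<Longrightarrow> finite_signed_measure (\<lambda>A. - \<sigma> A)"
  unfolding finite_signed_measure_def by (auto intro: sums_minus)

context signed
begin

text \<open>The negative variation is the positive variation of the negated measure, so every fact
  about \<open>pos\<close> is available for it; the rewrite phrases these facts with
  \<open>jordan_neg\<close>.\<close>

interpretation neg: signed "\<lambda>A. - \<sigma> A"
  rewrites "jordan_pos (\<lambda>A. - \<sigma> A) = jordan_neg \<sigma>"
  using signed by unfold_locales (auto intro: signed_uminus simp: jordan_neg_def)

text \<open>Complementation inside \<open>A\<close> exchanges the two suprema, since
  \<open>\<sigma> D = \<sigma> A - \<sigma> (A - D)\<close>. This replaces a Hahn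
  decomposition.\<close>

lemma jordan:
  assumes A: "A \<in> sets borel"
  shows "\<sigma> A = pos A - neg.pos A"
proof -
  have "pos A \<le> \<sigma> A + neg.pos A"
  proof (rule pos_least)
    fix D assume D: "D \<in> sets borel" "D \<subseteq> A"
    show "\<sigma> D \<le> \<sigma> A + neg.pos A"
      using neg.pos_upper[of "A - D" A] diff[OF A D] A D by auto
  qed
  moreover have "neg.pos A \<le> pos A - \<sigma> A"
  proof (rule neg.pos_least)
    fix D assume D: "D \<in> sets borel" "D \<subseteq> A"
    show "- \<sigma> D \<le> pos A - \<sigma> A"
      using pos_upper[of "A - D" A] diff[OF A D] A D by auto
  qed
  ultimately show ?thesis by simp
qed

lemma bounded_functional_signed_integral: "bounded_functional (signed_integral \<sigma>)"
  using bounded_functional_lincomb[OF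
      bounded_functional_integral[OF finite_measure_jordan_pos sets_jordan_pos]
      bounded_functional_integral[OF neg.finite_measure_jordan_pos neg.sets_jordan_pos], of 1 "-1"]
  by (simp add: signed_integral_def[abs_def])

lemma signed_integral_add:
  "f \<in> bounded_borel \<Longrightarrow> g \<in> bounded_borel \<Longrightarrow>
     signed_integral \<sigma> (f + g) = signed_integral \<sigma> f + signed_integral \<sigma> g"
  using bounded_functional_signed_integral by (auto simp: bounded_functional_def)

lemma signed_integral_scaleR:
  "f \<in> bounded_borel \<Longrightarrow> signed_integral \<sigma> (c *\<^sub>R f) = c * signed_integral \<sigma> f"
  using bounded_functional_signed_integral by (auto simp: bounded_functional_def)

lemma signed_integral_indicator:
  assumes A: "A \<in> sets borel"
  shows "signed_integral \<sigma> (indicator A) = \<sigma> A"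
proof -
  have "(\<integral>x. indicator A x \<partial>jordan_pos \<sigma>) = pos A"
    using A measure_jordan_pos[OF A] sets_eq_imp_space_eq[OF sets_jordan_pos] by simp
  moreover have "(\<integral>x. indicator A x \<partial>jordan_neg \<sigma>) = neg.pos A"
    using A neg.measure_jordan_pos[OF A] sets_eq_imp_space_eq[OF neg.sets_jordan_pos] by simp
  ultimately show ?thesis using jordan[OF A] by (simp add: signed_integral_def)
qed

text \<open>Each of the two Jordan parts has total mass at most \<open>K\<close>, whence the factor
  2. With \<open>K = norm v * norm w\<close> this later gives continuity of integrals in the field
  \<open>v\<close>.\<close>

lemma signed_integral_bound:
  assumes f: "f \<in> bounded_borel" "\<And>x. \<bar>f x\<bar> \<le> c"
    and K: "\<And>A. A \<in> sets borel \<Longrightarrow> \<bar>\<sigma> A\<bar> \<le> K"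
  shows "\<bar>signed_integral \<sigma> f\<bar> \<le> 2 * K * c"
proof -
  have c: "0 \<le> c" using f(2) order_trans[OF abs_ge_zero] by blast
  have *: "\<bar>\<integral>x. f x \<partial>M\<bar> \<le> K * c"
    if "finite_measure M" "sets M = sets borel" "measure M UNIV \<le> K" for M
  proof -
    interpret finite_measure M by fact
    have sp: "space M = UNIV" using sets_eq_imp_space_eq[OF that(2)] by simp
    have "\<bar>\<integral>x. f x \<partial>M\<bar> \<le> (\<integral>x. \<bar>f x\<bar> \<partial>M)" by (rule integral_abs_bound)
    also have "\<dots> \<le> (\<integral>x. c \<partial>M)"
      using f that integrable_bounded_borel[OF that(1,2) f(1)] by (intro integral_mono) auto
    also have "\<dots> = measure M UNIV * c" by (simp add: sp)
    also have "\<dots> \<le> K * c" using that(3) c by (rule mult_right_mono)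
    finally show ?thesis .
  qed
  have "pos UNIV \<le> K" "neg.pos UNIV \<le> K"
    using K by (auto intro!: pos_least neg.pos_least simp: abs_le_iff)
  then have "\<bar>\<integral>x. f x \<partial>jordan_pos \<sigma>\<bar> \<le> K * c" "\<bar>\<integral>x. f x \<partial>jordan_neg \<sigma>\<bar> \<le> K * c"
    using measure_jordan_pos[of UNIV] neg.measure_jordan_pos[of UNIV]
    by (auto intro!: * finite_measure_jordan_pos neg.finite_measure_jordan_pos)
  then show ?thesis unfolding signed_integral_def by linarith
qed

lemma signed_integral_tendsto:
  assumes f: "\<And>n. f n \<in> bounded_borel" "g \<in> bounded_borel" "\<And>n x. \<bar>f n x\<bar> \<le> c"
    and lim: "\<And>x. (\<lambda>n. f n x) \<longlonglongrightarrow> g x"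
  shows "(\<lambda>n. signed_integral \<sigma> (f n)) \<longlonglongrightarrow> signed_integral \<sigma> g"
proof -
  have *: "(\<lambda>n. \<integral>x. f n x \<partial>M) \<longlonglongrightarrow> (\<integral>x. g x \<partial>M)"
    if "finite_measure M" "sets M = sets borel" for M
  proof (rule integral_dominated_convergence[where w = "\<lambda>x. c"])
    interpret finite_measure M by fact
    show "integrable M (\<lambda>x. c)" by simp
    show "g \<in> borel_measurable M" "f n \<in> borel_measurable M" for n
      using f(1,2)[THEN bounded_borel_measurable] by (simp_all add: measurable_cong_sets[OF that(2) refl])
  qed (use f lim in auto)
  show ?thesis unfolding signed_integral_def
    by (intro tendsto_diff * finite_measure_jordan_pos neg.finite_measure_jordan_pos
        sets_jordan_pos neg.sets_jordan_pos)
qed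

text \<open>The measure with density \<open>k\<close>, given by its values on indicators. Countable
  additivity is dominated convergence for the partial sums of
  \<open>indicator (A i) * k\<close>.\<close>

lemma signed_density_measure:
  assumes k: "k \<in> bounded_borel"
  shows "finite_signed_measure (\<lambda>A. if A \<in> sets borel then signed_integral \<sigma> (indicator A * k) else 0)"
  unfolding finite_signed_measure_def
proof (intro conjI allI impI)
  have "signed_integral \<sigma> (0 *\<^sub>R 0) = 0 * signed_integral \<sigma> 0"
    by (rule signed_integral_scaleR) auto
  then show "(if {} \<in> sets borel then signed_integral \<sigma> (indicator {} * k) else 0) = 0"
    by (simp add: zero_fun_def times_fun_def)
next
  fix A :: "nat \<Rightarrow> 'a set" assume A: "range A \<subseteq> sets borel" "disjoint_family A"
  then have Ab: "\<And>n. A n \<in> sets borel" by auto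
  obtain c where c: "0 \<le> c" "\<And>x. \<bar>k x\<bar> \<le> c" using k by (metis bounded_borel_bound)
  have ind: "(\<Sum>i<n. indicator (A i) x) = (indicator (\<Union>i<n. A i) x :: real)" for n x
    using A(2) by (intro indicator_UN_disjoint[symmetric]) (auto simp: disjoint_family_on_def)
  have "(\<lambda>n. signed_integral \<sigma> (\<Sum>i<n. indicator (A i) * k)) \<longlonglongrightarrow> signed_integral \<sigma> (indicator (\<Union>i. A i) * k)"
  proof (rule signed_integral_tendsto[where c = c])
    fix n x
    have "(\<Sum>i<n. indicator (A i) * k) x = indicator (\<Union>i<n. A i) x * k x"
      by (simp add: sum_fun_apply sum_distrib_right[symmetric] ind)
    also have "\<bar>\<dots>\<bar> \<le> c" using c by (auto simp: indicator_def)
    finally show "\<bar>(\<Sum>i<n. indicator (A i) * k) x\<bar> \<le> c" .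
  next
    fix x
    have "(\<lambda>i. indicator (A i) x :: real) sums indicator (\<Union>i. A i) x"
      using A(2) by (intro indicator_sums) (auto simp: disjoint_family_on_def)
    then have "(\<lambda>i. indicator (A i) x * k x) sums (indicator (\<Union>i. A i) x * k x)"
      by (rule sums_mult2)
    then show "(\<lambda>n. (\<Sum>i<n. indicator (A i) * k) x) \<longlonglongrightarrow> (indicator (\<Union>i. A i) * k) x"
      by (simp add: sums_def sum_fun_apply)
  qed (use Ab k in auto)
  moreover have "signed_integral \<sigma> (\<Sum>i<n. indicator (A i) * k) = (\<Sum>i<n. signed_integral \<sigma> (indicator (A i) * k))" for n
    using Ab k by (intro bounded_functional_sum[OF bounded_functional_signed_integral]) auto
  ultimately show "(\<lambda>n. if A n \<in> sets borel then signed_integral \<sigma> (indicator (A n) * k) else 0) sums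
      (if (\<Union>n. A n) \<in> sets borel then signed_integral \<sigma> (indicator (\<Union>n. A n) * k) else 0)"
    using Ab by (simp add: sums_def)
qed auto

end

text \<open>The form in which \<open>bounded_functional_eqI\<close> is applied: integrals against
  densities, linear combinations and ordinary measures are all computed by comparing values on
  indicators.\<close>

lemma signed_integral_eqI:
  assumes \<sigma>: "finite_signed_measure \<sigma>" and I: "bounded_functional I"
    and "\<And>A. A \<in> sets borel \<Longrightarrow> I (indicator A) = \<sigma> A"
    and "f \<in> bounded_borel"
  shows "signed_integral \<sigma> f = I f"
proof -
  interpret signed \<sigma> by standard fact
  show ?thesis
    by (rule bounded_functional_eqI[OF bounded_functional_signed_integral I])
      (use assms in \<open>auto simp: signed_integral_indicator\<close>)
qed

lemma signed_integral_density:
  assumes \<sigma>: "finite_signed_measure \<sigma>" and k: "k \<in> bounded_borel" and f: "f \<in> bounded_borel"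
  shows "signed_integral (\<lambda>A. if A \<in> sets borel then signed_integral \<sigma> (indicator A * k) else 0) f
    = signed_integral \<sigma> (f * k)"
proof -
  interpret signed \<sigma> by standard fact
  obtain K where K: "\<And>f c. f \<in> bounded_borel \<Longrightarrow> (\<forall>x. \<bar>f x\<bar> \<le> c) \<Longrightarrow> \<bar>signed_integral \<sigma> f\<bar> \<le> K * c"
    using bounded_functional_signed_integral unfolding bounded_functional_def by metis
  obtain d where d: "0 \<le> d" "\<And>x. \<bar>k x\<bar> \<le> d" using k by (metis bounded_borel_bound)
  have "bounded_functional (\<lambda>f. signed_integral \<sigma> (f * k))"
    unfolding bounded_functional_def
  proof (intro conjI ballI allI exI impI)
    fix f g :: "'a \<Rightarrow> real" and c :: real assume f: "f \<in> bounded_borel"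
    show "signed_integral \<sigma> (c *\<^sub>R f * k) = c * signed_integral \<sigma> (f * k)"
    proof -
      have "c *\<^sub>R f * k = c *\<^sub>R (f * k)" by (simp add: fun_eq_iff)
      then show ?thesis using signed_integral_scaleR[OF bounded_borel_mult[OF f k]] by simp
    qed
    assume g: "g \<in> bounded_borel"
    show "signed_integral \<sigma> ((f + g) * k) = signed_integral \<sigma> (f * k) + signed_integral \<sigma> (g * k)"
      using signed_integral_add[OF bounded_borel_mult[OF f k] bounded_borel_mult[OF g k]]
      by (simp only: distrib_right)
  next
    fix f :: "'a \<Rightarrow> real" and c :: real assume f: "f \<in> bounded_borel" "\<forall>x. \<bar>f x\<bar> \<le> c"
    then have "\<bar>(f * k) x\<bar> \<le> c * d" for x
      using d order_trans[OF abs_ge_zero, of "f x" c] by (auto simp: abs_mult intro!: mult_mono)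
    then have "\<bar>signed_integral \<sigma> (f * k)\<bar> \<le> K * (c * d)" using f k by (intro K) auto
    then show "\<bar>signed_integral \<sigma> (f * k)\<bar> \<le> (K * d) * c" by (simp add: algebra_simps)
  qed
  then show ?thesis
    by (rule signed_integral_eqI[OF signed_density_measure[OF k] _ _ f]) simp
qed

lemma signed_lincomb:
  assumes "finite_signed_measure \<sigma>" "finite_signed_measure \<tau>"
  shows "finite_signed_measure (\<lambda>A. a * \<sigma> A + b * \<tau> A)"
  using assms unfolding finite_signed_measure_def by (auto intro!: sums_add sums_mult)

lemma signed_integral_lincomb:
  assumes "finite_signed_measure \<sigma>" "finite_signed_measure \<tau>" "f \<in> bounded_borel"
  shows "signed_integral (\<lambda>A. a * \<sigma> A + b * \<tau> A) f = a * signed_integral \<sigma> f + b * signed_integral \<tau> f"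
proof -
  interpret S: signed \<sigma> + T: signed \<tau> using assms by (auto simp: signed_def)
  show ?thesis
    by (rule signed_integral_eqI[OF signed_lincomb[OF assms(1,2)]
          bounded_functional_lincomb[OF S.bounded_functional_signed_integral T.bounded_functional_signed_integral]])
      (auto simp: S.signed_integral_indicator T.signed_integral_indicator assms)
qed

lemma signed_measure:
  assumes "finite_measure M" "sets M = sets borel"
  shows "finite_signed_measure (measure M)"
    and "f \<in> bounded_borel \<Longrightarrow> signed_integral (measure M) f = (\<integral>x. f x \<partial>M)"
proof -
  interpret finite_measure M by fact
  show 1: "finite_signed_measure (measure M)"
    unfolding finite_signed_measure_def
    using assms(2) by (auto intro!: finite_measure_UNION simp: measure_notin_sets)
  have "space M = UNIV" using sets_eq_imp_space_eq[OF assms(2)] by simp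
  then show "signed_integral (measure M) f = (\<integral>x. f x \<partial>M)" if "f \<in> bounded_borel"
    using that assms by (intro signed_integral_eqI[OF 1 bounded_functional_integral]) auto
qed

text \<open>The indicator of a closed set is the bounded pointwise limit of continuous functions, and the
  Borel sets on which the two measures agree form a Dynkin system.\<close>

lemma signed_eqI:
  fixes \<sigma> \<tau> :: "'a::metric_space set \<Rightarrow> real"
  assumes \<sigma>: "finite_signed_measure \<sigma>" and \<tau>: "finite_signed_measure \<tau>"
    and eq: "\<And>f. f \<in> bounded_borel \<Longrightarrow> continuous_on UNIV f \<Longrightarrow> signed_integral \<sigma> f = signed_integral \<tau> f"
  shows "\<sigma> = \<tau>"
proof -
  interpret S: signed \<sigma> + T: signed \<tau> using assms by (auto simp: signed_def)
  have closed: "\<sigma> F = \<tau> F" if F: "closed F" for F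
  proof (cases "F = {}")
    case False
    define f where "f n x = max 0 (1 - real n * infdist x F)" for n x
    have fc: "continuous_on UNIV (f n)" for n
      unfolding f_def[abs_def] by (intro continuous_intros)
    have f01: "\<bar>f n x\<bar> \<le> 1" for n x
      by (auto simp: f_def infdist_nonneg)
    have fb: "f n \<in> bounded_borel" for n
      using fc f01 by (intro bounded_borelI borel_measurable_continuous_onI) auto
    have lim: "(\<lambda>n. f n x) \<longlonglongrightarrow> indicator F x" for x
    proof (cases "x \<in> F")
      case True
      then show ?thesis by (simp add: f_def)
    next
      case False
      then have pos: "0 < infdist x F"
        using in_closed_iff_infdist_zero[OF F \<open>F \<noteq> {}\<close>, of x] infdist_nonneg[of x F] by linarith
      obtain N where N: "1 / infdist x F < real N" using reals_Archimedean2 by blast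
      have "f n x = 0" if "N \<le> n" for n
      proof -
        have "1 < real N * infdist x F" using N pos by (simp add: field_simps)
        also have "\<dots> \<le> real n * infdist x F" using that pos by (intro mult_right_mono) auto
        finally show ?thesis by (simp add: f_def)
      qed
      then show ?thesis using False
        by (intro tendsto_eventually) (auto simp: eventually_sequentially)
    qed
    have Fb: "F \<in> sets borel" using F by simp
    have "(\<lambda>n. signed_integral \<sigma> (f n)) \<longlonglongrightarrow> \<sigma> F"
      using S.signed_integral_tendsto[OF fb bounded_borel_indicator[OF Fb] f01 lim] Fb
      by (simp add: S.signed_integral_indicator)
    moreover have "(\<lambda>n. signed_integral \<tau> (f n)) \<longlonglongrightarrow> \<tau> F"
      using T.signed_integral_tendsto[OF fb bounded_borel_indicator[OF Fb] f01 lim] Fb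
      by (simp add: T.signed_integral_indicator)
    ultimately show ?thesis using eq[OF fb fc] LIMSEQ_unique by simp
  qed simp
  have sb: "sigma_sets UNIV (Collect closed) = sets (borel :: 'a measure)"
    by (simp add: borel_eq_closed)
  show ?thesis
  proof
    fix A
    show "\<sigma> A = \<tau> A"
    proof (cases "A \<in> sets borel")
      case True
      then have "A \<in> sigma_sets UNIV (Collect closed)" by (simp add: sb)
      have "Int_stable (Collect closed :: 'a set set)" "Collect closed \<subseteq> Pow (UNIV :: 'a set)"
        by (auto simp: Int_stable_def)
      then show ?thesis using \<open>A \<in> sigma_sets UNIV (Collect closed)\<close>
      proof (induction rule: sigma_sets_induct_disjoint)
        case (compl A)
        then have "A \<in> sets borel" by (simp add: sb)
        then show ?case
          using compl S.diff[of UNIV A] T.diff[of UNIV A] closed[of UNIV] by simp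
      next
        case (union A)
        then have "range A \<subseteq> sets borel" by (simp add: sb)
        then show ?case
          using S.sums[of A] T.sums[of A] union sums_unique2 by simp
      qed (auto intro: closed)
    qed (simp add: S.nonborel T.nonborel)
  qed
qed

text \<open>Every Borel subset of a \<nu>-null set is again \<nu>-null, so both suprema defining the
  Jordan parts vanish there. Thus both parts are absolutely continuous and the Radon-Nikodym theorem
  applies to each.\<close>

lemma signed_density_integral:
  fixes \<nu> :: "'a::topological_space measure"
  assumes \<nu>: "sigma_finite_measure \<nu>" "sets \<nu> = sets borel"
    and \<sigma>: "finite_signed_measure \<sigma>" and ac: "\<And>A. A \<in> null_sets \<nu> \<Longrightarrow> \<sigma> A = 0"
  shows "k \<in> bounded_borel \<Longrightarrow> integrable \<nu> (\<lambda>x. signed_density \<sigma> \<nu> x * k x)"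
    and "k \<in> bounded_borel \<Longrightarrow> signed_integral \<sigma> k = (\<integral>x. signed_density \<sigma> \<nu> x * k x \<partial>\<nu>)"
proof -
  interpret signed \<sigma> by standard fact
  interpret neg: signed "\<lambda>A. - \<sigma> A"
    rewrites "jordan_pos (\<lambda>A. - \<sigma> A) = jordan_neg \<sigma>"
    using \<sigma> by unfold_locales (auto intro: signed_uminus simp: jordan_neg_def)
  interpret V: sigma_finite_measure \<nu> by fact
  have null: "pos A = 0" "neg.pos A = 0" if "A \<in> null_sets \<nu>" for A
  proof -
    have "\<sigma> D = 0" if "D \<in> sets borel" "D \<subseteq> A" for D
      using that \<open>A \<in> null_sets \<nu>\<close> \<nu>(2) by (intro ac) (metis null_sets_subset)
    then show "pos A = 0" "neg.pos A = 0"
      by (auto intro!: antisym[OF pos_least pos_nonneg] antisym[OF neg.pos_least neg.pos_nonneg])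
  qed
  have P: "absolutely_continuous \<nu> (jordan_pos \<sigma>)" "absolutely_continuous \<nu> (jordan_neg \<sigma>)"
    unfolding absolutely_continuous_def
    using null measure_jordan_pos neg.measure_jordan_pos \<nu>(2)
      finite_measure.emeasure_eq_measure[OF finite_measure_jordan_pos]
      finite_measure.emeasure_eq_measure[OF neg.finite_measure_jordan_pos]
    by (auto simp: null_sets_def)
  have sf: "sigma_finite_measure (jordan_pos \<sigma>)" "sigma_finite_measure (jordan_neg \<sigma>)"
    using finite_measure_jordan_pos neg.finite_measure_jordan_pos
    by (auto simp: finite_measure_def)
  assume k: "k \<in> bounded_borel"
  have km: "k \<in> borel_measurable \<nu>"
    using bounded_borel_measurable[OF k] by (simp add: measurable_cong_sets[OF \<nu>(2) refl])
  have s: "sets (jordan_pos \<sigma>) = sets \<nu>" "sets (jordan_neg \<sigma>) = sets \<nu>" using \<nu>(2) by auto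
  have ip: "integrable (jordan_pos \<sigma>) k" "integrable (jordan_neg \<sigma>) k"
    by (auto intro!: integrable_bounded_borel finite_measure_jordan_pos neg.finite_measure_jordan_pos k)
  have i: "integrable \<nu> (\<lambda>x. enn2real (RN_deriv \<nu> (jordan_pos \<sigma>) x) * k x)"
     "integrable \<nu> (\<lambda>x. enn2real (RN_deriv \<nu> (jordan_neg \<sigma>) x) * k x)"
    using V.RN_deriv_integrable[OF sf(1) P(1) s(1) km] V.RN_deriv_integrable[OF sf(2) P(2) s(2) km] ip
    by auto
  have e: "(\<lambda>x. signed_density \<sigma> \<nu> x * k x) = (\<lambda>x. enn2real (RN_deriv \<nu> (jordan_pos \<sigma>) x) * k x -
      enn2real (RN_deriv \<nu> (jordan_neg \<sigma>) x) * k x)"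
    by (simp add: signed_density_def algebra_simps)
  show "integrable \<nu> (\<lambda>x. signed_density \<sigma> \<nu> x * k x)"
    unfolding e using i by (rule Bochner_Integration.integrable_diff)
  show "signed_integral \<sigma> k = (\<integral>x. signed_density \<sigma> \<nu> x * k x \<partial>\<nu>)"
    unfolding e signed_integral_def Bochner_Integration.integral_diff[OF i]
    using V.RN_deriv_integral[OF sf(1) P(1) s(1) km] V.RN_deriv_integral[OF sf(2) P(2) s(2) km] by simp
qed

section \<open>Hilbert spaces\<close>

lemma subspace_closure:
  fixes V :: "'a::real_normed_vector set"
  assumes "subspace V"
  shows "subspace (closure V)"
  unfolding subspace_def
proof (intro conjI ballI allI)
  show "0 \<in> closure V" using assms closure_subset subspace_0 by blast
next
  fix x y assume "x \<in> closure V" "y \<in> closure V"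
  then obtain f g where "\<And>n. f n \<in> V" "f \<longlonglongrightarrow> x" "\<And>n. g n \<in> V" "g \<longlonglongrightarrow> y"
    unfolding closure_sequential by blast
  then show "x + y \<in> closure V"
    unfolding closure_sequential
    by (intro exI[of _ "\<lambda>n. f n + g n"]) (auto intro: tendsto_add subspace_add[OF assms])
next
  fix c x assume "x \<in> closure V"
  then obtain f where "\<And>n. f n \<in> V" "f \<longlonglongrightarrow> x"
    unfolding closure_sequential by blast
  then show "c *\<^sub>R x \<in> closure V"
    unfolding closure_sequential
    by (intro exI[of _ "\<lambda>n. c *\<^sub>R f n"]) (auto intro: tendsto_scaleR subspace_scale[OF assms])
qed

text \<open>By the parallelogram law a sequence in \<open>V\<close> minimizing the distance to \<open>x\<close> is Cauchy.\<close>

lemma projection_exists: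
  fixes x :: "'h::{real_inner, complete_space}"
  assumes V: "subspace V" "closed V"
  shows "\<exists>y\<in>V. \<forall>z\<in>V. (x - y) \<bullet> z = 0"
proof -
  define d where "d = (INF y\<in>V. (norm (x - y))\<^sup>2)"
  have V0: "V \<noteq> {}" using V(1) subspace_0 by blast
  have bdd: "bdd_below ((\<lambda>y. (norm (x - y))\<^sup>2) ` V)" by (rule bdd_belowI[of _ 0]) auto
  have d_le: "d \<le> (norm (x - y))\<^sup>2" if "y \<in> V" for y
    unfolding d_def by (rule cINF_lower[OF bdd that])
  have "\<exists>y\<in>V. (norm (x - y))\<^sup>2 < d + 1 / real (Suc n)" for n
  proof -
    have "(INF y\<in>V. (norm (x - y))\<^sup>2) < d + 1 / real (Suc n)" unfolding d_def by simp
    then show ?thesis using cINF_less_iff[OF V0 bdd] by simp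
  qed
  then obtain y where y: "\<And>n. y n \<in> V" "\<And>n. (norm (x - y n))\<^sup>2 < d + 1 / real (Suc n)"
    by metis
  have par: "(norm (y m - y n))\<^sup>2 \<le> 2 / real (Suc m) + 2 / real (Suc n)" for m n
  proof -
    have "(1/2) *\<^sub>R (y m + y n) \<in> V" using y V(1) by (auto intro: subspace_scale subspace_add)
    then have "d \<le> (norm (x - (1/2) *\<^sub>R (y m + y n)))\<^sup>2" by (rule d_le)
    moreover have "(norm (y m - y n))\<^sup>2 + 4 * (norm (x - (1/2) *\<^sub>R (y m + y n)))\<^sup>2 =
        2 * (norm (x - y m))\<^sup>2 + 2 * (norm (x - y n))\<^sup>2"
      by (simp add: power2_norm_eq_inner inner_diff_left inner_diff_right inner_add_left inner_add_right
          inner_commute algebra_simps)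
    ultimately show ?thesis using y(2)[of m] y(2)[of n] by simp
  qed
  have "Cauchy y"
  proof (rule metric_CauchyI)
    fix e :: real assume e: "0 < e"
    \<comment> \<open>By \<open>par\<close>, two indices at least \<open>N\<close> have squared
      distance below \<open>4 / N\<close>.\<close>
    obtain N where N: "4 / e\<^sup>2 < real N" using reals_Archimedean2 by blast
    have "dist (y m) (y n) < e" if "m \<ge> N" "n \<ge> N" for m n
    proof -
      have N0: "0 < real N" using N e by (smt (verit) divide_pos_pos zero_less_power)
      have "2 / real (Suc m) \<le> 2 / real N" "2 / real (Suc n) < 2 / real N"
        using that N0 by (auto intro!: divide_left_mono divide_strict_left_mono)
      moreover have "4 / real N < e\<^sup>2" using N N0 e by (simp add: field_simps)
      ultimately have "(norm (y m - y n))\<^sup>2 < e\<^sup>2" using par[of m n] by simp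
      then show ?thesis using e by (simp add: dist_norm power_less_imp_less_base)
    qed
    then show "\<exists>M. \<forall>m\<ge>M. \<forall>n\<ge>M. dist (y m) (y n) < e" by blast
  qed
  then obtain l where l: "y \<longlonglongrightarrow> l" using Cauchy_convergent convergent_def by blast
  then have l: "l \<in> V" "y \<longlonglongrightarrow> l" using closed_sequentially[OF V(2)] y(1) by auto
  have "(\<lambda>n. (norm (x - y n))\<^sup>2) \<longlonglongrightarrow> (norm (x - l))\<^sup>2" using l by (intro tendsto_intros)
  moreover have "(\<lambda>n. d + 1 / real (Suc n)) \<longlonglongrightarrow> d + 0"
    by (intro tendsto_intros LIMSEQ_inverse_real_of_nat[unfolded inverse_eq_divide])
  ultimately have "(norm (x - l))\<^sup>2 \<le> d + 0"
    using y(2) by (intro LIMSEQ_le) (auto intro: less_imp_le)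
  then have min: "(norm (x - l))\<^sup>2 \<le> (norm (x - z))\<^sup>2" if "z \<in> V" for z
    using d_le[OF that] \<open>(norm (x - l))\<^sup>2 \<le> d + 0\<close> by linarith
  have "(x - l) \<bullet> z = 0" if z: "z \<in> V" for z
  proof (cases "z = 0")
    case False
    \<comment> \<open>The minimizer of the squared distance from \<open>x\<close> along the line
      \<open>l + t *\<^sub>R z\<close>; minimality of \<open>l\<close> then forces the linear term
      to vanish.\<close>
    define t where "t = ((x - l) \<bullet> z) / (z \<bullet> z)"
    have zz: "0 < z \<bullet> z" using False by simp
    have "l + t *\<^sub>R z \<in> V" using l z V(1) by (auto intro: subspace_scale subspace_add)
    then have "(norm (x - l))\<^sup>2 \<le> (norm ((x - l) - t *\<^sub>R z))\<^sup>2"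
      using min by (simp add: algebra_simps)
    also have "\<dots> = (norm (x - l))\<^sup>2 - 2 * t * ((x - l) \<bullet> z) + t * t * (z \<bullet> z)"
      by (simp add: power2_norm_eq_inner inner_diff_left inner_diff_right inner_commute algebra_simps)
    also have "t * t * (z \<bullet> z) = t * ((x - l) \<bullet> z)" using zz by (simp add: t_def)
    finally have "t * ((x - l) \<bullet> z) \<le> 0" by simp
    then have "((x - l) \<bullet> z)\<^sup>2 / (z \<bullet> z) \<le> 0" by (simp add: t_def power2_eq_square)
    then show ?thesis using zz by (simp add: divide_le_0_iff)
  qed simp
  then show ?thesis using l by blast
qed

lemma dense_subspaceI:
  fixes V :: "'h::{real_inner, complete_space} set"
  assumes V: "subspace V" and orth: "\<And>x. (\<And>y. y \<in> V \<Longrightarrow> x \<bullet> y = 0) \<Longrightarrow> x = 0"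
  shows "closure V = UNIV"
proof -
  have "x \<in> closure V" for x
  proof -
    obtain y where y: "y \<in> closure V" "\<And>z. z \<in> closure V \<Longrightarrow> (x - y) \<bullet> z = 0"
      using projection_exists[OF subspace_closure[OF V] closed_closure] by blast
    then have "x - y = 0" using closure_subset by (intro orth) blast
    with y show ?thesis by simp
  qed
  then show ?thesis by blast
qed

lemma orthogonal_dense_eq_0:
  fixes x :: "'h::real_inner"
  assumes "closure V = UNIV" "\<And>y. y \<in> V \<Longrightarrow> x \<bullet> y = 0"
  shows "x = 0"
proof -
  have "closed {y. x \<bullet> y = 0}" by (intro closed_Collect_eq continuous_intros)
  then have "closure V \<subseteq> {y. x \<bullet> y = 0}" using assms(2) by (intro closure_minimal) auto
  then have "x \<bullet> x = 0" using assms(1) by blast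
  then show ?thesis by simp
qed

lemma bounded_linear_eq_dense:
  assumes "bounded_linear S" "bounded_linear T" "closure V = UNIV" "\<And>x. x \<in> V \<Longrightarrow> S x = T x"
  shows "S = T"
proof -
  have "closed {x. S x = T x}"
    using assms(1,2) by (intro closed_Collect_eq linear_continuous_on) auto
  then have "closure V \<subseteq> {x. S x = T x}" using assms(4) by (intro closure_minimal) auto
  then show ?thesis using assms(3) by auto
qed

text \<open>Working with a linear relation instead of a function avoids a separate proof of well-definedness.\<close>

lemma bounded_relation_extension:
  fixes R :: "('x::real_normed_vector \<times> 'y::{real_normed_vector, complete_space}) set"
  assumes R: "subspace R" and bd: "\<And>x y. (x, y) \<in> R \<Longrightarrow> norm y \<le> K * norm x"
    and dense: "closure (fst ` R) = UNIV"
  obtains T where "bounded_linear T" "\<And>x y. (x, y) \<in> R \<Longrightarrow> T x = y" "\<And>x. norm (T x) \<le> K * norm x"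
proof -
  define G where "G = closure R"
  have G: "subspace G" unfolding G_def by (rule subspace_closure[OF R])
  have "closed {p :: 'x \<times> 'y. norm (snd p) \<le> K * norm (fst p)}"
    by (intro closed_Collect_le continuous_intros)
  then have "G \<subseteq> {p. norm (snd p) \<le> K * norm (fst p)}"
    unfolding G_def using bd by (intro closure_minimal) auto
  then have Gbd: "norm y \<le> K * norm x" if "(x, y) \<in> G" for x y using that by auto
  have total: "\<exists>y. (x, y) \<in> G" for x
  proof -
    have "x \<in> closure (fst ` R)" using dense by simp
    then obtain f where f: "\<And>n. f n \<in> fst ` R" "f \<longlonglongrightarrow> x"
      unfolding closure_sequential by blast
    have "\<exists>y. (f n, y) \<in> R" for n using f(1)[of n] by auto
    then obtain g where g: "\<And>n. (f n, g n) \<in> R" by metis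
    have gd: "dist (g m) (g n) \<le> K * dist (f m) (f n)" for m n
      using bd[of "f m - f n" "g m - g n"] subspace_diff[OF R g[of m] g[of n]] by (simp add: dist_norm)
    have "Cauchy g"
    proof (rule metric_CauchyI)
      fix e :: real assume e: "0 < e"
      define L where "L = max K 1"
      have "Cauchy f" using f(2) convergent_Cauchy convergent_def by blast
      then obtain M where M: "\<And>m n. m \<ge> M \<Longrightarrow> n \<ge> M \<Longrightarrow> dist (f m) (f n) < e / L"
        using metric_CauchyD[of f "e / L"] e by (auto simp: L_def)
      have "dist (g m) (g n) < e" if "m \<ge> M" "n \<ge> M" for m n
      proof -
        have "dist (g m) (g n) \<le> L * dist (f m) (f n)"
          by (rule order_trans[OF gd]) (auto simp: L_def intro: mult_right_mono)
        also have "\<dots> < L * (e / L)" using M[OF that] by (intro mult_strict_left_mono) (auto simp: L_def)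
        finally show ?thesis by (simp add: L_def)
      qed
      then show "\<exists>M. \<forall>m\<ge>M. \<forall>n\<ge>M. dist (g m) (g n) < e" by blast
    qed
    then obtain y where "g \<longlonglongrightarrow> y" using Cauchy_convergent convergent_def by blast
    then have "(\<lambda>n. (f n, g n)) \<longlonglongrightarrow> (x, y)" using f(2) by (intro tendsto_Pair)
    then have "(x, y) \<in> G" unfolding G_def closure_sequential using g
      by (intro exI[of _ "\<lambda>n. (f n, g n)"]) auto
    then show ?thesis ..
  qed
  have unique: "y = y'" if "(x, y) \<in> G" "(x, y') \<in> G" for x y y'
    using Gbd[of 0 "y - y'"] subspace_diff[OF G that] by simp
  define T where "T x = (THE y. (x, y) \<in> G)" for x
  have T: "(x, T x) \<in> G" for x
    unfolding T_def using total unique by (metis theI)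
  have T_eq: "T x = y" if "(x, y) \<in> G" for x y using unique[OF T that] .
  show thesis
  proof
    show "bounded_linear T"
    proof (rule bounded_linear_intro[where K = K])
      show "T (x + y) = T x + T y" for x y
        using subspace_add[OF G T T] by (intro T_eq) simp
      show "T (c *\<^sub>R x) = c *\<^sub>R T x" for c x
        using subspace_scale[OF G T] by (intro T_eq) simp
      show "norm (T x) \<le> norm x * K" for x using Gbd[OF T] by (simp add: mult.commute)
    qed
    show "T x = y" if "(x, y) \<in> R" for x y
      using that closure_subset by (intro T_eq) (auto simp: G_def)
    show "norm (T x) \<le> K * norm x" for x by (rule Gbd[OF T])
  qed
qed

text \<open>A vector orthogonal to the kernel represents \<open>F\<close> up to a scalar, because
  the kernel has codimension one.\<close>

lemma riesz_frechet:
  fixes F :: "'h::{real_inner, complete_space} \<Rightarrow> real"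
  assumes F: "bounded_linear F"
  obtains y where "\<And>x. F x = x \<bullet> y"
proof (cases "\<forall>x. F x = 0")
  case True
  then show ?thesis by (intro that[of 0]) simp
next
  case False
  interpret bounded_linear F by fact
  obtain x0 where x0: "F x0 \<noteq> 0" using False by blast
  define V where "V = {x. F x = 0}"
  have "subspace V" unfolding V_def subspace_def by (simp add: add scaleR zero)
  have "closed V" unfolding V_def by (intro closed_Collect_eq linear_continuous_on F continuous_intros)
  then obtain y where y: "y \<in> V" "\<And>z. z \<in> V \<Longrightarrow> (x0 - y) \<bullet> z = 0"
    using projection_exists[OF \<open>subspace V\<close>, of x0] by blast
  define e where "e = x0 - y"
  have Fe: "F e \<noteq> 0" using x0 y(1) by (simp add: e_def diff V_def)
  then have ee: "e \<bullet> e \<noteq> 0" using zero by auto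
  show ?thesis
  proof (rule that)
    fix x
    have "x - (F x / F e) *\<^sub>R e \<in> V" using Fe by (simp add: V_def diff scaleR)
    then have "e \<bullet> (x - (F x / F e) *\<^sub>R e) = 0" using y(2) by (simp add: e_def)
    then have "x \<bullet> e = (F x / F e) * (e \<bullet> e)" by (simp add: inner_diff_right inner_commute)
    then show "F x = x \<bullet> ((F e / (e \<bullet> e)) *\<^sub>R e)" using Fe ee by simp
  qed
qed

lemma abs_le_sup_norm:
  assumes "compact (UNIV :: 'a::metric_space set)" "continuous_on UNIV (f :: 'a \<Rightarrow> real)"
  shows "\<bar>f x\<bar> \<le> sup_norm f"
proof -
  obtain c where "\<And>x. \<bar>f x\<bar> \<le> c" using bounded_borel_continuous[OF assms] by (metis bounded_borel_bound)
  then show ?thesis unfolding sup_norm_def by (intro cSUP_upper bdd_aboveI[of _ c]) auto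
qed

text \<open>Positivity and the constants in \<open>A\<close> bound \<open>L\<close> by
  \<open>L 1\<close> times the supremum norm, so \<open>L\<close> extends to all continuous
  functions. The extension is still positive: an approximant of a nonnegative function becomes
  nonnegative after adding a small constant. The dense subspace matters because the energy
  functionals are defined on \<open>C\<close> only.\<close>

lemma riesz_representation:
  fixes L :: "('a::metric_space \<Rightarrow> real) \<Rightarrow> real"
  assumes cpt: "compact (UNIV :: 'a set)"
    and A: "subspace A" "\<And>g. g \<in> A \<Longrightarrow> continuous_on UNIV g" "1 \<in> A"
    and dense: "\<And>f e. continuous_on UNIV f \<Longrightarrow> 0 < e \<Longrightarrow> \<exists>g\<in>A. sup_norm (f - g) < e"
    and add: "\<And>f g. f \<in> A \<Longrightarrow> g \<in> A \<Longrightarrow> L (f + g) = L f + L g"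
    and scale: "\<And>c f. f \<in> A \<Longrightarrow> L (c *\<^sub>R f) = c * L f"
    and pos: "\<And>f. f \<in> A \<Longrightarrow> (\<And>x. 0 \<le> f x) \<Longrightarrow> 0 \<le> L f"
  obtains M where "finite_measure M" "sets M = sets borel" "\<And>g. g \<in> A \<Longrightarrow> L g = (\<integral>x. g x \<partial>M)"
proof -
  have bc: "f \<in> bcontfun" if "continuous_on UNIV f" for f :: "'a \<Rightarrow> real"
    using abs_le_sup_norm[OF cpt that] that by (intro bcontfun_normI[of f "sup_norm f"]) auto
  have ap: "apply_bcontfun (Bcontfun f) = f" if "continuous_on UNIV f" for f :: "'a \<Rightarrow> real"
    using bc[OF that] by (rule Bcontfun_inverse)
  have apA: "apply_bcontfun (Bcontfun f) = f" if "f \<in> A" for f by (rule ap[OF A(2)[OF that]])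
  have diffA: "f - g \<in> A" if "f \<in> A" "g \<in> A" for f g using that A(1) by (rule subspace_diff[rotated])
  have L_diff: "L (f - g) = L f - L g" if "f \<in> A" "g \<in> A" for f g
    using add[of "f - g" g] that diffA by simp
  have Lc: "c *\<^sub>R 1 \<in> A" for c using A(1,3) by (rule subspace_scale)
  have L_mono: "L f \<le> L g" if "f \<in> A" "g \<in> A" "\<And>x. f x \<le> g x" for f g
    using pos[of "g - f"] that L_diff diffA by simp
  \<comment> \<open>The graph of \<open>L\<close>, carried over to the type of bounded continuous
    functions, whose norm is the one needed for the extension.\<close>
  define R where "R = (\<lambda>g. (Bcontfun g, L g)) ` A"
  have R: "subspace R"
    unfolding R_def
  proof (rule subspaceI)
    have "L 0 = 0" using scale[OF subspace_0[OF A(1)], of 0] by (simp add: zero_fun_def)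
    moreover have "Bcontfun (0 :: 'a \<Rightarrow> real) = 0"
      by (intro bcontfun_eqI) (simp add: ap zero_fun_def)
    ultimately show "0 \<in> (\<lambda>g. (Bcontfun g, L g)) ` A"
      using subspace_0[OF A(1)] by (force simp: zero_prod_def image_iff)
  next
    fix x y assume "x \<in> (\<lambda>g. (Bcontfun g, L g)) ` A" "y \<in> (\<lambda>g. (Bcontfun g, L g)) ` A"
    then obtain f g where fg: "f \<in> A" "g \<in> A" "x = (Bcontfun f, L f)" "y = (Bcontfun g, L g)" by auto
    have "Bcontfun (f + g) = Bcontfun f + Bcontfun g"
      by (intro bcontfun_eqI) (simp only: apA fg subspace_add[OF A(1)] plus_bcontfun.rep_eq plus_fun_apply)
    then show "x + y \<in> (\<lambda>g. (Bcontfun g, L g)) ` A"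
      using fg add[OF fg(1,2)] subspace_add[OF A(1) fg(1,2)] by (intro image_eqI[of _ _ "f + g"]) auto
  next
    fix c x assume "x \<in> (\<lambda>g. (Bcontfun g, L g)) ` A"
    then obtain f where f: "f \<in> A" "x = (Bcontfun f, L f)" by auto
    have "Bcontfun (c *\<^sub>R f) = c *\<^sub>R Bcontfun f"
      by (intro bcontfun_eqI) (simp only: apA f subspace_scale[OF A(1)] scaleR_bcontfun.rep_eq scaleR_fun_apply)
    then show "c *\<^sub>R x \<in> (\<lambda>g. (Bcontfun g, L g)) ` A"
      using f scale[OF f(1)] subspace_scale[OF A(1) f(1)] by (intro image_eqI[of _ _ "c *\<^sub>R f"]) auto
  qed
  have bd: "norm y \<le> L 1 * norm x" if "(x, y) \<in> R" for x y
  proof -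
    obtain g where g: "g \<in> A" "x = Bcontfun g" "y = L g" using \<open>(x, y) \<in> R\<close> by (auto simp: R_def)
    have "\<bar>g t\<bar> \<le> norm x" for t
      using norm_bounded[of x t] g A by (simp add: ap)
    then have "g t \<le> (norm x *\<^sub>R 1) t" "((- norm x) *\<^sub>R 1) t \<le> g t" for t
      by (simp_all add: abs_le_iff minus_le_iff)
    then have "L g \<le> L (norm x *\<^sub>R 1)" "L ((- norm x) *\<^sub>R 1) \<le> L g"
      by (auto intro!: L_mono[OF g(1) Lc] L_mono[OF Lc g(1)] simp del: scaleR_minus_left scaleR_fun_apply)
    then have "\<bar>L g\<bar> \<le> norm x * L 1"
      unfolding scale[OF A(3)] by linarith
    then show ?thesis using g by (simp add: mult.commute)
  qed
  have Rdense: "closure (fst ` R) = UNIV"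
  proof -
    have "\<exists>y\<in>fst ` R. dist y x < e" if e: "0 < e" for x e
    proof -
      obtain g where g: "g \<in> A" "sup_norm (apply_bcontfun x - g) < e"
        using dense[of "apply_bcontfun x" e] e by (auto simp: continuous_on_apply_bcontfun)
      have "dist (Bcontfun g) x \<le> sup_norm (apply_bcontfun x - g)"
      proof (rule dist_bound)
        fix t
        have "continuous_on UNIV (apply_bcontfun x - g)"
          unfolding fun_diff_def using A g by (intro continuous_intros) auto
        from abs_le_sup_norm[OF cpt this, of t]
        show "dist (Bcontfun g t) (x t) \<le> sup_norm (apply_bcontfun x - g)"
          using A g by (simp add: ap dist_real_def abs_minus_commute)
      qed
      then have "dist (Bcontfun g) x < e" using g(2) by linarith
      moreover have "Bcontfun g \<in> fst ` R" using g(1) by (force simp: R_def)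
      ultimately show ?thesis by blast
    qed
    then show ?thesis by (auto simp: closure_approachable)
  qed
  obtain T where T: "bounded_linear T" "\<And>x y. (x, y) \<in> R \<Longrightarrow> T x = y" "\<And>x. norm (T x) \<le> L 1 * norm x"
    using bounded_relation_extension[OF R bd Rdense] by blast
  interpret T: bounded_linear T by fact
  interpret pf: positive_functional "\<lambda>f. T (Bcontfun f)"
  proof
    fix f g :: "'a \<Rightarrow> real" assume fg: "continuous_on UNIV f" "continuous_on UNIV g"
    have "Bcontfun (\<lambda>x. f x + g x) = Bcontfun f + Bcontfun g"
      by (intro bcontfun_eqI) (simp add: ap fg continuous_on_add)
    then show "T (Bcontfun (\<lambda>x. f x + g x)) = T (Bcontfun f) + T (Bcontfun g)" by (simp add: T.add)
  next
    fix f :: "'a \<Rightarrow> real" and c assume f: "continuous_on UNIV f"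
    have "Bcontfun (\<lambda>x. c * f x) = c *\<^sub>R Bcontfun f"
      by (intro bcontfun_eqI) (simp add: ap f continuous_on_mult_left)
    then show "T (Bcontfun (\<lambda>x. c * f x)) = c * T (Bcontfun f)" by (simp add: T.scaleR)
  next
    fix f :: "'a \<Rightarrow> real" assume f: "continuous_on UNIV f" "\<And>x. 0 \<le> f x"
    show "0 \<le> T (Bcontfun f)"
    proof (rule field_le_epsilon)
      fix e :: real assume e: "0 < e"
      \<comment> \<open>Two errors of size \<open>L 1 * d\<close> occur, one from the positivity of
        \<open>g + d *\<^sub>R 1\<close> and one from replacing \<open>f\<close> by
        \<open>g\<close>. The summand 1 keeps the denominator positive when \<open>L 1\<close> is
        zero.\<close>
      define d where "d = e / (2 * (L 1 + 1))"
      have L1: "0 \<le> L 1" by (intro pos A) auto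
      have d0: "0 < d" using L1 e by (simp add: d_def)
      have "2 * (L 1 + 1) * d = e" using L1 by (simp add: d_def)
      moreover have "2 * (L 1 + 1) * d = 2 * L 1 * d + 2 * d" by (simp add: algebra_simps)
      ultimately have d: "0 < d" "2 * L 1 * d \<le> e" using d0 by linarith+
      obtain g where g: "g \<in> A" "sup_norm (f - g) < d" using dense[OF f(1) d(1)] by blast
      have gc: "continuous_on UNIV g" using A g by auto
      have fg: "\<bar>f x - g x\<bar> \<le> d" for x
      proof -
        have "continuous_on UNIV (f - g)" unfolding fun_diff_def by (intro continuous_on_diff f gc)
        from abs_le_sup_norm[OF cpt this, of x] show ?thesis using g(2) by simp
      qed
      have "0 \<le> L (g + d *\<^sub>R 1)"
      proof (intro pos subspace_add[OF A(1)] g Lc)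
        fix x show "0 \<le> (g + d *\<^sub>R 1) x" using fg[of x] f(2)[of x] by simp
      qed
      then have "- (L 1 * d) \<le> L g" using add[OF g(1) Lc] scale[OF A(3)] by (simp add: mult.commute)
      moreover have "T (Bcontfun g) = L g" using g by (intro T) (auto simp: R_def)
      moreover have "\<bar>T (Bcontfun f - Bcontfun g)\<bar> \<le> L 1 * d"
      proof -
        have "norm (Bcontfun f - Bcontfun g) \<le> d"
          by (rule norm_bound) (use fg in \<open>simp add: ap f gc\<close>)
        then have "L 1 * norm (Bcontfun f - Bcontfun g) \<le> L 1 * d" using L1 by (rule mult_left_mono)
        then show ?thesis using T(3)[of "Bcontfun f - Bcontfun g"] by simp
      qed
      ultimately show "0 \<le> T (Bcontfun f) + e" using d(2) by (simp add: T.diff)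
    qed
  qed (rule cpt)
  show thesis
  proof
    show "finite_measure pf.rep_measure" by (rule pf.rep.finite_measure_axioms)
    show "sets pf.rep_measure = sets borel" by simp
    fix g assume g: "g \<in> A"
    have "L g = T (Bcontfun g)" using g by (intro T(2)[symmetric]) (auto simp: R_def)
    also have "\<dots> = (\<integral>x. g x \<partial>pf.rep_measure)" by (rule pf.I_eq_integral) (use A g in auto)
    finally show "L g = (\<integral>x. g x \<partial>pf.rep_measure)" .
  qed
qed

text \<open>The difference of the two integrals is bounded by a multiple of the supremum norm, so
  agreement on a uniformly dense set extends to all continuous functions.\<close>

lemma signed_eqI_dense:
  fixes \<sigma> \<tau> :: "'a::metric_space set \<Rightarrow> real"
  assumes cpt: "compact (UNIV :: 'a set)"
    and \<sigma>: "finite_signed_measure \<sigma>" and \<tau>: "finite_signed_measure \<tau>"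
    and A: "\<And>g. g \<in> A \<Longrightarrow> continuous_on UNIV g"
    and dense: "\<And>f e. continuous_on UNIV f \<Longrightarrow> 0 < e \<Longrightarrow> \<exists>g\<in>A. sup_norm (f - g) < e"
    and eq: "\<And>g. g \<in> A \<Longrightarrow> signed_integral \<sigma> g = signed_integral \<tau> g"
  shows "\<sigma> = \<tau>"
proof (rule signed_eqI[OF \<sigma> \<tau>])
  interpret S: signed \<sigma> + T: signed \<tau> using assms by (auto simp: signed_def)
  let ?D = "\<lambda>f. 1 * signed_integral \<sigma> f + (-1) * signed_integral \<tau> f"
  have D: "bounded_functional ?D"
    by (rule bounded_functional_lincomb[OF S.bounded_functional_signed_integral T.bounded_functional_signed_integral])
  then obtain K where K: "\<And>f c. f \<in> bounded_borel \<Longrightarrow> (\<forall>x. \<bar>f x\<bar> \<le> c) \<Longrightarrow> \<bar>?D f\<bar> \<le> K * c"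
    unfolding bounded_functional_def by metis
  fix f :: "'a \<Rightarrow> real" assume f: "f \<in> bounded_borel" "continuous_on UNIV f"
  have "\<bar>?D f\<bar> \<le> e" if e: "0 < e" for e
  proof -
    define d where "d = e / (\<bar>K\<bar> + 1)"
    have d0: "0 < d" using e by (simp add: d_def)
    have "(\<bar>K\<bar> + 1) * d = e" by (simp add: d_def)
    moreover have "K * d \<le> (\<bar>K\<bar> + 1) * d" using d0 by (intro mult_right_mono) auto
    ultimately have d: "0 < d" "K * d \<le> e" using d0 by linarith+
    obtain g where g: "g \<in> A" "sup_norm (f - g) < d" using dense[OF f(2) d(1)] by blast
    have gb: "g \<in> bounded_borel" using bounded_borel_continuous[OF cpt A] g by blast
    have c: "continuous_on UNIV (f - g)" unfolding fun_diff_def using A g f by (intro continuous_intros) auto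
    have "\<bar>(f - g) x\<bar> \<le> d" for x using abs_le_sup_norm[OF cpt c, of x] g(2) by simp
    then have "\<bar>?D (f - g)\<bar> \<le> K * d"
      by (intro K bounded_borel_continuous[OF cpt c]) auto
    moreover have "?D (f - g) = ?D f - ?D g" by (rule bounded_functional_diff[OF D f(1) gb])
    ultimately show ?thesis using eq[OF g(1)] d(2) by simp
  qed
  then have "\<bar>?D f\<bar> \<le> 0" by (rule field_le_epsilon) simp
  then show "signed_integral \<sigma> f = signed_integral \<tau> f" by simp
qed

section \<open>Energy measures of vector fields\<close>

lemma tens_add_left: "tens (g + g') f = tens g f + tens g' f"
  by (auto simp: tens_def fun_eq_iff field_simps)

lemma tens_scaleR_left: "tens (c *\<^sub>R g) f = c *\<^sub>R tens g f"
  by (auto simp: tens_def fun_eq_iff field_simps)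

lemma tens_one: "tens 1 f = d_u f"
  by (auto simp: tens_def fun_eq_iff)

lemma d_u_add: "d_u (f + g) = d_u f + d_u g"
  by (auto simp: d_u_def fun_eq_iff)

lemma d_u_scaleR: "d_u (c *\<^sub>R f) = c *\<^sub>R d_u f"
  by (auto simp: d_u_def fun_eq_iff algebra_simps)

text \<open>The averages in \<open>tens\<close> make the Leibniz rule an exact identity between
  functions of two points; \<open>product_rule\<close> is its image under
  \<open>\<iota>\<close>.\<close>

lemma d_u_mult: "d_u (f * g) = tens f g + tens g f"
  by (auto simp: d_u_def tens_def fun_eq_iff field_simps)

locale admissible_structure = form_data E C \<iota>
  for E :: "('a::metric_space \<Rightarrow> real) \<Rightarrow> ('a \<Rightarrow> real) \<Rightarrow> real"
    and C :: "('a \<Rightarrow> real) set"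
    and \<iota> :: "('a \<times> 'a \<Rightarrow> real) \<Rightarrow> 'h::{real_inner, complete_space}" +
  assumes adm: "admissible_form E C"
    and fos: "first_order_structure E C \<iota>"
    and one_C: "1 \<in> C"
begin

lemma C_Cc: "C \<subseteq> Cc"
  and C_subspace: "subspace C"
  and C_mult: "f \<in> C \<Longrightarrow> g \<in> C \<Longrightarrow> f * g \<in> C"
  and E_sym: "f \<in> C \<Longrightarrow> g \<in> C \<Longrightarrow> E f g = E g f"
  and E_add: "f \<in> C \<Longrightarrow> g \<in> C \<Longrightarrow> k \<in> C \<Longrightarrow> E (f + g) k = E f k + E g k"
  and E_scale: "f \<in> C \<Longrightarrow> g \<in> C \<Longrightarrow> E (c *\<^sub>R f) g = c * E f g"
  and C_dense: "f \<in> Cc \<Longrightarrow> 0 < e \<Longrightarrow> \<exists>g\<in>C. sup_norm (f - g) < e"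
  and C_clip: "u \<in> C \<Longrightarrow> (\<lambda>x. max (min (u x) 1) 0) \<in> C"
  and energy_positive: "f \<in> C \<Longrightarrow> g \<in> C \<Longrightarrow> (\<And>x. 0 \<le> g x) \<Longrightarrow> 0 \<le> E (f * g) f - E (f * f) g / 2"
  and E_local: "f \<in> C \<Longrightarrow> g \<in> C \<Longrightarrow> open U \<Longrightarrow> supp f \<subseteq> U \<Longrightarrow> (\<And>x. x \<in> U \<Longrightarrow> g x = c) \<Longrightarrow> E f g = 0"
proof -
  note a = adm[unfolded admissible_form_def Let_def]
  show "C \<subseteq> Cc" by (rule a[THEN conjunct1])
  show "subspace C" by (rule a[THEN conjunct2, THEN conjunct1])
  show "f \<in> C \<Longrightarrow> g \<in> C \<Longrightarrow> f * g \<in> C"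
    by (rule a[THEN conjunct2, THEN conjunct2, THEN conjunct1, rule_format])
  show "f \<in> C \<Longrightarrow> g \<in> C \<Longrightarrow> E f g = E g f"
    by (rule a[THEN conjunct2, THEN conjunct2, THEN conjunct2, THEN conjunct1, rule_format])
  show "f \<in> C \<Longrightarrow> g \<in> C \<Longrightarrow> k \<in> C \<Longrightarrow> E (f + g) k = E f k + E g k"
    by (rule a[THEN conjunct2, THEN conjunct2, THEN conjunct2, THEN conjunct2, THEN conjunct1, rule_format])
  show "f \<in> C \<Longrightarrow> g \<in> C \<Longrightarrow> E (c *\<^sub>R f) g = c * E f g"
    by (rule a[THEN conjunct2, THEN conjunct2, THEN conjunct2, THEN conjunct2, THEN conjunct2, THEN conjunct1, rule_format])
  show "f \<in> Cc \<Longrightarrow> 0 < e \<Longrightarrow> \<exists>g\<in>C. sup_norm (f - g) < e"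
    by (rule a[THEN conjunct2, THEN conjunct2, THEN conjunct2, THEN conjunct2, THEN conjunct2, THEN conjunct2, THEN conjunct2, THEN conjunct1, rule_format])
  show "u \<in> C \<Longrightarrow> (\<lambda>x. max (min (u x) 1) 0) \<in> C"
    using a[THEN conjunct2, THEN conjunct2, THEN conjunct2, THEN conjunct2, THEN conjunct2, THEN conjunct2, THEN conjunct2, THEN conjunct2, THEN conjunct2, THEN conjunct1] by blast
  show "f \<in> C \<Longrightarrow> g \<in> C \<Longrightarrow> (\<And>x. 0 \<le> g x) \<Longrightarrow> 0 \<le> E (f * g) f - E (f * f) g / 2"
    using a[THEN conjunct2, THEN conjunct2, THEN conjunct2, THEN conjunct2, THEN conjunct2, THEN conjunct2, THEN conjunct2, THEN conjunct2, THEN conjunct2, THEN conjunct2, THEN conjunct1] by blast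
  show "E f g = 0" if "f \<in> C" "g \<in> C" "open U" "supp f \<subseteq> U" "\<And>x. x \<in> U \<Longrightarrow> g x = c"
  proof -
    have "\<exists>U c. open U \<and> supp f \<subseteq> U \<and> (\<forall>x\<in>U. g x = c)"
      using that(3-5) by (intro exI[of _ U] exI[of _ c]) simp
    then show ?thesis by (rule a[THEN conjunct2, THEN conjunct2, THEN conjunct2, THEN conjunct2, THEN conjunct2, THEN conjunct2, THEN conjunct2, THEN conjunct2, THEN conjunct2, THEN conjunct2, THEN conjunct2, THEN bspec, OF that(1), THEN bspec, OF that(2), THEN mp])
  qed
qed

lemma compact_UNIV: "compact (UNIV :: 'a set)"
proof -
  have "compact (supp (1 :: 'a \<Rightarrow> real))" using one_C C_Cc by (auto simp: Cc_def)
  then show ?thesis by (simp add: supp_def)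
qed

lemma Cc_iff:
  fixes f :: "'a \<Rightarrow> real"
  shows "f \<in> Cc \<longleftrightarrow> continuous_on UNIV f"
  using compact_UNIV compact_Int_closed[OF compact_UNIV, of "supp f"]
  by (auto simp: Cc_def supp_def)

lemma C_continuous: "f \<in> C \<Longrightarrow> continuous_on UNIV f"
  using C_Cc by (auto simp: Cc_iff)

lemma Cc_bounded:
  fixes f :: "'a \<Rightarrow> real"
  shows "f \<in> Cc \<Longrightarrow> f \<in> bounded_borel"
  by (auto simp: Cc_iff intro: bounded_borel_continuous compact_UNIV)

lemma C_bounded: "f \<in> C \<Longrightarrow> f \<in> bounded_borel"
  using Cc_bounded C_Cc by blast

lemma Cc_add:
  fixes f g :: "'a \<Rightarrow> real"
  shows "f \<in> Cc \<Longrightarrow> g \<in> Cc \<Longrightarrow> f + g \<in> Cc"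
  unfolding Cc_iff plus_fun_def by (rule continuous_on_add)

lemma Cc_mult:
  fixes f g :: "'a \<Rightarrow> real"
  shows "f \<in> Cc \<Longrightarrow> g \<in> Cc \<Longrightarrow> f * g \<in> Cc"
  unfolding Cc_iff times_fun_def by (rule continuous_on_mult)

lemma Cc_scaleR:
  fixes f :: "'a \<Rightarrow> real"
  shows "f \<in> Cc \<Longrightarrow> c *\<^sub>R f \<in> Cc"
  unfolding Cc_iff scaleR_fun_def by (intro continuous_intros)

lemma Cc_one: "(1 :: 'a \<Rightarrow> real) \<in> Cc"
  using one_C C_Cc by blast

lemma Cc_subspace: "subspace (Cc :: ('a \<Rightarrow> real) set)"
proof (rule subspaceI)
  show "(0 :: 'a \<Rightarrow> real) \<in> Cc" using Cc_scaleR[OF Cc_one, of 0] by (simp only: scaleR_zero_left)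
qed (auto intro: Cc_add Cc_scaleR simp del: Cc_iff)

lemma abs_le_sup:
  fixes f :: "'a \<Rightarrow> real"
  shows "f \<in> Cc \<Longrightarrow> \<bar>f x\<bar> \<le> sup_norm f"
  using abs_le_sup_norm[OF compact_UNIV] by (simp add: Cc_iff)

lemma C_diff: "f \<in> C \<Longrightarrow> g \<in> C \<Longrightarrow> f - g \<in> C"
  using C_subspace by (rule subspace_diff)

lemma C_add: "f \<in> C \<Longrightarrow> g \<in> C \<Longrightarrow> f + g \<in> C"
  using C_subspace by (rule subspace_add)

lemma C_scaleR: "f \<in> C \<Longrightarrow> c *\<^sub>R f \<in> C"
  using C_subspace by (rule subspace_scale)

lemma C_dense_continuous:
  fixes f :: "'a \<Rightarrow> real"
  shows "continuous_on UNIV f \<Longrightarrow> 0 < e \<Longrightarrow> \<exists>g\<in>C. sup_norm (f - g) < e"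
  using C_dense by (simp only: Cc_iff)

lemma E_add_right: "f \<in> C \<Longrightarrow> g \<in> C \<Longrightarrow> k \<in> C \<Longrightarrow> E k (f + g) = E k f + E k g"
  using E_sym[of k "f + g"] E_sym[of k f] E_sym[of k g] E_add[of f g k] C_add by metis

lemma E_scale_right: "f \<in> C \<Longrightarrow> g \<in> C \<Longrightarrow> E g (c *\<^sub>R f) = c * E g f"
  using E_sym[of g "c *\<^sub>R f"] E_sym[of g f] E_scale[of f g c] C_scaleR by metis

lemma E_diff: "f \<in> C \<Longrightarrow> g \<in> C \<Longrightarrow> k \<in> C \<Longrightarrow> E (f - g) k = E f k - E g k"
  using E_add[of "f - g" g k] C_diff[of f g] by simp

lemma E_diff_right: "f \<in> C \<Longrightarrow> g \<in> C \<Longrightarrow> k \<in> C \<Longrightarrow> E k (f - g) = E k f - E k g"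
  using E_add_right[of "f - g" g k] C_diff[of f g] by simp

lemma E_one: "f \<in> C \<Longrightarrow> E f 1 = 0"
  using E_local[of f 1 UNIV 1] one_C by simp

section \<open>Energy measures of functions, as representing measures of the weak carre du
  champ\<close>

definition carre :: "('a \<Rightarrow> real) \<Rightarrow> ('a \<Rightarrow> real) \<Rightarrow> ('a \<Rightarrow> real) \<Rightarrow> real" where
  "carre f1 f2 g = (E (f1 * g) f2 + E f1 (f2 * g) - E (f1 * f2) g) / 2"

text \<open>Polarization reduces the mixed functional to diagonal ones, the only ones for which
  positivity is available.\<close>

lemma carre_polar:
  assumes f: "f1 \<in> C" "f2 \<in> C" and g: "g \<in> C"
  shows "carre f1 f2 g = (1/4) * carre (f1 + f2) (f1 + f2) g - (1/4) * carre (f1 - f2) (f1 - f2) g"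
proof -
  note m = C_mult[OF f(1) g] C_mult[OF f(2) g] C_mult[OF f(1,1)] C_mult[OF f(1,2)] C_mult[OF f(2,1)] C_mult[OF f(2,2)]
  have "(f1 + f2) * g = f1 * g + f2 * g" "(f1 - f2) * g = f1 * g - f2 * g"
    "(f1 + f2) * (f1 + f2) = (f1 * f1 + f1 * f2) + (f2 * f1 + f2 * f2)"
    "(f1 - f2) * (f1 - f2) = (f1 * f1 - f1 * f2) - (f2 * f1 - f2 * f2)"
    by (simp_all add: fun_eq_iff algebra_simps)
  moreover have "f2 * f1 = f1 * f2" by (rule mult.commute)
  ultimately show ?thesis
    unfolding carre_def
    using f g m
    by (simp only: E_add E_add_right E_diff E_diff_right C_add C_diff) (simp add: E_sym field_simps)
qed

text \<open>By symmetry of \<open>E\<close> the diagonal functional is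
  \<open>E (f * g) f - E (f * f) g / 2\<close>, whose positivity is one of the conditions on an
  admissible form.\<close>

lemma carre_measure:
  assumes f: "f \<in> C"
  obtains M where "finite_measure M" "sets M = sets borel" "\<And>g. g \<in> C \<Longrightarrow> carre f f g = (\<integral>x. g x \<partial>M)"
proof (rule riesz_representation[OF compact_UNIV C_subspace C_continuous one_C C_dense_continuous])
  fix g k assume g: "g \<in> C" and k: "k \<in> C"
  show "carre f f (g + k) = carre f f g + carre f f k"
    using f g k C_mult[OF f g] C_mult[OF f k] C_mult[OF f f]
    unfolding carre_def distrib_left by (simp add: E_add E_add_right field_simps del: plus_fun_apply)
next
  fix c g assume g: "g \<in> C"
  have "f * (c *\<^sub>R g) = c *\<^sub>R (f * g)" by (simp add: fun_eq_iff)
  then show "carre f f (c *\<^sub>R g) = c * carre f f g"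
    unfolding carre_def
    using E_scale[OF C_mult[OF f g] f] E_scale_right[OF C_mult[OF f g] f] E_scale_right[OF g C_mult[OF f f]]
    by (simp add: field_simps)
next
  fix g :: "'a \<Rightarrow> real" assume g: "g \<in> C" "\<And>x. 0 \<le> g x"
  show "0 \<le> carre f f g"
    using energy_positive[OF f g] E_sym[OF C_mult[OF f g(1)] f] by (simp add: carre_def)
qed (auto intro: that)

text \<open>Existence is the difference of the measures of \<open>f1 + f2\<close> and
  \<open>f1 - f2\<close>; uniqueness is density of \<open>C\<close> in the continuous functions.
  This turns the definite description of \<open>energy_measure\<close> into usable
  properties.\<close>

lemma energy_measure_ex1:
  assumes f: "f1 \<in> C" "f2 \<in> C"
  shows "\<exists>!\<sigma>. finite_signed_measure \<sigma> \<and> (\<forall>g\<in>C. signed_integral \<sigma> g = carre f1 f2 g)"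
proof (rule ex_ex1I)
  obtain M where M: "finite_measure M" "sets M = sets borel"
    "\<And>g. g \<in> C \<Longrightarrow> carre (f1 + f2) (f1 + f2) g = (\<integral>x. g x \<partial>M)"
    using carre_measure[OF C_add[OF f]] by blast
  obtain N where N: "finite_measure N" "sets N = sets borel"
    "\<And>g. g \<in> C \<Longrightarrow> carre (f1 - f2) (f1 - f2) g = (\<integral>x. g x \<partial>N)"
    using carre_measure[OF C_diff[OF f]] by blast
  let ?\<sigma> = "\<lambda>A. (1/4) * measure M A + (-1/4) * measure N A"
  have "signed_integral ?\<sigma> g = carre f1 f2 g" if g: "g \<in> C" for g
    unfolding signed_integral_lincomb[OF signed_measure(1)[OF M(1,2)] signed_measure(1)[OF N(1,2)] C_bounded[OF g]]
      signed_measure(2)[OF M(1,2) C_bounded[OF g]] signed_measure(2)[OF N(1,2) C_bounded[OF g]]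
      M(3)[OF g, symmetric] N(3)[OF g, symmetric] carre_polar[OF f g] by simp
  moreover have "finite_signed_measure ?\<sigma>"
    by (intro signed_lincomb signed_measure(1) M N)
  ultimately show "\<exists>\<sigma>. finite_signed_measure \<sigma> \<and> (\<forall>g\<in>C. signed_integral \<sigma> g = carre f1 f2 g)" by blast
next
  fix \<sigma> \<tau>
  assume "finite_signed_measure \<sigma> \<and> (\<forall>g\<in>C. signed_integral \<sigma> g = carre f1 f2 g)"
    "finite_signed_measure \<tau> \<and> (\<forall>g\<in>C. signed_integral \<tau> g = carre f1 f2 g)"
  then show "\<sigma> = \<tau>"
    by (intro signed_eqI_dense[OF compact_UNIV _ _ C_continuous C_dense_continuous]) auto
qed

lemma
  assumes f: "f1 \<in> C" "f2 \<in> C"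
  shows signed_energy_measure: "finite_signed_measure (energy_measure E C f1 f2)"
    and integral_energy_measure: "g \<in> C \<Longrightarrow> signed_integral (energy_measure E C f1 f2) g = carre f1 f2 g"
  using theI'[OF energy_measure_ex1[OF f]] unfolding energy_measure_def carre_def by auto

section \<open>Gradients and the dense span of simple fields\<close>

interpretation \<iota>: linear \<iota>
  using fos by (simp add: first_order_structure_def)

lemma inner_tens:
  "g1 \<in> Cc \<Longrightarrow> f1 \<in> C \<Longrightarrow> g2 \<in> Cc \<Longrightarrow> f2 \<in> C \<Longrightarrow>
     \<iota> (tens g1 f1) \<bullet> \<iota> (tens g2 f2) = signed_integral (energy_measure E C f1 f2) (g1 * g2)"
  using fos by (simp add: first_order_structure_def)

abbreviation elems :: "'h set" where
  "elems \<equiv> {\<iota> (tens g f) | g f. g \<in> Cc \<and> f \<in> C}"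

lemma dense_span_elems: "closure (span elems) = UNIV"
proof -
  have "\<iota> ` span {tens g f | g f. g \<in> Cc \<and> f \<in> C} = span (\<iota> ` {tens g f | g f. g \<in> Cc \<and> f \<in> C})"
    by (rule linear_span_image[OF \<iota>.linear_axioms, symmetric])
  moreover have "\<iota> ` {tens g f | g f. g \<in> Cc \<and> f \<in> C} = elems" by blast
  moreover have "closure (\<iota> ` span {tens g f | g f. g \<in> Cc \<and> f \<in> C}) = UNIV"
    using fos unfolding first_order_structure_def by blast
  ultimately show ?thesis by simp
qed

lemma eq_on_elems:
  assumes S: "bounded_linear S" and T: "bounded_linear T"
    and eq: "\<And>g f. g \<in> Cc \<Longrightarrow> f \<in> C \<Longrightarrow> S (\<iota> (tens g f)) = T (\<iota> (tens g f))"
  shows "S = T"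
proof (rule bounded_linear_eq_dense[OF S T dense_span_elems])
  interpret S: bounded_linear S by fact
  interpret T: bounded_linear T by fact
  fix x assume "x \<in> span elems"
  then show "S x = T x"
    by (rule linear_eq_on_span[OF S.linear_axioms T.linear_axioms, rotated]) (use eq in auto)
qed

lemma closed_subspace_elems:
  assumes "subspace V" "closed V" "\<And>g f. g \<in> Cc \<Longrightarrow> f \<in> C \<Longrightarrow> \<iota> (tens g f) \<in> V"
  shows "v \<in> V"
proof -
  have "span elems \<subseteq> V" using assms(1,3) by (intro span_minimal) auto
  then have "closure (span elems) \<subseteq> V" using assms(2) by (rule closure_minimal)
  then show ?thesis using dense_span_elems by blast
qed

lemma grad_tens: "grad f = \<iota> (tens 1 f)"
  by (simp add: grad_def tens_one)

lemma grad_add: "grad (f + g) = grad f + grad g"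
  and grad_scaleR: "grad (c *\<^sub>R f) = c *\<^sub>R grad f"
  and grad_diff: "grad (f - g) = grad f - grad g"
proof -
  show a: "grad (f + g) = grad f + grad g" for f g
    unfolding grad_def d_u_add by (rule \<iota>.add)
  show "grad (c *\<^sub>R f) = c *\<^sub>R grad f"
    unfolding grad_def d_u_scaleR by (rule \<iota>.scale)
  show "grad (f - g) = grad f - grad g" using a[of "f - g" g] by simp
qed

text \<open>Both multipliers are the constant 1, and the term \<open>E (f * g) 1\<close> drops out
  by locality of the form.\<close>

lemma grad_inner: "f \<in> C \<Longrightarrow> g \<in> C \<Longrightarrow> grad f \<bullet> grad g = E f g"
  using inner_tens[OF Cc_one _ Cc_one, of f g] integral_energy_measure[of f g 1] one_C E_one[OF C_mult, of f g]
  by (simp add: grad_tens carre_def)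

lemma grad_one: "grad 1 = 0"
  using grad_inner[OF one_C one_C] E_one[OF one_C] by simp

text \<open>The elements \<open>\<Sum> k\<^sub>i \<partial>f\<^sub>i\<close> of the span, each regarded as the map \<open>g \<mapsto> \<Sum> g k\<^sub>i \<partial>f\<^sub>i\<close>.\<close>

definition multipliers :: "(('a \<Rightarrow> real) \<Rightarrow> 'h) set" where
  "multipliers = span {\<lambda>g. \<iota> (tens (g * k) f) | k f. k \<in> Cc \<and> f \<in> C}"

lemma multipliers_linear:
  assumes "\<Phi> \<in> multipliers"
  shows "g \<in> Cc \<Longrightarrow> g' \<in> Cc \<Longrightarrow> \<Phi> (g + g') = \<Phi> g + \<Phi> g'"
    and "g \<in> Cc \<Longrightarrow> \<Phi> (c *\<^sub>R g) = c *\<^sub>R \<Phi> g"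
proof -
  have "\<forall>g g' c. \<Phi> (g + g') = \<Phi> g + \<Phi> g' \<and> \<Phi> (c *\<^sub>R g) = c *\<^sub>R \<Phi> g"
    using assms unfolding multipliers_def
  proof (rule span_induct)
    show "subspace {\<Phi> :: ('a \<Rightarrow> real) \<Rightarrow> 'h. \<forall>g g' c. \<Phi> (g + g') = \<Phi> g + \<Phi> g' \<and> \<Phi> (c *\<^sub>R g) = c *\<^sub>R \<Phi> g}"
      by (rule subspaceI) (auto simp: scaleR_right_distrib scaleR_left_commute)
  next
    fix \<Phi> assume "\<Phi> \<in> {\<lambda>g. \<iota> (tens (g * k) f) | k f. k \<in> Cc \<and> f \<in> C}"
    then obtain k f where \<Phi>: "\<Phi> = (\<lambda>g. \<iota> (tens (g * k) f))" by blast
    have "(c *\<^sub>R g) * k = c *\<^sub>R (g * k)" for c g by (simp add: fun_eq_iff)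
    then show "\<forall>g g' c. \<Phi> (g + g') = \<Phi> g + \<Phi> g' \<and> \<Phi> (c *\<^sub>R g) = c *\<^sub>R \<Phi> g"
      unfolding \<Phi> by (simp only: distrib_right tens_add_left \<iota>.add tens_scaleR_left \<iota>.scale) simp
  qed
  then show "\<Phi> (g + g') = \<Phi> g + \<Phi> g'" "\<Phi> (c *\<^sub>R g) = c *\<^sub>R \<Phi> g" by auto
qed

text \<open>On generators both sides integrate the same product against the same energy measure.
  This expresses symmetry of multiplication before multiplication is known to act on
  vectors.\<close>

lemma multipliers_inner:
  assumes "\<Phi> \<in> multipliers" "\<Psi> \<in> multipliers" and g: "g \<in> Cc" "g' \<in> Cc"
  shows "\<Phi> g \<bullet> \<Psi> g' = \<Phi> (g * g') \<bullet> \<Psi> 1"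
proof -
  let ?G = "{\<lambda>g. \<iota> (tens (g * k) f) | k f. k \<in> Cc \<and> f \<in> C}"
  have base: "\<Phi> g \<bullet> \<Psi> g' = \<Phi> (g * g') \<bullet> \<Psi> 1" if "\<Phi> \<in> ?G" "\<Psi> \<in> ?G" for \<Phi> \<Psi>
  proof -
    from that obtain k f k' f' where \<Phi>: "\<Phi> = (\<lambda>g. \<iota> (tens (g * k) f))" "k \<in> Cc" "f \<in> C"
      and \<Psi>: "\<Psi> = (\<lambda>g. \<iota> (tens (g * k') f'))" "k' \<in> Cc" "f' \<in> C" by blast
    have "(g * k) * (g' * k') = (g * g' * k) * (1 * k')" by (simp add: fun_eq_iff)
    then show ?thesis
      unfolding \<Phi>(1) \<Psi>(1) using \<Phi> \<Psi> g by (simp only: inner_tens Cc_mult Cc_one)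
  qed
  have step: "\<Phi> g \<bullet> \<Psi> g' = \<Phi> (g * g') \<bullet> \<Psi> 1" if "\<Psi> \<in> ?G" for \<Psi>
    using assms(1) unfolding multipliers_def
  proof (rule span_induct)
    show "subspace {\<Phi>. \<Phi> g \<bullet> \<Psi> g' = \<Phi> (g * g') \<bullet> \<Psi> 1}"
      by (rule subspaceI) (auto simp: inner_add_left)
  qed (use base that in blast)
  show ?thesis
    using assms(2) unfolding multipliers_def
  proof (rule span_induct)
    show "subspace {\<Psi>. \<Phi> g \<bullet> \<Psi> g' = \<Phi> (g * g') \<bullet> \<Psi> 1}"
      by (rule subspaceI) (auto simp: inner_add_right)
  qed (use step in blast)
qed

text \<open>Apply positivity of the scalar product to \<open>\<Phi> s\<close> with \<open>s\<^sup>2 = c\<^sup>2 - g\<^sup>2\<close>.\<close>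

lemma multipliers_norm:
  assumes \<Phi>: "\<Phi> \<in> multipliers" and g: "g \<in> Cc" and c: "\<And>x. \<bar>g x\<bar> \<le> c"
  shows "norm (\<Phi> g) \<le> c * norm (\<Phi> 1)"
proof -
  have c0: "0 \<le> c" using c order_trans[OF abs_ge_zero] by blast
  define s where "s x = sqrt (c\<^sup>2 - (g x)\<^sup>2)" for x
  have s: "s \<in> Cc" using g unfolding Cc_iff s_def[abs_def] by (intro continuous_intros)
  have "(g x)\<^sup>2 \<le> c\<^sup>2" for x using c[of x] by (simp add: abs_le_square_iff[symmetric] c0)
  then have "s x * s x = c\<^sup>2 - g x * g x" for x
    by (simp add: s_def flip: power2_eq_square)
  then have ss: "s * s = c\<^sup>2 *\<^sub>R 1 + (-1) *\<^sub>R (g * g)"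
    by (intro ext) simp
  have "0 \<le> \<Phi> s \<bullet> \<Phi> s" by simp
  also have "\<dots> = \<Phi> (s * s) \<bullet> \<Phi> 1" by (rule multipliers_inner[OF \<Phi> \<Phi> s s])
  also have "\<Phi> (s * s) = c\<^sup>2 *\<^sub>R \<Phi> 1 + (-1) *\<^sub>R \<Phi> (g * g)"
    unfolding ss using multipliers_linear[OF \<Phi>] by (simp only: Cc_scaleR Cc_one Cc_mult g)
  also have "\<dots> \<bullet> \<Phi> 1 = c\<^sup>2 * (\<Phi> 1 \<bullet> \<Phi> 1) - \<Phi> g \<bullet> \<Phi> g"
    using multipliers_inner[OF \<Phi> \<Phi> g g] by (simp add: inner_diff_left inner_add_left)
  finally have "(norm (\<Phi> g))\<^sup>2 \<le> (c * norm (\<Phi> 1))\<^sup>2"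
    by (simp add: power2_norm_eq_inner power_mult_distrib)
  then show ?thesis by (rule power2_le_imp_le) (simp add: c0)
qed

section \<open>The action of continuous functions on fields\<close>

definition is_act :: "('a \<Rightarrow> real) \<Rightarrow> ('h \<Rightarrow> 'h) \<Rightarrow> bool" where
  "is_act g T \<longleftrightarrow> bounded_linear T \<and> (\<forall>k\<in>Cc. \<forall>f\<in>C. T (\<iota> (tens k f)) = \<iota> (tens (g * k) f))"

lemma is_act_unique: "is_act g S \<Longrightarrow> is_act g T \<Longrightarrow> S = T"
  unfolding is_act_def by (intro eq_on_elems) auto

text \<open>\<open>R\<close> relates the value of a multiplier at 1, the vector itself, to its value
  at \<open>g\<close>, the multiplied vector. The norm estimate for multipliers contains both
  well-definedness and continuity.\<close>

lemma is_act_exists: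
  assumes g: "g \<in> Cc" and c: "\<And>x. \<bar>g x\<bar> \<le> c"
  shows "\<exists>T. is_act g T \<and> (\<forall>v. norm (T v) \<le> c * norm v)"
proof -
  define R where "R = (\<lambda>\<Phi>. (\<Phi> 1, \<Phi> g)) ` multipliers"
  have gen: "(\<iota> (tens k f), \<iota> (tens (g * k) f)) \<in> R" if "k \<in> Cc" "f \<in> C" for k f
  proof -
    have "(\<lambda>g. \<iota> (tens (g * k) f)) \<in> multipliers"
      unfolding multipliers_def using that by (intro span_base) blast
    then show ?thesis unfolding R_def by (rule rev_image_eqI) simp
  qed
  have "linear (\<lambda>\<Phi> :: ('a \<Rightarrow> real) \<Rightarrow> 'h. (\<Phi> 1, \<Phi> g))"
    by (rule linearI) auto
  then have R: "subspace R"
    unfolding R_def by (rule linear_subspace_image) (simp add: multipliers_def)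
  have "linear (fst :: 'h \<times> 'h \<Rightarrow> 'h)" by (rule linear_fst)
  then have "subspace (fst ` R)" using R by (rule linear_subspace_image)
  moreover have "elems \<subseteq> fst ` R" using gen by force
  ultimately have "span elems \<subseteq> fst ` R" by (intro span_minimal)
  then have dense: "closure (fst ` R) = UNIV"
    using closure_mono[of "span elems" "fst ` R"] dense_span_elems by auto
  have bd: "norm y \<le> c * norm x" if "(x, y) \<in> R" for x y
    using that multipliers_norm[OF _ g c] by (auto simp: R_def)
  obtain T where T: "bounded_linear T" "\<And>x y. (x, y) \<in> R \<Longrightarrow> T x = y" "\<And>x. norm (T x) \<le> c * norm x"
    using bounded_relation_extension[OF R bd dense] by blast
  then show ?thesis unfolding is_act_def using gen by blast
qed

lemma is_act_act: assumes "g \<in> Cc" shows "is_act g (act g)"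
proof -
  have "\<exists>!T. is_act g T"
    using is_act_exists[OF assms abs_le_sup[OF assms]] is_act_unique by blast
  then show ?thesis unfolding act_def is_act_def by (rule theI')
qed

lemma act_eqI: "g \<in> Cc \<Longrightarrow> is_act g T \<Longrightarrow> act g = T"
  using is_act_unique is_act_act by blast

lemma act_bounded_linear: "g \<in> Cc \<Longrightarrow> bounded_linear (act g)"
  and act_tens: "g \<in> Cc \<Longrightarrow> k \<in> Cc \<Longrightarrow> f \<in> C \<Longrightarrow> act g (\<iota> (tens k f)) = \<iota> (tens (g * k) f)"
  using is_act_act unfolding is_act_def by blast+

lemma act_grad: "g \<in> Cc \<Longrightarrow> f \<in> C \<Longrightarrow> act g (grad f) = \<iota> (tens g f)"
  using act_tens[OF _ Cc_one, of g f] by (simp add: grad_tens)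

lemma act_norm: "g \<in> Cc \<Longrightarrow> (\<And>x. \<bar>g x\<bar> \<le> c) \<Longrightarrow> norm (act g v) \<le> c * norm v"
  using is_act_exists[of g c] act_eqI by metis

lemma act_one: "act 1 = (\<lambda>v. v)"
  by (rule act_eqI[OF Cc_one]) (simp add: is_act_def bounded_linear_ident)

lemma act_plus:
  assumes "g \<in> Cc" "g' \<in> Cc" shows "act (g + g') v = act g v + act g' v"
proof -
  have "act (g + g') = (\<lambda>v. act g v + act g' v)"
    using assms by (intro act_eqI Cc_add)
      (simp_all add: is_act_def act_bounded_linear bounded_linear_add act_tens distrib_right tens_add_left \<iota>.add)
  then show ?thesis by simp
qed

lemma act_scaleR:
  assumes "g \<in> Cc" shows "act (c *\<^sub>R g) v = c *\<^sub>R act g v"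
proof -
  have "(c *\<^sub>R g) * k = c *\<^sub>R (g * k)" for k by (simp add: fun_eq_iff)
  then have "is_act (c *\<^sub>R g) (\<lambda>v. c *\<^sub>R act g v)"
    using assms
    by (simp only: is_act_def bounded_linear_compose[OF bounded_linear_scaleR_right act_bounded_linear]
        act_tens tens_scaleR_left \<iota>.scale) (simp add: act_tens)
  then have "act (c *\<^sub>R g) = (\<lambda>v. c *\<^sub>R act g v)"
    by (intro act_eqI Cc_scaleR assms)
  then show ?thesis by simp
qed

lemma act_mult:
  assumes "g \<in> Cc" "g' \<in> Cc" shows "act (g * g') v = act g (act g' v)"
proof -
  have "is_act (g * g') (\<lambda>v. act g (act g' v))"
    using assms
    by (simp only: is_act_def bounded_linear_compose[OF act_bounded_linear act_bounded_linear]
        act_tens Cc_mult mult.assoc ball_simps) (simp add: act_tens Cc_mult)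
  then have "act (g * g') = (\<lambda>v. act g (act g' v))"
    by (intro act_eqI Cc_mult assms)
  then show ?thesis by simp
qed

text \<open>On simple fields both sides are integrals of one and the same product; density is used
  in one argument after the other.\<close>

lemma act_symmetric:
  assumes g: "g \<in> Cc" shows "act g v \<bullet> w = v \<bullet> act g w"
proof -
  note bl = act_bounded_linear[OF g]
  have 1: "act g (\<iota> (tens k f)) \<bullet> \<iota> (tens k' f') = \<iota> (tens k f) \<bullet> act g (\<iota> (tens k' f'))"
    if "k \<in> Cc" "f \<in> C" "k' \<in> Cc" "f' \<in> C" for k f k' f'
  proof -
    have "(g * k) * k' = k * (g * k')" by (simp add: mult.commute mult.left_commute)
    then show ?thesis using that g by (simp only: act_tens inner_tens Cc_mult)
  qed
  have 2: "(\<lambda>w. act g (\<iota> (tens k f)) \<bullet> w) = (\<lambda>w. \<iota> (tens k f) \<bullet> act g w)"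
    if "k \<in> Cc" "f \<in> C" for k f
    using 1 that by (intro eq_on_elems bounded_linear_inner_right
        bounded_linear_compose[OF bounded_linear_inner_right bl]) auto
  have "(\<lambda>v. act g v \<bullet> w) = (\<lambda>v. v \<bullet> act g w)"
    using fun_cong[OF 2] by (intro eq_on_elems bounded_linear_inner_left
        bounded_linear_compose[OF bounded_linear_inner_left bl]) auto
  then show ?thesis by (rule fun_cong)
qed

lemma product_rule:
  assumes "f \<in> C" "g \<in> C" shows "grad (f * g) = act f (grad g) + act g (grad f)"
proof -
  have "f \<in> Cc" "g \<in> Cc" using assms C_Cc by auto
  then show ?thesis using assms by (simp add: act_grad) (simp only: grad_def d_u_mult \<iota>.add)
qed

section \<open>Energy measures of arbitrary fields\<close>

lemma quadratic_measure:
  obtains M where "finite_measure M" "sets M = sets borel" "\<And>g. g \<in> Cc \<Longrightarrow> act g v \<bullet> v = (\<integral>x. g x \<partial>M)"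
proof (rule riesz_representation[OF compact_UNIV Cc_subspace _ Cc_one, of "\<lambda>g. act g v \<bullet> v"])
  fix f :: "'a \<Rightarrow> real" and e :: real assume "continuous_on UNIV f" "0 < e"
  then show "\<exists>g\<in>Cc. sup_norm (f - g) < e"
    by (intro bexI[of _ f]) (auto simp: sup_norm_def Cc_iff zero_fun_def)
next
  fix f g :: "'a \<Rightarrow> real" assume "f \<in> Cc" "g \<in> Cc"
  then show "act (f + g) v \<bullet> v = act f v \<bullet> v + act g v \<bullet> v"
    by (simp only: act_plus inner_add_left)
next
  fix c and f :: "'a \<Rightarrow> real" assume "f \<in> Cc"
  then show "act (c *\<^sub>R f) v \<bullet> v = c * (act f v \<bullet> v)"
    by (simp only: act_scaleR inner_scaleR_left)
next
  fix f :: "'a \<Rightarrow> real" assume f: "f \<in> Cc" "\<And>x. 0 \<le> f x"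
  \<comment> \<open>A nonnegative continuous function is a square, which makes the functional the
    squared norm of \<open>act s v\<close>.\<close>
  define s where "s x = sqrt (f x)" for x
  have s: "s \<in> Cc" using f unfolding Cc_iff s_def[abs_def] by (intro continuous_intros) auto
  have "f = s * s" using f by (simp add: s_def fun_eq_iff)
  then have "act f v \<bullet> v = act s v \<bullet> act s v"
    using act_mult[OF s s] act_symmetric[OF s] by simp
  then show "0 \<le> act f v \<bullet> v" by simp
qed (auto simp: Cc_iff intro: that)

definition quadratic_rep :: "'h \<Rightarrow> 'a measure" where
  "quadratic_rep v = (SOME M. finite_measure M \<and> sets M = sets borel \<and> (\<forall>g\<in>Cc. act g v \<bullet> v = (\<integral>x. g x \<partial>M)))"

lemma quadratic_rep:
  "finite_measure (quadratic_rep v)" "sets (quadratic_rep v) = sets borel"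
  "g \<in> Cc \<Longrightarrow> act g v \<bullet> v = (\<integral>x. g x \<partial>quadratic_rep v)"
proof -
  have "\<exists>M. finite_measure M \<and> sets M = sets borel \<and> (\<forall>g\<in>Cc. act g v \<bullet> v = (\<integral>x. g x \<partial>M))"
    using quadratic_measure[of v] by metis
  from someI_ex[OF this] show "finite_measure (quadratic_rep v)" "sets (quadratic_rep v) = sets borel"
    "g \<in> Cc \<Longrightarrow> act g v \<bullet> v = (\<integral>x. g x \<partial>quadratic_rep v)"
    unfolding quadratic_rep_def by auto
qed

text \<open>The measure written \<nu> with indices \<open>v\<close>, \<open>w\<close>, built by
  polarization from representing measures of quadratic functionals.
  \<open>field_energy_measure_eq\<close> identifies it with the definite description.\<close>

definition mutual :: "'h \<Rightarrow> 'h \<Rightarrow> 'a set \<Rightarrow> real" where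
  "mutual v w A = (1/4) * measure (quadratic_rep (v + w)) A + (-1/4) * measure (quadratic_rep (v - w)) A"

lemma signed_mutual: "finite_signed_measure (mutual v w)"
  unfolding mutual_def[abs_def] by (intro signed_lincomb signed_measure(1) quadratic_rep)

lemma signed_integral_mutual:
  assumes g: "g \<in> Cc" shows "signed_integral (mutual v w) g = act g v \<bullet> w"
proof -
  interpret a: bounded_linear "act g" by (rule act_bounded_linear[OF g])
  have "signed_integral (mutual v w) g = (1/4) * (act g (v + w) \<bullet> (v + w)) + (-1/4) * (act g (v - w) \<bullet> (v - w))"
    unfolding mutual_def[abs_def]
      signed_integral_lincomb[OF signed_measure(1)[OF quadratic_rep(1,2)] signed_measure(1)[OF quadratic_rep(1,2)] Cc_bounded[OF g]]
      signed_measure(2)[OF quadratic_rep(1,2) Cc_bounded[OF g]] quadratic_rep(3)[OF g, symmetric] ..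
  also have "\<dots> = (1/2) * (act g v \<bullet> w + act g w \<bullet> v)"
    by (simp add: a.add a.diff inner_add_left inner_add_right inner_diff_left inner_diff_right algebra_simps)
  also have "act g w \<bullet> v = act g v \<bullet> w" using act_symmetric[OF g, of v w] by (simp add: inner_commute)
  finally show ?thesis by simp
qed

text \<open>Continuous functions determine a signed measure. Additivity, homogeneity, symmetry and
  agreement with the energy measures thereby become statements about the scalar products
  \<open>act g v \<bullet> w\<close>.\<close>

lemma mutual_eqI:
  assumes "finite_signed_measure \<sigma>" "\<And>g. g \<in> Cc \<Longrightarrow> signed_integral \<sigma> g = act g v \<bullet> w"
  shows "\<sigma> = mutual v w"
  using assms by (intro signed_eqI signed_mutual) (auto simp: Cc_iff signed_integral_mutual)

lemma mutual_add: "mutual (v + v') w A = mutual v w A + mutual v' w A"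
  and mutual_scaleR: "mutual (c *\<^sub>R v) w A = c * mutual v w A"
  and mutual_sym: "mutual v w = mutual w v"
  and mutual_self: "mutual v v = measure (quadratic_rep v)"
proof -
  have lc: "(\<lambda>A. a * mutual v w A + b * mutual v' w A) = mutual (a *\<^sub>R v + b *\<^sub>R v') w" for a b v v'
  proof (rule mutual_eqI)
    fix g :: "'a \<Rightarrow> real" assume g: "g \<in> Cc"
    interpret a: bounded_linear "act g" by (rule act_bounded_linear[OF g])
    show "signed_integral (\<lambda>A. a * mutual v w A + b * mutual v' w A) g = act g (a *\<^sub>R v + b *\<^sub>R v') \<bullet> w"
      using g by (simp add: signed_integral_lincomb signed_mutual Cc_bounded signed_integral_mutual
          a.add a.scaleR inner_add_left)
  qed (intro signed_lincomb signed_mutual)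
  show "mutual (v + v') w A = mutual v w A + mutual v' w A"
    using fun_cong[OF lc[of 1 v 1 v'], of A] by simp
  show "mutual (c *\<^sub>R v) w A = c * mutual v w A"
    using fun_cong[OF lc[of c v 0 v], of A] by simp
  show "mutual v w = mutual w v"
    by (rule mutual_eqI[OF signed_mutual])
      (simp add: signed_integral_mutual act_symmetric[of _ v w] inner_commute[of v])
  show "mutual v v = measure (quadratic_rep v)"
    using signed_measure[OF quadratic_rep(1,2)]
    by (intro mutual_eqI[symmetric]) (auto simp: Cc_bounded quadratic_rep(3))
qed

lemma mutual_nonneg: "0 \<le> mutual v v A"
  by (simp add: mutual_self)

text \<open>For fixed \<open>A\<close> the quadratic polynomial in \<open>t\<close> belonging to
  \<open>v + t *\<^sub>R w\<close> is nonnegative; the usual discriminant argument applies.\<close>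

lemma mutual_Cauchy_Schwarz: "(mutual v w A)\<^sup>2 \<le> mutual v v A * mutual w w A"
proof -
  have *: "mutual (v + t *\<^sub>R w) (v + t *\<^sub>R w) A = mutual v v A + 2 * t * mutual v w A + t\<^sup>2 * mutual w w A" for t
    using mutual_sym[of w v] mutual_sym[of v "v + t *\<^sub>R w"] mutual_sym[of w "v + t *\<^sub>R w"]
    by (simp add: mutual_add mutual_scaleR power2_eq_square algebra_simps)
  have nn: "0 \<le> mutual v v A + 2 * t * mutual v w A + t\<^sup>2 * mutual w w A" for t
    using mutual_nonneg[of "v + t *\<^sub>R w" A] unfolding * .
  show ?thesis
  proof (cases "mutual w w A = 0")
    case True
    have "mutual v w A = 0"
    proof (rule ccontr)
      assume "mutual v w A \<noteq> 0"
      \<comment> \<open>With vanishing quadratic coefficient the polynomial is affine, and this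
        \<open>t\<close> gives it the value -1.\<close>
      then show False using nn[of "- (mutual v v A + 1) / (2 * mutual v w A)"] True by (simp add: field_simps)
    qed
    then show ?thesis using True by simp
  next
    case False
    then have pos: "0 < mutual w w A" using mutual_nonneg[of w A] by simp
    then show ?thesis using nn[of "- mutual v w A / mutual w w A"]
      by (simp add: field_simps power2_eq_square)
  qed
qed

lemma mutual_UNIV: "mutual v w UNIV = v \<bullet> w"
proof -
  interpret s: signed "mutual v w" by standard (rule signed_mutual)
  have "(indicator UNIV :: 'a \<Rightarrow> real) = 1" by (simp add: fun_eq_iff)
  then show ?thesis using s.signed_integral_indicator[of UNIV] signed_integral_mutual[OF Cc_one] by (simp add: act_one)
qed

lemma abs_mutual_le: "\<bar>mutual v w A\<bar> \<le> norm v * norm w"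
proof -
  have m: "mutual v v A \<le> (norm v)\<^sup>2" for v
  proof -
    have "mutual v v A \<le> mutual v v UNIV"
      using finite_measure.finite_measure_mono[OF quadratic_rep(1), of A UNIV v] quadratic_rep(2)[of v]
      unfolding mutual_self by auto
    then show ?thesis by (simp add: mutual_UNIV power2_norm_eq_inner)
  qed
  have "(mutual v w A)\<^sup>2 \<le> (norm v)\<^sup>2 * (norm w)\<^sup>2"
    by (rule order_trans[OF mutual_Cauchy_Schwarz]) (intro mult_mono m mutual_nonneg, auto)
  then have "\<bar>mutual v w A\<bar>\<^sup>2 \<le> (norm v * norm w)\<^sup>2" by (simp add: power_mult_distrib)
  then show ?thesis by (rule power2_le_imp_le) simp
qed

lemma bounded_bilinear_mutual: "bounded_bilinear (\<lambda>v w. mutual v w A)"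
proof
  show "\<exists>K. \<forall>v w. norm (mutual v w A) \<le> norm v * norm w * K"
    by (intro exI[of _ 1]) (simp add: abs_mutual_le)
  show "mutual v (w + w') A = mutual v w A + mutual v w' A" for v w w'
    using mutual_add[of w w' v A] by (simp add: mutual_sym[of v])
  show "mutual v (c *\<^sub>R w) A = c *\<^sub>R mutual v w A" for c v w
    using mutual_scaleR[of c w v A] by (simp add: mutual_sym[of v])
qed (simp_all add: mutual_add mutual_scaleR)

text \<open>A test function is absorbed into the first multiplier, so both measures have the same
  integrals. For \<open>g1 = g2 = 1\<close> this recovers the energy measure of two
  functions.\<close>

lemma signed_integral_energy_tens:
  assumes "g1 \<in> Cc" "f1 \<in> C" "g2 \<in> Cc" "f2 \<in> C"
  shows "mutual (\<iota> (tens g1 f1)) (\<iota> (tens g2 f2)) =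
    (\<lambda>A. if A \<in> sets borel then signed_integral (energy_measure E C f1 f2) (indicator A * (g1 * g2)) else 0)"
proof (rule mutual_eqI[symmetric])
  have b: "g1 * g2 \<in> bounded_borel" using assms by (intro bounded_borel_mult Cc_bounded)
  interpret s: signed "energy_measure E C f1 f2" by standard (rule signed_energy_measure[OF assms(2,4)])
  show "finite_signed_measure
    (\<lambda>A. if A \<in> sets borel then signed_integral (energy_measure E C f1 f2) (indicator A * (g1 * g2)) else 0)"
    by (rule s.signed_density_measure[OF b])
  fix g :: "'a \<Rightarrow> real" assume g: "g \<in> Cc"
  have "g * (g1 * g2) = (g * g1) * g2" by (rule mult.assoc[symmetric])
  then show "signed_integral
     (\<lambda>A. if A \<in> sets borel then signed_integral (energy_measure E C f1 f2) (indicator A * (g1 * g2)) else 0) g =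
     act g (\<iota> (tens g1 f1)) \<bullet> \<iota> (tens g2 f2)"
    unfolding signed_integral_density[OF s.signed b Cc_bounded[OF g]]
    using assms g by (simp only: act_tens inner_tens Cc_mult)
qed

lemma energy_measure_eq_mutual:
  assumes "f1 \<in> C" "f2 \<in> C" shows "energy_measure E C f1 f2 = mutual (grad f1) (grad f2)"
proof
  fix A
  interpret s: signed "energy_measure E C f1 f2" by standard (rule signed_energy_measure[OF assms])
  have "indicator A * (1 * 1) = (indicator A :: 'a \<Rightarrow> real)" by simp
  then show "energy_measure E C f1 f2 A = mutual (grad f1) (grad f2) A"
    unfolding grad_tens signed_integral_energy_tens[OF Cc_one assms(1) Cc_one assms(2)]
    by (simp add: s.signed_integral_indicator s.nonborel)
qed

text \<open>A bounded bilinear form is fixed by its values on simple fields, first in one variable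
  and then in the other; off the Borel sets every finite signed measure vanishes by
  convention.\<close>

lemma field_energy_measure_eq: "field_energy_measure = mutual"
  unfolding field_energy_measure_def
proof (rule the_equality)
  show "(\<forall>v w. finite_signed_measure (mutual v w)) \<and>
             (\<forall>A\<in>sets borel. bounded_bilinear (\<lambda>v w. mutual v w A)) \<and>
             (\<forall>g1\<in>Cc. \<forall>f1\<in>C. \<forall>g2\<in>Cc. \<forall>f2\<in>C. \<forall>A\<in>sets borel.
                mutual (\<iota> (tens g1 f1)) (\<iota> (tens g2 f2)) A =
                signed_integral (energy_measure E C f1 f2) (indicator A * g1 * g2))"
    by (auto simp: signed_mutual bounded_bilinear_mutual signed_integral_energy_tens mult.assoc)
next
  fix N
  assume N: "(\<forall>v w. finite_signed_measure (N v w)) \<and>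
             (\<forall>A\<in>sets borel. bounded_bilinear (\<lambda>v w. N v w A)) \<and>
             (\<forall>g1\<in>Cc. \<forall>f1\<in>C. \<forall>g2\<in>Cc. \<forall>f2\<in>C. \<forall>A\<in>sets borel.
                N (\<iota> (tens g1 f1)) (\<iota> (tens g2 f2)) A =
                signed_integral (energy_measure E C f1 f2) (indicator A * g1 * g2))"
  have "N v w A = mutual v w A" for v w A
  proof (cases "A \<in> sets borel")
    case True
    interpret n: bounded_bilinear "\<lambda>v w. N v w A" using N True by blast
    interpret m: bounded_bilinear "\<lambda>v w. mutual v w A" by (rule bounded_bilinear_mutual)
    have 1: "N (\<iota> (tens g1 f1)) (\<iota> (tens g2 f2)) A = mutual (\<iota> (tens g1 f1)) (\<iota> (tens g2 f2)) A"
      if "g1 \<in> Cc" "f1 \<in> C" "g2 \<in> Cc" "f2 \<in> C" for g1 f1 g2 f2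
      using N True that by (simp add: signed_integral_energy_tens mult.assoc)
    have 2: "(\<lambda>w. N (\<iota> (tens g f)) w A) = (\<lambda>w. mutual (\<iota> (tens g f)) w A)" if "g \<in> Cc" "f \<in> C" for g f
      using 1 that by (intro eq_on_elems n.bounded_linear_right m.bounded_linear_right) auto
    have "(\<lambda>v. N v w A) = (\<lambda>v. mutual v w A)"
      using fun_cong[OF 2] by (intro eq_on_elems n.bounded_linear_left m.bounded_linear_left) auto
    then show ?thesis by (rule fun_cong)
  next
    case False
    interpret n: signed "N v w" using N by (simp add: signed_def)
    interpret m: signed "mutual v w" by standard (rule signed_mutual)
    show ?thesis using False by (simp add: n.nonborel m.nonborel)
  qed
  then show "N = mutual" by (simp add: fun_eq_iff)
qed

lemma field_measure_eq: "field_measure v = to_measure (mutual v v)"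
  by (simp add: field_measure_def field_energy_measure_eq)

lemma
  shows sets_to_measure_mutual: "sets (to_measure (mutual v v)) = sets borel"
    and finite_measure_mutual: "finite_measure (to_measure (mutual v v))"
    and measure_mutual: "A \<in> sets borel \<Longrightarrow> measure (to_measure (mutual v v)) A = mutual v v A"
proof -
  interpret s: signed "mutual v v" by standard (rule signed_mutual)
  note * = to_measure_nonneg[of "mutual v v", OF s.empty mutual_nonneg s.sums]
  show "sets (to_measure (mutual v v)) = sets borel" "finite_measure (to_measure (mutual v v))"
    "A \<in> sets borel \<Longrightarrow> measure (to_measure (mutual v v)) A = mutual v v A"
    using * by auto
qed

lemma signed_integral_mutual_self:
  assumes "g \<in> bounded_borel"
  shows "signed_integral (mutual v v) g = (\<integral>x. g x \<partial>to_measure (mutual v v))"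
proof -
  have "measure (to_measure (mutual v v)) = mutual v v"
  proof
    fix A
    interpret s: signed "mutual v v" by standard (rule signed_mutual)
    show "measure (to_measure (mutual v v)) A = mutual v v A"
      by (cases "A \<in> sets borel")
        (auto simp: measure_mutual s.nonborel sets_to_measure_mutual intro: measure_notin_sets)
  qed
  then show ?thesis using signed_measure(2)[OF finite_measure_mutual[of v] sets_to_measure_mutual assms] by simp
qed

end

section \<open>Martingale dimension one\<close>

text \<open>A basis of the column space has at most one element, so all columns are multiples of a
  single vector.\<close>

lemma matrix_rank_le_1_minor:
  assumes rank: "matrix_rank N A \<le> 1" and idx: "i < N" "i' < N" "j < N" "j' < N"
  shows "A i j * A i' j' = A i' j * A i j'"
proof -
  let ?col = "\<lambda>j i. if i < N then A i j else 0"
  obtain B where "B \<subseteq> ?col ` {..<N}" "independent B" "?col ` {..<N} \<subseteq> span B" "card B = dim (?col ` {..<N})"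
    by (rule real_vector.basis_exists)
  then have B: "B \<subseteq> ?col ` {..<N}" "?col ` {..<N} \<subseteq> span B" "card B = dim (?col ` {..<N})"
    by simp_all
  have "finite B" using B(1) finite_subset by blast
  have "card B = 0 \<or> card B = 1" using B(3) rank unfolding matrix_rank_def by linarith
  then have "\<exists>e. B \<subseteq> {e}" using \<open>finite B\<close> by (auto simp: card_1_singleton_iff)
  then obtain e where "B \<subseteq> {e}" ..
  then have "?col ` {..<N} \<subseteq> range (\<lambda>k. k *\<^sub>R e)"
    using order_trans[OF B(2) real_vector.span_mono[of B "{e}"]] unfolding real_vector.span_singleton by simp
  then have "\<exists>k. ?col j = k *\<^sub>R e" if "j < N" for j using that by blast
  then obtain k k' where k: "?col j = k *\<^sub>R e" "?col j' = k' *\<^sub>R e" using idx by meson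
  have "A l j = k * e l" "A l j' = k' * e l" if "l < N" for l
    using fun_cong[OF k(1), of l] fun_cong[OF k(2), of l] that by simp_all
  then show ?thesis using idx by simp
qed

text \<open>The positive and negative parts of \<open>k\<close> are densities of two finite measures
  \<open>P 1\<close> and \<open>P (-1)\<close>. Orthogonality to continuous functions makes their
  integrals agree there, hence the measures coincide.\<close>

lemma AE_zero_of_continuous:
  fixes k :: "'a::metric_space \<Rightarrow> real"
  assumes M: "finite_measure M" "sets M = sets borel" and k: "integrable M k"
    and orth: "\<And>g. g \<in> bounded_borel \<Longrightarrow> continuous_on UNIV g \<Longrightarrow> (\<integral>x. k x * g x \<partial>M) = 0"
  shows "AE x in M. k x = 0"
proof -
  define P where "P s = density M (\<lambda>x. ennreal (max (s * k x) 0))" for s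
  have km [measurable]: "k \<in> borel_measurable M" using k by auto
  have int: "integrable M (\<lambda>x. max (s * k x) 0)" for s
    using k by (intro Bochner_Integration.integrable_max) auto
  have P: "finite_measure (P s)" "sets (P s) = sets borel" for s
  proof
    have "emeasure (P s) (space (P s)) = (\<integral>\<^sup>+x. ennreal (max (s * k x) 0) \<partial>M)"
      unfolding P_def by (subst emeasure_density) (auto intro!: nn_integral_cong)
    also have "\<dots> < \<infinity>" using int[of s] by (subst nn_integral_eq_integral) auto
    finally show "emeasure (P s) (space (P s)) \<noteq> \<infinity>" by simp
    show "sets (P s) = sets borel" by (simp add: P_def M)
  qed
  have bm: "g \<in> borel_measurable M" if "g \<in> bounded_borel" for g
    using bounded_borel_measurable[OF that] by (simp add: measurable_cong_sets[OF M(2) refl])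
  have intg: "(\<integral>x. g x \<partial>P s) = (\<integral>x. max (s * k x) 0 * g x \<partial>M)" if "g \<in> bounded_borel" for g s
    unfolding P_def using bm[OF that] by (subst integral_real_density) auto
  have intP: "integrable M (\<lambda>x. max (s * k x) 0 * g x)" if g: "g \<in> bounded_borel" for g s
  proof -
    obtain c where c: "\<And>x. \<bar>g x\<bar> \<le> c" using g by (metis bounded_borel_bound)
    have bd: "norm (max (s * k x) 0 * g x) \<le> norm (max (s * k x) 0 * c)" for x
      using mult_left_mono[OF order_trans[OF c abs_ge_self], of "\<bar>max (s * k x) 0\<bar>" x]
      unfolding real_norm_def abs_mult by simp
    have "(\<lambda>x. max (s * k x) 0 * g x) \<in> borel_measurable M" using bm[OF g] by measurable
    then show ?thesis
      by (rule Bochner_Integration.integrable_bound[OF integrable_mult_left[OF int[of s], of c]])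
        (rule AE_I2, rule bd)
  qed
  have "k x = max (1 * k x) 0 - max ((-1) * k x) 0" for x by auto
  then have dec: "k x * y = max (1 * k x) 0 * y - max ((-1) * k x) 0 * y" for x y
    by (metis left_diff_distrib)
  have diff: "(\<integral>x. g x \<partial>P 1) - (\<integral>x. g x \<partial>P (-1)) = (\<integral>x. k x * g x \<partial>M)" if "g \<in> bounded_borel" for g
    unfolding dec intg[OF that] by (rule Bochner_Integration.integral_diff[symmetric]) (rule intP[OF that])+
  have eq: "measure (P 1) = measure (P (-1))"
  proof (rule signed_eqI[OF signed_measure(1)[OF P] signed_measure(1)[OF P]])
    fix f :: "'a \<Rightarrow> real" assume f: "f \<in> bounded_borel" "continuous_on UNIV f"
    show "signed_integral (measure (P 1)) f = signed_integral (measure (P (-1))) f"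
      unfolding signed_measure(2)[OF P f(1)] using diff[OF f(1)] orth[OF f] by simp
  qed
  have "(\<integral>x\<in>A. k x \<partial>M) = (\<integral>x\<in>A. 0 \<partial>M)" if "A \<in> sets M" for A
  proof -
    have A: "A \<in> sets borel" using that M by simp
    have "(\<integral>x. indicator A x \<partial>P 1) = (\<integral>x. (indicator A x :: real) \<partial>P (-1))"
      using A eq P(2) sets_eq_imp_space_eq[OF P(2)] by simp
    then show ?thesis
      using diff[OF bounded_borel_indicator[OF A]] by (simp add: set_lebesgue_integral_def mult.commute)
  qed
  then show ?thesis by (intro density_unique_real k) auto
qed

section \<open>The duality map as an isometry\<close>

locale l2_structure = admissible_structure E C \<iota> + boundary_data E C \<iota> cls b
  for E :: "('a::metric_space \<Rightarrow> real) \<Rightarrow> ('a \<Rightarrow> real) \<Rightarrow> real"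
    and C :: "('a \<Rightarrow> real) set"
    and \<iota> :: "('a \<times> 'a \<Rightarrow> real) \<Rightarrow> 'h::{real_inner, complete_space}"
    and cls :: "('a \<Rightarrow> real) \<Rightarrow> 'l::{real_inner, complete_space}"
    and b :: 'h +
  assumes L2: "L2_space (field_measure b) cls"
begin

abbreviation \<nu> :: "'a measure" where "\<nu> \<equiv> field_measure b"

lemma sets_nu [simp]: "sets \<nu> = sets borel"
  and finite_measure_nu: "finite_measure \<nu>"
  by (simp_all add: field_measure_eq sets_to_measure_mutual finite_measure_mutual)

lemma bounded_L2: "f \<in> bounded_borel \<Longrightarrow> f \<in> L2_functions \<nu>"
proof -
  assume f: "f \<in> bounded_borel"
  have "f * f \<in> bounded_borel" using f by blast
  then have "integrable \<nu> (f * f)"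
    by (rule integrable_bounded_borel[OF finite_measure_nu sets_nu])
  moreover have "f * f = (\<lambda>x. (f x)\<^sup>2)" by (simp add: fun_eq_iff power2_eq_square)
  moreover have "f \<in> borel_measurable \<nu>"
    using bounded_borel_measurable[OF f] by (simp add: measurable_cong_sets[OF sets_nu refl])
  ultimately show ?thesis by (simp add: L2_functions_def)
qed

lemma cls_add: "f \<in> Cc \<Longrightarrow> g \<in> Cc \<Longrightarrow> cls (f + g) = cls f + cls g"
  and cls_scaleR: "f \<in> Cc \<Longrightarrow> cls (c *\<^sub>R f) = c *\<^sub>R cls f"
  using L2 bounded_L2[OF Cc_bounded] unfolding L2_space_def by blast+

lemma cls_diff: "f \<in> Cc \<Longrightarrow> g \<in> Cc \<Longrightarrow> cls (f - g) = cls f - cls g"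
  using cls_add[of "f - g" g] subspace_diff[OF Cc_subspace, of f g] by simp

lemma cls_inner: "f \<in> L2_functions \<nu> \<Longrightarrow> g \<in> L2_functions \<nu> \<Longrightarrow> cls f \<bullet> cls g = (\<integral>x. f x * g x \<partial>\<nu>)"
  using L2 unfolding L2_space_def by blast

lemma cls_surj: obtains f where "f \<in> L2_functions \<nu>" "x = cls f"
  using L2 unfolding L2_space_def by blast

text \<open>The integral of \<open>f * g\<close> against \<nu> is
  \<open>act (f * g) b \<bullet> b\<close>, and symmetry of the action moves one factor to the other
  side.\<close>

lemma cls_inner_Cc:
  assumes "f \<in> Cc" "g \<in> Cc" shows "cls f \<bullet> cls g = act f b \<bullet> act g b"
proof -
  have "cls f \<bullet> cls g = signed_integral (mutual b b) (f * g)"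
    using cls_inner[OF bounded_L2[OF Cc_bounded[OF assms(1)]] bounded_L2[OF Cc_bounded[OF assms(2)]]]
      signed_integral_mutual_self[OF Cc_bounded[OF Cc_mult[OF assms]], of b]
    by (simp add: field_measure_eq)
  also have "\<dots> = act f (act g b) \<bullet> b" by (simp only: signed_integral_mutual Cc_mult assms act_mult)
  also have "\<dots> = act f b \<bullet> act g b" using act_symmetric[OF assms(1), of "act g b" b] by (simp add: inner_commute)
  finally show ?thesis .
qed

lemma subspace_cls: "subspace V \<Longrightarrow> V \<subseteq> Cc \<Longrightarrow> subspace (cls ` V)"
proof (rule subspaceI)
  assume V: "subspace V" "V \<subseteq> Cc"
  have "cls (0 *\<^sub>R 0) = 0 *\<^sub>R cls 0" by (rule cls_scaleR) (rule subspace_0[OF Cc_subspace])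
  then have "cls 0 = 0" by (simp add: zero_fun_def)
  then show "0 \<in> cls ` V" using subspace_0[OF V(1)] by (metis imageI)
  show "x + y \<in> cls ` V" if xy: "x \<in> cls ` V" "y \<in> cls ` V" for x y
  proof -
    obtain f g where fg: "f \<in> V" "g \<in> V" "x = cls f" "y = cls g" using xy by blast
    then have "x + y = cls (f + g)" using cls_add[OF subsetD[OF V(2) fg(1)] subsetD[OF V(2) fg(2)]] by simp
    then show ?thesis using subspace_add[OF V(1) fg(1,2)] by (rule image_eqI)
  qed
  show "c *\<^sub>R x \<in> cls ` V" if x: "x \<in> cls ` V" for c x
  proof -
    obtain f where f: "f \<in> V" "x = cls f" using x by blast
    then have "c *\<^sub>R x = cls (c *\<^sub>R f)" using cls_scaleR[OF subsetD[OF V(2) f(1)]] by simp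
    then show ?thesis using subspace_scale[OF V(1) f(1)] by (rule image_eqI)
  qed
qed

text \<open>With \<open>d = 1\<close> this gives density of \<open>Cc\<close>, and with \<open>d\<close> vanishing exactly on a closed null set it
  gives density of the functions vanishing there.\<close>

lemma cls_orthogonal:
  assumes d: "d \<in> Cc" and dnz: "AE x in \<nu>. d x \<noteq> 0"
    and orth: "\<And>g. g \<in> Cc \<Longrightarrow> y \<bullet> cls (d * g) = 0"
  shows "y = 0"
proof -
  obtain k where k: "k \<in> L2_functions \<nu>" "y = cls k" by (rule cls_surj)
  have km: "k \<in> borel_measurable \<nu>" and k2: "integrable \<nu> (\<lambda>x. (k x)\<^sup>2)"
    using k by (auto simp: L2_functions_def)
  have k1: "integrable \<nu> k"
  proof -
    interpret finite_measure \<nu> by (rule finite_measure_nu)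
    have "\<bar>k x\<bar> \<le> 1 + (k x)\<^sup>2" for x
    proof -
      have "0 \<le> (\<bar>k x\<bar> - 1)\<^sup>2" by (rule zero_le_power2)
      then have "2 * \<bar>k x\<bar> \<le> 1 + (k x)\<^sup>2" by (simp add: power2_diff)
      then show ?thesis using abs_ge_zero[of "k x"] by linarith
    qed
    then show ?thesis using k2 km
      by (intro Bochner_Integration.integrable_bound[of \<nu> "\<lambda>x. 1 + (k x)\<^sup>2" k]) auto
  qed
  have int: "integrable \<nu> (\<lambda>x. k x * g x)" if g: "g \<in> bounded_borel" for g
  proof -
    obtain c where c: "\<And>x. \<bar>g x\<bar> \<le> c" using g by (metis bounded_borel_bound)
    have bd: "norm (k x * g x) \<le> norm (\<bar>k x\<bar> * c)" for x
      using mult_left_mono[OF order_trans[OF c abs_ge_self], of "\<bar>k x\<bar>" x] by (simp add: abs_mult)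
    have "g \<in> borel_measurable \<nu>"
      using bounded_borel_measurable[OF g] by (simp add: measurable_cong_sets[OF sets_nu refl])
    then have "(\<lambda>x. k x * g x) \<in> borel_measurable \<nu>" using km by (rule borel_measurable_times[rotated])
    then show ?thesis
      by (rule Bochner_Integration.integrable_bound[OF integrable_mult_left[OF integrable_abs[OF k1], of c]])
        (rule AE_I2, rule bd)
  qed
  have "AE x in \<nu>. k x * d x = 0"
  proof (rule AE_zero_of_continuous[OF finite_measure_nu sets_nu int[OF Cc_bounded[OF d]]])
    fix g :: "'a \<Rightarrow> real" assume "g \<in> bounded_borel" "continuous_on UNIV g"
    then have g: "g \<in> Cc" by (simp add: Cc_iff)
    have "(\<integral>x. k x * d x * g x \<partial>\<nu>) = (\<integral>x. k x * (d * g) x \<partial>\<nu>)" by (simp add: mult.assoc)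
    also have "\<dots> = y \<bullet> cls (d * g)"
      unfolding k(2) by (rule cls_inner[OF k(1) bounded_L2[OF Cc_bounded[OF Cc_mult[OF d g]]], symmetric])
    finally show "(\<integral>x. k x * d x * g x \<partial>\<nu>) = 0" using orth[OF g] by simp
  qed
  with dnz have "AE x in \<nu>. k x * k x = 0" by eventually_elim auto
  then have "(\<integral>x. k x * k x \<partial>\<nu>) = 0" by (rule integral_eq_zero_AE)
  then show "y = 0" using cls_inner[OF k(1) k(1)] k(2) by simp
qed

lemma dense_cls_Cc: "closure (cls ` Cc) = UNIV"
proof (rule dense_subspaceI[OF subspace_cls[OF Cc_subspace order_refl]])
  fix y assume "\<And>x. x \<in> cls ` Cc \<Longrightarrow> y \<bullet> x = 0"
  then show "y = 0" by (intro cls_orthogonal[OF Cc_one]) simp_all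
qed

text \<open>By \<open>cls_inner_Cc\<close> the assignment of \<open>act g b\<close> to
  \<open>cls g\<close> is isometric. It is therefore well defined on classes and extends from the
  dense image of \<open>Cc\<close>.\<close>

lemma star_ex1: "\<exists>!T. bounded_linear T \<and> (\<forall>g\<in>Cc. T (cls g) = act g b)"
proof (rule ex_ex1I)
  define R where "R = (\<lambda>g. (cls g, act g b)) ` Cc"
  have R: "subspace R"
  proof (rule subspaceI)
    have "cls (0 *\<^sub>R 1) = 0 *\<^sub>R cls 1" "act (0 *\<^sub>R 1) b = 0 *\<^sub>R act 1 b"
      by (rule cls_scaleR[OF Cc_one], rule act_scaleR[OF Cc_one])
    moreover have "(0::real) *\<^sub>R (1 :: 'a \<Rightarrow> real) \<in> Cc" by (rule Cc_scaleR[OF Cc_one])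
    ultimately show "0 \<in> R" unfolding R_def zero_prod_def by (metis (no_types, lifting) image_eqI scaleR_zero_left)
    show "x + y \<in> R" if xy: "x \<in> R" "y \<in> R" for x y
    proof -
      obtain f g where fg: "f \<in> Cc" "g \<in> Cc" "x = (cls f, act f b)" "y = (cls g, act g b)"
        using xy unfolding R_def by blast
      then show ?thesis unfolding R_def
        by (intro image_eqI[of _ _ "f + g"]) (simp_all only: cls_add act_plus add_Pair Cc_add)
    qed
    show "c *\<^sub>R x \<in> R" if x: "x \<in> R" for c x
    proof -
      obtain f where f: "f \<in> Cc" "x = (cls f, act f b)"
        using x unfolding R_def by blast
      then show ?thesis unfolding R_def
        by (intro image_eqI[of _ _ "c *\<^sub>R f"]) (simp_all only: cls_scaleR act_scaleR scaleR_Pair Cc_scaleR)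
    qed
  qed
  have bd: "norm y \<le> 1 * norm x" if "(x, y) \<in> R" for x y
    using that cls_inner_Cc unfolding R_def by (auto simp: norm_eq_sqrt_inner)
  have "fst ` R = cls ` Cc" unfolding R_def by (simp add: image_image)
  then have dense: "closure (fst ` R) = UNIV" using dense_cls_Cc by simp
  obtain T where "bounded_linear T" "\<And>x y. (x, y) \<in> R \<Longrightarrow> T x = y"
    by (rule bounded_relation_extension[OF R bd dense]) (assumption, rule that)
  then show "\<exists>T. bounded_linear T \<and> (\<forall>g\<in>Cc. T (cls g) = act g b)"
    unfolding R_def by blast
next
  fix S T :: "'l \<Rightarrow> 'h"
  assume "bounded_linear S \<and> (\<forall>g\<in>Cc. S (cls g) = act g b)" "bounded_linear T \<and> (\<forall>g\<in>Cc. T (cls g) = act g b)"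
  then show "S = T" by (intro bounded_linear_eq_dense[OF _ _ dense_cls_Cc]) auto
qed

lemma star_bounded_linear: "bounded_linear star"
  and star_cls: "g \<in> Cc \<Longrightarrow> star (cls g) = act g b"
  using theI'[OF star_ex1] unfolding star_def by blast+

sublocale star: bounded_linear star by (rule star_bounded_linear)

lemma star_inner: "star x \<bullet> star y = x \<bullet> y"
proof -
  have 1: "(\<lambda>y. star (cls g) \<bullet> star y) = (\<lambda>y. cls g \<bullet> y)" if g: "g \<in> Cc" for g
    by (rule bounded_linear_eq_dense[OF bounded_linear_compose[OF bounded_linear_inner_right star_bounded_linear]
          bounded_linear_inner_right dense_cls_Cc]) (use g cls_inner_Cc in \<open>auto simp: star_cls\<close>)
  have "(\<lambda>x. star x \<bullet> star y) = (\<lambda>x. x \<bullet> y)"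
    by (rule bounded_linear_eq_dense[OF bounded_linear_compose[OF bounded_linear_inner_left star_bounded_linear]
          bounded_linear_inner_left dense_cls_Cc]) (use fun_cong[OF 1] in auto)
  then show ?thesis by (rule fun_cong)
qed

lemma star_norm: "norm (star x) = norm x"
  by (simp add: norm_eq_sqrt_inner star_inner)

lemma star_one: "star (cls 1) = b"
  by (simp only: star_cls[OF Cc_one] act_one)

text \<open>An isometry from a complete space. Consequently surjectivity only requires that nothing
  nonzero is orthogonal to the range.\<close>

lemma closed_range_star: "closed (range star)"
  unfolding closed_sequential_limits
proof (intro allI impI)
  fix f l assume "(\<forall>n. f n \<in> range star) \<and> f \<longlonglongrightarrow> l"
  then have fl: "\<And>n. f n \<in> range star" "f \<longlonglongrightarrow> l" by auto
  have "\<exists>x. f n = star x" for n using fl(1)[of n] by auto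
  then obtain g where g: "\<And>n. f n = star (g n)" by metis
  have dist: "dist (g m) (g n) = dist (f m) (f n)" for m n
    by (simp add: g dist_norm star_norm flip: star.diff)
  have "Cauchy f" using fl(2) convergent_Cauchy convergent_def by blast
  then have "Cauchy g" unfolding Cauchy_def dist .
  then obtain x where "g \<longlonglongrightarrow> x" using Cauchy_convergent convergent_def by blast
  then have "f \<longlonglongrightarrow> star x" unfolding g[abs_def] by (rule star.tendsto)
  then show "l \<in> range star" using fl(2) LIMSEQ_unique by blast
qed

end

section \<open>Null sets and bounded Borel test functions\<close>

context admissible_structure
begin

text \<open>The bound is \<open>signed_integral_bound\<close> with \<open>abs_mutual_le\<close>.
  Continuity in \<open>v\<close> allows identities between such integrals to be checked on simple
  fields only.\<close>

lemma bounded_linear_signed_integral_mutual: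
  assumes k: "k \<in> bounded_borel"
  shows "bounded_linear (\<lambda>v. signed_integral (mutual v w) k)"
proof -
  obtain c where c: "0 \<le> c" "\<And>x. \<bar>k x\<bar> \<le> c" using k by (metis bounded_borel_bound)
  have lin: "signed_integral (mutual (s *\<^sub>R v + t *\<^sub>R v') w) k = s * signed_integral (mutual v w) k + t * signed_integral (mutual v' w) k"
    for s t v v'
  proof -
    have "mutual (s *\<^sub>R v + t *\<^sub>R v') w = (\<lambda>A. s * mutual v w A + t * mutual v' w A)"
      by (simp add: fun_eq_iff mutual_add mutual_scaleR)
    then show ?thesis by (simp add: signed_integral_lincomb signed_mutual k)
  qed
  show ?thesis
  proof (rule bounded_linear_intro)
    show "signed_integral (mutual (v + v') w) k = signed_integral (mutual v w) k + signed_integral (mutual v' w) k" for v v'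
      using lin[of 1 v 1 v'] by simp
    show "signed_integral (mutual (s *\<^sub>R v) w) k = s *\<^sub>R signed_integral (mutual v w) k" for s v
      using lin[of s v 0 v] by simp
    show "norm (signed_integral (mutual v w) k) \<le> norm v * (2 * norm w * c)" for v
    proof -
      interpret s: signed "mutual v w" by standard (rule signed_mutual)
      show ?thesis using s.signed_integral_bound[OF k c(2) abs_mutual_le] by (simp add: algebra_simps)
    qed
  qed
qed

text \<open>Multiplying the field by \<open>g\<close> multiplies its mutual measure by the density
  \<open>g\<close>: the two measures agree on continuous functions, and hence as measures.\<close>

lemma signed_integral_mutual_act:
  assumes g: "g \<in> Cc" and k: "k \<in> bounded_borel"
  shows "signed_integral (mutual (act g u) w) k = signed_integral (mutual u w) (k * g)"
proof -
  note gb = Cc_bounded[OF g]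
  interpret s: signed "mutual u w" by standard (rule signed_mutual)
  have "(\<lambda>A. if A \<in> sets borel then signed_integral (mutual u w) (indicator A * g) else 0) = mutual (act g u) w"
  proof (rule mutual_eqI[OF s.signed_density_measure[OF gb]])
    fix g' :: "'a \<Rightarrow> real" assume g': "g' \<in> Cc"
    show "signed_integral (\<lambda>A. if A \<in> sets borel then signed_integral (mutual u w) (indicator A * g) else 0) g' =
        act g' (act g u) \<bullet> w"
      unfolding signed_integral_density[OF signed_mutual gb Cc_bounded[OF g']]
      by (simp only: signed_integral_mutual Cc_mult g g' act_mult)
  qed
  then show ?thesis using signed_integral_density[OF signed_mutual gb k, of u w] by simp
qed

text \<open>Nullity is inherited by Borel subsets of \<open>A\<close>, so Cauchy-Schwarz kills the
  mutual measure of \<open>grad f\<close> and any \<open>w\<close> inside \<open>A\<close>.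
  Multiplication by \<open>g\<close> only adds a density, and the set of admissible \<open>v\<close>
  is a closed subspace.\<close>

lemma mutual_null_gradients:
  assumes Ab: "A \<in> sets borel" and null: "\<And>f. f \<in> C \<Longrightarrow> mutual (grad f) (grad f) A = 0"
  shows "mutual v w A = 0"
proof -
  interpret m: bounded_bilinear "\<lambda>v w. mutual v w A" by (rule bounded_bilinear_mutual)
  have lin: "bounded_linear (\<lambda>v. mutual v w A)" by (rule m.bounded_linear_left)
  interpret l: bounded_linear "\<lambda>v. mutual v w A" by (rule lin)
  have "v \<in> {v. mutual v w A = 0}"
  proof (rule closed_subspace_elems)
    show "subspace {v. mutual v w A = 0}"
      by (rule subspaceI) (simp_all add: l.add l.scaleR l.zero)
    show "closed {v. mutual v w A = 0}"
      by (intro closed_Collect_eq linear_continuous_on lin continuous_intros)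
  next
    fix g f :: "'a \<Rightarrow> real" assume g: "g \<in> Cc" and f: "f \<in> C"
    have "mutual (grad f) (grad f) A = 0" by (rule null[OF f])
    then have fw: "mutual (grad f) w D = 0" if "D \<in> sets borel" "D \<subseteq> A" for D w
    proof -
      have "mutual (grad f) (grad f) D \<le> mutual (grad f) (grad f) A"
        using that Ab finite_measure.finite_measure_mono[OF quadratic_rep(1), of D A "grad f"] quadratic_rep(2)[of "grad f"]
        unfolding mutual_self by simp
      then have "mutual (grad f) (grad f) D = 0"
        using mutual_nonneg[of "grad f" D] \<open>mutual (grad f) (grad f) A = 0\<close> by simp
      then have "(mutual (grad f) w D)\<^sup>2 \<le> 0" using mutual_Cauchy_Schwarz[of "grad f" w D] by simp
      then show ?thesis by simp
    qed
    interpret s: signed "mutual (grad f) w" by standard (rule signed_mutual)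
    interpret t: signed "mutual (act g (grad f)) w" by standard (rule signed_mutual)
    have b: "indicator A * g \<in> bounded_borel" using Ab Cc_bounded[OF g] by blast
    have zero: "signed_integral (mutual (grad f) w) (k * indicator A) = 0" if k: "k \<in> bounded_borel" for k
    proof -
      \<comment> \<open>The restriction of the measure to \<open>A\<close> is the zero measure, so
        all its integrals vanish.\<close>
      have e: "(\<lambda>D. if D \<in> sets borel then signed_integral (mutual (grad f) w) (indicator D * indicator A) else 0) = (\<lambda>D. 0)"
      proof
        fix D
        have "indicator D * indicator A = (indicator (D \<inter> A) :: 'a \<Rightarrow> real)"
          by (simp add: fun_eq_iff indicator_inter_arith)
        then show "(if D \<in> sets borel then signed_integral (mutual (grad f) w) (indicator D * indicator A) else 0) = 0"
          using Ab fw[of "D \<inter> A"] s.signed_integral_indicator[of "D \<inter> A"] by simp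
      qed
      have z: "finite_signed_measure (\<lambda>D :: 'a set. 0 :: real)" by (simp add: finite_signed_measure_def)
      have "signed_integral (\<lambda>D :: 'a set. 0) k = 0"
        using signed_integral_lincomb[OF z z k, of 0 0] by simp
      then show ?thesis
        using signed_integral_density[OF signed_mutual bounded_borel_indicator[OF Ab] k, of "grad f" w]
        unfolding e by simp
    qed
    have "mutual (act g (grad f)) w A = signed_integral (mutual (act g (grad f)) w) (indicator A)"
      by (rule t.signed_integral_indicator[OF Ab, symmetric])
    also have "\<dots> = signed_integral (mutual (grad f) w) (g * indicator A)"
      using signed_integral_mutual_act[OF g bounded_borel_indicator[OF Ab]] by (simp add: mult.commute)
    also have "\<dots> = 0" by (rule zero[OF Cc_bounded[OF g]])
    finally show "\<iota> (tens g f) \<in> {v. mutual v w A = 0}" by (simp add: act_grad[OF g f])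
  qed
  then show ?thesis by simp
qed

lemma mutual_null:
  assumes dom: "energy_dominant E C M" and A: "A \<in> null_sets M"
  shows "mutual v w A = 0"
proof (rule mutual_null_gradients)
  show Ab: "A \<in> sets borel" using A dom by (auto simp: energy_dominant_def)
  fix f assume f: "f \<in> C"
  have "A \<in> null_sets (to_measure (energy_measure E C f f))"
    using dom A f by (auto simp: energy_dominant_def absolutely_continuous_def)
  then show "mutual (grad f) (grad f) A = 0"
    using measure_mutual[OF Ab, of "grad f"] energy_measure_eq_mutual[OF f f]
    by (simp add: measure_eq_0_null_sets)
qed

end

section \<open>Densities with respect to an energy-dominant measure\<close>

locale dominating = admissible_structure E C \<iota>
  for E :: "('a::metric_space \<Rightarrow> real) \<Rightarrow> ('a \<Rightarrow> real) \<Rightarrow> real"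
    and C :: "('a \<Rightarrow> real) set"
    and \<iota> :: "('a \<times> 'a \<Rightarrow> real) \<Rightarrow> 'h::{real_inner, complete_space}" +
  fixes M :: "'a measure"
  assumes dom: "energy_dominant E C M"
begin

lemma sets_M [simp]: "sets M = sets borel" and sf_M: "sigma_finite_measure M"
  using dom by (simp_all add: energy_dominant_def)

text \<open>Plays the part of the scalar product of the values of \<open>v\<close> and
  \<open>w\<close> at a point. The matrices in the definition of the index are its Gram matrices on
  gradients.\<close>

definition \<gamma> :: "'h \<Rightarrow> 'h \<Rightarrow> 'a \<Rightarrow> real" where
  "\<gamma> v w = signed_density (mutual v w) M"

lemma \<gamma>_integrable: "k \<in> bounded_borel \<Longrightarrow> integrable M (\<lambda>x. \<gamma> v w x * k x)"
  and \<gamma>_integral: "k \<in> bounded_borel \<Longrightarrow> signed_integral (mutual v w) k = (\<integral>x. \<gamma> v w x * k x \<partial>M)"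
  unfolding \<gamma>_def
  using signed_density_integral[OF sf_M sets_M signed_mutual mutual_null[OF dom]] by auto

lemma \<gamma>_measurable: "\<gamma> v w \<in> borel_measurable M"
  using borel_measurable_integrable[OF \<gamma>_integrable[OF bounded_borel_const[of 1], of v w]] by simp

lemma \<gamma>_sym: "\<gamma> v w = \<gamma> w v"
  by (simp add: \<gamma>_def mutual_sym)

text \<open>An identity that is linear in \<open>v\<close> extends from gradients to all of \<open>\<H>\<close>, after integration
  over sets on which \<open>\<alpha>\<close> and \<open>\<beta>\<close> are bounded.\<close>

lemma density_identity_extend:
  assumes \<alpha>: "\<alpha> \<in> borel_measurable M" and \<beta>: "\<beta> \<in> borel_measurable M"
    and grad: "\<And>f. f \<in> C \<Longrightarrow> AE x in M. \<alpha> x * \<gamma> (grad f) y x = \<beta> x * \<gamma> (grad f) z x"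
  shows "AE x in M. \<alpha> x * \<gamma> v y x = \<beta> x * \<gamma> v z x"
proof -
  define S where "S n = {x. \<bar>\<alpha> x\<bar> \<le> real n \<and> \<bar>\<beta> x\<bar> \<le> real n}" for n :: nat
  have am: "\<alpha> \<in> borel_measurable borel" "\<beta> \<in> borel_measurable borel"
    using \<alpha> \<beta> by (simp_all add: measurable_cong_sets[OF sets_M refl])
  have S: "S n \<in> sets borel" for n unfolding S_def using am by measurable
  have cut: "indicator (A \<inter> S n) * \<alpha> \<in> bounded_borel" "indicator (A \<inter> S n) * \<beta> \<in> bounded_borel"
    if "A \<in> sets borel" for A n
  proof -
    have "\<bar>indicator (A \<inter> S n) x * \<alpha> x\<bar> \<le> real n" "\<bar>indicator (A \<inter> S n) x * \<beta> x\<bar> \<le> real n" for x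
      by (auto simp: indicator_def S_def)
    then show "indicator (A \<inter> S n) * \<alpha> \<in> bounded_borel" "indicator (A \<inter> S n) * \<beta> \<in> bounded_borel"
      unfolding times_fun_def
      by (auto intro!: bounded_borelI[where c = "real n"] borel_measurable_times borel_measurable_indicator am
          sets.Int that S)
  qed
  have "AE x in M. \<gamma> v y x * (indicator (S n) x * \<alpha> x) = \<gamma> v z x * (indicator (S n) x * \<beta> x)" for n
  proof (rule density_unique_real)
    show "integrable M (\<lambda>x. \<gamma> v y x * (indicator (S n) x * \<alpha> x))"
      "integrable M (\<lambda>x. \<gamma> v z x * (indicator (S n) x * \<beta> x))"
      using \<gamma>_integrable[OF cut(1)[of UNIV n], of v y] \<gamma>_integrable[OF cut(2)[of UNIV n], of v z] by simp_all
  next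
    fix A assume "A \<in> sets M"
    then have A: "A \<in> sets borel" by simp
    have "v \<in> {v. signed_integral (mutual v y) (indicator (A \<inter> S n) * \<alpha>) = signed_integral (mutual v z) (indicator (A \<inter> S n) * \<beta>)}"
    proof (rule closed_subspace_elems)
      note bl = bounded_linear_signed_integral_mutual[OF cut(1)[OF A, of n], of y]
        bounded_linear_signed_integral_mutual[OF cut(2)[OF A, of n], of z]
      interpret l1: bounded_linear "\<lambda>v. signed_integral (mutual v y) (indicator (A \<inter> S n) * \<alpha>)" by (rule bl(1))
      interpret l2: bounded_linear "\<lambda>v. signed_integral (mutual v z) (indicator (A \<inter> S n) * \<beta>)" by (rule bl(2))
      show "subspace {v. signed_integral (mutual v y) (indicator (A \<inter> S n) * \<alpha>) = signed_integral (mutual v z) (indicator (A \<inter> S n) * \<beta>)}"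
        by (rule subspaceI)
          (simp_all only: mem_Collect_eq l1.add l1.scaleR l1.zero l2.add l2.scaleR l2.zero)
      show "closed {v. signed_integral (mutual v y) (indicator (A \<inter> S n) * \<alpha>) = signed_integral (mutual v z) (indicator (A \<inter> S n) * \<beta>)}"
        by (rule closed_Collect_eq[OF linear_continuous_on[OF bl(1)] linear_continuous_on[OF bl(2)]])
    next
      fix g f :: "'a \<Rightarrow> real" assume g: "g \<in> Cc" and f: "f \<in> C"
      have gb: "indicator (A \<inter> S n) * \<alpha> * g \<in> bounded_borel" "indicator (A \<inter> S n) * \<beta> * g \<in> bounded_borel"
        using cut[OF A, of n] Cc_bounded[OF g] by blast+
      have "signed_integral (mutual (\<iota> (tens g f)) y) (indicator (A \<inter> S n) * \<alpha>) =
          (\<integral>x. \<gamma> (grad f) y x * (indicator (A \<inter> S n) * \<alpha> * g) x \<partial>M)"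
        unfolding act_grad[OF g f, symmetric]
        by (simp only: signed_integral_mutual_act[OF g cut(1)[OF A]] \<gamma>_integral[OF gb(1)])
      also have "\<dots> = (\<integral>x. \<gamma> (grad f) z x * (indicator (A \<inter> S n) * \<beta> * g) x \<partial>M)"
      proof (rule integral_cong_AE)
        show "(\<lambda>x. \<gamma> (grad f) y x * (indicator (A \<inter> S n) * \<alpha> * g) x) \<in> borel_measurable M"
          "(\<lambda>x. \<gamma> (grad f) z x * (indicator (A \<inter> S n) * \<beta> * g) x) \<in> borel_measurable M"
          using \<gamma>_integrable[OF gb(1), of "grad f" y] \<gamma>_integrable[OF gb(2), of "grad f" z] by blast+
        show "AE x in M. \<gamma> (grad f) y x * (indicator (A \<inter> S n) * \<alpha> * g) x = \<gamma> (grad f) z x * (indicator (A \<inter> S n) * \<beta> * g) x"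
          using grad[OF f]
        proof eventually_elim
          case (elim x)
          have "\<gamma> (grad f) y x * (indicator (A \<inter> S n) * \<alpha> * g) x = indicator (A \<inter> S n) x * g x * (\<alpha> x * \<gamma> (grad f) y x)"
            by simp
          also have "\<dots> = indicator (A \<inter> S n) x * g x * (\<beta> x * \<gamma> (grad f) z x)" by (simp only: elim)
          finally show ?case by (simp only: times_fun_apply mult_ac)
        qed
      qed
      also have "\<dots> = signed_integral (mutual (\<iota> (tens g f)) z) (indicator (A \<inter> S n) * \<beta>)"
        unfolding act_grad[OF g f, symmetric]
        by (simp only: signed_integral_mutual_act[OF g cut(2)[OF A]] \<gamma>_integral[OF gb(2)])
      finally show "\<iota> (tens g f) \<in> {v. signed_integral (mutual v y) (indicator (A \<inter> S n) * \<alpha>) = signed_integral (mutual v z) (indicator (A \<inter> S n) * \<beta>)}"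
        by simp
    qed
    then have "(\<integral>x. \<gamma> v y x * (indicator (A \<inter> S n) * \<alpha>) x \<partial>M) = (\<integral>x. \<gamma> v z x * (indicator (A \<inter> S n) * \<beta>) x \<partial>M)"
      by (simp only: mem_Collect_eq \<gamma>_integral[OF cut(1)[OF A]] \<gamma>_integral[OF cut(2)[OF A]])
    then show "(\<integral>x\<in>A. \<gamma> v y x * (indicator (S n) x * \<alpha> x) \<partial>M) = (\<integral>x\<in>A. \<gamma> v z x * (indicator (S n) x * \<beta> x) \<partial>M)"
      unfolding set_lebesgue_integral_def by (simp add: indicator_inter_arith mult_ac)
  qed
  then have "AE x in M. \<forall>n. \<gamma> v y x * (indicator (S n) x * \<alpha> x) = \<gamma> v z x * (indicator (S n) x * \<beta> x)"
    unfolding AE_all_countable by blast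
  then show ?thesis
  proof eventually_elim
    case (elim x)
    obtain n where "max \<bar>\<alpha> x\<bar> \<bar>\<beta> x\<bar> \<le> real n" using real_arch_simple by blast
    then have "x \<in> S n" by (simp add: S_def)
    then show ?case using elim[rule_format, of n] by (simp add: mult.commute)
  qed
qed

text \<open>Rank one means that all \<open>2 \<times> 2\<close> minors of the densities vanish; extend the rows and columns of
  the minor one at a time.\<close>

lemma rank_one_orthogonal:
  assumes rank: "\<And>f1 f2 f3 f4. f1 \<in> C \<Longrightarrow> f2 \<in> C \<Longrightarrow> f3 \<in> C \<Longrightarrow> f4 \<in> C \<Longrightarrow>
      AE x in M. \<gamma> (grad f1) (grad f2) x * \<gamma> (grad f3) (grad f4) x = \<gamma> (grad f3) (grad f2) x * \<gamma> (grad f1) (grad f4) x"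
    and b: "AE x in M. \<gamma> b b x \<noteq> 0"
    and w: "\<And>A. mutual b w A = 0"
  shows "w = 0"
proof -
  \<comment> \<open>This holds at every point and not only almost everywhere: the two Jordan parts
    of the zero measure are the same measure, so the chosen densities cancel.\<close>
  have bw: "\<gamma> b w x = 0" for x
  proof -
    have "mutual b w = mutual 0 0" using w mutual_scaleR[of 0 0 0] by (simp add: fun_eq_iff)
    moreover have "mutual 0 (0::'h) = (\<lambda>A. - mutual 0 0 A)"
      using mutual_scaleR[of 0 0 0] by (simp add: fun_eq_iff)
    ultimately have "jordan_pos (mutual b w) = jordan_neg (mutual b w)" by (simp add: jordan_neg_def)
    then show ?thesis by (simp add: \<gamma>_def signed_density_def)
  qed
  have 1: "AE x in M. \<gamma> (grad f1) (grad f2) x * \<gamma> v (grad f3) x = \<gamma> (grad f3) (grad f2) x * \<gamma> v (grad f1) x"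
    if f: "f1 \<in> C" "f2 \<in> C" "f3 \<in> C" for f1 f2 f3 v
  proof (rule density_identity_extend[OF \<gamma>_measurable \<gamma>_measurable])
    show "AE x in M. \<gamma> (grad f1) (grad f2) x * \<gamma> (grad f) (grad f3) x = \<gamma> (grad f3) (grad f2) x * \<gamma> (grad f) (grad f1) x"
      if "f \<in> C" for f
      using rank[OF f(1,2,3) that] by (simp add: \<gamma>_sym[of "grad f"])
  qed
  have 2: "AE x in M. \<gamma> w (grad f1) x * \<gamma> b (grad f2) x = 0" if f: "f1 \<in> C" "f2 \<in> C" for f1 f2
  proof -
    have "AE x in M. \<gamma> (grad f1) (grad f2) x * \<gamma> b w x = \<gamma> w (grad f1) x * \<gamma> b (grad f2) x"
    proof (rule density_identity_extend[OF \<gamma>_measurable \<gamma>_measurable])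
      show "AE x in M. \<gamma> (grad f1) (grad f2) x * \<gamma> (grad f) w x = \<gamma> w (grad f1) x * \<gamma> (grad f) (grad f2) x"
        if "f \<in> C" for f
        using 1[OF f that, of w] by (simp add: \<gamma>_sym[of w "grad f"] mult.commute)
    qed
    then show ?thesis by eventually_elim (simp add: bw)
  qed
  \<comment> \<open>Extending the last gradient to \<open>b\<close> itself produces the factor
    \<open>\<gamma> b b x\<close>, which is nonzero almost everywhere and can be cancelled.\<close>
  have 3: "AE x in M. \<gamma> w (grad f) x = 0" if f: "f \<in> C" for f
  proof -
    have "AE x in M. \<gamma> w (grad f) x * \<gamma> b b x = (\<lambda>x. 0) x * \<gamma> b b x"
    proof (rule density_identity_extend[OF \<gamma>_measurable borel_measurable_const])
      show "AE x in M. \<gamma> w (grad f) x * \<gamma> (grad f2) b x = 0 * \<gamma> (grad f2) b x" if "f2 \<in> C" for f2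
        using 2[OF f that] by (simp add: \<gamma>_sym[of b])
    qed
    with b show ?thesis by eventually_elim simp
  qed
  show "w = 0"
  proof (rule orthogonal_dense_eq_0[OF dense_span_elems])
    fix y assume "y \<in> span elems"
    then show "w \<bullet> y = 0"
    proof (rule span_induct)
      show "subspace {y. w \<bullet> y = 0}" by (rule subspaceI) (auto simp: inner_add_right)
      fix y assume "y \<in> elems"
      then obtain g f where g: "g \<in> Cc" and f: "f \<in> C" and y: "y = \<iota> (tens g f)" by blast
      have "w \<bullet> y = act g w \<bullet> grad f" unfolding y act_grad[OF g f, symmetric] by (rule act_symmetric[OF g, symmetric])
      also have "\<dots> = (\<integral>x. \<gamma> w (grad f) x * g x \<partial>M)"
        using signed_integral_mutual[OF g] \<gamma>_integral[OF Cc_bounded[OF g]] by simp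
      also have "\<dots> = 0"
        using 3[OF f] by (intro integral_eq_zero_AE) auto
      finally show "w \<bullet> y = 0" .
    qed
  qed
qed

end

context l2_structure
begin

text \<open>A vector \<open>w\<close> orthogonal to all \<open>act g b\<close> has zero mutual
  measure with \<open>b\<close>, and rank one forces \<open>w = 0\<close>. So the range is dense,
  and it is closed because \<open>star\<close> is an isometry.\<close>

theorem star_surj:
  assumes dim: "has_martingale_dimension E C 1" and min: "minimal_energy_dominant E C \<nu>"
  shows "range star = UNIV"
proof -
  obtain M p where M: "minimal_energy_dominant E C M" and p: "pointwise_index E C M p"
    and d: "(1::enat) = Inf {c. AE x in M. p x \<le> c}"
    using dim unfolding has_martingale_dimension_def by blast
  interpret dominating E C \<iota> M
    by standard (use M in \<open>simp add: minimal_energy_dominant_def\<close>)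
  \<comment> \<open>The infimum of an empty set would be infinite. A nonempty set of extended
    naturals attains its infimum, so 1 itself bounds \<open>p\<close> almost everywhere.\<close>
  have "{c. AE x in M. p x \<le> c} \<noteq> {}"
  proof
    assume "{c. AE x in M. p x \<le> c} = {}"
    then have "(1::enat) = top" using d by simp
    then show False by (simp add: top_enat_def one_enat_def)
  qed
  then have "Inf {c. AE x in M. p x \<le> c} \<in> {c. AE x in M. p x \<le> c}" by (metis ex_in_conv wellorder_InfI)
  then have p1: "AE x in M. p x \<le> 1" using d by simp
  have ib: "index_bound E C M p" using p by (simp add: pointwise_index_def)
  have rank: "AE x in M. \<gamma> (grad f1) (grad f2) x * \<gamma> (grad f3) (grad f4) x = \<gamma> (grad f3) (grad f2) x * \<gamma> (grad f1) (grad f4) x"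
    if f: "f1 \<in> C" "f2 \<in> C" "f3 \<in> C" "f4 \<in> C" for f1 f2 f3 f4
  proof -
    \<comment> \<open>The four functions form one family of length 4; the required minor has rows 0,
      2 and columns 1, 3.\<close>
    define F where "F i = (if i = 0 then f1 else if i = 1 then f2 else if i = 2 then f3 else f4)" for i :: nat
    have FC: "F i \<in> C" for i using f by (simp add: F_def)
    have "AE x in M. enat (matrix_rank 4 (\<lambda>i j. signed_density (energy_measure E C (F i) (F j)) M x)) \<le> p x"
      using ib FC unfolding index_bound_def by blast
    with p1 show ?thesis
    proof eventually_elim
      case (elim x)
      have "enat (matrix_rank 4 (\<lambda>i j. signed_density (energy_measure E C (F i) (F j)) M x)) \<le> 1"
        using elim by (rule order_trans[rotated])
      then have r: "matrix_rank 4 (\<lambda>i j. \<gamma> (grad (F i)) (grad (F j)) x) \<le> 1"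
        by (simp add: one_enat_def energy_measure_eq_mutual[OF FC FC] \<gamma>_def)
      show ?case using matrix_rank_le_1_minor[OF r, of 0 2 1 3] by (simp add: F_def)
    qed
  qed
  \<comment> \<open>The zero set of the density is null for the energy measure of \<open>b\<close>.
    Since \<open>M\<close> is minimal and that measure is energy-dominant, the set is null for
    \<open>M\<close> as well.\<close>
  have b0: "AE x in M. \<gamma> b b x \<noteq> 0"
  proof -
    let ?Z = "{x. \<gamma> b b x = 0}"
    have Z: "?Z \<in> sets borel"
      using \<gamma>_measurable[of b b] by (simp add: measurable_cong_sets[OF sets_M refl])
    interpret s: signed "mutual b b" by standard (rule signed_mutual)
    have "mutual b b ?Z = (\<integral>x. \<gamma> b b x * indicator ?Z x \<partial>M)"
      using s.signed_integral_indicator[OF Z] \<gamma>_integral[OF bounded_borel_indicator[OF Z], of b b] by simp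
    also have "\<dots> = 0"
      by (rule integral_eq_zero_AE) (auto simp: indicator_def)
    finally have "measure \<nu> ?Z = 0" using measure_mutual[OF Z] by (simp add: field_measure_eq)
    then have "?Z \<in> null_sets \<nu>"
      using Z finite_measure.emeasure_eq_measure[OF finite_measure_nu] by (auto simp: null_sets_def)
    moreover have "absolutely_continuous \<nu> M"
      using min M by (auto simp: minimal_energy_dominant_def)
    ultimately have "?Z \<in> null_sets M" by (auto simp: absolutely_continuous_def)
    then show ?thesis using AE_not_in by fastforce
  qed
  have "closure (range star) = UNIV"
  proof (rule dense_subspaceI)
    show "subspace (range star)"
      using linear_subspace_image[OF star.linear_axioms subspace_UNIV] .
  next
    fix w assume w: "\<And>y. y \<in> range star \<Longrightarrow> w \<bullet> y = 0"
    have "mutual b w = mutual 0 w"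
    proof (rule mutual_eqI[OF signed_mutual])
      fix g :: "'a \<Rightarrow> real" assume g: "g \<in> Cc"
      interpret a: bounded_linear "act g" by (rule act_bounded_linear[OF g])
      have "act g b \<bullet> w = 0" using w[OF rangeI[of star "cls g"]] by (simp add: star_cls[OF g] inner_commute)
      then show "signed_integral (mutual b w) g = act g 0 \<bullet> w"
        by (simp add: signed_integral_mutual g a.zero)
    qed
    then have bw: "mutual b w A = 0" for A using mutual_scaleR[of 0 0 w A] by simp
    show "w = 0" by (rule rank_one_orthogonal[OF _ b0 bw]) (rule rank)
  qed
  then show ?thesis using closed_range_star by (simp add: closure_closed)
qed

end

section \<open>Complete forms\<close>

locale complete_structure = admissible_structure E C \<iota>
  for E :: "('a::metric_space \<Rightarrow> real) \<Rightarrow> ('a \<Rightarrow> real) \<Rightarrow> real"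
    and C :: "('a \<Rightarrow> real) set"
    and \<iota> :: "('a \<times> 'a \<Rightarrow> real) \<Rightarrow> 'h::{real_inner, complete_space}" +
  fixes p :: 'a
  assumes complete: "complete_form p"
begin

lemmas complete' = complete[unfolded complete_form_def]

lemma grad_eq_0: "f \<in> C \<Longrightarrow> grad f = 0 \<Longrightarrow> f x = f y"
proof -
  assume "f \<in> C" "grad f = 0"
  then have "f \<in> range (\<lambda>c x. c)" using complete'[THEN conjunct2, THEN conjunct1] by blast
  then show "f x = f y" by auto
qed

lemma vanishing_subset: "vanishing B \<subseteq> C"
  by (auto simp: vanishing_def)

lemma vanishing_empty: "vanishing {} = C"
  by (simp add: vanishing_def)

lemma subspace_vanishing: "subspace (vanishing B)"
  by (rule subspaceI) (auto simp: vanishing_def intro: C_add C_scaleR subspace_0[OF C_subspace])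

lemma subspace_grad_vanishing: "subspace (grad ` vanishing B)"
  by (rule linear_subspace_image[OF _ subspace_vanishing]) (rule linearI, rule grad_add, rule grad_scaleR)

lemma pin: "f \<in> C \<Longrightarrow> f - f q *\<^sub>R 1 \<in> vanishing {q}"
  using C_diff[OF _ C_scaleR[OF one_C]] by (simp add: vanishing_def)

lemma grad_zero: "grad 0 = 0"
  using grad_diff[of 1 1] by (simp only: diff_self)

lemma grad_shift: "grad (f - c *\<^sub>R 1) = grad f"
  by (simp only: grad_diff grad_scaleR grad_one scaleR_zero_right diff_zero)

text \<open>The supremum bound of a complete form concerns functions vanishing at \<open>p\<close>;
  subtracting the constant \<open>f p\<close> leaves the gradient unchanged.\<close>

lemma oscillation_bound: "\<exists>c>0. \<forall>f\<in>C. \<forall>x. \<bar>f x - f p\<bar> \<le> c * norm (grad f)"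
proof -
  obtain c where c: "0 < c" "\<And>f. f \<in> vanishing {p} \<Longrightarrow> sup_norm f \<le> c * sqrt (E f f)"
    using complete'[THEN conjunct2, THEN conjunct2, THEN conjunct2, THEN conjunct2] by blast
  have "\<bar>f x - f p\<bar> \<le> c * norm (grad f)" if f: "f \<in> C" for f x
  proof -
    let ?g = "f - f p *\<^sub>R 1"
    have g: "?g \<in> vanishing {p}" by (rule pin[OF f])
    then have gC: "?g \<in> C" using vanishing_subset by blast
    have "\<bar>?g x\<bar> \<le> sup_norm ?g" using gC C_Cc by (intro abs_le_sup) blast
    also have "\<dots> \<le> c * sqrt (E ?g ?g)" by (rule c(2)[OF g])
    also have "sqrt (E ?g ?g) = norm (grad ?g)" by (simp only: grad_inner[OF gC gC, symmetric] norm_eq_sqrt_inner)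
    finally show ?thesis unfolding grad_shift by simp
  qed
  with c(1) show ?thesis by blast
qed

text \<open>Gradients do not see constants, so the sequence is pinned at \<open>p\<close>, where
  completeness supplies a limit in energy. The oscillation bound makes the convergence pointwise,
  which identifies the limit function. Closedness of ranges and absence of atoms both rest on
  this.\<close>

lemma grad_limit:
  assumes F: "\<And>n. F n \<in> C" and Cauchy: "Cauchy (\<lambda>n. grad (F n))"
  shows "\<exists>u\<in>C. (\<lambda>n. grad (F n)) \<longlonglongrightarrow> grad u \<and> (\<forall>x. (\<lambda>n. F n x - F n p) \<longlonglongrightarrow> u x)"
proof -
  define G where "G n = F n - F n p *\<^sub>R 1" for n
  have G: "G n \<in> vanishing {p}" for n unfolding G_def by (rule pin[OF F])
  then have GC: "G n \<in> C" for n using vanishing_subset by blast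
  have gG: "grad (G n) = grad (F n)" for n unfolding G_def by (rule grad_shift)
  have E_norm: "sqrt (E f f) = norm (grad f)" if "f \<in> C" for f
    using that by (simp add: grad_inner[symmetric] norm_eq_sqrt_inner)
  have EG: "sqrt (E (G m - G n) (G m - G n)) = dist (grad (F m)) (grad (F n))" for m n
    using E_norm[OF C_diff[OF GC GC]] by (simp add: grad_diff gG dist_norm)
  have "\<forall>\<epsilon>>0. \<exists>M. \<forall>m\<ge>M. \<forall>n\<ge>M. sqrt (E (G m - G n) (G m - G n)) < \<epsilon>"
    unfolding EG using Cauchy unfolding Cauchy_def .
  moreover have cf: "\<And>F. (\<forall>n. F n \<in> vanishing {p}) \<Longrightarrow>
        (\<forall>\<epsilon>>0. \<exists>M. \<forall>m\<ge>M. \<forall>n\<ge>M. sqrt (E (F m - F n) (F m - F n)) < \<epsilon>) \<Longrightarrow>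
        (\<exists>f\<in>vanishing {p}. (\<lambda>n. sqrt (E (F n - f) (F n - f))) \<longlonglongrightarrow> 0)"
    using complete'[THEN conjunct2, THEN conjunct2, THEN conjunct2, THEN conjunct1] by simp
  ultimately obtain u where u: "u \<in> vanishing {p}" "(\<lambda>n. sqrt (E (G n - u) (G n - u))) \<longlonglongrightarrow> 0"
    using cf[of G] G by blast
  have uC: "u \<in> C" and up: "u p = 0" using u(1) by (auto simp: vanishing_def)
  have "sqrt (E (G n - u) (G n - u)) = norm (grad (F n) - grad u)" for n
    using E_norm[OF C_diff[OF GC uC]] by (simp add: grad_diff gG)
  then have nlim: "(\<lambda>n. norm (grad (F n) - grad u)) \<longlonglongrightarrow> 0" using u(2) by simp
  then have lim: "(\<lambda>n. grad (F n)) \<longlonglongrightarrow> grad u"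
    by (simp add: LIM_zero_iff tendsto_norm_zero_iff)
  obtain c where c: "0 < c" "\<And>f x. f \<in> C \<Longrightarrow> \<bar>f x - f p\<bar> \<le> c * norm (grad f)"
    using oscillation_bound by blast
  have "(\<lambda>n. F n x - F n p) \<longlonglongrightarrow> u x" for x
  proof -
    have "\<bar>F n x - F n p - u x\<bar> \<le> c * norm (grad (F n) - grad u)" for n
      using c(2)[OF C_diff[OF F uC], of n x] up by (simp add: grad_diff algebra_simps)
    moreover have "(\<lambda>n. c * norm (grad (F n) - grad u)) \<longlonglongrightarrow> 0"
      using tendsto_mult_right_zero[OF nlim] .
    ultimately have "(\<lambda>n. F n x - F n p - u x) \<longlonglongrightarrow> 0"
      by (intro Lim_null_comparison[of "\<lambda>n. F n x - F n p - u x" "\<lambda>n. c * norm (grad (F n) - grad u)"]) auto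
    then show ?thesis by (simp add: LIM_zero_iff)
  qed
  with uC lim show ?thesis by blast
qed

text \<open>The limit function is pinned at \<open>p\<close>, so on \<open>B\<close> it is only
  known to be constant. Subtracting that constant returns it to \<open>vanishing B\<close> with the
  same gradient.\<close>

lemma closed_grad_vanishing: "closed (grad ` vanishing B)"
  unfolding closed_sequential_limits
proof (intro allI impI)
  fix y l assume "(\<forall>n. y n \<in> grad ` vanishing B) \<and> y \<longlonglongrightarrow> l"
  then have y: "\<And>n. y n \<in> grad ` vanishing B" "y \<longlonglongrightarrow> l" by auto
  have "\<exists>f. f \<in> vanishing B \<and> y n = grad f" for n using y(1)[of n] by blast
  then obtain F where F: "\<And>n. F n \<in> vanishing B" "\<And>n. y n = grad (F n)" by metis
  have FC: "F n \<in> C" for n using F(1) vanishing_subset by blast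
  have yF: "y = (\<lambda>n. grad (F n))" using F(2) by blast
  have "Cauchy (\<lambda>n. grad (F n))" using y(2) unfolding yF by (metis convergent_Cauchy convergent_def)
  then obtain u where u: "u \<in> C" "(\<lambda>n. grad (F n)) \<longlonglongrightarrow> grad u" "\<And>x. (\<lambda>n. F n x - F n p) \<longlonglongrightarrow> u x"
    using grad_limit[of F, OF FC] by blast
  have l: "l = grad u" using y(2) u(2) unfolding yF by (rule LIMSEQ_unique)
  show "l \<in> grad ` vanishing B"
  proof (cases "B = {}")
    case True
    then show ?thesis using l u(1) by (simp add: vanishing_empty)
  next
    case False
    then obtain q where q: "q \<in> B" by blast
    have "u x = u q" if "x \<in> B" for x
    proof -
      have "F n x = F n q" for n using F(1)[of n] q that by (simp add: vanishing_def)
      then show ?thesis using u(3)[of x] u(3)[of q] LIMSEQ_unique by simp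
    qed
    then have "u - u q *\<^sub>R 1 \<in> vanishing B"
      using C_diff[OF u(1) C_scaleR[OF one_C]] by (simp add: vanishing_def)
    moreover have "l = grad (u - u q *\<^sub>R 1)" unfolding l grad_shift ..
    ultimately show ?thesis by blast
  qed
qed

lemma grad_projection: "\<exists>u\<in>vanishing B. \<forall>\<phi>\<in>vanishing B. (x - grad u) \<bullet> grad \<phi> = 0"
  using projection_exists[OF subspace_grad_vanishing[of B] closed_grad_vanishing, of x] by blast

section \<open>Absence of atoms\<close>

lemma bernoulli_bound:
  fixes t :: real
  assumes "0 \<le> t" "t \<le> 1"
  shows "real (Suc n) * t * (1 - t) ^ n \<le> 1"
proof -
  \<comment> \<open>Comparison with a geometric sum, whose product with \<open>t\<close> telescopes.
    The estimate controls the derivative term of the polynomials in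
    \<open>zero_set_null\<close>.\<close>
  have "real (Suc n) * (1 - t) ^ n = (\<Sum>i<Suc n. (1 - t) ^ n)" by simp
  also have "\<dots> \<le> (\<Sum>i<Suc n. (1 - t) ^ i)"
    using assms by (intro sum_mono power_decreasing) auto
  finally have "t * (real (Suc n) * (1 - t) ^ n) \<le> t * (\<Sum>i<Suc n. (1 - t) ^ i)"
    using assms by (intro mult_left_mono)
  also have "\<dots> = 1 - (1 - t) ^ Suc n" using one_diff_power_eq[of "1 - t" "Suc n"] by simp
  also have "\<dots> \<le> 1" using assms by simp
  finally show ?thesis by (simp add: algebra_simps)
qed

text \<open>The polynomials \<open>s (1 - s\<^sup>2)\<^bsup>n+1\<^esup>\<close> tend to \<open>0\<close> while their derivatives stay bounded and tend to
  the indicator of \<open>{s = 0}\<close>, so that closedness of the gradient forces that set to be null.\<close>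

lemma zero_set_null:
  assumes s: "s \<in> C" and s1: "\<And>x. \<bar>s x\<bar> < 1"
  shows "mutual (grad s) (grad s) {x. s x = 0} = 0"
proof -
  define K where "K n x = (1 - s x * s x) ^ n" for n x
  define M where "M = to_measure (mutual (grad s) (grad s))"
  have sC: "s \<in> Cc" using s C_Cc by blast
  have t01: "0 \<le> s x * s x" "s x * s x < 1" for x
    using s1[of x] abs_square_less_1[of "s x"] by (auto simp: power2_eq_square)
  have K_Suc: "K (Suc n) = K n - s * s * K n" for n
    by (simp add: K_def fun_eq_iff algebra_simps)
  have KC: "K n \<in> C" for n
  proof (induction n)
    case 0
    then show ?case using one_C by (simp add: K_def[abs_def] one_fun_def)
  next
    case (Suc n)
    then show ?case unfolding K_Suc by (intro C_diff C_mult s)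
  qed
  then have KCc: "K n \<in> Cc" for n using C_Cc by blast
  have add: "act f v + act g v = act (f + g) v" if "f \<in> Cc" "g \<in> Cc" for f g v
    using act_plus[OF that] by simp
  have gradK: "grad (K (Suc n)) = act ((- 2 * real (Suc n)) *\<^sub>R (s * K n)) (grad s)" for n
  proof (induction n)
    case 0
    have K0: "K 0 = 1" by (simp add: K_def fun_eq_iff)
    have "grad (K (Suc 0)) = grad 1 - grad (s * s)" unfolding K_Suc K0 by (simp only: grad_diff mult_1_right)
    also have "\<dots> = - (2::real) *\<^sub>R act s (grad s)"
      by (simp only: grad_one product_rule[OF s s]) (simp add: scaleR_2)
    finally have "grad (K (Suc 0)) = act ((- 2) *\<^sub>R s) (grad s)" by (simp only: act_scaleR[OF sC])
    moreover have "(- 2 * real (Suc 0)) *\<^sub>R (s * 1) = (- 2) *\<^sub>R s" by (simp add: fun_eq_iff)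
    ultimately show ?case unfolding K0 by (simp only:)
  next
    case (Suc n)
    define k where "k = 1 - s * s"
    have k: "k \<in> C" unfolding k_def by (intro C_diff one_C C_mult s)
    then have kc: "k \<in> Cc" using C_Cc by blast
    have KS: "K (Suc m) = k * K m" for m by (simp add: k_def K_def fun_eq_iff)
    have gk: "grad k = act ((- 2) *\<^sub>R s) (grad s)"
    proof -
      have "grad k = grad 1 - grad (s * s)" unfolding k_def by (rule grad_diff)
      also have "\<dots> = - (2::real) *\<^sub>R act s (grad s)"
        by (simp only: grad_one product_rule[OF s s]) (simp add: scaleR_2)
      finally show ?thesis by (simp only: act_scaleR[OF sC])
    qed
    have c: "(- 2 * real (Suc n)) *\<^sub>R (s * K n) \<in> Cc" "(- 2) *\<^sub>R s \<in> Cc"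
      by (intro Cc_scaleR Cc_mult sC KCc)+
    have "grad (K (Suc (Suc n))) = act k (grad (K (Suc n))) + act (K (Suc n)) (grad k)"
      unfolding KS[of "Suc n"] by (rule product_rule[OF k KC])
    also have "\<dots> = act (k * ((- 2 * real (Suc n)) *\<^sub>R (s * K n)) + K (Suc n) * ((- 2) *\<^sub>R s)) (grad s)"
      unfolding Suc.IH gk
      by (simp only: act_mult[OF kc c(1), symmetric] act_mult[OF KCc c(2), symmetric]
          add[OF Cc_mult[OF kc c(1)] Cc_mult[OF KCc c(2)]])
    also have "k * ((- 2 * real (Suc n)) *\<^sub>R (s * K n)) + K (Suc n) * ((- 2) *\<^sub>R s) =
        (- 2 * real (Suc (Suc n))) *\<^sub>R (s * K (Suc n))"
      unfolding KS[of n] by (rule ext) (simp add: algebra_simps)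
    finally show ?case .
  qed
  \<comment> \<open>\<open>u n\<close> is the polynomial in \<open>s\<close>, and \<open>q n\<close>
    is its derivative evaluated at \<open>s\<close>, so that the gradient of \<open>u n\<close> is
    \<open>q n\<close> acting on \<open>grad s\<close>.\<close>
  define u where "u n = s * K (Suc n)" for n
  define q where "q n = K (Suc n) + (- 2 * real (Suc n)) *\<^sub>R (s * (s * K n))" for n
  have uC: "u n \<in> C" for n unfolding u_def by (intro C_mult s KC)
  have qC: "q n \<in> Cc" for n unfolding q_def by (intro Cc_add Cc_scaleR Cc_mult sC KCc)
  have gradu: "grad (u n) = act (q n) (grad s)" for n
  proof -
    have e: "s * ((- 2 * real (Suc n)) *\<^sub>R (s * K n)) = (- 2 * real (Suc n)) *\<^sub>R (s * (s * K n))"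
      by (simp add: fun_eq_iff)
    have "grad (u n) = act s (grad (K (Suc n))) + act (K (Suc n)) (grad s)"
      unfolding u_def by (rule product_rule[OF s KC])
    also have "act s (grad (K (Suc n))) = act (s * ((- 2 * real (Suc n)) *\<^sub>R (s * K n))) (grad s)"
      unfolding gradK using act_mult[OF sC Cc_scaleR[OF Cc_mult[OF sC KCc]]] by simp
    also have "\<dots> + act (K (Suc n)) (grad s) = act (q n) (grad s)"
    proof -
      have c: "(- 2 * real (Suc n)) *\<^sub>R (s * (s * K n)) \<in> Cc" by (intro Cc_scaleR Cc_mult sC KCc)
      show ?thesis unfolding q_def e act_plus[OF KCc c] by (rule add.commute)
    qed
    finally show ?thesis .
  qed
  have qval: "q n x = (1 - s x * s x) ^ Suc n - 2 * (real (Suc n) * (s x * s x) * (1 - s x * s x) ^ n)" for n x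
    by (simp add: q_def K_def algebra_simps)
  have qbd: "\<bar>q n x\<bar> \<le> 3" for n x
  proof -
    have "0 \<le> (1 - s x * s x) ^ Suc n" "(1 - s x * s x) ^ Suc n \<le> 1"
      using t01[of x] by (auto intro!: power_le_one simp del: power_Suc)
    moreover have "0 \<le> real (Suc n) * (s x * s x) * (1 - s x * s x) ^ n"
      using t01[of x] by (intro mult_nonneg_nonneg[OF mult_nonneg_nonneg[OF of_nat_0_le_iff]] zero_le_power) auto
    moreover have "real (Suc n) * (s x * s x) * (1 - s x * s x) ^ n \<le> 1"
      using t01[of x] by (intro bernoulli_bound) auto
    ultimately show ?thesis unfolding qval by linarith
  qed
  let ?Z = "{x. s x = 0}"
  have Z: "?Z \<in> sets borel"
    using bounded_borel_measurable[OF Cc_bounded[OF sC]] by simp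
  have qlim: "(\<lambda>n. q n x) \<longlonglongrightarrow> indicator ?Z x" for x
  proof (cases "s x = 0")
    case True
    then show ?thesis by (simp add: qval)
  next
    case False
    define r where "r = 1 - s x * s x"
    have r: "norm r < 1"
      using t01[of x] False zero_less_mult_iff[of "s x" "s x"] by (auto simp: r_def abs_less_iff)
    have "(\<lambda>n. r ^ Suc n - 2 * (s x * s x) * (real n * r ^ n + r ^ n)) \<longlonglongrightarrow> 0 - 2 * (s x * s x) * (0 + 0)"
      using r by (intro tendsto_intros LIMSEQ_Suc[OF LIMSEQ_power_zero] LIMSEQ_power_zero powser_times_n_limit_0)
    moreover have "q n x = r ^ Suc n - 2 * (s x * s x) * (real n * r ^ n + r ^ n)" for n
      unfolding qval r_def[symmetric] by (simp add: algebra_simps)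
    ultimately show ?thesis using False by simp
  qed
  have fM: "finite_measure M" and sM: "sets M = sets borel"
    unfolding M_def by (rule finite_measure_mutual, rule sets_to_measure_mutual)
  have int: "act g (grad s) \<bullet> grad s = (\<integral>x. g x \<partial>M)" if "g \<in> Cc" for g
    unfolding M_def using signed_integral_mutual[OF that] signed_integral_mutual_self[OF Cc_bounded[OF that]] by metis
  have Zb: "indicator ?Z \<in> bounded_borel" using Z by (rule bounded_borel_indicator)
  define D where "D n = q n - indicator ?Z" for n
  have Db: "D n \<in> bounded_borel" for n
    using bounded_borel_add[OF Cc_bounded[OF qC] bounded_borel_scaleR[OF Zb, of "-1"], of n] by (simp add: D_def)
  define J where "J n = (\<integral>x. (D n * D n) x \<partial>M)" for n
  have J: "J \<longlonglongrightarrow> 0"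
  proof -
    interpret m: signed "measure M" by standard (rule signed_measure[OF fM sM])
    have "(\<lambda>n. signed_integral (measure M) (D n * D n)) \<longlonglongrightarrow> signed_integral (measure M) 0"
    \<comment> \<open>The derivative is bounded by 3, namely 1 from the power and 2 from
      \<open>bernoulli_bound\<close>. The indicator adds 1, so the square is at most 16.\<close>
    proof (rule m.signed_integral_tendsto[where c = 16])
      show "D n * D n \<in> bounded_borel" for n by (rule bounded_borel_mult[OF Db Db])
      show "\<bar>(D n * D n) x\<bar> \<le> 16" for n x
      proof -
        have "\<bar>D n x\<bar> \<le> 4" using qbd[of n x] by (auto simp: D_def indicator_def)
        then have "\<bar>D n x\<bar> * \<bar>D n x\<bar> \<le> 4 * 4" by (intro mult_mono) auto
        then show ?thesis by (simp add: abs_mult)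
      qed
      show "(\<lambda>n. (D n * D n) x) \<longlonglongrightarrow> 0 x" for x
      proof -
        have "(\<lambda>n. D n x) \<longlonglongrightarrow> indicator ?Z x - indicator ?Z x"
          unfolding D_def fun_diff_def by (intro tendsto_diff qlim tendsto_const)
        then have "(\<lambda>n. D n x * D n x) \<longlonglongrightarrow> 0 * 0" by (intro tendsto_mult) simp_all
        then show ?thesis by simp
      qed
    qed (rule bounded_borel_zero)
    moreover have "signed_integral (measure M) (D n * D n) = J n" for n
      unfolding J_def by (rule signed_measure(2)[OF fM sM bounded_borel_mult[OF Db Db]])
    moreover have "signed_integral (measure M) 0 = 0"
      using signed_measure(2)[OF fM sM bounded_borel_zero] by simp
    ultimately show ?thesis by simp
  qed
  have dist: "(dist (grad (u m)) (grad (u n)))\<^sup>2 \<le> 2 * J m + 2 * J n" for m n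
  proof -
    let ?r = "q m - q n"
    have rC: "?r \<in> Cc" using subspace_diff[OF Cc_subspace qC qC] .
    have "grad (u m) - grad (u n) = act ?r (grad s)"
      using act_plus[OF rC qC, of n "grad s"] by (simp add: gradu)
    then have "(dist (grad (u m)) (grad (u n)))\<^sup>2 = act ?r (grad s) \<bullet> act ?r (grad s)"
      by (simp add: dist_norm power2_norm_eq_inner)
    also have "\<dots> = act (?r * ?r) (grad s) \<bullet> grad s"
      unfolding act_mult[OF rC rC] by (rule act_symmetric[OF rC, symmetric])
    also have "\<dots> = (\<integral>x. (?r * ?r) x \<partial>M)" by (rule int[OF Cc_mult[OF rC rC]])
    also have "\<dots> \<le> (\<integral>x. 2 * (D m * D m) x + 2 * (D n * D n) x \<partial>M)"
    proof (rule integral_mono)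
      note i = integrable_bounded_borel[OF fM sM]
      show "integrable M (?r * ?r)" by (rule i[OF Cc_bounded[OF Cc_mult[OF rC rC]]])
      show "integrable M (\<lambda>x. 2 * (D m * D m) x + 2 * (D n * D n) x)"
        by (intro Bochner_Integration.integrable_add integrable_mult_right i bounded_borel_mult Db)
      show "(?r * ?r) x \<le> 2 * (D m * D m) x + 2 * (D n * D n) x" for x
      proof -
        have "?r x = D m x - D n x" by (simp add: D_def)
        then have "(?r * ?r) x = (D m x - D n x) * (D m x - D n x)" by (simp only: times_fun_apply)
        moreover have "0 \<le> (D m x + D n x) * (D m x + D n x)" by simp
        ultimately show ?thesis unfolding times_fun_apply by (simp add: algebra_simps)
      qed
    qed
    also have "\<dots> = 2 * J m + 2 * J n"
      unfolding J_def using integrable_bounded_borel[OF fM sM bounded_borel_mult[OF Db Db]]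
      by (subst Bochner_Integration.integral_add) (auto simp del: times_fun_apply)
    finally show ?thesis .
  qed
  have "Cauchy (\<lambda>n. grad (u n))"
  proof (rule metric_CauchyI)
    fix e :: real assume e: "0 < e"
    then have "\<forall>\<^sub>F n in sequentially. J n < e\<^sup>2 / 4" using order_tendstoD(2)[OF J, of "e\<^sup>2 / 4"] by simp
    then obtain N where N: "\<And>n. n \<ge> N \<Longrightarrow> J n < e\<^sup>2 / 4" by (auto simp: eventually_sequentially)
    have "dist (grad (u m)) (grad (u n)) < e" if "m \<ge> N" "n \<ge> N" for m n
    proof -
      have "(dist (grad (u m)) (grad (u n)))\<^sup>2 < e\<^sup>2" using dist[of m n] N[OF that(1)] N[OF that(2)] by linarith
      then show ?thesis using e by (simp add: power_less_imp_less_base)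
    qed
    then show "\<exists>M. \<forall>m\<ge>M. \<forall>n\<ge>M. dist (grad (u m)) (grad (u n)) < e" by blast
  qed
  then obtain w where w: "w \<in> C" "(\<lambda>n. grad (u n)) \<longlonglongrightarrow> grad w" "\<And>x. (\<lambda>n. u n x - u n p) \<longlonglongrightarrow> w x"
    using grad_limit[of u, OF uC] by blast
  have ulim: "(\<lambda>n. u n x) \<longlonglongrightarrow> 0" for x
  proof (cases "s x = 0")
    case True
    then show ?thesis by (simp add: u_def)
  next
    case False
    have "norm (1 - s x * s x) < 1"
      using t01[of x] False zero_less_mult_iff[of "s x" "s x"] by (auto simp: abs_less_iff)
    then have "(\<lambda>n. s x * (1 - s x * s x) ^ Suc n) \<longlonglongrightarrow> s x * 0"
      by (intro tendsto_intros LIMSEQ_Suc[OF LIMSEQ_power_zero])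
    then show ?thesis by (simp add: u_def K_def)
  qed
  \<comment> \<open>Gradients converge to the gradient of the pointwise limit, which is zero.
    Pairing with \<open>grad s\<close> then evaluates the limit a second time, as the energy of
    \<open>s\<close> on its zero set.\<close>
  have "w x = 0" for x
    using tendsto_diff[OF ulim[of x] ulim[of p]] w(3)[of x] LIMSEQ_unique by fastforce
  then have "w = 0" by (simp add: fun_eq_iff)
  then have "grad w = 0" by (simp only: grad_zero)
  then have "(\<lambda>n. grad (u n) \<bullet> grad s) \<longlonglongrightarrow> 0 \<bullet> grad s"
    using w(2) by (intro tendsto_inner tendsto_const) simp
  then have "(\<lambda>n. signed_integral (mutual (grad s) (grad s)) (q n)) \<longlonglongrightarrow> 0"
    by (simp add: gradu signed_integral_mutual[OF qC])
  moreover have "(\<lambda>n. signed_integral (mutual (grad s) (grad s)) (q n)) \<longlonglongrightarrow>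
      signed_integral (mutual (grad s) (grad s)) (indicator ?Z)"
    by (rule signed.signed_integral_tendsto[OF _ Cc_bounded[OF qC] Zb qbd qlim])
      (simp add: signed_def signed_mutual)
  ultimately have "signed_integral (mutual (grad s) (grad s)) (indicator ?Z) = 0"
    using LIMSEQ_unique by blast
  then show ?thesis
    using signed.signed_integral_indicator[OF _ Z, of "mutual (grad s) (grad s)"] by (simp add: signed_def signed_mutual)
qed

text \<open>Shifting \<open>f\<close> by its value at \<open>x0\<close> and dividing by a
  sufficiently large \<open>R\<close> gives a function of absolute value below 1 that vanishes at
  \<open>x0\<close>, so the point lies in a zero set of energy zero.\<close>

lemma no_atoms: "mutual v w {x0} = 0"
proof (rule mutual_null_gradients)
  fix f assume f: "f \<in> C"
  have fc: "f \<in> Cc" using f C_Cc by blast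
  define R where "R = sup_norm f + \<bar>f x0\<bar> + 1"
  define s where "s = (1 / R) *\<^sub>R (f - f x0 *\<^sub>R 1)"
  have R: "0 < R" using abs_le_sup[OF fc, of x0] unfolding R_def by linarith
  have sC: "s \<in> C" unfolding s_def by (intro C_scaleR C_diff f one_C)
  have "\<bar>s x\<bar> < 1" for x
  proof -
    have "\<bar>f x - f x0\<bar> < R" using abs_le_sup[OF fc, of x] unfolding R_def by linarith
    then show ?thesis using R by (simp add: s_def abs_mult field_simps)
  qed
  then have z: "mutual (grad s) (grad s) {x. s x = 0} = 0" by (rule zero_set_null[OF sC])
  have Z: "{x. s x = 0} \<in> sets borel"
    using bounded_borel_measurable[OF C_bounded[OF sC]] by simp
  have "mutual (grad s) (grad s) {x0} \<le> mutual (grad s) (grad s) {x. s x = 0}"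
    unfolding mutual_self
    by (rule finite_measure.finite_measure_mono[OF quadratic_rep(1)]) (use Z quadratic_rep(2) in \<open>auto simp: s_def\<close>)
  then have "mutual (grad s) (grad s) {x0} = 0" using z mutual_nonneg[of "grad s" "{x0}"] by linarith
  moreover have "grad s = (1 / R) *\<^sub>R grad f" unfolding s_def grad_scaleR grad_shift ..
  ultimately have "(1 / R) * ((1 / R) * mutual (grad f) (grad f) {x0}) = 0"
    by (simp only: mutual_scaleR mutual_sym[of "grad f" "(1 / R) *\<^sub>R grad f"])
  then show "mutual (grad f) (grad f) {x0} = 0" using R by simp
qed simp

section \<open>Interpolation and approximation on finite sets\<close>

lemma separating:
  assumes B: "finite B" and q: "q \<in> B"
  obtains e where "e \<in> C" "e q = 1" "\<And>x. x \<in> B - {q} \<Longrightarrow> e x = 0" "\<And>x. \<bar>e x\<bar> \<le> 1"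
proof (cases "B - {q} = {}")
  case True
  then show ?thesis using one_C by (intro that[of 1]) auto
next
  case False
  define d where "d = infdist q (B - {q})"
  have "closed (B - {q})" using B by (intro finite_imp_closed) simp
  then have "d \<noteq> 0" unfolding d_def using in_closed_iff_infdist_zero[OF _ False, of q] by auto
  then have d: "0 < d" using infdist_nonneg[of q "B - {q}"] by (simp add: d_def)
  \<comment> \<open>The values are 2 at \<open>q\<close> and -1 on the other points of
    \<open>B\<close>. An approximant within 1/2 therefore exceeds 1, respectively is negative, and
    clipping to the unit interval makes the values exact.\<close>
  define g where "g x = 2 - 3 * min 1 (dist x q / d)" for x
  have "continuous_on UNIV g" unfolding g_def[abs_def] using d by (intro continuous_intros) auto
  then have gc: "g \<in> Cc" by (simp add: Cc_iff)
  obtain u where u: "u \<in> C" "sup_norm (g - u) < 1/2" using C_dense[OF gc, of "1/2"] by auto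
  have uc: "u \<in> Cc" using u(1) C_Cc by blast
  have gu: "\<bar>g x - u x\<bar> < 1/2" for x
    using abs_le_sup[OF subspace_diff[OF Cc_subspace gc uc], of x] u(2) by simp
  show ?thesis
  proof (rule that[OF C_clip[OF u(1)]])
    have "g q = 2" by (simp add: g_def)
    then have "1 < u q" using gu[of q] by linarith
    then show "max (min (u q) 1) 0 = 1" by simp
    show "max (min (u x) 1) 0 = 0" if "x \<in> B - {q}" for x
    proof -
      have "d \<le> dist q x" unfolding d_def using that by (intro infdist_le)
      then have "1 \<le> dist x q / d" using d by (simp add: dist_commute)
      then have "g x = -1" by (simp add: g_def)
      then have "u x < 0" using gu[of x] by linarith
      then show ?thesis by simp
    qed
    show "\<bar>max (min (u x) 1) 0\<bar> \<le> 1" for x by auto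
  qed
qed

lemma interpolation:
  assumes B: "finite B"
  obtains f where "f \<in> C" "\<And>q. q \<in> B \<Longrightarrow> f q = a q" "\<And>x. \<bar>f x\<bar> \<le> (\<Sum>q\<in>B. \<bar>a q\<bar>)"
proof -
  have "\<forall>q\<in>B. \<exists>e. e \<in> C \<and> e q = 1 \<and> (\<forall>x\<in>B - {q}. e x = 0) \<and> (\<forall>x. \<bar>e x\<bar> \<le> 1)"
    using separating[OF B] by metis
  then obtain e where e: "\<And>q. q \<in> B \<Longrightarrow> e q \<in> C" "\<And>q. q \<in> B \<Longrightarrow> e q q = 1"
      "\<And>q x. q \<in> B \<Longrightarrow> x \<in> B \<Longrightarrow> x \<noteq> q \<Longrightarrow> e q x = 0" "\<And>q x. q \<in> B \<Longrightarrow> \<bar>e q x\<bar> \<le> 1"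
    unfolding Ball_def by (metis DiffI singletonD)
  define f where "f = (\<Sum>q\<in>B. a q *\<^sub>R e q)"
  have fx: "f x = (\<Sum>q\<in>B. a q * e q x)" for x by (simp add: f_def sum_fun_apply)
  show thesis
  proof
    show "f \<in> C" unfolding f_def by (intro subspace_sum[OF C_subspace] C_scaleR e)
    show "f q = a q" if q: "q \<in> B" for q
    proof -
      have "f q = (\<Sum>r\<in>B. if r = q then a q else 0)"
        unfolding fx
      proof (rule sum.cong[OF refl])
        fix r assume "r \<in> B"
        then show "a r * e r q = (if r = q then a q else 0)"
          using e(2)[OF q] e(3)[OF _ q, of r] by auto
      qed
      then show ?thesis using B q by simp
    qed
    show "\<bar>f x\<bar> \<le> (\<Sum>q\<in>B. \<bar>a q\<bar>)" for x
      unfolding fx using e(4)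
      by (intro order_trans[OF sum_abs] sum_mono) (auto simp: abs_mult intro: mult_left_le)
  qed
qed

text \<open>An approximant from \<open>C\<close> has values at most \<eta> on \<open>B\<close>,
  since \<open>g\<close> vanishes there. Removing them with an interpolating function costs at most
  \<open>card B\<close> times \<eta>, which explains the choice of \<eta>.\<close>

lemma approximation_vanishing:
  assumes B: "finite B" and g: "g \<in> Cc" "\<And>q. q \<in> B \<Longrightarrow> g q = 0" and eps: "0 < \<epsilon>"
  obtains \<phi> where "\<phi> \<in> vanishing B" "\<And>x. \<bar>g x - \<phi> x\<bar> \<le> \<epsilon>"
proof -
  define \<eta> where "\<eta> = \<epsilon> / (1 + real (card B))"
  have eta: "0 < \<eta>" using eps by (simp add: \<eta>_def)
  obtain f where f: "f \<in> C" "sup_norm (g - f) < \<eta>" using C_dense[OF g(1) eta] by blast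
  have fc: "f \<in> Cc" using f(1) C_Cc by blast
  have gf: "\<bar>g x - f x\<bar> \<le> \<eta>" for x
    using abs_le_sup[OF subspace_diff[OF Cc_subspace g(1) fc], of x] f(2) by simp
  obtain k where k: "k \<in> C" "\<And>q. q \<in> B \<Longrightarrow> k q = f q" "\<And>x. \<bar>k x\<bar> \<le> (\<Sum>q\<in>B. \<bar>f q\<bar>)"
    using interpolation[OF B, of f] by blast
  have "(\<Sum>q\<in>B. \<bar>f q\<bar>) \<le> (\<Sum>q\<in>B. \<eta>)"
  proof (rule sum_mono)
    show "\<bar>f q\<bar> \<le> \<eta>" if "q \<in> B" for q using gf[of q] g(2)[OF that] by simp
  qed
  then have kb: "\<bar>k x\<bar> \<le> real (card B) * \<eta>" for x using k(3)[of x] by simp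
  show thesis
  proof
    show "f - k \<in> vanishing B" using C_diff[OF f(1) k(1)] k(2) by (simp add: vanishing_def)
    have "\<eta> + real (card B) * \<eta> = (1 + real (card B)) * \<eta>" by (simp add: algebra_simps)
    also have "\<dots> = \<epsilon>" by (simp add: \<eta>_def)
    finally have "\<eta> + real (card B) * \<eta> = \<epsilon>" .
    then show "\<bar>g x - (f - k) x\<bar> \<le> \<epsilon>" for x using gf[of x] kb[of x] by simp
  qed
qed

text \<open>As \<open>L\<close> annihilates constants, pinning the test function at \<open>p\<close>
  bounds \<open>L\<close> by the norm of the gradient. The Riesz-Frechet vector of the resulting
  functional, projected onto the gradients, is the gradient of the solution.\<close>

lemma neumann:
  assumes lin: "\<And>\<phi> \<psi>. \<phi> \<in> C \<Longrightarrow> \<psi> \<in> C \<Longrightarrow> L (\<phi> + \<psi>) = L \<phi> + L \<psi>" "\<And>c \<phi>. \<phi> \<in> C \<Longrightarrow> L (c *\<^sub>R \<phi>) = c * L \<phi>"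
    and bd: "\<And>\<phi>. \<phi> \<in> C \<Longrightarrow> \<bar>L \<phi>\<bar> \<le> K * sup_norm \<phi>" and one: "L 1 = 0"
  obtains u where "u \<in> C" "\<And>\<phi>. \<phi> \<in> C \<Longrightarrow> E u \<phi> = L \<phi>"
proof -
  obtain c where c: "0 < c" "\<And>f x. f \<in> C \<Longrightarrow> \<bar>f x - f p\<bar> \<le> c * norm (grad f)"
    using oscillation_bound by blast
  have Lbd: "\<bar>L \<phi>\<bar> \<le> (\<bar>K\<bar> * c) * norm (grad \<phi>)" if \<phi>: "\<phi> \<in> C" for \<phi>
  proof -
    let ?g = "\<phi> + (- \<phi> p) *\<^sub>R 1"
    have gC: "?g \<in> C" by (intro C_add C_scaleR \<phi> one_C)
    have "L ?g = L \<phi>"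
      by (simp only: lin(1)[OF \<phi> C_scaleR[OF one_C]] lin(2)[OF one_C] one mult_zero_right add_0_right)
    moreover have "sup_norm ?g \<le> c * norm (grad \<phi>)"
      unfolding sup_norm_def by (rule cSUP_least) (use c(2)[OF \<phi>] in auto)
    then have "\<bar>K\<bar> * sup_norm ?g \<le> \<bar>K\<bar> * (c * norm (grad \<phi>))" by (intro mult_left_mono) auto
    moreover have "0 \<le> sup_norm ?g"
      using abs_le_sup[OF subsetD[OF C_Cc gC], of p] by linarith
    then have "K * sup_norm ?g \<le> \<bar>K\<bar> * sup_norm ?g" by (intro mult_right_mono) auto
    ultimately show ?thesis using bd[OF gC] by (simp add: mult.assoc)
  qed
  \<comment> \<open>A vector is related to \<open>L \<phi>\<close> when \<open>grad \<phi>\<close>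
    is its projection onto the gradients. This extends the functional to the whole Hilbert space
    without choosing a representative \<phi>.\<close>
  define R where "R = {(x, L \<phi>) | x \<phi>. \<phi> \<in> C \<and> (\<forall>\<psi>\<in>C. (x - grad \<phi>) \<bullet> grad \<psi> = 0)}"
  have R: "subspace R"
  proof (rule subspaceI)
    have "L (0 *\<^sub>R 1) = 0 * L 1" by (rule lin(2)[OF one_C])
    moreover have "(0 :: real) *\<^sub>R (1 :: 'a \<Rightarrow> real) = 0" by (simp add: fun_eq_iff)
    ultimately have "L 0 = 0" by simp
    moreover note grad_zero
    moreover have "0 \<in> C" by (rule subspace_0[OF C_subspace])
    ultimately have "(0, 0) \<in> R" unfolding R_def by force
    then show "0 \<in> R" by (simp only: zero_prod_def)
  next
    fix a a' assume a: "a \<in> R" "a' \<in> R"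
    then obtain x \<phi> x' \<phi>' where x: "a = (x, L \<phi>)" "\<phi> \<in> C" "\<forall>\<psi>\<in>C. (x - grad \<phi>) \<bullet> grad \<psi> = 0"
      and x': "a' = (x', L \<phi>')" "\<phi>' \<in> C" "\<forall>\<psi>\<in>C. (x' - grad \<phi>') \<bullet> grad \<psi> = 0"
      unfolding R_def by blast
    have "((x + x') - grad (\<phi> + \<phi>')) \<bullet> grad \<psi> = 0" if "\<psi> \<in> C" for \<psi>
      using x(3) x'(3) that by (simp add: grad_add inner_diff_left inner_add_left)
    moreover have "a + a' = (x + x', L (\<phi> + \<phi>'))" using x x' lin(1) by simp
    ultimately show "a + a' \<in> R" unfolding R_def using C_add[OF x(2) x'(2)] by blast
  next
    fix k a assume a: "a \<in> R"
    then obtain x \<phi> where x: "a = (x, L \<phi>)" "\<phi> \<in> C" "\<forall>\<psi>\<in>C. (x - grad \<phi>) \<bullet> grad \<psi> = 0"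
      unfolding R_def by blast
    have "(k *\<^sub>R x - grad (k *\<^sub>R \<phi>)) \<bullet> grad \<psi> = 0" if "\<psi> \<in> C" for \<psi>
      using x(3) that by (simp add: grad_scaleR inner_diff_left)
    moreover have "k *\<^sub>R a = (k *\<^sub>R x, L (k *\<^sub>R \<phi>))" using x lin(2) by simp
    ultimately show "k *\<^sub>R a \<in> R" unfolding R_def using C_scaleR[OF x(2)] by blast
  qed
  have Rbd: "norm y \<le> (\<bar>K\<bar> * c) * norm x" if xy: "(x, y) \<in> R" for x y
  proof -
    obtain \<phi> where \<phi>: "\<phi> \<in> C" "y = L \<phi>" "\<forall>\<psi>\<in>C. (x - grad \<phi>) \<bullet> grad \<psi> = 0"
      using xy unfolding R_def by blast
    have "grad \<phi> \<bullet> grad \<phi> = x \<bullet> grad \<phi>" using \<phi> by (simp add: inner_diff_left)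
    then have "(norm (grad \<phi>))\<^sup>2 \<le> norm x * norm (grad \<phi>)"
      using norm_cauchy_schwarz[of x "grad \<phi>"] by (simp add: power2_norm_eq_inner)
    then have "norm (grad \<phi>) \<le> norm x" by (cases "grad \<phi> = 0") (simp_all add: power2_eq_square)
    then have "(\<bar>K\<bar> * c) * norm (grad \<phi>) \<le> (\<bar>K\<bar> * c) * norm x" using c(1) by (intro mult_left_mono) auto
    then show ?thesis using Lbd[OF \<phi>(1)] \<phi>(2) by simp
  qed
  have total: "\<exists>y. (x, y) \<in> R" for x
    using grad_projection[of "{}" x, unfolded vanishing_empty] unfolding R_def by blast
  then have "fst ` R = UNIV" by force
  then have dense: "closure (fst ` R) = UNIV" by simp
  obtain T where T: "bounded_linear T" "\<And>x y. (x, y) \<in> R \<Longrightarrow> T x = y"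
    by (rule bounded_relation_extension[OF R Rbd dense]) (assumption, rule that)
  obtain y where y: "\<And>x. T x = x \<bullet> y" using riesz_frechet[OF T(1)] by blast
  obtain u where u: "u \<in> C" "\<And>\<phi>. \<phi> \<in> C \<Longrightarrow> (y - grad u) \<bullet> grad \<phi> = 0"
    using grad_projection[of "{}" y, unfolded vanishing_empty] by blast
  have "E u \<phi> = L \<phi>" if \<phi>: "\<phi> \<in> C" for \<phi>
  proof -
    have "(grad \<phi>, L \<phi>) \<in> R" unfolding R_def using \<phi> by fastforce
    then have "L \<phi> = grad \<phi> \<bullet> y" using T(2) y by metis
    also have "\<dots> = y \<bullet> grad \<phi>" by (rule inner_commute)
    also have "\<dots> = grad u \<bullet> grad \<phi>" using u(2)[OF \<phi>] unfolding inner_diff_left by simp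
    also have "\<dots> = E u \<phi>" by (rule grad_inner[OF u(1) \<phi>])
    finally show ?thesis ..
  qed
  with u(1) show thesis by (rule that)
qed

end

section \<open>Boundary representations\<close>

locale boundary_setting = complete_structure E C \<iota> p + l2_structure E C \<iota> cls b
  for E :: "('a::metric_space \<Rightarrow> real) \<Rightarrow> ('a \<Rightarrow> real) \<Rightarrow> real"
    and C :: "('a \<Rightarrow> real) set"
    and \<iota> :: "('a \<times> 'a \<Rightarrow> real) \<Rightarrow> 'h::{real_inner, complete_space}"
    and p :: 'a
    and cls :: "('a \<Rightarrow> real) \<Rightarrow> 'l::{real_inner, complete_space}"
    and b :: 'h +
  fixes B :: "'a set" and v :: 'h and h :: "'a \<Rightarrow> real"
  assumes dim: "has_martingale_dimension E C 1"
    and fin: "finite B"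
    and b_ker: "b \<in> ker_coderiv B"
    and min: "minimal_energy_dominant E C \<nu>"
    and h: "h \<in> C" and v_ker: "v \<in> ker_coderiv {}" and b_dec: "b = grad h + v"
begin

section \<open>The gradient transported to functions, and density of the functions vanishing on a
  finite set\<close>

lemma star_star_inv: "star (star_inv y) = y"
  unfolding star_inv_def using star_surj[OF dim min] by (intro f_inv_into_f) simp

lemma star_inj: "star x = star y \<Longrightarrow> x = y"
proof -
  assume "star x = star y"
  then have "norm (x - y) = 0" by (simp add: star_norm[symmetric] star.diff)
  then show "x = y" by simp
qed

lemma star_inv_add: "star_inv (x + y) = star_inv x + star_inv y"
  and star_inv_scaleR: "star_inv (c *\<^sub>R x) = c *\<^sub>R star_inv x"
  by (rule star_inj, simp only: star.add star.scaleR star_star_inv)+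

lemma inner_star_inv: "x \<bullet> star_inv y = star x \<bullet> y"
  using star_inner[of x "star_inv y"] by (simp add: star_star_inv)

definition D :: "('a \<Rightarrow> real) \<Rightarrow> 'l" where
  "D \<phi> = star_inv (grad \<phi>)"

lemma D_add: "D (f + g) = D f + D g"
  and D_scaleR: "D (c *\<^sub>R f) = c *\<^sub>R D f"
  unfolding D_def by (simp_all only: grad_add star_inv_add grad_scaleR star_inv_scaleR)

lemma inner_D: "x \<bullet> D \<phi> = star x \<bullet> grad \<phi>"
  unfolding D_def by (rule inner_star_inv)

lemma D_inner_D: "f \<in> C \<Longrightarrow> g \<in> C \<Longrightarrow> D f \<bullet> D g = E f g"
  by (simp only: inner_D) (simp add: D_def star_star_inv grad_inner)

lemma C_Cc': "f \<in> C \<Longrightarrow> f \<in> Cc"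
  using C_Cc by blast

lemma vanishing_C: "f \<in> vanishing S \<Longrightarrow> f \<in> C"
  using vanishing_subset by blast

text \<open>A finite set is null because there are no atoms, so the distance \<open>d\<close> to it
  is nonzero almost everywhere. Each \<open>d * g\<close> is a uniform limit of elements of
  \<open>vanishing S\<close>; hence a vector orthogonal to these is orthogonal to every
  \<open>d * g\<close> and vanishes.\<close>

lemma dense_vanishing:
  assumes S: "finite S"
  shows "closure (cls ` vanishing S) = UNIV"
proof (rule dense_subspaceI)
  show "subspace (cls ` vanishing S)"
    using vanishing_subset C_Cc by (intro subspace_cls subspace_vanishing) blast
next
  fix y assume y: "\<And>x. x \<in> cls ` vanishing S \<Longrightarrow> y \<bullet> x = 0"
  define d where "d x = (if S = {} then 1 else infdist x S)" for x
  have d: "d \<in> Cc" unfolding Cc_iff d_def[abs_def] by (cases "S = {}") (auto intro!: continuous_intros)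
  have d0: "d x = 0 \<longleftrightarrow> x \<in> S" for x
    using in_closed_iff_infdist_zero[OF finite_imp_closed[OF S], of x] by (simp add: d_def)
  have "S \<in> null_sets \<nu>"
  proof -
    have "{x} \<in> null_sets \<nu>" for x
      using measure_mutual[of "{x}" b] no_atoms[of b b x] finite_measure.emeasure_eq_measure[OF finite_measure_nu, of "{x}"]
      by (auto simp: null_sets_def field_measure_eq sets_to_measure_mutual)
    then have "(\<Union>x\<in>S. {x}) \<in> null_sets \<nu>" using S by (intro null_sets.finite_UN) auto
    then show ?thesis by simp
  qed
  then have "AE x in \<nu>. x \<notin> S" by (rule AE_not_in)
  then have dnz: "AE x in \<nu>. d x \<noteq> 0" by (simp add: d0)
  show "y = 0"
  proof (rule cls_orthogonal[OF d dnz])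
    fix g :: "'a \<Rightarrow> real" assume g: "g \<in> Cc"
    have dg: "d * g \<in> Cc" by (rule Cc_mult[OF d g])
    have bound: "\<bar>y \<bullet> cls (d * g)\<bar> \<le> norm y * norm b * e" if e: "0 < e" for e
    proof -
      have "(d * g) q = 0" if "q \<in> S" for q using d0[of q] that by simp
      then obtain \<phi> where \<phi>: "\<phi> \<in> vanishing S" "\<And>x. \<bar>(d * g) x - \<phi> x\<bar> \<le> e"
        using approximation_vanishing[OF S dg _ e] by blast
      have \<phi>c: "\<phi> \<in> Cc" using \<phi>(1) vanishing_C C_Cc' by blast
      have r: "d * g - \<phi> \<in> Cc" by (rule subspace_diff[OF Cc_subspace dg \<phi>c])
      have "y \<bullet> cls \<phi> = 0" using y \<phi>(1) by blast
      then have "y \<bullet> cls (d * g) = y \<bullet> cls (d * g - \<phi>)" by (simp only: cls_diff[OF dg \<phi>c] inner_diff_right diff_zero)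
      then have CS: "\<bar>y \<bullet> cls (d * g)\<bar> \<le> norm y * norm (cls (d * g - \<phi>))"
        using Cauchy_Schwarz_ineq2[of y "cls (d * g - \<phi>)"] by (simp only:)
      have n: "norm (cls (d * g - \<phi>)) = norm (act (d * g - \<phi>) b)"
        by (simp only: norm_eq_sqrt_inner cls_inner_Cc[OF r r])
      have "norm (act (d * g - \<phi>) b) \<le> e * norm b" using \<phi>(2) by (intro act_norm[OF r]) simp
      then have "norm y * norm (act (d * g - \<phi>) b) \<le> norm y * (e * norm b)" by (rule mult_left_mono) simp
      from order_trans[OF CS[unfolded n] this] show ?thesis by (simp only: mult_ac)
    qed
    show "y \<bullet> cls (d * g) = 0"
    proof (rule ccontr)
      assume "y \<bullet> cls (d * g) \<noteq> 0"
      then have pos: "0 < \<bar>y \<bullet> cls (d * g)\<bar>" by simp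
      \<comment> \<open>Chosen so that the bound is less than the positive number it bounds; the
        summand 1 avoids division by zero.\<close>
      define e where "e = \<bar>y \<bullet> cls (d * g)\<bar> / (2 * (norm y * norm b + 1))"
      have n: "0 < norm y * norm b + 1" by (simp add: add_nonneg_pos)
      then have e: "0 < e" unfolding e_def using pos by simp
      have "\<bar>y \<bullet> cls (d * g)\<bar> = 2 * ((norm y * norm b + 1) * e)"
        unfolding e_def using n by (simp only: times_divide_eq_right) (simp add: field_simps)
      moreover have "norm y * norm b * e \<le> (norm y * norm b + 1) * e" using e by (intro mult_right_mono) auto
      ultimately show False using bound[OF e] pos by linarith
    qed
  qed
qed

section \<open>Adjoints, harmonic functions and normal parts\<close>

lemma adjoint_grad_iff:
  "(w, u) \<in> adjoint_graph (grad_graph S) \<longleftrightarrow> (\<forall>\<phi>\<in>vanishing S. w \<bullet> grad \<phi> = u \<bullet> cls \<phi>)"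
  unfolding adjoint_graph_def grad_graph_def by (auto simp: inner_commute[of w] inner_commute[of u])

text \<open>Density of the functions vanishing on \<open>S\<close> makes the adjoint single-valued,
  so a vector satisfying the defining identity is the value selected by
  \<open>op_value\<close>.\<close>

lemma coderivI:
  assumes S: "finite S" and eq: "\<And>\<phi>. \<phi> \<in> vanishing S \<Longrightarrow> w \<bullet> grad \<phi> = u \<bullet> cls \<phi>"
  shows "w \<in> coderiv_dom S" "coderiv S w = u"
proof -
  have mem: "(w, u) \<in> adjoint_graph (grad_graph S)"
    using eq by (simp add: adjoint_grad_iff)
  then show "w \<in> coderiv_dom S" unfolding coderiv_dom_def by blast
  show "coderiv S w = u"
    unfolding coderiv_def op_value_def
  proof (rule the_equality)
    show "(w, u) \<in> adjoint_graph (grad_graph S)" by (rule mem)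
    fix u' assume "(w, u') \<in> adjoint_graph (grad_graph S)"
    then have "(u' - u) \<bullet> y = 0" if "y \<in> cls ` vanishing S" for y
      using that mem by (auto simp: adjoint_grad_iff inner_diff_left)
    then have "u' - u = 0" by (rule orthogonal_dense_eq_0[OF dense_vanishing[OF S]])
    then show "u' = u" by simp
  qed
qed

lemma coderivD:
  assumes S: "finite S" and w: "w \<in> coderiv_dom S" and \<phi>: "\<phi> \<in> vanishing S"
  shows "w \<bullet> grad \<phi> = coderiv S w \<bullet> cls \<phi>"
proof -
  obtain u where u: "(w, u) \<in> adjoint_graph (grad_graph S)" using w by (auto simp: coderiv_dom_def)
  then have *: "w \<bullet> grad \<phi> = u \<bullet> cls \<phi>" if "\<phi> \<in> vanishing S" for \<phi>
    using that by (simp add: adjoint_grad_iff)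
  show ?thesis using coderivI(2)[OF S *] *[OF \<phi>] by simp
qed

text \<open>Existence: subtract from a separating function the element of \<open>vanishing B\<close>
  whose gradient is the projection of its gradient. Uniqueness: the difference of two candidates has
  zero energy, hence is constant, and it vanishes at \<open>q\<close>.\<close>

lemma harmonic_hat:
  assumes B: "finite B" and q: "q \<in> B"
  shows "harmonic_hat B q \<in> C" "harmonic_hat B q q = 1" "\<And>x. x \<in> B - {q} \<Longrightarrow> harmonic_hat B q x = 0"
proof -
  let ?P = "\<lambda>\<psi>. \<psi> \<in> C \<and> \<psi> q = 1 \<and> (\<forall>x\<in>B - {q}. \<psi> x = 0) \<and> (\<forall>\<phi>\<in>vanishing B. E \<psi> \<phi> = 0)"
  have "\<exists>!\<psi>. ?P \<psi>"
  proof (rule ex_ex1I)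
    obtain e where e: "e \<in> C" "e q = 1" "\<And>x. x \<in> B - {q} \<Longrightarrow> e x = 0" using separating[OF B q] by metis
    obtain u where u: "u \<in> vanishing B" "\<And>\<phi>. \<phi> \<in> vanishing B \<Longrightarrow> (grad e - grad u) \<bullet> grad \<phi> = 0"
      using grad_projection[of B "grad e"] by blast
    have uC: "u \<in> C" and uB: "\<And>x. x \<in> B \<Longrightarrow> u x = 0" using u(1) by (auto simp: vanishing_def)
    have eu: "e - u \<in> C" by (rule C_diff[OF e(1) uC])
    have "E (e - u) \<phi> = 0" if \<phi>: "\<phi> \<in> vanishing B" for \<phi>
    proof -
      have "\<phi> \<in> C" using \<phi> vanishing_subset by blast
      then have "E (e - u) \<phi> = grad (e - u) \<bullet> grad \<phi>" by (rule grad_inner[OF eu, symmetric])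
      then show ?thesis using u(2)[OF \<phi>] by (simp only: grad_diff)
    qed
    then have "?P (e - u)" using eu e uB q by simp
    then show "\<exists>\<psi>. ?P \<psi>" by blast
  next
    fix \<psi> \<psi>' assume \<psi>: "?P \<psi>" and \<psi>': "?P \<psi>'"
    have d: "\<psi> - \<psi>' \<in> vanishing B"
    proof -
      have "\<psi> x = \<psi>' x" if "x \<in> B" for x using \<psi> \<psi>' that by (cases "x = q") auto
      then show ?thesis using \<psi> \<psi>' C_diff by (simp add: vanishing_def)
    qed
    then have dC: "\<psi> - \<psi>' \<in> C" using vanishing_subset by blast
    have "E (\<psi> - \<psi>') (\<psi> - \<psi>') = 0" using E_diff[OF _ _ dC, of \<psi> \<psi>'] \<psi> \<psi>' d by auto
    then have "grad (\<psi> - \<psi>') = 0" using grad_inner[OF dC dC] by simp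
    then have "(\<psi> - \<psi>') x = (\<psi> - \<psi>') q" for x using grad_eq_0[OF dC] by blast
    then show "\<psi> = \<psi>'" using \<psi> \<psi>' by (simp add: fun_eq_iff)
  qed
  from theI'[OF this] show "harmonic_hat B q \<in> C" "harmonic_hat B q q = 1" "\<And>x. x \<in> B - {q} \<Longrightarrow> harmonic_hat B q x = 0"
    unfolding harmonic_hat_def by blast+
qed

lemma harmonic_hat_sum:
  assumes \<phi>: "\<phi> \<in> C"
  shows "\<phi> - (\<Sum>q\<in>B. \<phi> q *\<^sub>R harmonic_hat B q) \<in> vanishing B"
proof -
  have "(\<Sum>q\<in>B. \<phi> q *\<^sub>R harmonic_hat B q) \<in> C"
    by (intro subspace_sum[OF C_subspace] C_scaleR harmonic_hat(1)[OF fin])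
  then have c: "\<phi> - (\<Sum>q\<in>B. \<phi> q *\<^sub>R harmonic_hat B q) \<in> C" by (rule C_diff[OF \<phi>])
  have "(\<Sum>q\<in>B. \<phi> q *\<^sub>R harmonic_hat B q) x = \<phi> x" if x: "x \<in> B" for x
  proof -
    have "(\<Sum>q\<in>B. \<phi> q * harmonic_hat B q x) = (\<Sum>q\<in>B. if q = x then \<phi> x else 0)"
    proof (rule sum.cong[OF refl])
      fix q assume q: "q \<in> B"
      show "\<phi> q * harmonic_hat B q x = (if q = x then \<phi> x else 0)"
        using harmonic_hat(2)[OF fin q] harmonic_hat(3)[OF fin q, of x] x by auto
    qed
    then show ?thesis using fin x by (simp add: sum_fun_apply)
  qed
  with c show ?thesis by (simp add: vanishing_def)
qed

text \<open>The functional annihilates \<open>vanishing B\<close>, and \<open>\<phi>\<close> differs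
  from its harmonic interpolation by such a function. Using the difference itself instead of
  \<open>normal\<close> lets empty \<open>B\<close> be included.\<close>

lemma normal_sum:
  assumes w: "w \<in> coderiv_dom B" and \<phi>: "\<phi> \<in> C"
  shows "w \<bullet> grad \<phi> - coderiv B w \<bullet> cls \<phi> = (\<Sum>q\<in>B. \<phi> q * normal_at B w q)"
proof (cases "B = {}")
  case True
  then show ?thesis using coderivD[OF fin w, of \<phi>] \<phi> by (simp add: vanishing_def)
next
  case False
  let ?s = "\<Sum>q\<in>B. \<phi> q *\<^sub>R harmonic_hat B q"
  define N where "N \<psi> = w \<bullet> grad \<psi> - coderiv B w \<bullet> cls \<psi>" for \<psi>
  have hat: "harmonic_hat B q \<in> C" if "q \<in> B" for q by (rule harmonic_hat(1)[OF fin that])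
  have Nsum: "(\<Sum>q\<in>S. \<phi> q *\<^sub>R harmonic_hat B q) \<in> C \<and> N (\<Sum>q\<in>S. \<phi> q *\<^sub>R harmonic_hat B q) = (\<Sum>q\<in>S. \<phi> q * N (harmonic_hat B q))"
    if "finite S" "S \<subseteq> B" for S
    using that
  proof (induction S rule: finite_induct)
    case empty
    have "cls (0 *\<^sub>R 1) = 0 *\<^sub>R cls 1" by (rule cls_scaleR[OF Cc_one])
    moreover have "(0 :: real) *\<^sub>R (1 :: 'a \<Rightarrow> real) = 0" by (simp add: fun_eq_iff)
    ultimately have "cls 0 = 0" by (simp only: scaleR_zero_left)
    then have "N 0 = 0" unfolding N_def grad_zero by simp
    then show ?case using subspace_0[OF C_subspace] by (simp only: sum.empty simp_thms)
  next
    case (insert q S)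
    let ?t = "\<Sum>q\<in>S. \<phi> q *\<^sub>R harmonic_hat B q"
    have "S \<subseteq> B" using insert.prems by blast
    from insert.IH[OF this] have t: "?t \<in> C" "N ?t = (\<Sum>q\<in>S. \<phi> q * N (harmonic_hat B q))" by blast+
    have q: "harmonic_hat B q \<in> C" using hat insert.prems by simp
    then have a: "\<phi> q *\<^sub>R harmonic_hat B q \<in> C" by (rule C_scaleR)
    have "N (\<phi> q *\<^sub>R harmonic_hat B q + ?t) = \<phi> q * N (harmonic_hat B q) + N ?t"
      unfolding N_def grad_add grad_scaleR cls_add[OF C_Cc'[OF a] C_Cc'[OF t(1)]] cls_scaleR[OF C_Cc'[OF q]]
      by (simp add: inner_add_right algebra_simps)
    then show ?case using C_add[OF a t(1)] t(2) by (simp only: sum.insert[OF insert.hyps] simp_thms)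
  qed
  have s: "?s \<in> C" "N ?s = (\<Sum>q\<in>B. \<phi> q * N (harmonic_hat B q))" using Nsum[OF fin] by auto
  have "N (\<phi> - ?s) = 0" unfolding N_def using coderivD[OF fin w harmonic_hat_sum[OF \<phi>]] by simp
  moreover have "N (\<phi> - ?s) = N \<phi> - N ?s"
    unfolding N_def grad_diff cls_diff[OF C_Cc'[OF \<phi>] C_Cc'[OF s(1)]] by (simp add: inner_diff_right)
  moreover have "N (harmonic_hat B q) = normal_at B w q" for q
    using False by (simp add: N_def normal_at_def normal_def)
  ultimately show ?thesis using s(2) by (simp add: N_def)
qed

lemma normal_eq:
  "w \<in> coderiv_dom B \<Longrightarrow> \<phi> \<in> C \<Longrightarrow> normal B w \<phi> = (\<Sum>q\<in>B. \<phi> q * normal_at B w q)"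
  using normal_sum by (simp add: normal_def)

text \<open>One integration-by-parts formula determines three things: functions vanishing on
  \<open>B\<close> give the domain and the value of the adjoint, and the harmonic functions isolate
  the boundary coefficients.\<close>

lemma normal_atI:
  assumes eq: "\<And>\<phi>. \<phi> \<in> C \<Longrightarrow> w \<bullet> grad \<phi> = u \<bullet> cls \<phi> + (\<Sum>q\<in>B. \<phi> q * n q)"
  shows "w \<in> coderiv_dom B" "coderiv B w = u" "q \<in> B \<Longrightarrow> normal_at B w q = n q"
proof -
  have *: "w \<bullet> grad \<phi> = u \<bullet> cls \<phi>" if "\<phi> \<in> vanishing B" for \<phi>
    using eq[OF vanishing_C[OF that]] that by (simp add: vanishing_def)
  show "w \<in> coderiv_dom B" "coderiv B w = u" using coderivI[OF fin *] by auto
  show "normal_at B w q = n q" if q: "q \<in> B"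
  proof -
    have c: "harmonic_hat B q \<in> C" by (rule harmonic_hat(1)[OF fin q])
    have "normal_at B w q = w \<bullet> grad (harmonic_hat B q) - u \<bullet> cls (harmonic_hat B q)"
      using q \<open>coderiv B w = u\<close> by (auto simp: normal_at_def normal_def)
    also have "\<dots> = (\<Sum>r\<in>B. harmonic_hat B q r * n r)" using eq[OF c] by simp
    also have "\<dots> = (\<Sum>r\<in>B. if r = q then n q else 0)"
    proof (rule sum.cong[OF refl])
      fix r assume "r \<in> B"
      then show "harmonic_hat B q r * n r = (if r = q then n q else 0)"
        using harmonic_hat(2)[OF fin q] harmonic_hat(3)[OF fin q, of r] by auto
    qed
    finally show ?thesis using fin q by simp
  qed
qed

abbreviation \<beta> :: "'a \<Rightarrow> real" where "\<beta> \<equiv> normal_at B b"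

lemma b_coderiv: "b \<in> coderiv_dom B" "coderiv B b = 0"
proof -
  have "b \<bullet> grad \<phi> = 0 \<bullet> cls \<phi>" if "\<phi> \<in> vanishing B" for \<phi>
    using b_ker that by (simp add: ker_coderiv_def)
  from coderivI[OF fin this] show "b \<in> coderiv_dom B" "coderiv B b = 0" by auto
qed

lemma b_grad: "\<phi> \<in> C \<Longrightarrow> b \<bullet> grad \<phi> = (\<Sum>q\<in>B. \<phi> q * \<beta> q)"
  using normal_sum[OF b_coderiv(1)] b_coderiv(2) by simp

text \<open>The left-hand side is \<open>\<langle>b, \<partial>(g \<phi>)\<rangle>\<close> by the product rule.\<close>

lemma D_parts:
  assumes "g \<in> C" "\<phi> \<in> C"
  shows "cls g \<bullet> D \<phi> + cls \<phi> \<bullet> D g = (\<Sum>q\<in>B. g q * \<phi> q * \<beta> q)"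
proof -
  have "cls f \<bullet> D k = b \<bullet> act f (grad k)" if "f \<in> C" for f k
    by (simp only: inner_D star_cls[OF C_Cc'[OF that]] act_symmetric[OF C_Cc'[OF that]])
  then have "cls g \<bullet> D \<phi> + cls \<phi> \<bullet> D g = b \<bullet> grad (g * \<phi>)"
    using assms by (simp only: product_rule inner_add_right)
  also have "\<dots> = (\<Sum>q\<in>B. (g * \<phi>) q * \<beta> q)" by (rule b_grad[OF C_mult[OF assms]])
  finally show ?thesis by simp
qed

section \<open>The operator \<open>perp\<close> and the splitting of
  \<open>L\<^sup>2\<close>\<close>

lemma perpI:
  assumes S: "finite S" and eq: "\<And>\<phi>. \<phi> \<in> vanishing S \<Longrightarrow> f \<bullet> D \<phi> = - (u \<bullet> cls \<phi>)"
  shows "f \<in> perp_dom S" "perp S f = u"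
proof -
  have "star f \<bullet> grad \<phi> = (- u) \<bullet> cls \<phi>" if "\<phi> \<in> vanishing S" for \<phi>
    using eq[OF that] by (simp add: inner_D)
  from coderivI[OF S this] show "f \<in> perp_dom S" "perp S f = u"
    by (simp_all add: perp_dom_def perp_def)
qed

lemma perpD:
  assumes "finite S" "f \<in> perp_dom S" "\<phi> \<in> vanishing S"
  shows "f \<bullet> D \<phi> = - (perp S f \<bullet> cls \<phi>)"
  using coderivD[of S "star f" \<phi>] assms by (simp add: perp_dom_def perp_def inner_D)

lemma ker_perp_iff: "f \<in> ker_perp \<longleftrightarrow> (\<forall>\<phi>\<in>C. f \<bullet> D \<phi> = 0)"
proof
  assume "f \<in> ker_perp"
  then have "f \<in> perp_dom {}" "perp {} f = 0" by (auto simp: ker_perp_def)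
  then show "\<forall>\<phi>\<in>C. f \<bullet> D \<phi> = 0" using perpD[of "{}" f] by (auto simp: vanishing_empty)
next
  assume *: "\<forall>\<phi>\<in>C. f \<bullet> D \<phi> = 0"
  have "f \<bullet> D \<phi> = - (0 \<bullet> cls \<phi>)" if "\<phi> \<in> vanishing {}" for \<phi>
    using * that by (simp add: vanishing_empty)
  from perpI[OF finite.emptyI this] show "f \<in> ker_perp" by (simp add: ker_perp_def)
qed

lemma subspace_ker_perp: "subspace ker_perp"
  by (rule subspaceI) (auto simp: ker_perp_iff inner_add_left)

lemma ker_perp_add: "f \<in> ker_perp \<Longrightarrow> g \<in> ker_perp \<Longrightarrow> f + g \<in> ker_perp"
  and ker_perp_scaleR: "f \<in> ker_perp \<Longrightarrow> c *\<^sub>R f \<in> ker_perp"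
  and ker_perp_diff: "f \<in> ker_perp \<Longrightarrow> g \<in> ker_perp \<Longrightarrow> f - g \<in> ker_perp"
  using subspace_ker_perp by (auto intro: subspace_add subspace_scale subspace_diff)

text \<open>Projection of \<open>star x\<close> onto the closed space of gradients; the remainder is
  orthogonal to all of them.\<close>

lemma decomposition:
  obtains u w where "u \<in> C" "w \<in> ker_perp" "x = D u + w"
proof -
  obtain u where u: "u \<in> C" "\<And>\<phi>. \<phi> \<in> C \<Longrightarrow> (star x - grad u) \<bullet> grad \<phi> = 0"
    using grad_projection[of "{}" "star x", unfolded vanishing_empty] by blast
  have "x - D u \<in> ker_perp"
    using u(2) by (simp add: ker_perp_iff inner_D star.diff) (simp add: D_def star_star_inv)
  with u(1) show thesis by (rule that) simp
qed

definition vhat :: 'l where "vhat = star_inv v"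

lemma vhat_ker: "vhat \<in> ker_perp"
  using v_ker by (simp add: ker_perp_iff inner_D vhat_def star_star_inv ker_coderiv_def vanishing_empty)

text \<open>Since \<open>b = star (cls 1)\<close>, the decomposition of \<open>b\<close> becomes one
  of the constant 1. This is the source of the non-uniqueness of representations and of the vectors
  \<open>e_minus\<close> and \<open>e_plus\<close>.\<close>

lemma one_dec: "cls 1 = D h + vhat"
  by (rule star_inj) (simp only: star_one star.add D_def vhat_def star_star_inv b_dec[symmetric])

text \<open>A canonical representation with the boundary values \<open>n\<close> and the component
  \<open>z\<close> as explicit parameters instead of quantities computed from \<open>f\<close>, so
  that representations can be added, scaled and prescribed.\<close>

definition represents where
  "represents f g n u z w \<longleftrightarrow>
     g \<in> C \<and> u \<in> C \<and> z \<in> ker_perp \<and> w \<in> ker_perp \<and> f = cls g + D u + w \<and>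
     (\<forall>\<phi>\<in>C. E u \<phi> = (\<Sum>q\<in>B. \<phi> q * (n q - g q * \<beta> q)) - z \<bullet> cls \<phi>)"

text \<open>The boundary term \<open>- g q * \<beta> q\<close> in the equation for \<open>u\<close>
  cancels the one arising from integrating \<open>g\<close> by parts, so only \<open>n\<close>
  remains. Through \<open>normal_atI\<close> this shows that \<open>n\<close> and
  \<open>D g + z\<close> are the normal part and the value of \<open>perp\<close>.\<close>

lemma represents_parts:
  assumes r: "represents f g n u z w" and \<phi>: "\<phi> \<in> C"
  shows "f \<bullet> D \<phi> = - ((D g + z) \<bullet> cls \<phi>) + (\<Sum>q\<in>B. \<phi> q * n q)"
proof -
  have g: "g \<in> C" and u: "u \<in> C" and w: "w \<in> ker_perp" and f: "f = cls g + D u + w"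
    and weak: "E u \<phi> = (\<Sum>q\<in>B. \<phi> q * (n q - g q * \<beta> q)) - z \<bullet> cls \<phi>"
    using r \<phi> by (auto simp: represents_def)
  have "w \<bullet> D \<phi> = 0" using w \<phi> by (simp add: ker_perp_iff)
  then have "f \<bullet> D \<phi> = cls g \<bullet> D \<phi> + E u \<phi>" using D_inner_D[OF u \<phi>] by (simp add: f inner_add_left)
  also have "cls g \<bullet> D \<phi> = (\<Sum>q\<in>B. g q * \<phi> q * \<beta> q) - D g \<bullet> cls \<phi>"
    using D_parts[OF g \<phi>] by (simp add: inner_commute)
  finally show ?thesis
    unfolding weak by (simp add: inner_add_left algebra_simps sum_subtractf sum.distrib)
qed

lemma represents_perp:
  assumes r: "represents f g n u z w"
  shows "f \<in> perp_dom B" "perp B f = D g + z" "\<And>q. q \<in> B \<Longrightarrow> normal_at B (star f) q = n q"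
proof -
  have eq: "star f \<bullet> grad \<phi> = (- (D g + z)) \<bullet> cls \<phi> + (\<Sum>q\<in>B. \<phi> q * n q)" if "\<phi> \<in> C" for \<phi>
    using represents_parts[OF r that] unfolding inner_D inner_minus_left .
  from normal_atI[OF eq] show "f \<in> perp_dom B" "perp B f = D g + z" "\<And>q. q \<in> B \<Longrightarrow> normal_at B (star f) q = n q"
    by (auto simp: perp_dom_def perp_def)
qed

lemma represents_normal_grad:
  assumes r: "represents f g n u z w" and q: "q \<in> B"
  shows "normal_at B (grad u) q = n q - g q * \<beta> q"
proof (rule normal_atI(3)[OF _ q])
  fix \<phi> assume \<phi>: "\<phi> \<in> C"
  then show "grad u \<bullet> grad \<phi> = (- z) \<bullet> cls \<phi> + (\<Sum>q\<in>B. \<phi> q * (n q - g q * \<beta> q))"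
    using r grad_inner[OF _ \<phi>, of u] by (simp add: represents_def)
qed

lemma represents_canonical:
  assumes r: "represents f g n u z w"
  shows "canonical_representation B f g u w" "z_part B f g = z"
proof -
  have g: "g \<in> C" and u: "u \<in> C" and z: "z \<in> ker_perp" and w: "w \<in> ker_perp" and f: "f = cls g + D u + w"
    and weak: "\<And>\<phi>. \<phi> \<in> C \<Longrightarrow> E u \<phi> = (\<Sum>q\<in>B. \<phi> q * (n q - g q * \<beta> q)) - z \<bullet> cls \<phi>"
    using r by (auto simp: represents_def)
  show zp: "z_part B f g = z" using represents_perp(2)[OF r] by (simp add: z_part_def D_def)
  have sf: "star f \<in> coderiv_dom B" using represents_perp(1)[OF r] by (simp add: perp_dom_def)
  have "E u \<phi> = normal B (star f) \<phi> - normal B b (g * \<phi>) - z \<bullet> cls \<phi>" if \<phi>: "\<phi> \<in> C" for \<phi>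
    unfolding weak[OF \<phi>] normal_eq[OF sf \<phi>] normal_eq[OF b_coderiv(1) C_mult[OF g \<phi>]]
    using represents_perp(3)[OF r] by (simp add: algebra_simps sum_subtractf)
  then show "canonical_representation B f g u w"
    unfolding canonical_representation_def weak_solution_def zp using g u z w f by (simp add: D_def)
qed

text \<open>\<open>G_minus\<close> and \<open>G_plus\<close> refer to all canonical representations
  of \<open>f\<close>; here each of them is brought into the linear format, so that any two can be
  compared.\<close>

lemma canonical_represents:
  assumes f: "f \<in> perp_dom B" and c: "canonical_representation B f g u w"
  shows "represents f g (normal_at B (star f)) u (z_part B f g) w"
proof -
  have g: "g \<in> C" and u: "u \<in> C"
    and weak: "\<And>\<phi>. \<phi> \<in> C \<Longrightarrow> E u \<phi> = normal B (star f) \<phi> - normal B b (g * \<phi>) - z_part B f g \<bullet> cls \<phi>"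
    using c by (auto simp: canonical_representation_def weak_solution_def)
  have sf: "star f \<in> coderiv_dom B" using f by (simp add: perp_dom_def)
  have "E u \<phi> = (\<Sum>q\<in>B. \<phi> q * (normal_at B (star f) q - g q * \<beta> q)) - z_part B f g \<bullet> cls \<phi>" if \<phi>: "\<phi> \<in> C" for \<phi>
    unfolding weak[OF \<phi>] normal_eq[OF sf \<phi>] normal_eq[OF b_coderiv(1) C_mult[OF g \<phi>]]
    by (simp add: algebra_simps sum_subtractf)
  then show ?thesis
    using c g u unfolding represents_def canonical_representation_def D_def by blast
qed

text \<open>\<open>perp B f\<close> and then \<open>f - cls g\<close> are split orthogonally. The
  equation for \<open>u\<close> results from equating two expressions for
  \<open>f \<bullet> D \<phi>\<close>, one from the normal part of \<open>star f\<close> and one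
  from the product rule for \<open>g\<close>.\<close>

lemma represents_exists:
  assumes f: "f \<in> perp_dom B"
  obtains g u z w where "represents f g (normal_at B (star f)) u z w"
proof -
  obtain g z where g: "g \<in> C" "z \<in> ker_perp" "perp B f = D g + z" by (rule decomposition)
  obtain u w where u: "u \<in> C" "w \<in> ker_perp" "f - cls g = D u + w" by (rule decomposition)
  have fe: "f = cls g + D u + w" using u(3) by (simp add: algebra_simps)
  have sf: "star f \<in> coderiv_dom B" using f by (simp add: perp_dom_def)
  have "E u \<phi> = (\<Sum>q\<in>B. \<phi> q * (normal_at B (star f) q - g q * \<beta> q)) - z \<bullet> cls \<phi>" if \<phi>: "\<phi> \<in> C" for \<phi>
  proof -
    have "w \<bullet> D \<phi> = 0" using u(2) \<phi> by (simp add: ker_perp_iff)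
    then have "f \<bullet> D \<phi> = cls g \<bullet> D \<phi> + E u \<phi>" using D_inner_D[OF u(1) \<phi>] by (simp add: fe inner_add_left)
    moreover have "f \<bullet> D \<phi> + (D g + z) \<bullet> cls \<phi> = (\<Sum>q\<in>B. \<phi> q * normal_at B (star f) q)"
      using normal_sum[OF sf \<phi>] g(3) by (simp add: inner_D perp_def)
        (metis add.inverse_inverse diff_minus_eq_add inner_add_left inner_minus_left)
    moreover have "cls g \<bullet> D \<phi> + D g \<bullet> cls \<phi> = (\<Sum>q\<in>B. g q * \<phi> q * \<beta> q)"
      using D_parts[OF g(1) \<phi>] by (simp add: inner_commute)
    ultimately show ?thesis by (simp add: inner_add_left algebra_simps sum_subtractf)
  qed
  then have "represents f g (normal_at B (star f)) u z w"
    unfolding represents_def using g(1,2) u(1,2) fe by blast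
  then show thesis by (rule that)
qed

lemma represents_add:
  assumes "represents f g n u z w" "represents f' g' n' u' z' w'"
  shows "represents (f + f') (g + g') (n + n') (u + u') (z + z') (w + w')"
  unfolding represents_def
proof (intro conjI ballI)
  have a: "g \<in> C" "u \<in> C" "z \<in> ker_perp" "w \<in> ker_perp" "f = cls g + D u + w"
    and a': "g' \<in> C" "u' \<in> C" "z' \<in> ker_perp" "w' \<in> ker_perp" "f' = cls g' + D u' + w'"
    using assms by (auto simp: represents_def)
  show "g + g' \<in> C" "u + u' \<in> C" "z + z' \<in> ker_perp" "w + w' \<in> ker_perp"
    using a a' by (auto intro: C_add ker_perp_add)
  show "f + f' = cls (g + g') + D (u + u') + (w + w')"
    unfolding cls_add[OF C_Cc'[OF a(1)] C_Cc'[OF a'(1)]] D_add a(5) a'(5) by simp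
  fix \<phi> assume \<phi>: "\<phi> \<in> C"
  have "E u \<phi> = (\<Sum>q\<in>B. \<phi> q * (n q - g q * \<beta> q)) - z \<bullet> cls \<phi>"
    "E u' \<phi> = (\<Sum>q\<in>B. \<phi> q * (n' q - g' q * \<beta> q)) - z' \<bullet> cls \<phi>"
    using assms \<phi> by (auto simp: represents_def)
  then show "E (u + u') \<phi> = (\<Sum>q\<in>B. \<phi> q * ((n + n') q - (g + g') q * \<beta> q)) - (z + z') \<bullet> cls \<phi>"
    unfolding E_add[OF a(2) a'(2) \<phi>] by (simp add: inner_add_left algebra_simps sum.distrib sum_subtractf)
qed

lemma represents_scaleR:
  assumes "represents f g n u z w"
  shows "represents (c *\<^sub>R f) (c *\<^sub>R g) (c *\<^sub>R n) (c *\<^sub>R u) (c *\<^sub>R z) (c *\<^sub>R w)"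
  unfolding represents_def
proof (intro conjI ballI)
  have a: "g \<in> C" "u \<in> C" "z \<in> ker_perp" "w \<in> ker_perp" "f = cls g + D u + w"
    using assms by (auto simp: represents_def)
  show "c *\<^sub>R g \<in> C" "c *\<^sub>R u \<in> C" "c *\<^sub>R z \<in> ker_perp" "c *\<^sub>R w \<in> ker_perp"
    using a by (auto intro: C_scaleR ker_perp_scaleR)
  show "c *\<^sub>R f = cls (c *\<^sub>R g) + D (c *\<^sub>R u) + c *\<^sub>R w"
    unfolding cls_scaleR[OF C_Cc'[OF a(1)]] D_scaleR a(5) by (simp add: scaleR_add_right)
  fix \<phi> assume \<phi>: "\<phi> \<in> C"
  have e: "E u \<phi> = (\<Sum>q\<in>B. \<phi> q * (n q - g q * \<beta> q)) - z \<bullet> cls \<phi>"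
    using assms \<phi> by (auto simp: represents_def)
  show "E (c *\<^sub>R u) \<phi> = (\<Sum>q\<in>B. \<phi> q * ((c *\<^sub>R n) q - (c *\<^sub>R g) q * \<beta> q)) - c *\<^sub>R z \<bullet> cls \<phi>"
    unfolding E_scale[OF a(2) \<phi>] e
    by (simp add: right_diff_distrib sum_distrib_left sum_subtractf mult_ac)
qed

text \<open>This is \<open>one_dec\<close> solved for 0. The function \<open>h\<close> has Neumann
  data \<beta> because \<open>v\<close> is orthogonal to every gradient.\<close>

lemma represents_zero_one: "represents 0 1 0 (- 1 *\<^sub>R h) 0 (- 1 *\<^sub>R vhat)"
  unfolding represents_def
proof (intro conjI ballI)
  show "1 \<in> C" "- 1 *\<^sub>R h \<in> C" "0 \<in> ker_perp" "- 1 *\<^sub>R vhat \<in> ker_perp"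
    by (rule one_C, rule C_scaleR[OF h], rule subspace_0[OF subspace_ker_perp], rule ker_perp_scaleR[OF vhat_ker])
  show "0 = cls 1 + D (- 1 *\<^sub>R h) + - 1 *\<^sub>R vhat"
    unfolding D_scaleR one_dec by simp
  fix \<phi> assume \<phi>: "\<phi> \<in> C"
  have "v \<bullet> grad \<phi> = 0" using v_ker \<phi> by (simp add: ker_coderiv_def vanishing_empty)
  then have "E h \<phi> = (\<Sum>q\<in>B. \<phi> q * \<beta> q)"
    using b_grad[OF \<phi>] grad_inner[OF h \<phi>] by (simp add: b_dec inner_add_left)
  then show "E (- 1 *\<^sub>R h) \<phi> = (\<Sum>q\<in>B. \<phi> q * (0 q - 1 q * \<beta> q)) - 0 \<bullet> cls \<phi>"
    unfolding E_scale[OF h \<phi>] by (simp add: sum_negf)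
qed

text \<open>Two representations of the same element differ by a multiple of \<open>represents_zero_one\<close>.\<close>

lemma represents_zero:
  assumes r: "represents 0 g n u z w"
  obtains c where "g = c *\<^sub>R 1" "\<And>q. q \<in> B \<Longrightarrow> n q = 0" "z = 0" "w = - c *\<^sub>R vhat"
proof -
  have a: "g \<in> C" "u \<in> C" "z \<in> ker_perp" "w \<in> ker_perp" "0 = cls g + D u + w"
    using r by (auto simp: represents_def)
  have "(0::'l) \<bullet> D \<phi> = - (0 \<bullet> cls \<phi>)" if "\<phi> \<in> vanishing B" for \<phi> by simp
  from perpI(2)[OF fin this] have Dz: "D g + z = 0" using represents_perp(2)[OF r] by simp
  have zD: "z \<bullet> D g = 0" using a by (simp add: ker_perp_iff)
  have "z \<bullet> (D g + z) = 0" using Dz by simp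
  then have "z \<bullet> z = 0" using zD by (simp add: inner_add_right)
  then have z: "z = 0" by simp
  then have "star (D g) = 0" using Dz by (simp add: star.zero)
  then have "grad g = 0" by (simp add: D_def star_star_inv)
  then have "g x = g p" for x using grad_eq_0[OF a(1)] by blast
  then have g: "g = g p *\<^sub>R 1" by (simp add: fun_eq_iff)
  define k where "k = g p"
  have "n q = 0" if "q \<in> B" for q
  proof -
    have "star 0 \<bullet> grad \<phi> = 0 \<bullet> cls \<phi> + (\<Sum>q\<in>B. \<phi> q * (\<lambda>q. 0) q)" if "\<phi> \<in> C" for \<phi>
      by (simp add: star.zero)
    from normal_atI(3)[OF this \<open>q \<in> B\<close>] show ?thesis using represents_perp(3)[OF r \<open>q \<in> B\<close>] by simp
  qed
  moreover have "w = - k *\<^sub>R vhat"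
  proof -
    have "cls g = k *\<^sub>R cls 1" using cls_scaleR[OF Cc_one, of k] g by (simp add: k_def)
    then have "(w + k *\<^sub>R vhat) + (D u + k *\<^sub>R D h) = cls g + D u + w"
      by (simp add: one_dec scaleR_add_right)
    also have "\<dots> = 0" by (rule a(5)[symmetric])
    \<comment> \<open>The left side lies in \<open>ker_perp\<close> and the right side in the range
      of \<open>D\<close>, so the vector is orthogonal to itself.\<close>
    finally have s: "w + k *\<^sub>R vhat = - (D u + k *\<^sub>R D h)" by (simp only: eq_neg_iff_add_eq_0)
    have wk: "w + k *\<^sub>R vhat \<in> ker_perp" using a by (intro ker_perp_add ker_perp_scaleR vhat_ker)
    have "(w + k *\<^sub>R vhat) \<bullet> D u = 0" "(w + k *\<^sub>R vhat) \<bullet> D h = 0" using wk a(2) h by (auto simp: ker_perp_iff)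
    then have "(w + k *\<^sub>R vhat) \<bullet> - (D u + k *\<^sub>R D h) = 0"
      unfolding inner_minus_right inner_add_right inner_scaleR_right by simp
    then have "(w + k *\<^sub>R vhat) \<bullet> (w + k *\<^sub>R vhat) = 0" unfolding s[symmetric] .
    then show ?thesis by (simp add: add_eq_0_iff2)
  qed
  ultimately show thesis using g z that[of k] by (simp add: k_def)
qed

end

section \<open>The boundary quadruple\<close>

context boundary_setting
begin

abbreviation ip where "ip \<equiv> ip_tilde B"
abbreviation em where "em \<equiv> e_minus B v"
abbreviation ep where "ep \<equiv> e_plus B v"

lemma B_parts: "B = B_null B \<union> (B_neg B \<union> B_pos B)"
    "B_null B \<inter> (B_neg B \<union> B_pos B) = {}" "B_neg B \<inter> B_pos B = {}"
  by (auto simp: B_null_def B_neg_def B_pos_def)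

lemma finite_parts: "finite (B_null B)" "finite (B_neg B)" "finite (B_pos B)"
  using fin by (auto simp: B_null_def B_neg_def B_pos_def)

lemma sum_parts: "sum k B = sum k (B_null B) + sum k (B_neg B) + sum k (B_pos B)"
proof -
  have "sum k B = sum k (B_null B \<union> (B_neg B \<union> B_pos B))" using B_parts(1) by simp
  then show ?thesis using B_parts(2,3) finite_parts by (simp add: sum.union_disjoint add.assoc)
qed

lemma ip_add: "ip (F + G) K = ip F K + ip G K"
  by (cases F; cases G; cases K) (simp add: sum.distrib inner_add_left algebra_simps)

lemma ip_scaleR: "ip (c *\<^sub>R F) K = c * ip F K"
  by (cases F; cases K) (simp add: sum_distrib_left algebra_simps)

lemma ip_sym: "ip F K = ip K F"
  by (cases F; cases K) (simp add: inner_commute mult.commute)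

lemma ip_scaleR_right: "ip K (c *\<^sub>R F) = c * ip K F"
  using ip_scaleR[of c F K] by (simp only: ip_sym[of K])

lemma ip_diff: "ip (F - G) K = ip F K - ip G K"
  using ip_add[of "F - G" G K] by simp

lemma subspace_H_tilde: "subspace (H_tilde B)"
  by (rule subspaceI)
    (auto simp: H_tilde_def ell_def zero_prod_def ker_perp_add ker_perp_scaleR subspace_0[OF subspace_ker_perp])

text \<open>Membership in \<open>H_tilde\<close> is what gives definiteness: the sums only see each
  component on its own part of \<open>B\<close>, where the weights are nonzero.\<close>

lemma ip_pos:
  assumes F: "F \<in> H_tilde B" "F \<noteq> 0" shows "0 < ip F F"
proof -
  obtain F1 G1 K1 k1 where Fe: "F = (F1, G1, K1, k1)" by (cases F) auto
  have nn: "0 \<le> (\<Sum>q\<in>B_null B. F1 q * F1 q)" "0 \<le> (\<Sum>q\<in>B_neg B. G1 q * G1 q * \<bar>\<beta> q\<bar>)"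
    "0 \<le> (\<Sum>q\<in>B_pos B. K1 q * K1 q * \<bar>\<beta> q\<bar>)" "0 \<le> k1 \<bullet> k1"
    by (auto intro!: sum_nonneg)
  then have "0 \<le> ip F F" by (simp add: Fe)
  moreover have "ip F F \<noteq> 0"
  proof
    assume "ip F F = 0"
    then have z: "(\<Sum>q\<in>B_null B. F1 q * F1 q) = 0" "(\<Sum>q\<in>B_neg B. G1 q * G1 q * \<bar>\<beta> q\<bar>) = 0"
      "(\<Sum>q\<in>B_pos B. K1 q * K1 q * \<bar>\<beta> q\<bar>) = 0" "k1 \<bullet> k1 = 0"
      using nn unfolding Fe ip_tilde.simps by linarith+
    have ell: "F1 q = 0" if "q \<notin> B_null B" for q using F(1) that by (simp add: Fe H_tilde_def ell_def)
    have ell': "G1 q = 0" if "q \<notin> B_neg B" for q using F(1) that by (simp add: Fe H_tilde_def ell_def)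
    have ell'': "K1 q = 0" if "q \<notin> B_pos B" for q using F(1) that by (simp add: Fe H_tilde_def ell_def)
    have nz: "\<beta> q \<noteq> 0" if "q \<in> B_neg B \<or> q \<in> B_pos B" for q
      using that by (auto simp: B_neg_def B_pos_def)
    have "\<forall>q\<in>B_null B. F1 q * F1 q = 0"
      by (rule sum_nonneg_eq_0_iff[OF finite_parts(1), THEN iffD1, OF _ z(1)]) simp
    then have "F1 q = 0" for q using ell[of q] by auto
    moreover have "\<forall>q\<in>B_neg B. G1 q * G1 q * \<bar>\<beta> q\<bar> = 0"
      by (rule sum_nonneg_eq_0_iff[OF finite_parts(2), THEN iffD1, OF _ z(2)]) simp
    then have "G1 q = 0" for q using ell'[of q] nz[of q] by auto
    moreover have "\<forall>q\<in>B_pos B. K1 q * K1 q * \<bar>\<beta> q\<bar> = 0"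
      by (rule sum_nonneg_eq_0_iff[OF finite_parts(3), THEN iffD1, OF _ z(3)]) simp
    then have "K1 q = 0" for q using ell''[of q] nz[of q] by auto
    ultimately have "F = 0" using z(4) by (simp add: Fe zero_prod_def fun_eq_iff)
    then show False using F(2) by simp
  qed
  ultimately show ?thesis by simp
qed

text \<open>The unprojected tuples, with the normal part of \<open>grad u\<close> already replaced
  by \<open>n q - g q * \<beta> q\<close>. Division by \<open>\<bar>\<beta> q\<bar>\<close> turns
  the second term into \<open>+ g q\<close> on \<open>B_neg\<close> and \<open>- g q\<close> on
  \<open>B_pos\<close>.\<close>

definition TM :: "('a \<Rightarrow> real) \<Rightarrow> ('a \<Rightarrow> real) \<Rightarrow> 'l \<Rightarrow> 'l \<Rightarrow> ('a, 'l) boundary_tuple" where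
  "TM g n z w = (restr (B_null B) (\<lambda>q. (1 / sqrt 2) * (g q + n q)), restr (B_neg B) (\<lambda>q. n q / \<bar>\<beta> q\<bar> + g q),
     restr (B_pos B) (\<lambda>q. n q / \<bar>\<beta> q\<bar>), (1 / sqrt 2) *\<^sub>R (w + z))"

definition TP :: "('a \<Rightarrow> real) \<Rightarrow> ('a \<Rightarrow> real) \<Rightarrow> 'l \<Rightarrow> 'l \<Rightarrow> ('a, 'l) boundary_tuple" where
  "TP g n z w = (restr (B_null B) (\<lambda>q. (1 / sqrt 2) * (g q - n q)), restr (B_neg B) (\<lambda>q. n q / \<bar>\<beta> q\<bar>),
     restr (B_pos B) (\<lambda>q. n q / \<bar>\<beta> q\<bar> - g q), (1 / sqrt 2) *\<^sub>R (w - z))"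

lemma T_H_tilde:
  assumes "z \<in> ker_perp" "w \<in> ker_perp"
  shows "TM g n z w \<in> H_tilde B" "TP g n z w \<in> H_tilde B"
  using assms
  by (auto simp: TM_def TP_def H_tilde_def ell_def restr_def intro: ker_perp_scaleR ker_perp_add ker_perp_diff)

lemma T_add:
  "TM (g + g') (n + n') (z + z') (w + w') = TM g n z w + TM g' n' z' w'"
  "TP (g + g') (n + n') (z + z') (w + w') = TP g n z w + TP g' n' z' w'"
  by (auto simp: TM_def TP_def restr_def fun_eq_iff algebra_simps add_divide_distrib diff_divide_distrib
      scaleR_add_right scaleR_diff_right)

lemma T_scaleR:
  "TM (c *\<^sub>R g) (c *\<^sub>R n) (c *\<^sub>R z) (c *\<^sub>R w) = c *\<^sub>R TM g n z w"
  "TP (c *\<^sub>R g) (c *\<^sub>R n) (c *\<^sub>R z) (c *\<^sub>R w) = c *\<^sub>R TP g n z w"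
  by (auto simp: TM_def TP_def restr_def fun_eq_iff algebra_simps add_divide_distrib diff_divide_distrib
      scaleR_add_right scaleR_diff_right)

lemma T_cong:
  assumes "\<And>q. q \<in> B \<Longrightarrow> g q = g' q" "\<And>q. q \<in> B \<Longrightarrow> n q = n' q"
  shows "TM g n z w = TM g' n' z w" "TP g n z w = TP g' n' z w"
  using assms by (auto simp: TM_def TP_def restr_def fun_eq_iff B_null_def B_neg_def B_pos_def)

lemma T_one: "TM 1 0 0 (- 1 *\<^sub>R vhat) = em" "TP 1 0 0 (- 1 *\<^sub>R vhat) = ep"
  by (auto simp: TM_def TP_def e_minus_def e_plus_def restr_def fun_eq_iff vhat_def)

lemma sum_restr: "(\<Sum>q\<in>S. restr S F q * restr S G q) = (\<Sum>q\<in>S. F q * G q)"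
  "(\<Sum>q\<in>S. restr S F q * restr S G q * k q) = (\<Sum>q\<in>S. F q * G q * k q)"
  by (auto simp: restr_def)

lemma sum_diff_neg:
  assumes "\<And>q. q \<in> S \<Longrightarrow> (P q :: real) - M q = - k q"
  shows "sum P S - sum M S = - sum k S"
  using assms by (simp flip: sum_subtractf sum_negf)

text \<open>On \<open>B_null\<close> and in the last component this is polarization of a product
  into sums and differences, with the factors \<open>1 / sqrt 2\<close> absorbing the constant. On
  the other two parts the squares of \<open>n q / \<bar>\<beta> q\<bar>\<close> cancel, and the sign
  of \<beta> supplies the term with \<open>g q * g' q\<close>.\<close>

lemma boundary_form:
  "ip (TP g n z w) (TP g' n' z' w') - ip (TM g n z w) (TM g' n' z' w') =
    - ((\<Sum>q\<in>B. g q * n' q + g' q * n q - g q * g' q * \<beta> q) + z \<bullet> w' + z' \<bullet> w)"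
proof -
  have half: "(1 / sqrt 2 * x) * (1 / sqrt 2 * y) = x * y / 2" for x y :: real by simp
  let ?k = "\<lambda>q. g q * n' q + g' q * n q - g q * g' q * \<beta> q"
  have 0: "(\<Sum>q\<in>B_null B. (1 / sqrt 2 * (g q - n q)) * (1 / sqrt 2 * (g' q - n' q))) -
      (\<Sum>q\<in>B_null B. (1 / sqrt 2 * (g q + n q)) * (1 / sqrt 2 * (g' q + n' q))) = - sum ?k (B_null B)"
  proof (rule sum_diff_neg)
    fix q assume "q \<in> B_null B"
    then have "\<beta> q = 0" by (simp add: B_null_def)
    then show "(1 / sqrt 2 * (g q - n q)) * (1 / sqrt 2 * (g' q - n' q)) -
        (1 / sqrt 2 * (g q + n q)) * (1 / sqrt 2 * (g' q + n' q)) = - ?k q"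
      unfolding half by (simp add: field_simps)
  qed
  have 1: "(\<Sum>q\<in>B_neg B. n q / \<bar>\<beta> q\<bar> * (n' q / \<bar>\<beta> q\<bar>) * \<bar>\<beta> q\<bar>) -
      (\<Sum>q\<in>B_neg B. (n q / \<bar>\<beta> q\<bar> + g q) * (n' q / \<bar>\<beta> q\<bar> + g' q) * \<bar>\<beta> q\<bar>) = - sum ?k (B_neg B)"
  proof (rule sum_diff_neg)
    fix q assume "q \<in> B_neg B"
    then have "\<beta> q < 0" by (simp add: B_neg_def)
    then show "n q / \<bar>\<beta> q\<bar> * (n' q / \<bar>\<beta> q\<bar>) * \<bar>\<beta> q\<bar> -
        (n q / \<bar>\<beta> q\<bar> + g q) * (n' q / \<bar>\<beta> q\<bar> + g' q) * \<bar>\<beta> q\<bar> = - ?k q"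
      by (simp add: field_simps)
  qed
  have 2: "(\<Sum>q\<in>B_pos B. (n q / \<bar>\<beta> q\<bar> - g q) * (n' q / \<bar>\<beta> q\<bar> - g' q) * \<bar>\<beta> q\<bar>) -
      (\<Sum>q\<in>B_pos B. n q / \<bar>\<beta> q\<bar> * (n' q / \<bar>\<beta> q\<bar>) * \<bar>\<beta> q\<bar>) = - sum ?k (B_pos B)"
  proof (rule sum_diff_neg)
    fix q assume "q \<in> B_pos B"
    then have "0 < \<beta> q" by (simp add: B_pos_def)
    then show "(n q / \<bar>\<beta> q\<bar> - g q) * (n' q / \<bar>\<beta> q\<bar> - g' q) * \<bar>\<beta> q\<bar> -
        n q / \<bar>\<beta> q\<bar> * (n' q / \<bar>\<beta> q\<bar>) * \<bar>\<beta> q\<bar> = - ?k q"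
      by (simp add: field_simps)
  qed
  have "((1 / sqrt 2) *\<^sub>R x) \<bullet> ((1 / sqrt 2) *\<^sub>R y) = (x \<bullet> y) / 2" for x y :: 'l by simp
  then have 3: "((1 / sqrt 2) *\<^sub>R (w - z)) \<bullet> ((1 / sqrt 2) *\<^sub>R (w' - z')) -
      ((1 / sqrt 2) *\<^sub>R (w + z)) \<bullet> ((1 / sqrt 2) *\<^sub>R (w' + z')) = - (z \<bullet> w' + z' \<bullet> w)"
    by (simp only:) (simp add: inner_diff_left inner_diff_right inner_add_left inner_add_right inner_commute[of z' w] field_simps)
  show ?thesis
    unfolding TM_def TP_def ip_tilde.simps sum_restr sum_parts[of ?k] using 0 1 2 3 by linarith
qed

text \<open>The boundary form against the tuples of the constant 1. Its right-hand side is, up to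
  sign, the compatibility defect of the Neumann problem for \<open>u\<close>.\<close>

lemma boundary_form_one:
  "ip (TP g n z w) ep - ip (TM g n z w) em = - ((\<Sum>q\<in>B. n q - g q * \<beta> q) - z \<bullet> vhat)"
  using boundary_form[of g n z w 1 0 0 "- 1 *\<^sub>R vhat"] unfolding T_one by simp

lemma inner_cls_one: "z \<in> ker_perp \<Longrightarrow> z \<bullet> cls 1 = z \<bullet> vhat"
  using h by (simp add: one_dec inner_add_right ker_perp_iff)

text \<open>The equation for \<open>u\<close> tested with the constant 1. It is the reason why a
  single constant can make both tuples orthogonal to their vectors.\<close>

lemma represents_ip:
  assumes r: "represents f g n u z w" shows "ip (TP g n z w) ep = ip (TM g n z w) em"
proof -
  have u: "u \<in> C" and z: "z \<in> ker_perp"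
    and weak: "\<And>\<phi>. \<phi> \<in> C \<Longrightarrow> E u \<phi> = (\<Sum>q\<in>B. \<phi> q * (n q - g q * \<beta> q)) - z \<bullet> cls \<phi>"
    using r by (auto simp: represents_def)
  have "0 = (\<Sum>q\<in>B. n q - g q * \<beta> q) - z \<bullet> vhat"
    using weak[OF one_C] E_one[OF u] inner_cls_one[OF z] by simp
  then show ?thesis using boundary_form_one[of g n z w] by simp
qed

lemma e_H_tilde: "em \<in> H_tilde B" "ep \<in> H_tilde B"
  unfolding T_one[symmetric] by (intro T_H_tilde subspace_0[OF subspace_ker_perp] ker_perp_scaleR vhat_ker)+

lemma H_iff: "F \<in> H_minus B v \<longleftrightarrow> F \<in> H_tilde B \<and> ip F em = 0"
    "F \<in> H_plus B v \<longleftrightarrow> F \<in> H_tilde B \<and> ip F ep = 0"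
  unfolding H_minus_def H_plus_def orth_complement_def real_vector.span_singleton
  by (auto simp: ip_scaleR_right dest: spec[of _ 1])

lemma subspace_H: "subspace (H_minus B v)" "subspace (H_plus B v)"
proof -
  have "ip 0 K = 0" for K using ip_diff[of K K K] by simp
  then have "subspace {F \<in> H_tilde B. ip F e = 0}" for e
    using subspace_H_tilde unfolding subspace_def mem_Collect_eq by (simp only: ip_add ip_scaleR) simp
  moreover have "H_minus B v = {F \<in> H_tilde B. ip F em = 0}" "H_plus B v = {F \<in> H_tilde B. ip F ep = 0}"
    using H_iff by blast+
  ultimately show "subspace (H_minus B v)" "subspace (H_plus B v)" by simp_all
qed

text \<open>\<open>V\<close> is the complement of \<open>e\<close>, so a shift along
  \<open>e\<close> is invisible to the projection. Any other candidate differs from \<open>F\<close>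
  by an element of \<open>V\<close> orthogonal to itself, which settles the definite
  description.\<close>

lemma orth_proj_shift:
  assumes V: "V = {F \<in> H_tilde B. ip F e = 0}" and F: "F \<in> V"
  shows "orth_proj ip V (F + c *\<^sub>R e) = F"
  unfolding orth_proj_def
proof (rule the_equality)
  have "ip (F + c *\<^sub>R e - F) K = 0" if "K \<in> V" for K
    using that V ip_sym[of e K] by (simp add: ip_scaleR)
  with F show "F \<in> V \<and> (\<forall>K\<in>V. ip (F + c *\<^sub>R e - F) K = 0)" by blast
next
  fix G assume G: "G \<in> V \<and> (\<forall>K\<in>V. ip (F + c *\<^sub>R e - G) K = 0)"
  have FGt: "F - G \<in> H_tilde B" using F G V subspace_diff[OF subspace_H_tilde] by blast
  have FGe: "ip (F - G) e = 0" using F G V by (simp add: ip_diff)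
  have "ip (F + c *\<^sub>R e - G) (F - G) = 0" using G FGt FGe V by blast
  moreover have "F + c *\<^sub>R e - G = (F - G) + c *\<^sub>R e" by simp
  moreover have "ip ((F - G) + c *\<^sub>R e) (F - G) = ip (F - G) (F - G) + c * ip (F - G) e"
    unfolding ip_add ip_scaleR ip_sym[of e "F - G"] ..
  ultimately have "ip (F - G) (F - G) = 0" unfolding FGe by simp
  then have "F - G = 0" using ip_pos[OF FGt] by force
  then show "G = F" by simp
qed

lemma represents_difference:
  assumes r: "represents f g n u z w" and r': "represents f g' n' u' z' w'"
  obtains c where "TM g' n' z' w' = TM g n z w + c *\<^sub>R em" "TP g' n' z' w' = TP g n z w + c *\<^sub>R ep"
    "z' = z"
proof -
  have d: "represents 0 (g' + (-1) *\<^sub>R g) (n' + (-1) *\<^sub>R n) (u' + (-1) *\<^sub>R u) (z' + (-1) *\<^sub>R z) (w' + (-1) *\<^sub>R w)"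
    using represents_add[OF r' represents_scaleR[OF r, of "-1"]] by simp
  then obtain c where c: "g' + (-1) *\<^sub>R g = c *\<^sub>R 1" "\<And>q. q \<in> B \<Longrightarrow> (n' + (-1) *\<^sub>R n) q = 0"
      "z' + (-1) *\<^sub>R z = 0" "w' + (-1) *\<^sub>R w = - c *\<^sub>R vhat"
    by (rule represents_zero) (rule that)
  have z: "z' = z + c *\<^sub>R 0" using c(3) by simp
  have w: "w' = w + c *\<^sub>R (- 1 *\<^sub>R vhat)" using c(4) by (simp add: algebra_simps)
  have gq: "g' q = (g + c *\<^sub>R 1) q" for q using fun_cong[OF c(1), of q] by simp
  have nq: "n' q = (n + c *\<^sub>R 0) q" if "q \<in> B" for q using c(2)[OF that] by simp
  show thesis
  proof (rule that[of c])
    show "TM g' n' z' w' = TM g n z w + c *\<^sub>R em" "TP g' n' z' w' = TP g n z w + c *\<^sub>R ep"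
      using T_cong[of g' "g + c *\<^sub>R 1" n' "n + c *\<^sub>R 0" z' w', OF gq nq]
      unfolding z w T_add T_scaleR T_one by blast+
    show "z' = z" using c(3) by simp
  qed
qed

lemma represents_tuples:
  assumes r: "represents f g n u z w"
  shows "(restr (B_null B) (\<lambda>q. (1 / sqrt 2) * (g q + normal_at B (star f) q)),
        restr (B_neg B) (\<lambda>q. normal_at B (grad u) q / \<bar>\<beta> q\<bar>),
        restr (B_pos B) (\<lambda>q. normal_at B (star f) q / \<bar>\<beta> q\<bar>),
        (1 / sqrt 2) *\<^sub>R (w + z_part B f g)) = TM g n z w"
    and "(restr (B_null B) (\<lambda>q. (1 / sqrt 2) * (g q - normal_at B (star f) q)),
        restr (B_neg B) (\<lambda>q. normal_at B (star f) q / \<bar>\<beta> q\<bar>),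
        restr (B_pos B) (\<lambda>q. normal_at B (grad u) q / \<bar>\<beta> q\<bar>),
        (1 / sqrt 2) *\<^sub>R (w - z_part B f g)) = TP g n z w"
proof -
  have n: "normal_at B (star f) q = n q" "normal_at B (grad u) q = n q - g q * \<beta> q" if "q \<in> B" for q
    using represents_perp(3)[OF r that] represents_normal_grad[OF r that] by auto
  have neg: "normal_at B (grad u) q / \<bar>\<beta> q\<bar> = n q / \<bar>\<beta> q\<bar> + g q" if "q \<in> B_neg B" for q
    using that n(2)[of q] by (simp add: B_neg_def field_simps)
  have pos: "normal_at B (grad u) q / \<bar>\<beta> q\<bar> = n q / \<bar>\<beta> q\<bar> - g q" if "q \<in> B_pos B" for q
    using that n(2)[of q] by (simp add: B_pos_def field_simps)
  have sub: "B_null B \<subseteq> B" "B_neg B \<subseteq> B" "B_pos B \<subseteq> B" by (auto simp: B_null_def B_neg_def B_pos_def)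
  show "(restr (B_null B) (\<lambda>q. (1 / sqrt 2) * (g q + normal_at B (star f) q)),
        restr (B_neg B) (\<lambda>q. normal_at B (grad u) q / \<bar>\<beta> q\<bar>),
        restr (B_pos B) (\<lambda>q. normal_at B (star f) q / \<bar>\<beta> q\<bar>),
        (1 / sqrt 2) *\<^sub>R (w + z_part B f g)) = TM g n z w"
    "(restr (B_null B) (\<lambda>q. (1 / sqrt 2) * (g q - normal_at B (star f) q)),
        restr (B_neg B) (\<lambda>q. normal_at B (star f) q / \<bar>\<beta> q\<bar>),
        restr (B_pos B) (\<lambda>q. normal_at B (grad u) q / \<bar>\<beta> q\<bar>),
        (1 / sqrt 2) *\<^sub>R (w - z_part B f g)) = TP g n z w"
    unfolding TM_def TP_def represents_canonical(2)[OF r]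
    using n(1) neg pos sub by (auto simp: restr_def fun_eq_iff)
qed

text \<open>Another canonical representation changes the tuple by a multiple of \<open>em\<close>,
  which the projection removes. Hence the definite description has exactly one solution.\<close>

lemma G_minus_eq:
  assumes r: "represents f g n u z w" and mem: "TM g n z w \<in> H_minus B v"
  shows "G_minus B v f = TM g n z w"
  unfolding G_minus_def
proof (rule the_equality)
  have Hm: "H_minus B v = {F \<in> H_tilde B. ip F em = 0}" using H_iff(1) by blast
  have "orth_proj ip (H_minus B v) (TM g n z w + 0 *\<^sub>R em) = TM g n z w" by (rule orth_proj_shift[OF Hm mem])
  then have "orth_proj ip (H_minus B v) (TM g n z w) = TM g n z w" by simp
  then show "\<exists>g' u w'. canonical_representation B f g' u w' \<and> TM g n z w = orth_proj ip (H_minus B v)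
       (restr (B_null B) (\<lambda>q. (1 / sqrt 2) * (g' q + normal_at B (star f) q)),
        restr (B_neg B) (\<lambda>q. normal_at B (grad u) q / \<bar>\<beta> q\<bar>),
        restr (B_pos B) (\<lambda>q. normal_at B (star f) q / \<bar>\<beta> q\<bar>),
        (1 / sqrt 2) *\<^sub>R (w' + z_part B f g'))"
    using represents_canonical(1)[OF r] represents_tuples(1)[OF r]
    by (intro exI[of _ g] exI[of _ u] exI[of _ w]) (simp only: simp_thms)
  fix F assume "\<exists>g' u w'. canonical_representation B f g' u w' \<and> F = orth_proj ip (H_minus B v)
       (restr (B_null B) (\<lambda>q. (1 / sqrt 2) * (g' q + normal_at B (star f) q)),
        restr (B_neg B) (\<lambda>q. normal_at B (grad u) q / \<bar>\<beta> q\<bar>),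
        restr (B_pos B) (\<lambda>q. normal_at B (star f) q / \<bar>\<beta> q\<bar>),
        (1 / sqrt 2) *\<^sub>R (w' + z_part B f g'))"
  then obtain g' u' w' where c: "canonical_representation B f g' u' w'"
    and F: "F = orth_proj ip (H_minus B v)
       (restr (B_null B) (\<lambda>q. (1 / sqrt 2) * (g' q + normal_at B (star f) q)),
        restr (B_neg B) (\<lambda>q. normal_at B (grad u') q / \<bar>\<beta> q\<bar>),
        restr (B_pos B) (\<lambda>q. normal_at B (star f) q / \<bar>\<beta> q\<bar>),
        (1 / sqrt 2) *\<^sub>R (w' + z_part B f g'))"
    by blast
  have r': "represents f g' (normal_at B (star f)) u' (z_part B f g') w'"
    by (rule canonical_represents[OF represents_perp(1)[OF r] c])
  obtain k where k: "TM g' (normal_at B (star f)) (z_part B f g') w' = TM g n z w + k *\<^sub>R em"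
    by (rule represents_difference[OF r r'])
  show "F = TM g n z w"
    unfolding F represents_tuples(1)[OF r'] k by (rule orth_proj_shift[OF Hm mem])
qed

lemma G_plus_eq:
  assumes r: "represents f g n u z w" and mem: "TP g n z w \<in> H_plus B v"
  shows "G_plus B v f = TP g n z w"
  unfolding G_plus_def
proof (rule the_equality)
  have Hp: "H_plus B v = {F \<in> H_tilde B. ip F ep = 0}" using H_iff(2) by blast
  have "orth_proj ip (H_plus B v) (TP g n z w + 0 *\<^sub>R ep) = TP g n z w" by (rule orth_proj_shift[OF Hp mem])
  then have "orth_proj ip (H_plus B v) (TP g n z w) = TP g n z w" by simp
  then show "\<exists>g' u w'. canonical_representation B f g' u w' \<and> TP g n z w = orth_proj ip (H_plus B v)
       (restr (B_null B) (\<lambda>q. (1 / sqrt 2) * (g' q - normal_at B (star f) q)),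
        restr (B_neg B) (\<lambda>q. normal_at B (star f) q / \<bar>\<beta> q\<bar>),
        restr (B_pos B) (\<lambda>q. normal_at B (grad u) q / \<bar>\<beta> q\<bar>),
        (1 / sqrt 2) *\<^sub>R (w' - z_part B f g'))"
    using represents_canonical(1)[OF r] represents_tuples(2)[OF r]
    by (intro exI[of _ g] exI[of _ u] exI[of _ w]) (simp only: simp_thms)
  fix F assume "\<exists>g' u w'. canonical_representation B f g' u w' \<and> F = orth_proj ip (H_plus B v)
       (restr (B_null B) (\<lambda>q. (1 / sqrt 2) * (g' q - normal_at B (star f) q)),
        restr (B_neg B) (\<lambda>q. normal_at B (star f) q / \<bar>\<beta> q\<bar>),
        restr (B_pos B) (\<lambda>q. normal_at B (grad u) q / \<bar>\<beta> q\<bar>),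
        (1 / sqrt 2) *\<^sub>R (w' - z_part B f g'))"
  then obtain g' u' w' where c: "canonical_representation B f g' u' w'"
    and F: "F = orth_proj ip (H_plus B v)
       (restr (B_null B) (\<lambda>q. (1 / sqrt 2) * (g' q - normal_at B (star f) q)),
        restr (B_neg B) (\<lambda>q. normal_at B (star f) q / \<bar>\<beta> q\<bar>),
        restr (B_pos B) (\<lambda>q. normal_at B (grad u') q / \<bar>\<beta> q\<bar>),
        (1 / sqrt 2) *\<^sub>R (w' - z_part B f g'))"
    by blast
  have r': "represents f g' (normal_at B (star f)) u' (z_part B f g') w'"
    by (rule canonical_represents[OF represents_perp(1)[OF r] c])
  obtain k where k: "TP g' (normal_at B (star f)) (z_part B f g') w' = TP g n z w + k *\<^sub>R ep"
    by (rule represents_difference[OF r r'])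
  show "F = TP g n z w"
    unfolding F represents_tuples(2)[OF r'] k by (rule orth_proj_shift[OF Hp mem])
qed

section \<open>Normalized representations and the boundary maps\<close>

definition normalized where
  "normalized f g n u z w \<longleftrightarrow> represents f g n u z w \<and> ip (TM g n z w) em = 0"

text \<open>Orthogonality is imposed on the minus tuple alone; \<open>represents_ip\<close>
  transfers it to the plus tuple.\<close>

lemma normalized_G:
  assumes "normalized f g n u z w"
  shows "G_minus B v f = TM g n z w" "G_plus B v f = TP g n z w"
    "TM g n z w \<in> H_minus B v" "TP g n z w \<in> H_plus B v"
proof -
  have r: "represents f g n u z w" and e: "ip (TM g n z w) em = 0" using assms by (auto simp: normalized_def)
  have zw: "z \<in> ker_perp" "w \<in> ker_perp" using r by (auto simp: represents_def)
  show m: "TM g n z w \<in> H_minus B v" "TP g n z w \<in> H_plus B v"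
    using T_H_tilde[OF zw] e represents_ip[OF r] by (auto simp: H_iff)
  show "G_minus B v f = TM g n z w" "G_plus B v f = TP g n z w"
    using G_minus_eq[OF r m(1)] G_plus_eq[OF r m(2)] .
qed

lemma normalized_exists:
  assumes f: "f \<in> perp_dom B"
  obtains g n u z w where "normalized f g n u z w"
proof -
  obtain g u z w where r: "represents f g (normal_at B (star f)) u z w" by (rule represents_exists[OF f])
  let ?n = "normal_at B (star f)"
  define c where "c = - ip (TM g ?n z w) em / ip em em"
  have r': "represents f (g + c *\<^sub>R 1) (?n + c *\<^sub>R 0) (u + c *\<^sub>R (- 1 *\<^sub>R h)) (z + c *\<^sub>R 0) (w + c *\<^sub>R (- 1 *\<^sub>R vhat))"
    using represents_add[OF r represents_scaleR[OF represents_zero_one, of c]] by (simp only: scaleR_zero_right add_0_right)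
  have T: "TM (g + c *\<^sub>R 1) (?n + c *\<^sub>R 0) (z + c *\<^sub>R 0) (w + c *\<^sub>R (- 1 *\<^sub>R vhat)) = TM g ?n z w + c *\<^sub>R em"
    unfolding T_add T_scaleR T_one ..
  have "ip (TM g ?n z w + c *\<^sub>R em) em = 0"
  \<comment> \<open>If \<open>em\<close> vanishes, the quotient defining \<open>c\<close> is 0 by
    convention and the orthogonality condition is void.\<close>
  proof (cases "em = 0")
    case True
    have "ip K em = 0" for K using ip_scaleR_right[of K 0 em] True by simp
    then show ?thesis by this
  next
    case False
    then have "ip em em \<noteq> 0" using ip_pos[OF e_H_tilde(1)] by simp
    then show ?thesis by (simp only: ip_add ip_scaleR) (simp add: c_def)
  qed
  then have "normalized f (g + c *\<^sub>R 1) (?n + c *\<^sub>R 0) (u + c *\<^sub>R (- 1 *\<^sub>R h)) (z + c *\<^sub>R 0) (w + c *\<^sub>R (- 1 *\<^sub>R vhat))"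
    unfolding normalized_def T using r' by blast
  then show thesis by (rule that)
qed

lemma G_add:
  assumes "f \<in> perp_dom B" "f' \<in> perp_dom B"
  shows "f + f' \<in> perp_dom B" "G_minus B v (f + f') = G_minus B v f + G_minus B v f'"
    "G_plus B v (f + f') = G_plus B v f + G_plus B v f'"
proof -
  obtain g n u z w where f: "normalized f g n u z w" by (rule normalized_exists[OF assms(1)])
  obtain g' n' u' z' w' where f': "normalized f' g' n' u' z' w'" by (rule normalized_exists[OF assms(2)])
  have r: "represents (f + f') (g + g') (n + n') (u + u') (z + z') (w + w')"
    using f f' unfolding normalized_def by (blast intro: represents_add)
  have "ip (TM (g + g') (n + n') (z + z') (w + w')) em = 0"
    using f f' unfolding normalized_def T_add ip_add by simp
  then have N: "normalized (f + f') (g + g') (n + n') (u + u') (z + z') (w + w')"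
    using r unfolding normalized_def by blast
  show "f + f' \<in> perp_dom B" by (rule represents_perp(1)[OF r])
  show "G_minus B v (f + f') = G_minus B v f + G_minus B v f'"
    "G_plus B v (f + f') = G_plus B v f + G_plus B v f'"
    unfolding normalized_G[OF N] normalized_G[OF f] normalized_G[OF f'] T_add by (rule refl)+
qed

lemma G_scaleR:
  assumes "f \<in> perp_dom B"
  shows "c *\<^sub>R f \<in> perp_dom B" "G_minus B v (c *\<^sub>R f) = c *\<^sub>R G_minus B v f"
    "G_plus B v (c *\<^sub>R f) = c *\<^sub>R G_plus B v f"
proof -
  obtain g n u z w where f: "normalized f g n u z w" by (rule normalized_exists[OF assms(1)])
  have r: "represents (c *\<^sub>R f) (c *\<^sub>R g) (c *\<^sub>R n) (c *\<^sub>R u) (c *\<^sub>R z) (c *\<^sub>R w)"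
    using f unfolding normalized_def by (blast intro: represents_scaleR)
  have "ip (TM (c *\<^sub>R g) (c *\<^sub>R n) (c *\<^sub>R z) (c *\<^sub>R w)) em = 0"
    using f unfolding normalized_def T_scaleR ip_scaleR by simp
  then have N: "normalized (c *\<^sub>R f) (c *\<^sub>R g) (c *\<^sub>R n) (c *\<^sub>R u) (c *\<^sub>R z) (c *\<^sub>R w)"
    using r unfolding normalized_def by blast
  show "c *\<^sub>R f \<in> perp_dom B" by (rule represents_perp(1)[OF r])
  show "G_minus B v (c *\<^sub>R f) = c *\<^sub>R G_minus B v f"
    "G_plus B v (c *\<^sub>R f) = c *\<^sub>R G_plus B v f"
    unfolding normalized_G[OF N] normalized_G[OF f] T_scaleR by (rule refl)+
qed

text \<open>\<open>represents_parts\<close> is applied to each element with the function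
  \<open>g\<close> of the other as test function. The components in \<open>ker_perp\<close> are
  orthogonal to the range of \<open>D\<close>, and \<open>boundary_form\<close> matches what
  remains.\<close>

lemma green:
  assumes "f \<in> perp_dom B" "f' \<in> perp_dom B"
  shows "- perp B f \<bullet> f' + f \<bullet> - perp B f' =
    ip (G_plus B v f) (G_plus B v f') - ip (G_minus B v f) (G_minus B v f')"
proof -
  obtain g n u z w where N: "normalized f g n u z w" by (rule normalized_exists[OF assms(1)])
  obtain g' n' u' z' w' where N': "normalized f' g' n' u' z' w'" by (rule normalized_exists[OF assms(2)])
  have r: "represents f g n u z w" and r': "represents f' g' n' u' z' w'"
    using N N' by (auto simp: normalized_def)
  have a: "g \<in> C" "u \<in> C" "z \<in> ker_perp" "f = cls g + D u + w"
    and a': "g' \<in> C" "u' \<in> C" "z' \<in> ker_perp" "f' = cls g' + D u' + w'"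
    using r r' by (auto simp: represents_def)
  have zf': "z \<bullet> f' = z \<bullet> cls g' + z \<bullet> w'" using a(3) a' by (simp add: ker_perp_iff inner_add_right)
  have z'f: "z' \<bullet> f = z' \<bullet> cls g + z' \<bullet> w" using a'(3) a by (simp add: ker_perp_iff inner_add_right)
  have 1: "f' \<bullet> D g = - (D g' \<bullet> cls g + z' \<bullet> cls g) + (\<Sum>q\<in>B. g q * n' q)"
    using represents_parts[OF r' a(1)] by (simp add: inner_add_left)
  have 2: "f \<bullet> D g' = - (D g \<bullet> cls g' + z \<bullet> cls g') + (\<Sum>q\<in>B. g' q * n q)"
    using represents_parts[OF r a'(1)] by (simp add: inner_add_left)
  have 3: "D g' \<bullet> cls g + D g \<bullet> cls g' = (\<Sum>q\<in>B. g q * g' q * \<beta> q)"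
    using D_parts[OF a(1) a'(1)] by (simp add: inner_commute)
  have S: "(\<Sum>q\<in>B. g q * n' q + g' q * n q - g q * g' q * \<beta> q) =
      (\<Sum>q\<in>B. g q * n' q) + (\<Sum>q\<in>B. g' q * n q) - (\<Sum>q\<in>B. g q * g' q * \<beta> q)"
    by (simp add: sum.distrib sum_subtractf)
  have L: "- perp B f \<bullet> f' + f \<bullet> - perp B f' = - (f' \<bullet> D g + z \<bullet> f' + (f \<bullet> D g' + z' \<bullet> f))"
    unfolding represents_perp(2)[OF r] represents_perp(2)[OF r']
    by (simp add: inner_add_left inner_add_right inner_diff_left inner_diff_right inner_commute[of "D g"] inner_commute[of f z'])
  show ?thesis
    unfolding L normalized_G[OF N] normalized_G[OF N'] boundary_form S zf' z'f
    using 1 2 3 by linarith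
qed

lemma G_surj:
  assumes Fm: "Fm \<in> H_minus B v" and Fp: "Fp \<in> H_plus B v"
  obtains f where "f \<in> perp_dom B" "G_minus B v f = Fm" "G_plus B v f = Fp"
proof -
  obtain a1 b1 c1 k1 where m: "Fm = (a1, b1, c1, k1)" by (cases Fm) auto
  obtain a2 b2 c2 k2 where p: "Fp = (a2, b2, c2, k2)" by (cases Fp) auto
  have mem: "a1 \<in> ell (B_null B)" "b1 \<in> ell (B_neg B)" "c1 \<in> ell (B_pos B)" "k1 \<in> ker_perp"
    "a2 \<in> ell (B_null B)" "b2 \<in> ell (B_neg B)" "c2 \<in> ell (B_pos B)" "k2 \<in> ker_perp"
    using Fm Fp by (auto simp: H_iff H_tilde_def m p)
  \<comment> \<open>The equations \<open>TM \<gamma> n z w = Fm\<close> and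
    \<open>TP \<gamma> n z w = Fp\<close> solved for the four unknowns, separately on each part of
    \<open>B\<close>.\<close>
  define \<gamma> where "\<gamma> q = (if \<beta> q = 0 then (a1 q + a2 q) / sqrt 2 else if \<beta> q < 0 then b1 q - b2 q else c1 q - c2 q)" for q
  define n where "n q = (if \<beta> q = 0 then (a1 q - a2 q) / sqrt 2 else if \<beta> q < 0 then b2 q * \<bar>\<beta> q\<bar> else c1 q * \<bar>\<beta> q\<bar>)" for q
  define z where "z = (1 / sqrt 2) *\<^sub>R (k1 - k2)"
  define w where "w = (1 / sqrt 2) *\<^sub>R (k1 + k2)"
  have zw: "z \<in> ker_perp" "w \<in> ker_perp"
    unfolding z_def w_def by (intro ker_perp_scaleR ker_perp_diff ker_perp_add mem)+
  have s: "1 / sqrt 2 * ((x + y) / sqrt 2 + (x - y) / sqrt 2) = x"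
    "1 / sqrt 2 * ((x + y) / sqrt 2 - (x - y) / sqrt 2) = y" for x y :: real
    by (simp_all add: field_simps)
  have "(1 / sqrt 2) *\<^sub>R (w + z) = k1" "(1 / sqrt 2) *\<^sub>R (w - z) = k2"
  proof -
    have "w + z = (2 / sqrt 2) *\<^sub>R k1" "w - z = (2 / sqrt 2) *\<^sub>R k2"
      unfolding w_def z_def by (simp_all add: scaleR_add_right scaleR_diff_right flip: scaleR_add_left)
    then show "(1 / sqrt 2) *\<^sub>R (w + z) = k1" "(1 / sqrt 2) *\<^sub>R (w - z) = k2" by simp_all
  qed
  then have TM: "TM \<gamma> n z w = Fm" and TP: "TP \<gamma> n z w = Fp"
    using mem s unfolding TM_def TP_def m p
    by (auto simp: fun_eq_iff restr_def ell_def B_null_def B_neg_def B_pos_def \<gamma>_def n_def)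
  \<comment> \<open>The tuples depend on \<open>g\<close> only through its values on
    \<open>B\<close>, so any interpolating function in \<open>C\<close> will do.\<close>
  obtain g where g: "g \<in> C" "\<And>q. q \<in> B \<Longrightarrow> g q = \<gamma> q" using interpolation[OF fin, of \<gamma>] by metis
  have TMg: "TM g n z w = Fm" and TPg: "TP g n z w = Fp"
    using T_cong[of g \<gamma> n n z w] g(2) TM TP by auto
  define L where "L \<phi> = (\<Sum>q\<in>B. \<phi> q * (n q - g q * \<beta> q)) - z \<bullet> cls \<phi>" for \<phi>
  obtain u where u: "u \<in> C" "\<And>\<phi>. \<phi> \<in> C \<Longrightarrow> E u \<phi> = L \<phi>"
  proof (rule neumann[of L "(\<Sum>q\<in>B. \<bar>n q - g q * \<beta> q\<bar>) + norm z * norm b"])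
    show "L (\<phi> + \<psi>) = L \<phi> + L \<psi>" if "\<phi> \<in> C" "\<psi> \<in> C" for \<phi> \<psi>
      unfolding L_def cls_add[OF C_Cc'[OF that(1)] C_Cc'[OF that(2)]]
      by (simp add: inner_add_right sum.distrib sum_subtractf algebra_simps)
    show "L (c *\<^sub>R \<phi>) = c * L \<phi>" if "\<phi> \<in> C" for c \<phi>
      unfolding L_def cls_scaleR[OF C_Cc'[OF that]]
      by (simp add: right_diff_distrib sum_distrib_left mult.assoc)
    show "\<bar>L \<phi>\<bar> \<le> ((\<Sum>q\<in>B. \<bar>n q - g q * \<beta> q\<bar>) + norm z * norm b) * sup_norm \<phi>" if \<phi>: "\<phi> \<in> C" for \<phi>
    proof -
      note c = C_Cc'[OF \<phi>]
      have "\<bar>\<Sum>q\<in>B. \<phi> q * (n q - g q * \<beta> q)\<bar> \<le> (\<Sum>q\<in>B. \<bar>\<phi> q * (n q - g q * \<beta> q)\<bar>)" by (rule sum_abs)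
      also have "\<dots> \<le> (\<Sum>q\<in>B. sup_norm \<phi> * \<bar>n q - g q * \<beta> q\<bar>)"
        using abs_le_sup[OF c] by (intro sum_mono) (simp add: abs_mult mult_right_mono)
      finally have 1: "\<bar>\<Sum>q\<in>B. \<phi> q * (n q - g q * \<beta> q)\<bar> \<le> sup_norm \<phi> * (\<Sum>q\<in>B. \<bar>n q - g q * \<beta> q\<bar>)"
        by (simp only: sum_distrib_left)
      have nc: "norm (cls \<phi>) = norm (act \<phi> b)" by (simp only: norm_eq_sqrt_inner cls_inner_Cc[OF c c])
      have "norm (act \<phi> b) \<le> sup_norm \<phi> * norm b" by (rule act_norm[OF c abs_le_sup[OF c]])
      then have "norm z * norm (cls \<phi>) \<le> norm z * (sup_norm \<phi> * norm b)" unfolding nc by (rule mult_left_mono) simp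
      then have 2: "\<bar>z \<bullet> cls \<phi>\<bar> \<le> norm z * (sup_norm \<phi> * norm b)"
        using Cauchy_Schwarz_ineq2[of z "cls \<phi>"] by linarith
      have "\<bar>L \<phi>\<bar> \<le> sup_norm \<phi> * (\<Sum>q\<in>B. \<bar>n q - g q * \<beta> q\<bar>) + norm z * (sup_norm \<phi> * norm b)"
        unfolding L_def using 1 2 by linarith
      then show ?thesis by (simp add: algebra_simps)
    qed
    \<comment> \<open>By \<open>boundary_form_one\<close> the difference of these two conditions is
      the compatibility condition \<open>L 1 = 0\<close>.\<close>
    have "ip Fm em = 0" "ip Fp ep = 0" using Fm Fp by (auto simp: H_iff)
    then show "L 1 = 0"
      using boundary_form_one[of g n z w] inner_cls_one[OF zw(1)] unfolding TMg TPg by (simp add: L_def)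
  qed (rule that)
  define f where "f = cls g + D u + w"
  have r: "represents f g n u z w"
    unfolding represents_def f_def using g(1) u zw by (simp add: L_def)
  have "ip (TM g n z w) em = 0" unfolding TMg using Fm by (simp add: H_iff)
  with r have N: "normalized f g n u z w" by (simp add: normalized_def)
  show thesis
    using that[OF represents_perp(1)[OF r]] normalized_G(1,2)[OF N] TMg TPg by simp
qed

text \<open>The sign in \<open>max_extension\<close> cancels the one in \<open>skew_graph\<close>,
  and \<open>star\<close> is unitary; what remains is the adjoint of the gradient at
  \<open>star f\<close>. Its value is therefore minus \<open>perp\<close>.\<close>

lemma max_extension_iff: "(f, y) \<in> max_extension (skew_graph B) \<longleftrightarrow> (star f, y) \<in> adjoint_graph (grad_graph B)"
proof -
  have "(f, y) \<in> max_extension (skew_graph B) \<longleftrightarrow> (\<forall>\<phi>\<in>vanishing B. D \<phi> \<bullet> f = cls \<phi> \<bullet> y)"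
    unfolding max_extension_def adjoint_graph_def skew_graph_def D_def by force
  also have "\<dots> \<longleftrightarrow> (\<forall>\<phi>\<in>vanishing B. star f \<bullet> grad \<phi> = y \<bullet> cls \<phi>)"
    by (simp only: inner_commute[of "D _"] inner_D inner_commute[of "cls _"])
  also have "\<dots> \<longleftrightarrow> (star f, y) \<in> adjoint_graph (grad_graph B)" by (simp only: adjoint_grad_iff)
  finally show ?thesis .
qed

lemma Domain_max_extension: "Domain (max_extension (skew_graph B)) = perp_dom B"
  by (auto simp: Domain_iff max_extension_iff perp_dom_def coderiv_dom_def)

lemma op_value_max_extension: "op_value (max_extension (skew_graph B)) f = - perp B f"
  by (simp add: op_value_def max_extension_iff perp_def coderiv_def)

text \<open>Skewness is \<open>D_parts\<close> with vanishing boundary sum. Different functions may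
  have the same class, so single-valuedness needs an argument: by skewness two values have equal
  products with the dense domain.\<close>

lemma densely_defined_skew_graph: "densely_defined_skew (skew_graph B)"
  unfolding densely_defined_skew_def
proof (intro conjI)
  have graph: "skew_graph B = (\<lambda>\<phi>. (cls \<phi>, - D \<phi>)) ` vanishing B"
    by (auto simp: skew_graph_def D_def)
  have skew: "- D \<phi> \<bullet> cls \<psi> = - (cls \<phi> \<bullet> - D \<psi>)" if "\<phi> \<in> vanishing B" "\<psi> \<in> vanishing B" for \<phi> \<psi>
  proof -
    have "(\<Sum>q\<in>B. \<phi> q * \<psi> q * \<beta> q) = 0" using that by (simp add: vanishing_def)
    then show ?thesis
      using D_parts[OF vanishing_C[OF that(1)] vanishing_C[OF that(2)]] by (simp add: inner_commute add_eq_0_iff)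
  qed
  then show "\<forall>(x, y)\<in>skew_graph B. \<forall>(x', y')\<in>skew_graph B. y \<bullet> x' = - (x \<bullet> y')"
    unfolding graph by blast
  have "Domain (skew_graph B) = cls ` vanishing B" unfolding graph by force
  then show "closure (Domain (skew_graph B)) = UNIV" using dense_vanishing[OF fin] by simp
  show sub: "subspace (skew_graph B)"
    unfolding graph
  proof (rule subspaceI)
    have "cls (0 *\<^sub>R 1) = 0 *\<^sub>R cls 1" by (rule cls_scaleR[OF Cc_one])
    moreover have "D (0 *\<^sub>R 1) = 0 *\<^sub>R D 1" by (rule D_scaleR)
    moreover have "(0 :: real) *\<^sub>R (1 :: 'a \<Rightarrow> real) = 0" by (simp add: fun_eq_iff)
    ultimately have "(cls 0, - D 0) = 0" by (simp add: zero_prod_def)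
    from image_eqI[of 0 "\<lambda>\<phi>. (cls \<phi>, - D \<phi>)", OF this[symmetric] subspace_0[OF subspace_vanishing]]
    show "0 \<in> (\<lambda>\<phi>. (cls \<phi>, - D \<phi>)) ` vanishing B" .
  next
    fix x y assume xy: "x \<in> (\<lambda>\<phi>. (cls \<phi>, - D \<phi>)) ` vanishing B" "y \<in> (\<lambda>\<phi>. (cls \<phi>, - D \<phi>)) ` vanishing B"
    then obtain \<phi> \<psi> where p: "\<phi> \<in> vanishing B" "\<psi> \<in> vanishing B" "x = (cls \<phi>, - D \<phi>)" "y = (cls \<psi>, - D \<psi>)" by blast
    have "x + y = (cls (\<phi> + \<psi>), - D (\<phi> + \<psi>))"
      unfolding p(3,4) D_add cls_add[OF C_Cc'[OF vanishing_C[OF p(1)]] C_Cc'[OF vanishing_C[OF p(2)]]] by simp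
    then show "x + y \<in> (\<lambda>\<phi>. (cls \<phi>, - D \<phi>)) ` vanishing B"
      using subspace_add[OF subspace_vanishing p(1,2)] by (rule image_eqI)
  next
    fix c x assume x: "x \<in> (\<lambda>\<phi>. (cls \<phi>, - D \<phi>)) ` vanishing B"
    then obtain \<phi> where p: "\<phi> \<in> vanishing B" "x = (cls \<phi>, - D \<phi>)" by blast
    have "c *\<^sub>R x = (cls (c *\<^sub>R \<phi>), - D (c *\<^sub>R \<phi>))"
      unfolding p(2) D_scaleR cls_scaleR[OF C_Cc'[OF vanishing_C[OF p(1)]]] by simp
    then show "c *\<^sub>R x \<in> (\<lambda>\<phi>. (cls \<phi>, - D \<phi>)) ` vanishing B"
      using subspace_scale[OF subspace_vanishing p(1)] by (rule image_eqI)
  qed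
  show "single_valued (skew_graph B)"
  proof (rule single_valuedI)
    fix x y y' assume "(x, y) \<in> skew_graph B" "(x, y') \<in> skew_graph B"
    then obtain \<phi> \<psi> where p: "\<phi> \<in> vanishing B" "\<psi> \<in> vanishing B" "x = cls \<phi>" "y = - D \<phi>" "x = cls \<psi>" "y' = - D \<psi>"
      unfolding graph by blast
    have "(y - y') \<bullet> k = 0" if k: "k \<in> cls ` vanishing B" for k
    proof -
      obtain \<eta> where e: "\<eta> \<in> vanishing B" "k = cls \<eta>" using k by blast
      show ?thesis
        using skew[OF p(1) e(1)] skew[OF p(2) e(1)] p e(2) by (simp only: inner_diff_left diff_self)
    qed
    then have "y - y' = 0" by (rule orthogonal_dense_eq_0[OF dense_vanishing[OF fin]])
    then show "y = y'" by simp
  qed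
qed

lemma pre_hilbert_H: "pre_hilbert (H_minus B v) ip" "pre_hilbert (H_plus B v) ip"
proof -
  have "pre_hilbert H ip" if "subspace H" "H \<subseteq> H_tilde B" for H
    unfolding pre_hilbert_def
  proof (intro conjI ballI allI impI)
    fix F G K c assume F: "F \<in> H"
    show "ip F G = ip G F" by (rule ip_sym)
    show "ip (F + G) K = ip F K + ip G K" by (rule ip_add)
    show "ip (c *\<^sub>R F) G = c * ip F G" by (rule ip_scaleR)
    show "0 < ip F F" if "F \<noteq> 0" using ip_pos[OF subsetD[OF \<open>H \<subseteq> H_tilde B\<close> F] that] .
  qed (rule that(1))
  moreover have "H_minus B v \<subseteq> H_tilde B" "H_plus B v \<subseteq> H_tilde B" using H_iff by blast+
  ultimately show "pre_hilbert (H_minus B v) ip" "pre_hilbert (H_plus B v) ip" using subspace_H by blast+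
qed

theorem boundary_quadruple_G:
  "boundary_quadruple (skew_graph B) (H_minus B v) ip (H_plus B v) ip (G_minus B v) (G_plus B v)"
  unfolding boundary_quadruple_def Let_def Domain_max_extension op_value_max_extension
proof (intro conjI)
  show "densely_defined_skew (skew_graph B)" by (rule densely_defined_skew_graph)
  show "pre_hilbert (H_minus B v) ip" "pre_hilbert (H_plus B v) ip" by (rule pre_hilbert_H)+
  show "linear_map_on (perp_dom B) (G_minus B v)" "linear_map_on (perp_dom B) (G_plus B v)"
    by (simp_all add: linear_map_on_def G_add(2,3) G_scaleR(2,3))
  show "\<forall>f1\<in>perp_dom B. \<forall>f2\<in>perp_dom B. - perp B f1 \<bullet> f2 + f1 \<bullet> - perp B f2 =
      ip (G_plus B v f1) (G_plus B v f2) - ip (G_minus B v f1) (G_minus B v f2)"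
    using green by (intro ballI)
  have mem: "G_minus B v f \<in> H_minus B v \<and> G_plus B v f \<in> H_plus B v" if f: "f \<in> perp_dom B" for f
  proof -
    obtain g n u z w where N: "normalized f g n u z w" by (rule normalized_exists[OF f])
    show ?thesis using normalized_G[OF N] by simp
  qed
  note zero = subspace_0[OF subspace_H(1)] subspace_0[OF subspace_H(2)]
  show "{x + y |x y. x \<in> perp_dom B \<and> G_plus B v x = 0 \<and> y \<in> perp_dom B \<and> G_minus B v y = 0} = perp_dom B"
  proof (intro set_eqI iffI)
    fix f assume "f \<in> {x + y |x y. x \<in> perp_dom B \<and> G_plus B v x = 0 \<and> y \<in> perp_dom B \<and> G_minus B v y = 0}"
    then show "f \<in> perp_dom B" using G_add(1) by blast
  next
    fix f assume f: "f \<in> perp_dom B"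
    \<comment> \<open>Joint surjectivity allows the boundary values of \<open>x\<close> to be
      prescribed as those of \<open>f\<close> on the minus side and 0 on the plus side; the
      remainder then has minus value 0.\<close>
    obtain x where x: "x \<in> perp_dom B" "G_minus B v x = G_minus B v f" "G_plus B v x = 0"
      using G_surj[OF _ zero(2)] mem[OF f] by metis
    have nx: "(- 1) *\<^sub>R x \<in> perp_dom B" by (rule G_scaleR(1)[OF x(1)])
    have y: "f + (- 1) *\<^sub>R x \<in> perp_dom B" by (rule G_add(1)[OF f nx])
    have "G_minus B v (f + (- 1) *\<^sub>R x) = 0"
      unfolding G_add(2)[OF f nx] G_scaleR(2)[OF x(1)] x(2) by simp
    moreover have "f = x + (f + (- 1) *\<^sub>R x)" by simp
    ultimately show "f \<in> {x + y |x y. x \<in> perp_dom B \<and> G_plus B v x = 0 \<and> y \<in> perp_dom B \<and> G_minus B v y = 0}"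
      using x(1,3) y by blast
  qed
  show "G_minus B v ` perp_dom B = H_minus B v"
  proof (intro set_eqI iffI)
    fix F assume "F \<in> H_minus B v"
    then obtain f where "f \<in> perp_dom B" "G_minus B v f = F" using G_surj[OF _ zero(2)] by metis
    then show "F \<in> G_minus B v ` perp_dom B" by blast
  qed (use mem in blast)
  show "G_plus B v ` perp_dom B = H_plus B v"
  proof (intro set_eqI iffI)
    fix F assume "F \<in> H_plus B v"
    then obtain f where "f \<in> perp_dom B" "G_plus B v f = F" using G_surj[OF zero(1)] by metis
    then show "F \<in> G_plus B v ` perp_dom B" by blast
  qed (use mem in blast)
qed

end

theorem theorem9p9:
  fixes E :: "('a::{metric_space, second_countable_topology} \<Rightarrow> real) \<Rightarrow> ('a \<Rightarrow> real) \<Rightarrow> real"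
    and C :: "('a \<Rightarrow> real) set"
    and \<iota> :: "('a \<times> 'a \<Rightarrow> real) \<Rightarrow> 'h::{real_inner, complete_space}"
    and cls :: "('a \<Rightarrow> real) \<Rightarrow> 'l::{real_inner, complete_space}"
    and B :: "'a set" and p :: 'a and b v :: 'h and h :: "'a \<Rightarrow> real"
  assumes "locally compact (UNIV :: 'a set)"
    and "admissible_form E C"
    and "first_order_structure E C \<iota>"
    and "has_martingale_dimension E C 1"
    and "finite B" and "p \<notin> B"
    and "form_data.complete_form E C \<iota> p"
    and "b \<in> form_data.ker_coderiv C \<iota> B"
    and "minimal_energy_dominant E C (form_data.field_measure E C \<iota> b)"
    and "L2_space (form_data.field_measure E C \<iota> b) cls"
    and "h \<in> C" and "v \<in> form_data.ker_coderiv C \<iota> {}" and "b = form_data.grad \<iota> h + v"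
  shows "boundary_quadruple
           (boundary_data.skew_graph C \<iota> cls b B)
           (boundary_data.H_minus E C \<iota> cls b B v) (boundary_data.ip_tilde E C \<iota> cls b B)
           (boundary_data.H_plus E C \<iota> cls b B v) (boundary_data.ip_tilde E C \<iota> cls b B)
           (boundary_data.G_minus E C \<iota> cls b B v) (boundary_data.G_plus E C \<iota> cls b B v)"
proof -
  have "1 \<in> C" using assms(7) by (simp add: form_data.complete_form_def)
  then interpret boundary_setting E C \<iota> p cls b B v h
    using assms by unfold_locales
  show ?thesis by (rule boundary_quadruple_G)
qed

end
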